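(* Let $H$ be a Hopf algebra with bijective antipode over a field $k$, let $G=\mathrm{Aut}_{Hopf}(H)\times \mathrm{Aut}_{Hopf}(H)$ with multiplication $(\alpha,\beta)*(\gamma,\delta)=(\alpha\gamma,\ \delta\gamma^{-1}\beta\gamma)$, and let $\mathcal{YD}(H)_{fd}$ be the full subcategory of $\mathcal{YD}(H)$ consisting of finite dimensional objects. Then $\mathcal{YD}(H)_{fd}$ is a braided T-category over $G$ with left and right dualities, where for $M\in{}_H\mathcal{YD}^H(\alpha,\beta)$ finite dimensional, with dual bases $\{e_i\}$, $\{e^i\}$ of $M$ and $\mathrm{Hom}(M,k)$: (left dual) $M^*=\mathrm{Hom}(M,k)\in{}_H\mathcal{YD}^H(\alpha^{-1},\alpha\beta^{-1}\alpha^{-1})$ with $(h\cdot f)(m)=f\big(\beta^{-1}\alpha^{-1}(S(h))\cdot m\big)$, $f_{(0)}(m)\otimes f_{(1)}=f(m_{(0)})\otimes S^{-1}(m_{(1)})$, and structure morphisms $b_M:k\to M\otimes M^*$, $b_M(1)=\sum_i e_i\otimes e^i$, and $d_M:M^*\otimes M\to k$, $d_M(f\otimes m)=f(m)$; (right dual) ${}^*M=\mathrm{Hom}(M,k)\in{}_H\mathcal{YD}^H(\alpha^{-1},\alpha\beta^{-1}\alpha^{-1})$ with $(h\cdot f)(m)=f\big(\beta^{-1}\alpha^{-1}(S^{-1}(h))\cdot m\big)$, $f_{(0)}(m)\otimes f_{(1)}=f(m_{(0)})\otimes S(m_{(1)})$, and structure morphisms $b_M:k\to{}^*M\otimes M$,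 $b_M(1)=\sum_i e^i\otimes e_i$, and $d_M:M\otimes{}^*M\to k$, $d_M(m\otimes f)=f(m)$.
   Context: $k$ is a field, $\otimes=\otimes_k$, $H$ is a Hopf algebra over $k$ with bijective antipode $S$; Sweedler notation $\Delta(h)=h_1\otimes h_2$. $\mathrm{Aut}_{Hopf}(H)$ is the group of Hopf algebra automorphisms of $H$. For $\alpha,\beta\in \mathrm{Aut}_{Hopf}(H)$, an $(\alpha,\beta)$-Yetter-Drinfeld module over $H$ is a vector space $M$ that is a left $H$-module ($h\otimes m\mapsto h\cdot m$) and a right $H$-comodule ($m\mapsto m_{(0)}\otimes m_{(1)}\in M\otimes H$) such that for all $h\in H$, $m\in M$: $$(h\cdot m)_{(0)}\otimes (h\cdot m)_{(1)}=h_2\cdot m_{(0)}\otimes \beta(h_3)\,m_{(1)}\,\alpha(S^{-1}(h_1)).$$ ${}_H\mathcal{YD}^H(\alpha,\beta)$ is the category of these, with $H$-linear $H$-colinear maps as morphisms; ${}_H\mathcal{YD}^H={}_H\mathcal{YD}^H(\mathrm{id},\mathrm{id})$. $(G,* )$ is a group with unit $(\mathrm{id},\mathrm{id})$ and $(\alpha,\beta)^{-1}=(\alpha^{-1},\alpha\beta^{-1}\alpha^{-1})$. $\mathcal{YD}(H)$ is the disjoint union of the categories ${}_H\mathcal{YD}^H(\alpha,\beta)$, $(\alpha,\beta)\in G$, with the following structure (restricted to finite dimensional objects for $\mathcal{YD}(H)_{fd}$): - Objects carry their index $(\alpha,\beta)$; there are no morphisms between different components. - Tensor product: for $M\in{}_H\mathcal{YD}^H(\alpha,\beta)$,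 $N\in{}_H\mathcal{YD}^H(\gamma,\delta)$, $M\otimes N\in{}_H\mathcal{YD}^H((\alpha,\beta)*(\gamma,\delta))$ is the vector space $M\otimes N$ with $h\cdot(m\otimes n)=\gamma(h_1)\cdot m\otimes\gamma^{-1}\beta\gamma(h_2)\cdot n$ and $m\otimes n\mapsto (m_{(0)}\otimes n_{(0)})\otimes n_{(1)}m_{(1)}$; on morphisms it is the tensor product of linear maps. - Unit: $k$ with trivial structures ($h\cdot 1=\varepsilon(h)1$, $1\mapsto 1\otimes 1$), in ${}_H\mathcal{YD}^H$. - For $(\alpha,\beta)\in G$ and $N\in{}_H\mathcal{YD}^H(\gamma,\delta)$, $\varphi_{(\alpha,\beta)}(N)={}^{(\alpha,\beta)}N\in{}_H\mathcal{YD}^H((\alpha,\beta)*(\gamma,\delta)*(\alpha,\beta)^{-1})$ is $N$ as a vector space, with action $h\rightharpoonup n=\gamma^{-1}\beta\gamma\alpha^{-1}(h)\cdot n$ and coaction $n\mapsto n_{(0)}\otimes\alpha\beta^{-1}(n_{(1)})$; $\varphi_{(\alpha,\beta)}$ is the identity on morphisms. - For $M\in{}_H\mathcal{YD}^H(\alpha,\beta)$ and $N\in{}_H\mathcal{YD}^H(\gamma,\delta)$, ${}^MN:={}^{(\alpha,\beta)}N$ and the braiding is $c_{M,N}:M\otimes N\to{}^MN\otimes M$, $c_{M,N}(m\otimes n)=n_{(0)}\otimes\beta^{-1}(n_{(1)})\cdot m$. Braided T-category (braided crossed group-category) over a group $G$: a (strict, up to the usual identifications of vector spaces) monoidal category $\mathcal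 T$ that is a disjoint union of subcategories $\mathcal T_a$ ($a\in G$), with $U\otimes V\in\mathcal T_{ab}$ for $U\in\mathcal T_a$, $V\in\mathcal T_b$ and unit object in $\mathcal T_1$; together with a group homomorphism $\varphi:G\to \mathrm{aut}(\mathcal T)$, $a\mapsto\varphi_a$, into the group of invertible strict monoidal endofunctors of $\mathcal T$, with $\varphi_b(\mathcal T_a)=\mathcal T_{bab^{-1}}$; and a braiding, i.e. a family of isomorphisms $c_{U,V}:U\otimes V\to{}^UV\otimes U$ (where ${}^UV=\varphi_a(V)$ for $U\in\mathcal T_a$) such that (i) $(\varphi_a(g)\otimes f)\circ c_{U,V}=c_{U',V'}\circ(f\otimes g)$ for all morphisms $f:U\to U'$ in $\mathcal T_a$ and $g:V\to V'$ in $\mathcal T$; (ii) $c_{U\otimes V,W}=(c_{U,{}^VW}\otimes\mathrm{id}_V)\circ(\mathrm{id}_U\otimes c_{V,W})$; (iii) $c_{U,V\otimes W}=(\mathrm{id}_{{}^UV}\otimes c_{U,W})\circ(c_{U,V}\otimes\mathrm{id}_W)$; (iv) $\varphi_b(c_{U,V})=c_{\varphi_b(U),\varphi_b(V)}$ for all $b\in G$. A left duality on a T-category $\mathcal T$ with unit object $I$ assigns to each $U\in\mathcal T_a$ an object $U^*\in\mathcal T_{a^{-1}}$ and morphisms $b_U:I\to U\otimes U^*$, $d_U:U^*\otimes U\to I$ in $\mathcal T_1$ with $(\mathrm{id}_U\otimes d_U)(b_U\otimes\mathrm{id}_U)=\mathrm{id}_U$ and $(d_U\otimes\mathrm{id}_{U^*})(\mathrm{id}_{U^*}\otimes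 b_U)=\mathrm{id}_{U^*}$, compatible with conjugation: $\varphi_b(U^* )=(\varphi_b(U))^*$, $\varphi_b(b_U)=b_{\varphi_b(U)}$, $\varphi_b(d_U)=d_{\varphi_b(U)}$. A right duality is defined similarly, with ${}^*U\in\mathcal T_{a^{-1}}$, $b_U:I\to{}^*U\otimes U$, $d_U:U\otimes{}^*U\to I$, $(d_U\otimes\mathrm{id}_U)(\mathrm{id}_U\otimes b_U)=\mathrm{id}_U$ and $(\mathrm{id}_{{}^*U}\otimes d_U)(b_U\otimes\mathrm{id}_{{}^*U})=\mathrm{id}_{{}^*U}$. *)

theory Defs
  imports "HOL-Algebra.Bij" "HOL-Algebra.AbelCoset" "HOL-Algebra.RingHom" "Jordan_Normal_Form.Missing_VectorSpace"
begin

section \<open>Braided T-categories\<close>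

subsection \<open>Monoidal categories\<close>

text \<open>
  The data of a monoidal category that is a disjoint union of components indexed by a group:
  \<open>Deg U = a\<close> means that the object \<open>U\<close> lies in the component of \<open>a\<close>, and \<open>(PhiO a, PhiA a)\<close>
  is the conjugation functor of \<open>a\<close> on objects and on arrows. As only the usual identifications of
  vector spaces make tensor products of vector spaces strictly associative and unital,
  the associator and the unitors are kept as part of the data.
\<close>

record ('o, 'a) category_data =
  Obj :: "'o set"
  Arr :: "'a set"
  Dom :: "'a \<Rightarrow> 'o"
  Cod :: "'a \<Rightarrow> 'o"
  Ident :: "'o \<Rightarrow> 'a"
  Comp :: "'a \<Rightarrow> 'a \<Rightarrow> 'a"  (infixr "\<cdot>\<index>" 60)

record ('o, 'a) monoidal_data = "('o, 'a) category_data" +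
  TenO :: "'o \<Rightarrow> 'o \<Rightarrow> 'o"  (infixr "\<star>\<index>" 75)
  TenA :: "'a \<Rightarrow> 'a \<Rightarrow> 'a"  (infixr "\<bullet>\<index>" 75)
  UnitO :: "'o"
  Assoc :: "'o \<Rightarrow> 'o \<Rightarrow> 'o \<Rightarrow> 'a"
  LUnit :: "'o \<Rightarrow> 'a"
  RUnit :: "'o \<Rightarrow> 'a"

record ('o, 'a, 'g) t_data = "('o, 'a) monoidal_data" +
  Deg :: "'o \<Rightarrow> 'g"
  PhiO :: "'g \<Rightarrow> 'o \<Rightarrow> 'o"
  PhiA :: "'g \<Rightarrow> 'a \<Rightarrow> 'a"
  Braid :: "'o \<Rightarrow> 'o \<Rightarrow> 'a"

definition homset :: "('o, 'a, 'z) category_data_scheme \<Rightarrow> 'o \<Rightarrow> 'o \<Rightarrow> 'a set" where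
  "homset C X Y = {f \<in> Arr C. Dom C f = X \<and> Cod C f = Y}"

definition inverse_arrows :: "('o, 'a, 'z) category_data_scheme \<Rightarrow> 'a \<Rightarrow> 'a \<Rightarrow> bool" where
  "inverse_arrows C f g \<longleftrightarrow>
     f \<in> Arr C \<and> g \<in> homset C (Cod C f) (Dom C f) \<and>
     g \<cdot>\<^bsub>C\<^esub> f = Ident C (Dom C f) \<and> f \<cdot>\<^bsub>C\<^esub> g = Ident C (Cod C f)"

definition iso_arrow :: "('o, 'a, 'z) category_data_scheme \<Rightarrow> 'a \<Rightarrow> bool" where
  "iso_arrow C f \<longleftrightarrow> (\<exists>g. inverse_arrows C f g)"

definition inv_arrow :: "('o, 'a, 'z) category_data_scheme \<Rightarrow> 'a \<Rightarrow> 'a" where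
  "inv_arrow C f = (THE g. inverse_arrows C f g)"

text \<open>Restricting the objects and the arrows; all other data are inherited.\<close>

definition full_subcategory ::
    "('o, 'a, 'z) category_data_scheme \<Rightarrow> ('o \<Rightarrow> bool) \<Rightarrow> ('o, 'a, 'z) category_data_scheme" where
  "full_subcategory C P =
     C\<lparr>Obj := {X \<in> Obj C. P X}, Arr := {f \<in> Arr C. P (Dom C f) \<and> P (Cod C f)}\<rparr>"

locale category_ax =
  fixes C :: "('o, 'a, 'z) category_data_scheme" (structure)
  assumes dom_obj: "f \<in> Arr C \<Longrightarrow> Dom C f \<in> Obj C"
    and cod_obj: "f \<in> Arr C \<Longrightarrow> Cod C f \<in> Obj C"
    and ident_hom: "X \<in> Obj C \<Longrightarrow> Ident C X \<in> homset C X X"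
    and comp_hom: "f \<in> homset C X Y \<Longrightarrow> g \<in> homset C Y Z \<Longrightarrow> g \<cdot> f \<in> homset C X Z"
    and comp_ident: "f \<in> homset C X Y \<Longrightarrow> f \<cdot> Ident C X = f"
    and ident_comp: "f \<in> homset C X Y \<Longrightarrow> Ident C Y \<cdot> f = f"
    and comp_assoc: "f \<in> homset C W X \<Longrightarrow> g \<in> homset C X Y \<Longrightarrow> h \<in> homset C Y Z \<Longrightarrow>
      (h \<cdot> g) \<cdot> f = h \<cdot> (g \<cdot> f)"

locale monoidal_category = category_ax C
  for C :: "('o, 'a, 'z) monoidal_data_scheme" (structure) +
  assumes ten_obj: "X \<in> Obj C \<Longrightarrow> Y \<in> Obj C \<Longrightarrow> X \<star> Y \<in> Obj C"
    and ten_hom: "f \<in> homset C X X' \<Longrightarrow> g \<in> homset C Y Y' \<Longrightarrow> f \<bullet> g \<in> homset C (X \<star> Y) (X' \<star> Y')"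
    and ten_ident: "X \<in> Obj C \<Longrightarrow> Y \<in> Obj C \<Longrightarrow> Ident C X \<bullet> Ident C Y = Ident C (X \<star> Y)"
    and ten_comp: "f \<in> homset C X X' \<Longrightarrow> f' \<in> homset C X' X'' \<Longrightarrow>
      g \<in> homset C Y Y' \<Longrightarrow> g' \<in> homset C Y' Y'' \<Longrightarrow>
      (f' \<cdot> f) \<bullet> (g' \<cdot> g) = (f' \<bullet> g') \<cdot> (f \<bullet> g)"
    and unit_obj: "UnitO C \<in> Obj C"
    and assoc_hom: "X \<in> Obj C \<Longrightarrow> Y \<in> Obj C \<Longrightarrow> Z \<in> Obj C \<Longrightarrow>
      Assoc C X Y Z \<in> homset C ((X \<star> Y) \<star> Z) (X \<star> (Y \<star> Z))"
    and assoc_iso: "X \<in> Obj C \<Longrightarrow> Y \<in> Obj C \<Longrightarrow> Z \<in> Obj C \<Longrightarrow> iso_arrow C (Assoc C X Y Z)"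
    and assoc_natural: "f \<in> homset C X X' \<Longrightarrow> g \<in> homset C Y Y' \<Longrightarrow> h \<in> homset C Z Z' \<Longrightarrow>
      Assoc C X' Y' Z' \<cdot> ((f \<bullet> g) \<bullet> h) = (f \<bullet> (g \<bullet> h)) \<cdot> Assoc C X Y Z"
    and lunit_hom: "X \<in> Obj C \<Longrightarrow> LUnit C X \<in> homset C (UnitO C \<star> X) X"
    and lunit_iso: "X \<in> Obj C \<Longrightarrow> iso_arrow C (LUnit C X)"
    and lunit_natural: "f \<in> homset C X Y \<Longrightarrow>
      LUnit C Y \<cdot> (Ident C (UnitO C) \<bullet> f) = f \<cdot> LUnit C X"
    and runit_hom: "X \<in> Obj C \<Longrightarrow> RUnit C X \<in> homset C (X \<star> UnitO C) X"
    and runit_iso: "X \<in> Obj C \<Longrightarrow> iso_arrow C (RUnit C X)"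
    and runit_natural: "f \<in> homset C X Y \<Longrightarrow>
      RUnit C Y \<cdot> (f \<bullet> Ident C (UnitO C)) = f \<cdot> RUnit C X"
    and pentagon: "W \<in> Obj C \<Longrightarrow> X \<in> Obj C \<Longrightarrow> Y \<in> Obj C \<Longrightarrow> Z \<in> Obj C \<Longrightarrow>
      (Ident C W \<bullet> Assoc C X Y Z) \<cdot> Assoc C W (X \<star> Y) Z \<cdot> (Assoc C W X Y \<bullet> Ident C Z) =
      Assoc C W X (Y \<star> Z) \<cdot> Assoc C (W \<star> X) Y Z"
    and triangle: "X \<in> Obj C \<Longrightarrow> Y \<in> Obj C \<Longrightarrow>
      (Ident C X \<bullet> LUnit C Y) \<cdot> Assoc C X (UnitO C) Y = RUnit C X \<bullet> Ident C Y"

text \<open>The invertible strict monoidal endofunctors of \<open>C\<close>.\<close>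

definition strict_monoidal_auto ::
    "('o, 'a, 'z) monoidal_data_scheme \<Rightarrow> ('o \<Rightarrow> 'o) \<Rightarrow> ('a \<Rightarrow> 'a) \<Rightarrow> bool" where
  "strict_monoidal_auto C FO FA \<longleftrightarrow>
     bij_betw FO (Obj C) (Obj C) \<and> bij_betw FA (Arr C) (Arr C) \<and>
     (\<forall>f \<in> Arr C. Dom C (FA f) = FO (Dom C f) \<and> Cod C (FA f) = FO (Cod C f)) \<and>
     (\<forall>X \<in> Obj C. FA (Ident C X) = Ident C (FO X)) \<and>
     (\<forall>f \<in> Arr C. \<forall>g \<in> Arr C. Dom C g = Cod C f \<longrightarrow> FA (g \<cdot>\<^bsub>C\<^esub> f) = FA g \<cdot>\<^bsub>C\<^esub> FA f) \<and>
     (\<forall>X \<in> Obj C. \<forall>Y \<in> Obj C. FO (X \<star>\<^bsub>C\<^esub> Y) = FO X \<star>\<^bsub>C\<^esub> FO Y) \<and>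
     (\<forall>f \<in> Arr C. \<forall>g \<in> Arr C. FA (f \<bullet>\<^bsub>C\<^esub> g) = FA f \<bullet>\<^bsub>C\<^esub> FA g) \<and>
     FO (UnitO C) = UnitO C \<and>
     (\<forall>X \<in> Obj C. \<forall>Y \<in> Obj C. \<forall>Z \<in> Obj C.
        FA (Assoc C X Y Z) = Assoc C (FO X) (FO Y) (FO Z)) \<and>
     (\<forall>X \<in> Obj C. FA (LUnit C X) = LUnit C (FO X) \<and> FA (RUnit C X) = RUnit C (FO X))"

subsection \<open>T-categories, braidings and dualities\<close>

locale T_category = group G + monoidal_category C
  for G :: "('g, 'y) monoid_scheme" and C :: "('o, 'a, 'g, 'z) t_data_scheme" (structure) +
  assumes deg_closed: "X \<in> Obj C \<Longrightarrow> Deg C X \<in> carrier G"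
    and deg_arr: "f \<in> Arr C \<Longrightarrow> Deg C (Dom C f) = Deg C (Cod C f)"
    and deg_ten: "X \<in> Obj C \<Longrightarrow> Y \<in> Obj C \<Longrightarrow> Deg C (X \<star> Y) = Deg C X \<otimes>\<^bsub>G\<^esub> Deg C Y"
    and deg_unit: "Deg C (UnitO C) = \<one>\<^bsub>G\<^esub>"
    and phi_auto: "a \<in> carrier G \<Longrightarrow> strict_monoidal_auto C (PhiO C a) (PhiA C a)"
    and phiO_mult: "a \<in> carrier G \<Longrightarrow> b \<in> carrier G \<Longrightarrow> X \<in> Obj C \<Longrightarrow>
      PhiO C (a \<otimes>\<^bsub>G\<^esub> b) X = PhiO C a (PhiO C b X)"
    and phiA_mult: "a \<in> carrier G \<Longrightarrow> b \<in> carrier G \<Longrightarrow> f \<in> Arr C \<Longrightarrow>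
      PhiA C (a \<otimes>\<^bsub>G\<^esub> b) f = PhiA C a (PhiA C b f)"
    and phiO_component: "a \<in> carrier G \<Longrightarrow> b \<in> carrier G \<Longrightarrow>
      PhiO C b ` {X \<in> Obj C. Deg C X = a} =
      {X \<in> Obj C. Deg C X = b \<otimes>\<^bsub>G\<^esub> a \<otimes>\<^bsub>G\<^esub> inv\<^bsub>G\<^esub> b}"
    and phiA_component: "a \<in> carrier G \<Longrightarrow> b \<in> carrier G \<Longrightarrow>
      PhiA C b ` {f \<in> Arr C. Deg C (Dom C f) = a} =
      {f \<in> Arr C. Deg C (Dom C f) = b \<otimes>\<^bsub>G\<^esub> a \<otimes>\<^bsub>G\<^esub> inv\<^bsub>G\<^esub> b}"

abbreviation act_by :: "('o, 'a, 'g, 'z) t_data_scheme \<Rightarrow> 'o \<Rightarrow> 'o \<Rightarrow> 'o" where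
  "act_by C U V \<equiv> PhiO C (Deg C U) V"

text \<open>
  The two hexagon axioms are the strict ones with the associators inserted; note that
  \<open>act_by C U (act_by C V W) = act_by C (U \<star>\<^bsub>C\<^esub> V) W\<close> and
  \<open>act_by C U (V \<star>\<^bsub>C\<^esub> W) = act_by C U V \<star>\<^bsub>C\<^esub> act_by C U W\<close> hold strictly in a T-category.
\<close>

locale braided_T_category = T_category G C
  for G :: "('g, 'y) monoid_scheme" and C :: "('o, 'a, 'g, 'z) t_data_scheme" (structure) +
  assumes braid_hom: "U \<in> Obj C \<Longrightarrow> V \<in> Obj C \<Longrightarrow>
      Braid C U V \<in> homset C (U \<star> V) (act_by C U V \<star> U)"
    and braid_iso: "U \<in> Obj C \<Longrightarrow> V \<in> Obj C \<Longrightarrow> iso_arrow C (Braid C U V)"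
    and braid_natural: "f \<in> homset C U U' \<Longrightarrow> g \<in> homset C V V' \<Longrightarrow>
      (PhiA C (Deg C U) g \<bullet> f) \<cdot> Braid C U V = Braid C U' V' \<cdot> (f \<bullet> g)"
    and braid_hexagon1: "U \<in> Obj C \<Longrightarrow> V \<in> Obj C \<Longrightarrow> W \<in> Obj C \<Longrightarrow>
      Braid C (U \<star> V) W =
        Assoc C (act_by C U (act_by C V W)) U V
        \<cdot> (Braid C U (act_by C V W) \<bullet> Ident C V)
        \<cdot> inv_arrow C (Assoc C U (act_by C V W) V)
        \<cdot> (Ident C U \<bullet> Braid C V W)
        \<cdot> Assoc C U V W"
    and braid_hexagon2: "U \<in> Obj C \<Longrightarrow> V \<in> Obj C \<Longrightarrow> W \<in> Obj C \<Longrightarrow>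
      Braid C U (V \<star> W) =
        inv_arrow C (Assoc C (act_by C U V) (act_by C U W) U)
        \<cdot> (Ident C (act_by C U V) \<bullet> Braid C U W)
        \<cdot> Assoc C (act_by C U V) U W
        \<cdot> (Braid C U V \<bullet> Ident C W)
        \<cdot> inv_arrow C (Assoc C U V W)"
    and braid_phi: "b \<in> carrier G \<Longrightarrow> U \<in> Obj C \<Longrightarrow> V \<in> Obj C \<Longrightarrow>
      PhiA C b (Braid C U V) = Braid C (PhiO C b U) (PhiO C b V)"

locale left_duality = T_category G C
  for G :: "('g, 'y) monoid_scheme" and C :: "('o, 'a, 'g, 'z) t_data_scheme" (structure) +
  fixes D :: "'o \<Rightarrow> 'o" and b :: "'o \<Rightarrow> 'a" and d :: "'o \<Rightarrow> 'a"
  assumes dual_obj: "U \<in> Obj C \<Longrightarrow> D U \<in> Obj C"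
    and dual_deg: "U \<in> Obj C \<Longrightarrow> Deg C (D U) = inv\<^bsub>G\<^esub> (Deg C U)"
    and coev_hom: "U \<in> Obj C \<Longrightarrow> b U \<in> homset C (UnitO C) (U \<star> D U)"
    and ev_hom: "U \<in> Obj C \<Longrightarrow> d U \<in> homset C (D U \<star> U) (UnitO C)"
    and snake1: "U \<in> Obj C \<Longrightarrow>
      RUnit C U \<cdot> (Ident C U \<bullet> d U) \<cdot> Assoc C U (D U) U \<cdot> (b U \<bullet> Ident C U)
        \<cdot> inv_arrow C (LUnit C U) = Ident C U"
    and snake2: "U \<in> Obj C \<Longrightarrow>
      LUnit C (D U) \<cdot> (d U \<bullet> Ident C (D U)) \<cdot> inv_arrow C (Assoc C (D U) U (D U))
        \<cdot> (Ident C (D U) \<bullet> b U) \<cdot> inv_arrow C (RUnit C (D U)) = Ident C (D U)"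
    and dual_phi: "a \<in> carrier G \<Longrightarrow> U \<in> Obj C \<Longrightarrow> PhiO C a (D U) = D (PhiO C a U)"
    and coev_phi: "a \<in> carrier G \<Longrightarrow> U \<in> Obj C \<Longrightarrow> PhiA C a (b U) = b (PhiO C a U)"
    and ev_phi: "a \<in> carrier G \<Longrightarrow> U \<in> Obj C \<Longrightarrow> PhiA C a (d U) = d (PhiO C a U)"

locale right_duality = T_category G C
  for G :: "('g, 'y) monoid_scheme" and C :: "('o, 'a, 'g, 'z) t_data_scheme" (structure) +
  fixes D :: "'o \<Rightarrow> 'o" and b :: "'o \<Rightarrow> 'a" and d :: "'o \<Rightarrow> 'a"
  assumes dual_obj: "U \<in> Obj C \<Longrightarrow> D U \<in> Obj C"
    and dual_deg: "U \<in> Obj C \<Longrightarrow> Deg C (D U) = inv\<^bsub>G\<^esub> (Deg C U)"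
    and coev_hom: "U \<in> Obj C \<Longrightarrow> b U \<in> homset C (UnitO C) (D U \<star> U)"
    and ev_hom: "U \<in> Obj C \<Longrightarrow> d U \<in> homset C (U \<star> D U) (UnitO C)"
    and snake1: "U \<in> Obj C \<Longrightarrow>
      LUnit C U \<cdot> (d U \<bullet> Ident C U) \<cdot> inv_arrow C (Assoc C U (D U) U)
        \<cdot> (Ident C U \<bullet> b U) \<cdot> inv_arrow C (RUnit C U) = Ident C U"
    and snake2: "U \<in> Obj C \<Longrightarrow>
      RUnit C (D U) \<cdot> (Ident C (D U) \<bullet> d U) \<cdot> Assoc C (D U) U (D U) \<cdot> (b U \<bullet> Ident C (D U))
        \<cdot> inv_arrow C (LUnit C (D U)) = Ident C (D U)"
    and dual_phi: "a \<in> carrier G \<Longrightarrow> U \<in> Obj C \<Longrightarrow> PhiO C a (D U) = D (PhiO C a U)"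
    and coev_phi: "a \<in> carrier G \<Longrightarrow> U \<in> Obj C \<Longrightarrow> PhiA C a (b U) = b (PhiO C a U)"
    and ev_phi: "a \<in> carrier G \<Longrightarrow> U \<in> Obj C \<Longrightarrow> PhiA C a (d U) = d (PhiO C a U)"


section \<open>Tensor products of vector spaces\<close>

text \<open>
  The tensor product is the free vector space on \<open>carrier M \<times> carrier N\<close> (finitely supported
  functions, vanishing off that set) modulo the subspace spanned by the bilinearity relations; its
  elements are cosets.
\<close>

definition free_space :: "('k, 'y) ring_scheme \<Rightarrow> 'x set \<Rightarrow> ('k, 'x \<Rightarrow> 'k) module" where
  "free_space K A = (ring.func_space K UNIV)
     \<lparr>carrier := {f. f \<in> UNIV \<rightarrow> carrier K \<and> finite {p. f p \<noteq> \<zero>\<^bsub>K\<^esub>} \<and> (\<forall>p. p \<notin> A \<longrightarrow> f p = \<zero>\<^bsub>K\<^esub>)}\<rparr>"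

definition free_gen :: "('k, 'y) ring_scheme \<Rightarrow> 'x \<Rightarrow> 'x \<Rightarrow> 'k" where
  "free_gen K p = (\<lambda>q. if q = p then \<one>\<^bsub>K\<^esub> else \<zero>\<^bsub>K\<^esub>)"

definition tensor_relations ::
    "('k, 'y) ring_scheme \<Rightarrow> ('k, 'm, 'u) module_scheme \<Rightarrow> ('k, 'n, 'w) module_scheme
      \<Rightarrow> ('m \<times> 'n \<Rightarrow> 'k) set" where
  "tensor_relations K M N = (let F = free_space K (carrier M \<times> carrier N) in
     {free_gen K (m \<oplus>\<^bsub>M\<^esub> m', n) \<ominus>\<^bsub>F\<^esub> (free_gen K (m, n) \<oplus>\<^bsub>F\<^esub> free_gen K (m', n)) | m m' n.
        m \<in> carrier M \<and> m' \<in> carrier M \<and> n \<in> carrier N} \<union>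
     {free_gen K (m, n \<oplus>\<^bsub>N\<^esub> n') \<ominus>\<^bsub>F\<^esub> (free_gen K (m, n) \<oplus>\<^bsub>F\<^esub> free_gen K (m, n')) | m n n'.
        m \<in> carrier M \<and> n \<in> carrier N \<and> n' \<in> carrier N} \<union>
     {free_gen K (a \<odot>\<^bsub>M\<^esub> m, n) \<ominus>\<^bsub>F\<^esub> (a \<odot>\<^bsub>F\<^esub> free_gen K (m, n)) | a m n.
        a \<in> carrier K \<and> m \<in> carrier M \<and> n \<in> carrier N} \<union>
     {free_gen K (m, a \<odot>\<^bsub>N\<^esub> n) \<ominus>\<^bsub>F\<^esub> (a \<odot>\<^bsub>F\<^esub> free_gen K (m, n)) | a m n.
        a \<in> carrier K \<and> m \<in> carrier M \<and> n \<in> carrier N})"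

definition tensor_null ::
    "('k, 'y) ring_scheme \<Rightarrow> ('k, 'm, 'u) module_scheme \<Rightarrow> ('k, 'n, 'w) module_scheme
      \<Rightarrow> ('m \<times> 'n \<Rightarrow> 'k) set" where
  "tensor_null K M N =
     module.span K (free_space K (carrier M \<times> carrier N)) (tensor_relations K M N)"

definition tensor ::
    "('k, 'y) ring_scheme \<Rightarrow> ('k, 'm, 'u) module_scheme \<Rightarrow> ('k, 'n, 'w) module_scheme
      \<Rightarrow> ('k, ('m \<times> 'n \<Rightarrow> 'k) set) module" where
  "tensor K M N = (let F = free_space K (carrier M \<times> carrier N); R = tensor_null K M N in
     \<lparr>carrier = a_rcosets\<^bsub>F\<^esub> R,
      mult = undefined, one = undefined,
      zero = R,
      add = (\<lambda>s t. s <+>\<^bsub>F\<^esub> t),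
      smult = (\<lambda>a t. R <+>\<^bsub>F\<^esub> ((\<lambda>f. a \<odot>\<^bsub>F\<^esub> f) ` t))\<rparr>)"

definition pure ::
    "('k, 'y) ring_scheme \<Rightarrow> ('k, 'm, 'u) module_scheme \<Rightarrow> ('k, 'n, 'w) module_scheme
      \<Rightarrow> 'm \<Rightarrow> 'n \<Rightarrow> ('m \<times> 'n \<Rightarrow> 'k) set" where
  "pure K M N m n =
     tensor_null K M N +>\<^bsub>free_space K (carrier M \<times> carrier N)\<^esub> free_gen K (m, n)"

text \<open>
  \<open>sweedler K P B t\<close> is \<open>\<Sum>\<^sub>i B m\<^sub>i n\<^sub>i\<close> in \<open>P\<close> for any representation \<open>t = \<Sum>\<^sub>i m\<^sub>i \<otimes> n\<^sub>i\<close>; this is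
  independent of the representation when \<open>B\<close> is bilinear, which is the only case in which it is
  used. With \<open>t\<close> the value of a comultiplication or a coaction it expresses Sweedler's notation:
  \<open>sweedler K P (\<lambda>h1 h2. B h1 h2) (comult H h)\<close> is \<open>B(h\<^sub>1, h\<^sub>2)\<close>.
\<close>

definition sweedler ::
    "('k, 'y) ring_scheme \<Rightarrow> ('k, 'p, 'u) module_scheme \<Rightarrow> ('m \<Rightarrow> 'n \<Rightarrow> 'p)
      \<Rightarrow> ('m \<times> 'n \<Rightarrow> 'k) set \<Rightarrow> 'p" where
  "sweedler K P B t = (let f = (SOME f. f \<in> t) in
     finsum P (\<lambda>p. f p \<odot>\<^bsub>P\<^esub> B (fst p) (snd p)) {p. f p \<noteq> \<zero>\<^bsub>K\<^esub>})"

definition scalars :: "('k, 'y) ring_scheme \<Rightarrow> ('k, 'k) module" where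
  "scalars K = \<lparr>carrier = carrier K, mult = mult K, one = one K, zero = zero K, add = add K,
                smult = mult K\<rparr>"

definition dual_space ::
    "('k, 'y) ring_scheme \<Rightarrow> ('k, 'v, 'u) module_scheme \<Rightarrow> ('k, 'v \<Rightarrow> 'k) module" where
  "dual_space K V = (ring.func_space K (carrier V))
     \<lparr>carrier := {f \<in> extensional (carrier V). linear_map K V (scalars K) f}\<rparr>"

text \<open>The element \<open>e\<^sup>i\<close> of the basis dual to \<open>B\<close> that belongs to \<open>e\<^sub>i = e \<in> B\<close>.\<close>

definition dual_vector ::
    "('k, 'y) ring_scheme \<Rightarrow> ('k, 'v, 'u) module_scheme \<Rightarrow> 'v set \<Rightarrow> 'v \<Rightarrow> 'v \<Rightarrow> 'k" where
  "dual_vector K V B e = (THE f. f \<in> carrier (dual_space K V) \<and>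
     (\<forall>e' \<in> B. f e' = (if e' = e then \<one>\<^bsub>K\<^esub> else \<zero>\<^bsub>K\<^esub>)))"


section \<open>Hopf algebras and their automorphisms\<close>

record ('k, 'h) hopf = "('k, 'h) module" +
  comult :: "'h \<Rightarrow> ('h \<times> 'h \<Rightarrow> 'k) set"
  counit :: "'h \<Rightarrow> 'k"
  antipode :: "'h \<Rightarrow> 'h"

locale hopf_algebra =
  fixes K :: "('k, 'y) ring_scheme" and H :: "('k, 'h, 'z) hopf_scheme" (structure)
  assumes space: "vectorspace K H"
    and ring: "ring H"
    and smult_mult_left: "a \<in> carrier K \<Longrightarrow> x \<in> carrier H \<Longrightarrow> y \<in> carrier H \<Longrightarrow>
      (a \<odot> x) \<otimes> y = a \<odot> (x \<otimes> y)"
    and smult_mult_right: "a \<in> carrier K \<Longrightarrow> x \<in> carrier H \<Longrightarrow> y \<in> carrier H \<Longrightarrow>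
      x \<otimes> (a \<odot> y) = a \<odot> (x \<otimes> y)"
    and comult_linear: "linear_map K H (tensor K H H) (comult H)"
    and counit_linear: "linear_map K H (scalars K) (counit H)"
    and coassoc: "h \<in> carrier H \<Longrightarrow>
      sweedler K (tensor K H (tensor K H H))
        (\<lambda>h1 h2. sweedler K (tensor K H (tensor K H H))
          (\<lambda>h11 h12. pure K H (tensor K H H) h11 (pure K H H h12 h2)) (comult H h1)) (comult H h) =
      sweedler K (tensor K H (tensor K H H))
        (\<lambda>h1 h2. pure K H (tensor K H H) h1 (comult H h2)) (comult H h)"
    and counit_left: "h \<in> carrier H \<Longrightarrow> sweedler K H (\<lambda>h1 h2. counit H h1 \<odot> h2) (comult H h) = h"
    and counit_right: "h \<in> carrier H \<Longrightarrow> sweedler K H (\<lambda>h1 h2. counit H h2 \<odot> h1) (comult H h) = h"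
    and comult_mult: "g \<in> carrier H \<Longrightarrow> h \<in> carrier H \<Longrightarrow>
      comult H (g \<otimes> h) =
      sweedler K (tensor K H H) (\<lambda>g1 g2. sweedler K (tensor K H H)
        (\<lambda>h1 h2. pure K H H (g1 \<otimes> h1) (g2 \<otimes> h2)) (comult H h)) (comult H g)"
    and comult_one: "comult H \<one> = pure K H H \<one> \<one>"
    and counit_mult: "g \<in> carrier H \<Longrightarrow> h \<in> carrier H \<Longrightarrow>
      counit H (g \<otimes> h) = counit H g \<otimes>\<^bsub>K\<^esub> counit H h"
    and counit_one: "counit H \<one> = \<one>\<^bsub>K\<^esub>"
    and antipode_linear: "linear_map K H H (antipode H)"
    and antipode_left: "h \<in> carrier H \<Longrightarrow>
      sweedler K H (\<lambda>h1 h2. antipode H h1 \<otimes> h2) (comult H h) = counit H h \<odot> \<one>"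
    and antipode_right: "h \<in> carrier H \<Longrightarrow>
      sweedler K H (\<lambda>h1 h2. h1 \<otimes> antipode H h2) (comult H h) = counit H h \<odot> \<one>"

abbreviation antipode_inv :: "('k, 'h, 'z) hopf_scheme \<Rightarrow> 'h \<Rightarrow> 'h" where
  "antipode_inv H \<equiv> inv_into (carrier H) (antipode H)"

text \<open>
  Hopf algebra automorphisms are the bialgebra automorphisms; compatibility with the antipode is
  automatic. As in \<^const>\<open>AutoGroup\<close>, maps are extensional and multiplication is composition.
\<close>

definition hopf_auto :: "('k, 'y) ring_scheme \<Rightarrow> ('k, 'h, 'z) hopf_scheme \<Rightarrow> ('h \<Rightarrow> 'h) set" where
  "hopf_auto K H = {f \<in> Bij (carrier H).
     linear_map K H H f \<and> f \<in> ring_hom H H \<and>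
     (\<forall>h \<in> carrier H.
        comult H (f h) =
          sweedler K (tensor K H H) (\<lambda>h1 h2. pure K H H (f h1) (f h2)) (comult H h) \<and>
        counit H (f h) = counit H h)}"

definition hopf_auto_group ::
    "('k, 'y) ring_scheme \<Rightarrow> ('k, 'h, 'z) hopf_scheme \<Rightarrow> ('h \<Rightarrow> 'h) monoid" where
  "hopf_auto_group K H = BijGroup (carrier H) \<lparr>carrier := hopf_auto K H\<rparr>"

definition yd_group ::
    "('k, 'y) ring_scheme \<Rightarrow> ('k, 'h, 'z) hopf_scheme \<Rightarrow> (('h \<Rightarrow> 'h) \<times> ('h \<Rightarrow> 'h)) monoid" where
  "yd_group K H = (let A = hopf_auto_group K H in
     \<lparr>carrier = carrier A \<times> carrier A,
      mult = (\<lambda>(\<alpha>, \<beta>) (\<gamma>, \<delta>). (\<alpha> \<otimes>\<^bsub>A\<^esub> \<gamma>, \<delta> \<otimes>\<^bsub>A\<^esub> inv\<^bsub>A\<^esub> \<gamma> \<otimes>\<^bsub>A\<^esub> \<beta> \<otimes>\<^bsub>A\<^esub> \<gamma>)),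
      one = (\<one>\<^bsub>A\<^esub>, \<one>\<^bsub>A\<^esub>)\<rparr>)"


section \<open>Yetter-Drinfeld modules\<close>

locale left_module =
  fixes K :: "('k, 'y) ring_scheme" and H :: "('k, 'h, 'z) hopf_scheme"
    and M :: "('k, 'v, 'u) module_scheme" and op :: "'h \<Rightarrow> 'v \<Rightarrow> 'v"
  assumes space: "vectorspace K M"
    and op_linear_right: "h \<in> carrier H \<Longrightarrow> linear_map K M M (op h)"
    and op_linear_left: "m \<in> carrier M \<Longrightarrow> linear_map K H M (\<lambda>h. op h m)"
    and op_one: "m \<in> carrier M \<Longrightarrow> op \<one>\<^bsub>H\<^esub> m = m"
    and op_mult: "g \<in> carrier H \<Longrightarrow> h \<in> carrier H \<Longrightarrow> m \<in> carrier M \<Longrightarrow>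
      op (g \<otimes>\<^bsub>H\<^esub> h) m = op g (op h m)"

locale right_comodule =
  fixes K :: "('k, 'y) ring_scheme" and H :: "('k, 'h, 'z) hopf_scheme"
    and M :: "('k, 'v, 'u) module_scheme" and \<rho> :: "'v \<Rightarrow> ('v \<times> 'h \<Rightarrow> 'k) set"
  assumes space: "vectorspace K M"
    and coact_linear: "linear_map K M (tensor K M H) \<rho>"
    and coact_coassoc: "m \<in> carrier M \<Longrightarrow>
      sweedler K (tensor K M (tensor K H H))
        (\<lambda>m0 m1. sweedler K (tensor K M (tensor K H H))
          (\<lambda>m00 m01. pure K M (tensor K H H) m00 (pure K H H m01 m1)) (\<rho> m0)) (\<rho> m) =
      sweedler K (tensor K M (tensor K H H))
        (\<lambda>m0 m1. pure K M (tensor K H H) m0 (comult H m1)) (\<rho> m)"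
    and coact_counit: "m \<in> carrier M \<Longrightarrow>
      sweedler K M (\<lambda>m0 m1. counit H m1 \<odot>\<^bsub>M\<^esub> m0) (\<rho> m) = m"

text \<open>Here \<open>h\<^sub>1 \<otimes> h\<^sub>2 \<otimes> h\<^sub>3\<close> is obtained by applying the comultiplication to \<open>h23\<close> in \<open>h1 \<otimes> h23\<close>.\<close>

locale yd_module = left_module K H M op + right_comodule K H M \<rho>
  for K :: "('k, 'y) ring_scheme" and H :: "('k, 'h, 'z) hopf_scheme"
    and \<alpha> :: "'h \<Rightarrow> 'h" and \<beta> :: "'h \<Rightarrow> 'h"
    and M :: "('k, 'v, 'u) module_scheme" and op :: "'h \<Rightarrow> 'v \<Rightarrow> 'v"
    and \<rho> :: "'v \<Rightarrow> ('v \<times> 'h \<Rightarrow> 'k) set" +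
  assumes compatibility: "h \<in> carrier H \<Longrightarrow> m \<in> carrier M \<Longrightarrow>
      \<rho> (op h m) =
      sweedler K (tensor K M H) (\<lambda>h1 h23. sweedler K (tensor K M H) (\<lambda>h2 h3.
        sweedler K (tensor K M H) (\<lambda>m0 m1.
          pure K M H (op h2 m0) (\<beta> h3 \<otimes>\<^bsub>H\<^esub> m1 \<otimes>\<^bsub>H\<^esub> \<alpha> (antipode_inv H h1)))
        (\<rho> m)) (comult H h23)) (comult H h)"

text \<open>
  Objects carry their index \<open>(\<alpha>, \<beta>)\<close>. The underlying vector space has as carrier an arbitrary
  subset of a type \<open>'v\<close>, with arbitrary operations. The action and the coaction are extensional
  because \<open>\<phi>\<close> has to be a homomorphism on the nose.
\<close>

record ('k, 'h, 'v) yd =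
  Space :: "('k, 'v) module"
  act :: "'h \<Rightarrow> 'v \<Rightarrow> 'v"
  coact :: "'v \<Rightarrow> ('v \<times> 'h \<Rightarrow> 'k) set"
  idx :: "('h \<Rightarrow> 'h) \<times> ('h \<Rightarrow> 'h)"

record ('k, 'h, 'v) yd_arrow =
  source :: "('k, 'h, 'v) yd"
  target :: "('k, 'h, 'v) yd"
  mapping :: "'v \<Rightarrow> 'v"

definition yd_objects ::
    "('k, 'y) ring_scheme \<Rightarrow> ('k, 'h, 'z) hopf_scheme \<Rightarrow> ('k, 'h, 'v) yd set" where
  "yd_objects K H = {M. idx M \<in> carrier (yd_group K H) \<and>
     yd_module K H (fst (idx M)) (snd (idx M)) (Space M) (act M) (coact M) \<and>
     act M \<in> extensional (carrier H) \<and>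
     (\<forall>h \<in> carrier H. act M h \<in> extensional (carrier (Space M))) \<and>
     coact M \<in> extensional (carrier (Space M))}"

definition yd_arrows ::
    "('k, 'y) ring_scheme \<Rightarrow> ('k, 'h, 'z) hopf_scheme \<Rightarrow> ('k, 'h, 'v) yd_arrow set" where
  "yd_arrows K H = {f. let M = source f; N = target f; F = mapping f in
     M \<in> yd_objects K H \<and> N \<in> yd_objects K H \<and> idx M = idx N \<and>
     F \<in> extensional (carrier (Space M)) \<and>
     linear_map K (Space M) (Space N) F \<and>
     (\<forall>h \<in> carrier H. \<forall>m \<in> carrier (Space M). F (act M h m) = act N h (F m)) \<and>
     (\<forall>m \<in> carrier (Space M). coact N (F m) =
        sweedler K (tensor K (Space N) H) (\<lambda>m0 m1. pure K (Space N) H (F m0) m1) (coact M m))}"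

subsection \<open>Realizing vector spaces on subsets of a fixed type\<close>

text \<open>
  The elements of \<open>M \<otimes> N\<close>, of \<open>Hom(M, k)\<close> and of \<open>k\<close> live in types other than \<open>'v\<close>. These vector
  spaces are transported to subsets of \<open>'v\<close> along a fixed choice of an injection of their carriers.
  Such injections exist whenever \<open>'v\<close> is infinite and at least as large as the field, for all the
  spaces considered here.
\<close>

definition realize :: "'x set \<Rightarrow> 'x \<Rightarrow> 'v" where
  "realize A = (SOME r. inj_on r A)"

definition unrealize :: "'x set \<Rightarrow> 'v \<Rightarrow> 'x" where
  "unrealize A = inv_into A (realize A)"

definition realize_space :: "('k, 'x, 'u) module_scheme \<Rightarrow> ('k, 'v) module" where
  "realize_space V = (let r = realize (carrier V); u = unrealize (carrier V) in
     \<lparr>carrier = r ` carrier V,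
      mult = undefined, one = undefined,
      zero = r \<zero>\<^bsub>V\<^esub>,
      add = (\<lambda>x y. r (u x \<oplus>\<^bsub>V\<^esub> u y)),
      smult = (\<lambda>a x. r (a \<odot>\<^bsub>V\<^esub> u x))\<rparr>)"

subsection \<open>The category\<close>

text \<open>
  \<open>ten_space\<close>, \<open>ten_pure\<close> and \<open>ten_sweedler\<close> are \<^const>\<open>tensor\<close>, \<^const>\<open>pure\<close> and
  \<^const>\<open>sweedler\<close> for the realized tensor product of two objects.
\<close>

definition ten_space ::
    "('k, 'y) ring_scheme \<Rightarrow> ('k, 'h, 'v) yd \<Rightarrow> ('k, 'h, 'v) yd \<Rightarrow> ('k, 'v) module" where
  "ten_space K M N = realize_space (tensor K (Space M) (Space N))"

definition ten_pure ::
    "('k, 'y) ring_scheme \<Rightarrow> ('k, 'h, 'v) yd \<Rightarrow> ('k, 'h, 'v) yd \<Rightarrow> 'v \<Rightarrow> 'v \<Rightarrow> 'v" where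
  "ten_pure K M N m n =
     realize (carrier (tensor K (Space M) (Space N))) (pure K (Space M) (Space N) m n)"

definition ten_sweedler ::
    "('k, 'y) ring_scheme \<Rightarrow> ('k, 'h, 'v) yd \<Rightarrow> ('k, 'h, 'v) yd
      \<Rightarrow> ('k, 'p, 'u) module_scheme \<Rightarrow> ('v \<Rightarrow> 'v \<Rightarrow> 'p) \<Rightarrow> 'v \<Rightarrow> 'p" where
  "ten_sweedler K M N P B x =
     sweedler K P B (unrealize (carrier (tensor K (Space M) (Space N))) x)"

definition yd_tensor ::
    "('k, 'y) ring_scheme \<Rightarrow> ('k, 'h, 'z) hopf_scheme
      \<Rightarrow> ('k, 'h, 'v) yd \<Rightarrow> ('k, 'h, 'v) yd \<Rightarrow> ('k, 'h, 'v) yd" where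
  "yd_tensor K H M N = (let
       A = hopf_auto_group K H; \<beta> = snd (idx M); \<gamma> = fst (idx N);
       V = ten_space K M N; W = tensor K V H in
     \<lparr>Space = V,
      act = (\<lambda>h \<in> carrier H. \<lambda>x \<in> carrier V.
        sweedler K V (\<lambda>h1 h2. ten_sweedler K M N V (\<lambda>m n.
          ten_pure K M N (act M (\<gamma> h1) m) (act N ((inv\<^bsub>A\<^esub> \<gamma> \<otimes>\<^bsub>A\<^esub> \<beta> \<otimes>\<^bsub>A\<^esub> \<gamma>) h2) n)) x)
        (comult H h)),
      coact = (\<lambda>x \<in> carrier V.
        ten_sweedler K M N W (\<lambda>m n.
          sweedler K W (\<lambda>m0 m1. sweedler K W (\<lambda>n0 n1.
            pure K V H (ten_pure K M N m0 n0) (n1 \<otimes>\<^bsub>H\<^esub> m1))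
          (coact N n)) (coact M m)) x),
      idx = idx M \<otimes>\<^bsub>yd_group K H\<^esub> idx N\<rparr>)"

definition yd_tensor_arrow ::
    "('k, 'y) ring_scheme \<Rightarrow> ('k, 'h, 'z) hopf_scheme
      \<Rightarrow> ('k, 'h, 'v) yd_arrow \<Rightarrow> ('k, 'h, 'v) yd_arrow \<Rightarrow> ('k, 'h, 'v) yd_arrow" where
  "yd_tensor_arrow K H f g =
     \<lparr>source = yd_tensor K H (source f) (source g),
      target = yd_tensor K H (target f) (target g),
      mapping = (\<lambda>x \<in> carrier (ten_space K (source f) (source g)).
        ten_sweedler K (source f) (source g) (ten_space K (target f) (target g)) (\<lambda>m n.
          ten_pure K (target f) (target g) (mapping f m) (mapping g n)) x)\<rparr>"

definition yd_unit ::
    "('k, 'y) ring_scheme \<Rightarrow> ('k, 'h, 'z) hopf_scheme \<Rightarrow> ('k, 'h, 'v) yd" where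
  "yd_unit K H = (let V = realize_space (scalars K) in
     \<lparr>Space = V,
      act = (\<lambda>h \<in> carrier H. \<lambda>x \<in> carrier V. counit H h \<odot>\<^bsub>V\<^esub> x),
      coact = (\<lambda>x \<in> carrier V. pure K V H x \<one>\<^bsub>H\<^esub>),
      idx = \<one>\<^bsub>yd_group K H\<^esub>\<rparr>)"

definition yd_assoc ::
    "('k, 'y) ring_scheme \<Rightarrow> ('k, 'h, 'z) hopf_scheme
      \<Rightarrow> ('k, 'h, 'v) yd \<Rightarrow> ('k, 'h, 'v) yd \<Rightarrow> ('k, 'h, 'v) yd \<Rightarrow> ('k, 'h, 'v) yd_arrow" where
  "yd_assoc K H M N P = (let
       MN = yd_tensor K H M N; NP = yd_tensor K H N P; V = ten_space K M NP in
     \<lparr>source = yd_tensor K H MN P,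
      target = yd_tensor K H M NP,
      mapping = (\<lambda>x \<in> carrier (ten_space K MN P).
        ten_sweedler K MN P V (\<lambda>y p. ten_sweedler K M N V (\<lambda>m n.
          ten_pure K M NP m (ten_pure K N P n p)) y) x)\<rparr>)"

definition yd_lunit ::
    "('k, 'y) ring_scheme \<Rightarrow> ('k, 'h, 'z) hopf_scheme
      \<Rightarrow> ('k, 'h, 'v) yd \<Rightarrow> ('k, 'h, 'v) yd_arrow" where
  "yd_lunit K H M =
     \<lparr>source = yd_tensor K H (yd_unit K H) M,
      target = M,
      mapping = (\<lambda>x \<in> carrier (ten_space K (yd_unit K H) M).
        ten_sweedler K (yd_unit K H) M (Space M)
          (\<lambda>a m. unrealize (carrier K) a \<odot>\<^bsub>Space M\<^esub> m) x)\<rparr>"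

definition yd_runit ::
    "('k, 'y) ring_scheme \<Rightarrow> ('k, 'h, 'z) hopf_scheme
      \<Rightarrow> ('k, 'h, 'v) yd \<Rightarrow> ('k, 'h, 'v) yd_arrow" where
  "yd_runit K H M =
     \<lparr>source = yd_tensor K H M (yd_unit K H),
      target = M,
      mapping = (\<lambda>x \<in> carrier (ten_space K M (yd_unit K H)).
        ten_sweedler K M (yd_unit K H) (Space M)
          (\<lambda>m a. unrealize (carrier K) a \<odot>\<^bsub>Space M\<^esub> m) x)\<rparr>"

definition yd_phi ::
    "('k, 'y) ring_scheme \<Rightarrow> ('k, 'h, 'z) hopf_scheme
      \<Rightarrow> ('h \<Rightarrow> 'h) \<times> ('h \<Rightarrow> 'h) \<Rightarrow> ('k, 'h, 'v) yd \<Rightarrow> ('k, 'h, 'v) yd" where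
  "yd_phi K H a N = (let
       A = hopf_auto_group K H; G = yd_group K H;
       \<alpha> = fst a; \<beta> = snd a; \<gamma> = fst (idx N); V = Space N in
     \<lparr>Space = V,
      act = (\<lambda>h \<in> carrier H. \<lambda>n \<in> carrier V.
        act N ((inv\<^bsub>A\<^esub> \<gamma> \<otimes>\<^bsub>A\<^esub> \<beta> \<otimes>\<^bsub>A\<^esub> \<gamma> \<otimes>\<^bsub>A\<^esub> inv\<^bsub>A\<^esub> \<alpha>) h) n),
      coact = (\<lambda>n \<in> carrier V.
        sweedler K (tensor K V H) (\<lambda>n0 n1. pure K V H n0 ((\<alpha> \<otimes>\<^bsub>A\<^esub> inv\<^bsub>A\<^esub> \<beta>) n1)) (coact N n)),
      idx = a \<otimes>\<^bsub>G\<^esub> idx N \<otimes>\<^bsub>G\<^esub> inv\<^bsub>G\<^esub> a\<rparr>)"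

definition yd_phi_arrow ::
    "('k, 'y) ring_scheme \<Rightarrow> ('k, 'h, 'z) hopf_scheme
      \<Rightarrow> ('h \<Rightarrow> 'h) \<times> ('h \<Rightarrow> 'h) \<Rightarrow> ('k, 'h, 'v) yd_arrow \<Rightarrow> ('k, 'h, 'v) yd_arrow" where
  "yd_phi_arrow K H a f =
     \<lparr>source = yd_phi K H a (source f), target = yd_phi K H a (target f), mapping = mapping f\<rparr>"

definition yd_braid ::
    "('k, 'y) ring_scheme \<Rightarrow> ('k, 'h, 'z) hopf_scheme
      \<Rightarrow> ('k, 'h, 'v) yd \<Rightarrow> ('k, 'h, 'v) yd \<Rightarrow> ('k, 'h, 'v) yd_arrow" where
  "yd_braid K H M N = (let
       A = hopf_auto_group K H; \<beta> = snd (idx M);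
       MN = yd_phi K H (idx M) N; V = ten_space K MN M in
     \<lparr>source = yd_tensor K H M N,
      target = yd_tensor K H MN M,
      mapping = (\<lambda>x \<in> carrier (ten_space K M N).
        ten_sweedler K M N V (\<lambda>m n. sweedler K V (\<lambda>n0 n1.
          ten_pure K MN M n0 (act M ((inv\<^bsub>A\<^esub> \<beta>) n1) m)) (coact N n)) x)\<rparr>)"

definition YD ::
    "('k, 'y) ring_scheme \<Rightarrow> ('k, 'h, 'z) hopf_scheme
      \<Rightarrow> (('k, 'h, 'v) yd, ('k, 'h, 'v) yd_arrow, ('h \<Rightarrow> 'h) \<times> ('h \<Rightarrow> 'h)) t_data" where
  "YD K H =
     \<lparr>Obj = yd_objects K H,
      Arr = yd_arrows K H,
      Dom = source,
      Cod = target,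
      Ident = (\<lambda>M. \<lparr>source = M, target = M, mapping = (\<lambda>m \<in> carrier (Space M). m)\<rparr>),
      Comp = (\<lambda>g f. \<lparr>source = source f, target = target g,
        mapping = compose (carrier (Space (source f))) (mapping g) (mapping f)\<rparr>),
      TenO = yd_tensor K H,
      TenA = yd_tensor_arrow K H,
      UnitO = yd_unit K H,
      Assoc = yd_assoc K H,
      LUnit = yd_lunit K H,
      RUnit = yd_runit K H,
      Deg = idx,
      PhiO = yd_phi K H,
      PhiA = yd_phi_arrow K H,
      Braid = yd_braid K H\<rparr>"

definition YD_fd ::
    "('k, 'y) ring_scheme \<Rightarrow> ('k, 'h, 'z) hopf_scheme
      \<Rightarrow> (('k, 'h, 'v) yd, ('k, 'h, 'v) yd_arrow, ('h \<Rightarrow> 'h) \<times> ('h \<Rightarrow> 'h)) t_data" where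
  "YD_fd K H = full_subcategory (YD K H) (\<lambda>M. vectorspace.fin_dim K (Space M))"

subsection \<open>Duals\<close>

text \<open>
  The left and the right dual differ only by exchanging \<open>S\<close> and \<open>S\<^sup>-\<^sup>1\<close>, so they are both instances of
  the following construction, where \<open>S\<close> occurs in the action and \<open>T\<close> in the coaction. The coaction
  of \<open>f\<close> is the unique element \<open>f\<^sub>0 \<otimes> f\<^sub>1\<close> of \<open>Hom(M, k) \<otimes> H\<close> such that
  \<open>f\<^sub>0(m) \<otimes> f\<^sub>1 = f(m\<^sub>0) \<otimes> T(m\<^sub>1)\<close> in \<open>k \<otimes> H\<close> for all \<open>m\<close>.
\<close>

definition functional :: "('k, 'y) ring_scheme \<Rightarrow> ('k, 'h, 'v) yd \<Rightarrow> 'v \<Rightarrow> 'v \<Rightarrow> 'k" where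
  "functional K M = unrealize (carrier (dual_space K (Space M)))"

definition yd_dual ::
    "('k, 'y) ring_scheme \<Rightarrow> ('k, 'h, 'z) hopf_scheme \<Rightarrow> ('h \<Rightarrow> 'h) \<Rightarrow> ('h \<Rightarrow> 'h)
      \<Rightarrow> ('k, 'h, 'v) yd \<Rightarrow> ('k, 'h, 'v) yd" where
  "yd_dual K H S T M = (let
       A = hopf_auto_group K H; \<alpha> = fst (idx M); \<beta> = snd (idx M);
       D = dual_space K (Space M); V = realize_space D; kH = tensor K (scalars K) H in
     \<lparr>Space = V,
      act = (\<lambda>h \<in> carrier H. \<lambda>f \<in> carrier V.
        realize (carrier D) (\<lambda>m \<in> carrier (Space M).
          functional K M f (act M ((inv\<^bsub>A\<^esub> \<beta> \<otimes>\<^bsub>A\<^esub> inv\<^bsub>A\<^esub> \<alpha>) (S h)) m))),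
      coact = (\<lambda>f \<in> carrier V. (THE t. t \<in> carrier (tensor K V H) \<and>
        (\<forall>m \<in> carrier (Space M).
          sweedler K kH (\<lambda>f0 f1. pure K (scalars K) H (functional K M f0 m) f1) t =
          sweedler K kH (\<lambda>m0 m1. pure K (scalars K) H (functional K M f m0) (T m1))
            (coact M m)))),
      idx = (inv\<^bsub>A\<^esub> \<alpha>, \<alpha> \<otimes>\<^bsub>A\<^esub> inv\<^bsub>A\<^esub> \<beta> \<otimes>\<^bsub>A\<^esub> inv\<^bsub>A\<^esub> \<alpha>)\<rparr>)"

definition yd_left_dual ::
    "('k, 'y) ring_scheme \<Rightarrow> ('k, 'h, 'z) hopf_scheme \<Rightarrow> ('k, 'h, 'v) yd \<Rightarrow> ('k, 'h, 'v) yd" where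
  "yd_left_dual K H = yd_dual K H (antipode H) (antipode_inv H)"

definition yd_right_dual ::
    "('k, 'y) ring_scheme \<Rightarrow> ('k, 'h, 'z) hopf_scheme \<Rightarrow> ('k, 'h, 'v) yd \<Rightarrow> ('k, 'h, 'v) yd" where
  "yd_right_dual K H = yd_dual K H (antipode_inv H) (antipode H)"

definition dual_elt :: "('k, 'y) ring_scheme \<Rightarrow> ('k, 'h, 'v) yd \<Rightarrow> 'v set \<Rightarrow> 'v \<Rightarrow> 'v" where
  "dual_elt K M B e = realize (carrier (dual_space K (Space M))) (dual_vector K (Space M) B e)"

text \<open>
  The coevaluations \<open>c \<mapsto> c \<Sum>\<^sub>i e\<^sub>i \<otimes> e\<^sup>i\<close> and \<open>c \<mapsto> c \<Sum>\<^sub>i e\<^sup>i \<otimes> e\<^sub>i\<close> formed with a given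
  basis \<open>B\<close>, and then with some chosen one.
\<close>

definition left_coev_basis ::
    "('k, 'y) ring_scheme \<Rightarrow> ('k, 'h, 'z) hopf_scheme \<Rightarrow> 'v set
      \<Rightarrow> ('k, 'h, 'v) yd \<Rightarrow> ('k, 'h, 'v) yd_arrow" where
  "left_coev_basis K H B M = (let D = yd_left_dual K H M; V = ten_space K M D in
     \<lparr>source = yd_unit K H,
      target = yd_tensor K H M D,
      mapping = (\<lambda>c \<in> carrier (Space (yd_unit K H :: ('k, 'h, 'v) yd)).
        unrealize (carrier K) c \<odot>\<^bsub>V\<^esub> finsum V (\<lambda>e. ten_pure K M D e (dual_elt K M B e)) B)\<rparr>)"

definition right_coev_basis ::
    "('k, 'y) ring_scheme \<Rightarrow> ('k, 'h, 'z) hopf_scheme \<Rightarrow> 'v set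
      \<Rightarrow> ('k, 'h, 'v) yd \<Rightarrow> ('k, 'h, 'v) yd_arrow" where
  "right_coev_basis K H B M = (let D = yd_right_dual K H M; V = ten_space K D M in
     \<lparr>source = yd_unit K H,
      target = yd_tensor K H D M,
      mapping = (\<lambda>c \<in> carrier (Space (yd_unit K H :: ('k, 'h, 'v) yd)).
        unrealize (carrier K) c \<odot>\<^bsub>V\<^esub> finsum V (\<lambda>e. ten_pure K D M (dual_elt K M B e) e) B)\<rparr>)"

definition left_coev ::
    "('k, 'y) ring_scheme \<Rightarrow> ('k, 'h, 'z) hopf_scheme \<Rightarrow> ('k, 'h, 'v) yd \<Rightarrow> ('k, 'h, 'v) yd_arrow"
  where "left_coev K H M = left_coev_basis K H (SOME B. vectorspace.basis K (Space M) B) M"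

definition right_coev ::
    "('k, 'y) ring_scheme \<Rightarrow> ('k, 'h, 'z) hopf_scheme \<Rightarrow> ('k, 'h, 'v) yd \<Rightarrow> ('k, 'h, 'v) yd_arrow"
  where "right_coev K H M = right_coev_basis K H (SOME B. vectorspace.basis K (Space M) B) M"

definition left_ev ::
    "('k, 'y) ring_scheme \<Rightarrow> ('k, 'h, 'z) hopf_scheme \<Rightarrow> ('k, 'h, 'v) yd \<Rightarrow> ('k, 'h, 'v) yd_arrow"
  where
  "left_ev K H M = (let D = yd_left_dual K H M; I = yd_unit K H in
     \<lparr>source = yd_tensor K H D M,
      target = I,
      mapping = (\<lambda>x \<in> carrier (ten_space K D M). ten_sweedler K D M (Space I)
        (\<lambda>f m. realize (carrier K) (functional K M f m)) x)\<rparr>)"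

definition right_ev ::
    "('k, 'y) ring_scheme \<Rightarrow> ('k, 'h, 'z) hopf_scheme \<Rightarrow> ('k, 'h, 'v) yd \<Rightarrow> ('k, 'h, 'v) yd_arrow"
  where
  "right_ev K H M = (let D = yd_right_dual K H M; I = yd_unit K H in
     \<lparr>source = yd_tensor K H M D,
      target = I,
      mapping = (\<lambda>x \<in> carrier (ten_space K M D). ten_sweedler K M D (Space I)
        (\<lambda>m f. realize (carrier K) (functional K M f m)) x)\<rparr>)"

end

(* Moving the factor S^-1(h_1) to the other side turns the compatibility condition into
     h_1 m_0 \<otimes> \<beta>(h_2) m_1 = (h_2 m)_0 \<otimes> (h_2 m)_1 \<alpha>(h_1),
   which contains no antipode and is stable under precomposition with an automorphism, so that
   conjugates, tensor products and the braiding reduce to coassociativity and this one identity.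
   The inverse of the braiding is n \<otimes> m |-> \<beta>^-1(S(n_1)) m \<otimes> n_0. All identities between morphisms
   are checked on pure tensors.

   For the duals, an element of Hom(M, k) \<otimes> W is determined by its evaluations at the elements m
   of M, and the canonical element sum_i e^i \<otimes> e_i evaluates at m to m. Hence it is independent of
   the basis, and every statement on the coactions of the duals and on the coevaluations becomes an
   identity for the coaction of m, settled by coassociativity and the antipode axiom. The two duals
   differ by exchanging S and S^-1, both anti-automorphisms of H that commute with Aut(H). *)

theory Submission
  imports Defs
begin

text \<open>Every object lives on a subset of the type \<open>'v\<close>, reached through
  \<open>realize\<close>, an injection picked by choice. Injections exist only for carriers no
  larger than \<open>'v\<close>. This is why the categorical part works with \<open>fdv\<close>:
  tensor products, duals and the ground field stay finite dimensional, so their carriers fit as soon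
  as \<open>'v\<close> is infinite and contains a copy of the field. The injection depends on the
  carrier alone and conjugation keeps the underlying space; hence \<phi>(M \<otimes> N) and
  \<phi>(M) \<otimes> \<phi>(N) are realized by the same map and are equal on the nose, as
  strictness demands. A second choice is hidden in \<open>sweedler\<close>, which sums over an
  arbitrary representative of a coset. Once independence of it is known for bilinear maps, such sums
  are handled by a few rules: linear maps move inside, sums with independent arguments commute, and
  a sum over a pure tensor is a value. Together with rules that prove linearity along the syntax of
  a term they are given to the simplifier, so that most coherence laws reduce to expanding both
  sides on pure tensors.\<close>

definition lin ::
    "('k, 'y) ring_scheme \<Rightarrow> ('k, 'm, 'u) module_scheme \<Rightarrow> ('k, 'n, 'w) module_scheme
      \<Rightarrow> ('m \<Rightarrow> 'n) \<Rightarrow> bool" where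
  "lin K V W f \<longleftrightarrow> f \<in> module_hom K V W"

lemma linI:
  assumes "\<And>x. x \<in> carrier V \<Longrightarrow> f x \<in> carrier W"
    and "\<And>x y. x \<in> carrier V \<Longrightarrow> y \<in> carrier V \<Longrightarrow> f (x \<oplus>\<^bsub>V\<^esub> y) = f x \<oplus>\<^bsub>W\<^esub> f y"
    and "\<And>a x. a \<in> carrier K \<Longrightarrow> x \<in> carrier V \<Longrightarrow> f (a \<odot>\<^bsub>V\<^esub> x) = a \<odot>\<^bsub>W\<^esub> f x"
  shows "lin K V W f"
  using assms by (auto simp: lin_def module_hom_def)

lemma
  assumes "lin K V W f"
  shows lin_closed: "x \<in> carrier V \<Longrightarrow> f x \<in> carrier W"
    and lin_add: "x \<in> carrier V \<Longrightarrow> y \<in> carrier V \<Longrightarrow> f (x \<oplus>\<^bsub>V\<^esub> y) = f x \<oplus>\<^bsub>W\<^esub> f y"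
    and lin_smult: "a \<in> carrier K \<Longrightarrow> x \<in> carrier V \<Longrightarrow> f (a \<odot>\<^bsub>V\<^esub> x) = a \<odot>\<^bsub>W\<^esub> f x"
  using assms by (auto simp: lin_def module_hom_def)

text \<open>\<open>linear_map\<close> bundles linearity with the vector space axioms of source and
  target. Splitting these off leaves \<open>lin\<close>, a condition on the function alone, which
  can be derived by rules that follow the syntax of a composite term.\<close>

lemma linear_map_iff_lin:
  "linear_map K V W f \<longleftrightarrow> vectorspace K V \<and> vectorspace K W \<and> lin K V W f"
  by (auto simp: linear_map_def mod_hom_def mod_hom_axioms_def lin_def vectorspace_def)

lemma lin_comp: "lin K U V f \<Longrightarrow> lin K V W g \<Longrightarrow> lin K U W (\<lambda>x. g (f x))"
  by (auto simp: lin_def module_hom_def Pi_iff)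

lemma lin_cong:
  "vectorspace K V \<Longrightarrow> (\<And>x. x \<in> carrier V \<Longrightarrow> f x = g x) \<Longrightarrow> lin K V W f \<longleftrightarrow> lin K V W g"
proof -
  assume "vectorspace K V" and eq: "\<And>x. x \<in> carrier V \<Longrightarrow> f x = g x"
  then interpret vectorspace K V by simp
  show ?thesis by (auto simp: lin_def module_hom_def Pi_iff eq)
qed

lemma lin_zero:
  assumes "vectorspace K V" "vectorspace K W" "lin K V W f"
  shows "f \<zero>\<^bsub>V\<^esub> = \<zero>\<^bsub>W\<^esub>"
proof -
  interpret linear_map K V W f using assms by (simp add: linear_map_iff_lin)
  show ?thesis by simp
qed

text \<open>Infinite index sets are included: there \<open>finsum\<close> is zero on both sides, and
  \<open>f\<close> preserves zero.\<close>

lemma lin_finsum: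
  assumes "vectorspace K V" "vectorspace K W" "lin K V W f" "g \<in> A \<rightarrow> carrier V"
  shows "f (finsum V g A) = finsum W (\<lambda>x. f (g x)) A"
  using assms(4)
proof (induct A rule: infinite_finite_induct)
  interpret V: vectorspace K V by fact
  interpret W: vectorspace K W by fact
  note f = lin_closed[OF assms(3)] lin_add[OF assms(3)] lin_zero[OF assms(1-3)]
  { case (infinite A) then show ?case by (simp add: f) }
  { case empty then show ?case by (simp add: f) }
  { case (insert a A)
    then have gx: "\<And>x. x \<in> insert a A \<Longrightarrow> g x \<in> carrier V" by auto
    then have "f (finsum V g A) = (\<Oplus>\<^bsub>W\<^esub>x\<in>A. f (g x))" using insert by auto
    with insert(1,2) gx show ?case by (simp add: f Pi_iff V.M.finsum_closed W.M.finsum_insert) }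
qed

lemma (in abelian_monoid) finsum_swap:
  assumes "\<And>a b. a \<in> A \<Longrightarrow> b \<in> B \<Longrightarrow> g a b \<in> carrier G"
  shows "finsum G (\<lambda>a. finsum G (g a) B) A = finsum G (\<lambda>b. finsum G (\<lambda>a. g a b) A) B"
  using assms
proof (induct A rule: infinite_finite_induct)
  case (insert a A)
  have "finsum G (\<lambda>b. g a b \<oplus> finsum G (\<lambda>a. g a b) A) B =
        finsum G (\<lambda>b. finsum G (\<lambda>a. g a b) (insert a A)) B"
    using insert by (intro finsum_cong') auto
  moreover have "finsum G (\<lambda>b. g a b \<oplus> finsum G (\<lambda>a. g a b) A) B =
      finsum G (g a) B \<oplus> finsum G (\<lambda>b. finsum G (\<lambda>a. g a b) A) B"
    using insert by (intro finsum_addf) auto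
  ultimately show ?case using insert by auto
qed auto

lemma (in abelian_monoid) finsum_delta:
  assumes "finite A" "i \<in> A" "g i \<in> carrier G" "\<And>j. j \<in> A \<Longrightarrow> j \<noteq> i \<Longrightarrow> g j = \<zero>"
  shows "finsum G g A = g i"
proof -
  have "finsum G g {i} = finsum G g A"
  proof (rule add.finprod_mono_neutral_cong_left)
    show "g \<in> A \<rightarrow> carrier G" using assms(3,4) by (metis Pi_I zero_closed)
  qed (use assms in auto)
  then show ?thesis using assms(3) by simp
qed

subsection \<open>Scalars and free spaces\<close>

lemma scalars_simps [simp]:
  "carrier (scalars K) = carrier K" "add (scalars K) = add K" "zero (scalars K) = zero K"
  "mult (scalars K) = mult K" "one (scalars K) = one K" "smult (scalars K) = mult K"
  by (simp_all add: scalars_def)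

lemma vectorspace_scalars: assumes "field K" shows "vectorspace K (scalars K)"
proof -
  interpret field K by fact
  show ?thesis
    by (rule vs_criteria)
      (auto simp: assms a_ac m_assoc l_distr r_distr intro!: bexI[of _ "\<ominus>\<^bsub>K\<^esub> _"] r_neg)
qed

lemma finsum_scalars: "finsum (scalars K) = finsum K"
  by (simp add: fun_eq_iff finsum_def finprod_def)

lemma free_space_simps:
  assumes "ring K"
  shows "carrier (free_space K A) =
      {f. f \<in> UNIV \<rightarrow> carrier K \<and> finite {p. f p \<noteq> \<zero>\<^bsub>K\<^esub>} \<and> (\<forall>p. p \<notin> A \<longrightarrow> f p = \<zero>\<^bsub>K\<^esub>)}"
    and "f \<oplus>\<^bsub>free_space K A\<^esub> g = (\<lambda>p. f p \<oplus>\<^bsub>K\<^esub> g p)"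
    and "a \<odot>\<^bsub>free_space K A\<^esub> f = (\<lambda>p. a \<otimes>\<^bsub>K\<^esub> f p)"
    and "\<zero>\<^bsub>free_space K A\<^esub> = (\<lambda>p. \<zero>\<^bsub>K\<^esub>)"
  by (simp_all add: free_space_def ring.func_space_def[OF assms] fun_eq_iff)

lemma vectorspace_free_space:
  fixes A :: "'b set" and K :: "('a, 'y) ring_scheme"
  assumes "field K" shows "vectorspace K (free_space K A)"
proof -
  interpret field K by fact
  have supp_add: "finite {p. f p \<oplus>\<^bsub>K\<^esub> g p \<noteq> \<zero>\<^bsub>K\<^esub>}"
    if "finite {p. f p \<noteq> \<zero>\<^bsub>K\<^esub>}" "finite {p. g p \<noteq> \<zero>\<^bsub>K\<^esub>}" for f g :: "'b \<Rightarrow> 'a"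
    by (rule finite_subset[OF _ finite_UnI[OF that]]) auto
  have supp_smult: "finite {p. a \<otimes>\<^bsub>K\<^esub> f p \<noteq> \<zero>\<^bsub>K\<^esub>}"
    if "finite {p. f p \<noteq> \<zero>\<^bsub>K\<^esub>}" "a \<in> carrier K" for f :: "'b \<Rightarrow> 'a" and a
    by (rule finite_subset[OF _ that(1)]) (use that in auto)
  have neg: "\<exists>g\<in>carrier (free_space K A). f \<oplus>\<^bsub>free_space K A\<^esub> g = \<zero>\<^bsub>free_space K A\<^esub>"
    if f: "f \<in> carrier (free_space K A)" for f :: "'b \<Rightarrow> 'a"
  proof (rule bexI)
    \<comment> \<open>The negative is written as a multiple of \<open>f\<close> by -1, so that its
      finite support comes from \<open>supp_smult\<close>.\<close>
    show "f \<oplus>\<^bsub>free_space K A\<^esub> (\<lambda>p. \<ominus>\<^bsub>K\<^esub> \<one>\<^bsub>K\<^esub> \<otimes>\<^bsub>K\<^esub> f p) = \<zero>\<^bsub>free_space K A\<^esub>"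
      using f by (auto simp: free_space_simps[OF ring_axioms] Pi_iff l_minus r_neg)
    show "(\<lambda>p. \<ominus>\<^bsub>K\<^esub> \<one>\<^bsub>K\<^esub> \<otimes>\<^bsub>K\<^esub> f p) \<in> carrier (free_space K A)"
      using f by (auto simp: free_space_simps[OF ring_axioms] Pi_iff intro!: supp_smult)
  qed
  show ?thesis
    apply (rule vs_criteria)
    using neg apply (auto simp: assms free_space_simps[OF ring_axioms] Pi_iff
        intro!: supp_add supp_smult a_comm a_assoc m_assoc l_distr r_distr)
    done
qed

lemma free_gen_closed: assumes "field K" "p \<in> A" shows "free_gen K p \<in> carrier (free_space K A)"
proof -
  interpret field K by fact
  have "{q. free_gen K p q \<noteq> \<zero>\<^bsub>K\<^esub>} \<subseteq> {p}" by (auto simp: free_gen_def)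
  then have "finite {q. free_gen K p q \<noteq> \<zero>\<^bsub>K\<^esub>}" by (rule finite_subset) simp
  then show ?thesis using assms(2)
    by (auto simp: free_space_simps[OF ring_axioms] free_gen_def)
qed

text \<open>The sum that \<open>sweedler\<close> forms out of a representative, seen as a function
  of the representative. On \<open>free_space\<close> it is the linear extension of \<open>B\<close>
  from the generators.\<close>

definition lin_ext ::
    "('k, 'y) ring_scheme \<Rightarrow> ('k, 'p, 'u) module_scheme \<Rightarrow> ('x \<Rightarrow> 'p) \<Rightarrow> ('x \<Rightarrow> 'k) \<Rightarrow> 'p" where
  "lin_ext K P B f = finsum P (\<lambda>p. f p \<odot>\<^bsub>P\<^esub> B p) {p. f p \<noteq> \<zero>\<^bsub>K\<^esub>}"

text \<open>Supports can shrink under addition and scaling. Summing over a common finite superset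
  allows the sums for different \<open>f\<close> to be compared term by term.\<close>

lemma lin_ext_superset:
  assumes "vectorspace K P" "\<And>p. B p \<in> carrier P" "\<And>p. f p \<in> carrier K"
    and "finite A" "{p. f p \<noteq> \<zero>\<^bsub>K\<^esub>} \<subseteq> A"
  shows "lin_ext K P B f = finsum P (\<lambda>p. f p \<odot>\<^bsub>P\<^esub> B p) A"
proof -
  interpret vectorspace K P by fact
  show ?thesis unfolding lin_ext_def
    by (rule add.finprod_mono_neutral_cong_left) (use assms in auto)
qed

text \<open>\<open>B\<close> takes values in \<open>P\<close> at every point, also outside
  \<open>A\<close>. A map that is only meaningful on pairs of carrier elements is extended by zero
  through \<open>cut\<close> to meet this condition.\<close>

lemma lin_lin_ext:
  assumes P: "vectorspace K P" and B: "\<And>p. B p \<in> carrier P"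
  shows "lin K (free_space K A) P (lin_ext K P B)"
proof -
  interpret vectorspace K P by fact
  interpret F: vectorspace K "free_space K A" by (rule vectorspace_free_space) unfold_locales
  note s = free_space_simps[OF ring_axioms]
  show ?thesis
  proof (rule linI)
    fix f assume f: "f \<in> carrier (free_space K A)"
    show "lin_ext K P B f \<in> carrier P"
      unfolding lin_ext_def using f B by (intro M.finsum_closed) (auto simp: s Pi_iff)
    fix g assume g: "g \<in> carrier (free_space K A)"
    let ?A = "{p. f p \<noteq> \<zero>\<^bsub>K\<^esub>} \<union> {p. g p \<noteq> \<zero>\<^bsub>K\<^esub>}"
    have fg: "f p \<in> carrier K" "g p \<in> carrier K" for p using f g by (auto simp: s)
    have fin: "finite ?A" using f g by (simp add: s)
    have "lin_ext K P B (f \<oplus>\<^bsub>free_space K A\<^esub> g) = finsum P (\<lambda>p. (f p \<oplus>\<^bsub>K\<^esub> g p) \<odot>\<^bsub>P\<^esub> B p) ?A"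
      unfolding s by (rule lin_ext_superset) (use assms fg fin in auto)
    also have "\<dots> = finsum P (\<lambda>p. f p \<odot>\<^bsub>P\<^esub> B p \<oplus>\<^bsub>P\<^esub> g p \<odot>\<^bsub>P\<^esub> B p) ?A"
      using fg B by (intro M.finsum_cong') (auto simp: smult_l_distr)
    also have "\<dots> = lin_ext K P B f \<oplus>\<^bsub>P\<^esub> lin_ext K P B g"
      using fg B fin assms by (subst M.finsum_addf) (auto simp: lin_ext_superset[where A = ?A])
    finally show "lin_ext K P B (f \<oplus>\<^bsub>free_space K A\<^esub> g) = lin_ext K P B f \<oplus>\<^bsub>P\<^esub> lin_ext K P B g" .
  next
    fix a f assume a: "a \<in> carrier K" and f: "f \<in> carrier (free_space K A)"
    let ?A = "{p. f p \<noteq> \<zero>\<^bsub>K\<^esub>}"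
    have fg: "f p \<in> carrier K" for p using f by (auto simp: s)
    have fin: "finite ?A" using f by (simp add: s)
    have "lin_ext K P B (a \<odot>\<^bsub>free_space K A\<^esub> f) = finsum P (\<lambda>p. (a \<otimes>\<^bsub>K\<^esub> f p) \<odot>\<^bsub>P\<^esub> B p) ?A"
      unfolding s by (rule lin_ext_superset) (use assms fg fin a in auto)
    also have "\<dots> = finsum P (\<lambda>p. a \<odot>\<^bsub>P\<^esub> (f p \<odot>\<^bsub>P\<^esub> B p)) ?A"
      using fg B a by (intro M.finsum_cong') (auto simp: smult_assoc1)
    also have "\<dots> = a \<odot>\<^bsub>P\<^esub> lin_ext K P B f"
      unfolding lin_ext_def using fg B a by (subst finsum_smult) auto
    finally show "lin_ext K P B (a \<odot>\<^bsub>free_space K A\<^esub> f) = a \<odot>\<^bsub>P\<^esub> lin_ext K P B f" .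
  qed
qed

lemma lin_ext_free_gen:
  assumes P: "vectorspace K P" and B: "\<And>p. B p \<in> carrier P"
  shows "lin_ext K P B (free_gen K p) = B p"
proof -
  interpret vectorspace K P by fact
  have "lin_ext K P B (free_gen K p) = finsum P (\<lambda>q. free_gen K p q \<odot>\<^bsub>P\<^esub> B q) {p}"
    using assms by (intro lin_ext_superset) (auto simp: free_gen_def)
  then show ?thesis using B by (simp add: free_gen_def)
qed

lemma lin_lin_ext_image:
  assumes V: "vectorspace K P" "vectorspace K Q" "lin K P Q g" and B: "\<And>p. B p \<in> carrier P"
    and f: "\<And>p. f p \<in> carrier K"
  shows "g (lin_ext K P B f) = lin_ext K Q (\<lambda>p. g (B p)) f"
proof -
  interpret P: vectorspace K P by fact
  interpret Q: vectorspace K Q by fact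
  show ?thesis unfolding lin_ext_def
    by (subst lin_finsum[OF V]) (auto simp: B f lin_smult[OF V(3)] lin_closed[OF V(3)] intro!: Q.M.finsum_cong')
qed

text \<open>Evaluation at a point is linear, so both sides can be compared coordinate by coordinate.
  The identity expresses that the generators span the free space.\<close>

lemma lin_ext_id:
  assumes K: "field K" and f: "f \<in> carrier (free_space K A)"
  shows "lin_ext K (free_space K A) (\<lambda>p. if p \<in> A then free_gen K p else \<zero>\<^bsub>free_space K A\<^esub>) f = f"
    (is "lin_ext K ?F ?B f = f")
proof
  interpret field K by fact
  interpret F: vectorspace K ?F by (rule vectorspace_free_space) fact
  note s = free_space_simps[OF ring_axioms]
  have fK: "f p \<in> carrier K" for p using f by (auto simp: s)
  fix q
  have ev: "lin K ?F (scalars K) (\<lambda>f. f q)"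
    by (rule linI) (auto simp: s)
  have "lin_ext K ?F ?B f q = lin_ext K (scalars K) (\<lambda>p. ?B p q) f"
    by (rule lin_lin_ext_image[OF F.vectorspace_axioms vectorspace_scalars ev])
      (auto simp: K free_gen_closed fK)
  \<comment> \<open>\<open>q\<close> is added to the support because \<open>f q\<close> may be zero,
    while \<open>finsum_delta\<close> wants the surviving index inside the set.\<close>
  also have "\<dots> = finsum (scalars K) (\<lambda>p. f p \<odot>\<^bsub>scalars K\<^esub> ?B p q) (insert q {p. f p \<noteq> \<zero>\<^bsub>K\<^esub>})"
    using f by (intro lin_ext_superset vectorspace_scalars) (auto simp: K fK s free_gen_def)
  also have "\<dots> = finsum K (\<lambda>p. f p \<otimes>\<^bsub>K\<^esub> ?B p q) (insert q {p. f p \<noteq> \<zero>\<^bsub>K\<^esub>})"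
    by (simp add: finsum_scalars)
  also have "\<dots> = f q \<otimes>\<^bsub>K\<^esub> ?B q q"
    using f by (intro finsum_delta) (auto simp: s free_gen_def fK)
  also have "\<dots> = f q" using f fK by (auto simp: s free_gen_def)
  finally show "lin_ext K ?F ?B f q = f q" .
qed

subsection \<open>Quotients\<close>

lemma span_least:
  assumes "vectorspace K V" "S \<subseteq> carrier V" "submodule K W V" "S \<subseteq> W"
  shows "module.span K V S \<subseteq> W"
proof -
  interpret vectorspace K V by fact
  show ?thesis using assms by (intro span_is_subset) auto
qed

locale quotient_space = vectorspace K F
  for K :: "('k, 'y) ring_scheme" and F :: "('k, 'x, 'u) module_scheme" +
  fixes R :: "'x set"
  assumes sub: "submodule K R F"
begin

lemma abelian_subgroup_R: "abelian_subgroup R F"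
proof (rule abelian_subgroupI3)
  interpret S: submodule K R F by (rule sub)
  have inv: "\<ominus>\<^bsub>F\<^esub> x \<in> R" if "x \<in> R" for x
    using S.smult_closed[OF R.add.inv_closed[OF R.one_closed] that] S.subset that
      smult_minus_1[of x] by (metis subsetD)
  have ne: "R \<noteq> {}" using S.zero_closed by blast
  show "additive_subgroup R F"
    by (rule additive_subgroup.intro, rule M.add.subgroupI)
      (use S.subset ne inv in \<open>auto simp: a_inv_def[symmetric]\<close>)
qed unfold_locales

sublocale R: abelian_subgroup R F by (rule abelian_subgroup_R)

lemma coset_zero: "R = R +>\<^bsub>F\<^esub> \<zero>\<^bsub>F\<^esub>"
  using R.a_rcos_const[of "\<zero>\<^bsub>F\<^esub>"] by simp

lemma coset_add:
  "f \<in> carrier F \<Longrightarrow> g \<in> carrier F \<Longrightarrow> (R +>\<^bsub>F\<^esub> f) <+>\<^bsub>F\<^esub> (R +>\<^bsub>F\<^esub> g) = R +>\<^bsub>F\<^esub> (f \<oplus>\<^bsub>F\<^esub> g)"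
  by (rule R.a_rcos_sum)

lemma coset_eq:
  assumes f: "f \<in> carrier F" and g: "g \<in> carrier F"
  shows "R +>\<^bsub>F\<^esub> f = R +>\<^bsub>F\<^esub> g \<longleftrightarrow> f \<ominus>\<^bsub>F\<^esub> g \<in> R"
proof
  assume "R +>\<^bsub>F\<^esub> f = R +>\<^bsub>F\<^esub> g"
  then have "f \<in> R +>\<^bsub>F\<^esub> g" using R.a_rcos_self[OF f] by simp
  then show "f \<ominus>\<^bsub>F\<^esub> g \<in> R" using R.a_rcos_module_imp[OF g] by (simp add: a_minus_def)
next
  assume "f \<ominus>\<^bsub>F\<^esub> g \<in> R"
  then have "f \<in> R +>\<^bsub>F\<^esub> g" using R.a_rcos_module_rev[OF g f] by (simp add: a_minus_def)
  then show "R +>\<^bsub>F\<^esub> f = R +>\<^bsub>F\<^esub> g" using R.a_repr_independence'[OF _ g] by simp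
qed

text \<open>Adding \<open>R\<close> to the scaled coset matters for the scalar zero, where the image
  of a coset shrinks to the single element zero. For all other scalars the image is already a
  coset.\<close>

lemma coset_smult:
  assumes a: "a \<in> carrier K" and f: "f \<in> carrier F"
  shows "R <+>\<^bsub>F\<^esub> ((\<lambda>f. a \<odot>\<^bsub>F\<^esub> f) ` (R +>\<^bsub>F\<^esub> f)) = R +>\<^bsub>F\<^esub> (a \<odot>\<^bsub>F\<^esub> f)"
proof
  interpret S: submodule K R F by (rule sub)
  have RF: "r \<in> carrier F" if "r \<in> R" for r using S.subset that by auto
  show "R <+>\<^bsub>F\<^esub> ((\<lambda>f. a \<odot>\<^bsub>F\<^esub> f) ` (R +>\<^bsub>F\<^esub> f)) \<subseteq> R +>\<^bsub>F\<^esub> (a \<odot>\<^bsub>F\<^esub> f)"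
  proof
    fix x assume "x \<in> R <+>\<^bsub>F\<^esub> ((\<lambda>f. a \<odot>\<^bsub>F\<^esub> f) ` (R +>\<^bsub>F\<^esub> f))"
    then obtain r s where rs: "r \<in> R" "s \<in> R" and x: "x = r \<oplus>\<^bsub>F\<^esub> a \<odot>\<^bsub>F\<^esub> (s \<oplus>\<^bsub>F\<^esub> f)"
      by (auto simp: set_add_def' a_r_coset_def')
    have "x = (r \<oplus>\<^bsub>F\<^esub> a \<odot>\<^bsub>F\<^esub> s) \<oplus>\<^bsub>F\<^esub> a \<odot>\<^bsub>F\<^esub> f"
      unfolding x using rs a f RF by (simp add: smult_r_distr M.a_assoc)
    moreover have "r \<oplus>\<^bsub>F\<^esub> a \<odot>\<^bsub>F\<^esub> s \<in> R" using rs a by simp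
    ultimately show "x \<in> R +>\<^bsub>F\<^esub> (a \<odot>\<^bsub>F\<^esub> f)" unfolding a_r_coset_def' by blast
  qed
  show "R +>\<^bsub>F\<^esub> (a \<odot>\<^bsub>F\<^esub> f) \<subseteq> R <+>\<^bsub>F\<^esub> ((\<lambda>f. a \<odot>\<^bsub>F\<^esub> f) ` (R +>\<^bsub>F\<^esub> f))"
  proof
    fix x assume "x \<in> R +>\<^bsub>F\<^esub> (a \<odot>\<^bsub>F\<^esub> f)"
    then obtain r where "r \<in> R" "x = r \<oplus>\<^bsub>F\<^esub> a \<odot>\<^bsub>F\<^esub> f" by (auto simp: a_r_coset_def')
    then show "x \<in> R <+>\<^bsub>F\<^esub> ((\<lambda>f. a \<odot>\<^bsub>F\<^esub> f) ` (R +>\<^bsub>F\<^esub> f))"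
      using R.a_rcos_self[OF f] unfolding set_add_def' by blast
  qed
qed

lemma cosets: "a_rcosets\<^bsub>F\<^esub> R = (\<lambda>f. R +>\<^bsub>F\<^esub> f) ` carrier F"
  by (auto simp: A_RCOSETS_def')

text \<open>Only the carrier and the vector space operations are prescribed, so that the result
  applies to \<open>tensor\<close>, whose record also has the undefined fields \<open>mult\<close>
  and \<open>one\<close>.\<close>

lemma vectorspace_quotient:
  assumes "carrier Q = a_rcosets\<^bsub>F\<^esub> R" "zero Q = R" "add Q = (\<lambda>s t. s <+>\<^bsub>F\<^esub> t)"
    "smult Q = (\<lambda>a t. R <+>\<^bsub>F\<^esub> ((\<lambda>f. a \<odot>\<^bsub>F\<^esub> f) ` t))"
  shows "vectorspace K Q"
proof (rule vs_criteria)
  show "field K" by unfold_locales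
  show "\<zero>\<^bsub>Q\<^esub> \<in> carrier Q" unfolding assms cosets using coset_zero by (intro image_eqI[of R _ "\<zero>\<^bsub>F\<^esub>"]) auto
  show "\<forall>v\<in>carrier Q. \<exists>neg_v\<in>carrier Q. v \<oplus>\<^bsub>Q\<^esub> neg_v = \<zero>\<^bsub>Q\<^esub>"
  proof
    fix v assume "v \<in> carrier Q"
    then obtain f where f: "f \<in> carrier F" "v = R +>\<^bsub>F\<^esub> f" unfolding assms cosets by auto
    then have "v \<oplus>\<^bsub>Q\<^esub> (R +>\<^bsub>F\<^esub> (\<ominus>\<^bsub>F\<^esub> f)) = \<zero>\<^bsub>Q\<^esub>"
      unfolding assms by (simp add: coset_add M.r_neg flip: coset_zero)
    then show "\<exists>neg_v\<in>carrier Q. v \<oplus>\<^bsub>Q\<^esub> neg_v = \<zero>\<^bsub>Q\<^esub>"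
      using f unfolding assms cosets by (auto intro!: bexI[of _ "\<ominus>\<^bsub>F\<^esub> f"])
  qed
  show "\<forall>v\<in>carrier Q. v \<oplus>\<^bsub>Q\<^esub> \<zero>\<^bsub>Q\<^esub> = v"
  proof -
    have "(R +>\<^bsub>F\<^esub> f) <+>\<^bsub>F\<^esub> R = R +>\<^bsub>F\<^esub> f" if "f \<in> carrier F" for f
      using coset_add[OF that M.zero_closed] that by (simp flip: coset_zero)
    then show ?thesis unfolding assms cosets by auto
  qed
qed (auto simp: assms cosets coset_add coset_smult smult_l_distr smult_r_distr smult_assoc1
    M.a_ac)

end

section \<open>Bilinear maps and the universal property of the tensor product\<close>

definition bilin ::
    "('k, 'y) ring_scheme \<Rightarrow> ('k, 'm, 'u) module_scheme \<Rightarrow> ('k, 'n, 'w) module_scheme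
      \<Rightarrow> ('k, 'p, 'v) module_scheme \<Rightarrow> ('m \<Rightarrow> 'n \<Rightarrow> 'p) \<Rightarrow> bool" where
  "bilin K M N P B \<longleftrightarrow> (\<forall>b \<in> carrier N. lin K M P (\<lambda>a. B a b)) \<and> (\<forall>a \<in> carrier M. lin K N P (\<lambda>b. B a b))"

lemma bilinI:
  "(\<And>b. b \<in> carrier N \<Longrightarrow> lin K M P (\<lambda>a. B a b)) \<Longrightarrow> (\<And>a. a \<in> carrier M \<Longrightarrow> lin K N P (\<lambda>b. B a b))
    \<Longrightarrow> bilin K M N P B"
  by (simp add: bilin_def)

lemma bilin_closed: "bilin K M N P B \<Longrightarrow> a \<in> carrier M \<Longrightarrow> b \<in> carrier N \<Longrightarrow> B a b \<in> carrier P"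
  by (auto simp: bilin_def dest: lin_closed)

text \<open>The typed variant of \<^const>\<open>sweedler\<close>: cutting \<open>B\<close> off outside \<open>carrier M \<times> carrier N\<close> makes
  the congruence rule unconditional.\<close>

definition sw ::
    "('k, 'y) ring_scheme \<Rightarrow> ('k, 'm, 'u) module_scheme \<Rightarrow> ('k, 'n, 'w) module_scheme
      \<Rightarrow> ('k, 'p, 'v) module_scheme \<Rightarrow> ('m \<Rightarrow> 'n \<Rightarrow> 'p) \<Rightarrow> ('m \<times> 'n \<Rightarrow> 'k) set \<Rightarrow> 'p" where
  "sw K M N P B t =
     sweedler K P (\<lambda>a b. if a \<in> carrier M \<and> b \<in> carrier N then B a b else \<zero>\<^bsub>P\<^esub>) t"

lemma sw_cong:
  "t = t' \<Longrightarrow> (\<And>a b. a \<in> carrier M \<Longrightarrow> b \<in> carrier N \<Longrightarrow> B a b = B' a b)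
    \<Longrightarrow> sw K M N P B t = sw K M N P B' t'"
  unfolding sw_def by (rule arg_cong2[where f = "\<lambda>B. sweedler K P B"]) (auto simp: fun_eq_iff)

text \<open>Under the binders of a Sweedler sum the simplifier thereby gets membership of the bound
  elements in the carriers, on which nearly all conditions of the rewrite rules depend.\<close>

lemma sw_cong_simp [cong]:
  "M = M' \<Longrightarrow> N = N' \<Longrightarrow> P = P' \<Longrightarrow> t = t'
    \<Longrightarrow> (\<And>a b. a \<in> carrier M' \<Longrightarrow> b \<in> carrier N' \<Longrightarrow> B a b = B' a b)
    \<Longrightarrow> sw K M N P B t = sw K M' N' P' B' t'"
  by (simp only:) (rule sw_cong[OF refl])

definition cut ::
    "('k, 'm, 'u) module_scheme \<Rightarrow> ('k, 'n, 'w) module_scheme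
      \<Rightarrow> ('k, 'p, 'v) module_scheme \<Rightarrow> ('m \<Rightarrow> 'n \<Rightarrow> 'p) \<Rightarrow> 'm \<times> 'n \<Rightarrow> 'p" where
  "cut M N P B p = (if p \<in> carrier M \<times> carrier N then B (fst p) (snd p) else \<zero>\<^bsub>P\<^esub>)"

text \<open>Here the choice of a representative becomes visible. For bilinear \<open>B\<close> it is
  removed by \<open>sw_coset\<close>; the rules for general \<open>B\<close> keep \<open>t\<close>
  fixed, and with it the representative.\<close>

lemma sw_lin_ext: "sw K M N P B t = lin_ext K P (cut M N P B) (SOME f. f \<in> t)"
  by (simp add: sw_def sweedler_def lin_ext_def cut_def Let_def mem_Times_iff)

lemma foldSetD_cong:
  "(A, y) \<in> foldSetD D f e \<Longrightarrow> (\<And>x. x \<in> A \<Longrightarrow> f x = g x) \<Longrightarrow> (A, y) \<in> foldSetD D g e"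
proof (induct set: foldSetD)
  case (insertI x A y)
  then have "(insert x A, g x y) \<in> foldSetD D g e" by (intro foldSetD.insertI) auto
  then show ?case using insertI by simp
qed (rule foldSetD.emptyI)

text \<open>\<open>foldSetD\<close> evaluates the summand only at elements of \<open>A\<close>, so
  the two fold relations coincide, whether or not the summands lie in the carrier.\<close>

lemma finsum_cong_weak:
  assumes "\<And>x. x \<in> A \<Longrightarrow> f x = g x" shows "finsum G f A = finsum G g A"
proof -
  have "(A, y) \<in> foldSetD D ((\<oplus>\<^bsub>G\<^esub>) \<circ> f) e \<longleftrightarrow> (A, y) \<in> foldSetD D ((\<oplus>\<^bsub>G\<^esub>) \<circ> g) e" for D y e
    using foldSetD_cong[of A y D "(\<oplus>\<^bsub>G\<^esub>) \<circ> f" e "(\<oplus>\<^bsub>G\<^esub>) \<circ> g"]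
      foldSetD_cong[of A y D "(\<oplus>\<^bsub>G\<^esub>) \<circ> g" e "(\<oplus>\<^bsub>G\<^esub>) \<circ> f"] assms by auto
  then show ?thesis by (simp add: finsum_def finprod_def foldD_def)
qed

locale tensor_product = M: vectorspace K M + N: vectorspace K N
  for K :: "('k, 'y) ring_scheme"
    and M :: "('k, 'm, 'u) module_scheme" and N :: "('k, 'n, 'w) module_scheme"
begin

abbreviation "F \<equiv> free_space K (carrier M \<times> carrier N)"
abbreviation "R \<equiv> tensor_null K M N"
abbreviation "T \<equiv> tensor K M N"

lemma K_field: "field K" by unfold_locales

sublocale F: vectorspace K F by (rule vectorspace_free_space) unfold_locales

lemma gen_closed: "m \<in> carrier M \<Longrightarrow> n \<in> carrier N \<Longrightarrow> free_gen K (m, n) \<in> carrier F"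
  by (rule free_gen_closed[OF K_field]) simp

lemma relations_closed: "tensor_relations K M N \<subseteq> carrier F"
  unfolding tensor_relations_def Let_def
  by (auto intro!: F.M.minus_closed F.M.add.m_closed F.smult_closed gen_closed)

lemma quotient_space_null: "quotient_space K F R"
  by (intro quotient_space.intro F.vectorspace_axioms quotient_space_axioms.intro)
    (unfold tensor_null_def, rule F.span_is_submodule[OF relations_closed])

sublocale Q: quotient_space K F R by (rule quotient_space_null)

lemma T_simps:
  "carrier T = a_rcosets\<^bsub>F\<^esub> R" "zero T = R" "add T = (\<lambda>s t. s <+>\<^bsub>F\<^esub> t)"
  "smult T = (\<lambda>a t. R <+>\<^bsub>F\<^esub> ((\<lambda>f. a \<odot>\<^bsub>F\<^esub> f) ` t))"
  by (simp_all add: tensor_def Let_def)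

lemma vectorspace_T: "vectorspace K T" by (rule Q.vectorspace_quotient) (simp_all add: T_simps)

lemma lin_proj: "lin K F T (\<lambda>f. R +>\<^bsub>F\<^esub> f)"
  by (rule linI) (auto simp: T_simps Q.cosets Q.coset_add Q.coset_smult)

text \<open>The element chosen from a coset lies in the free space and represents the same coset.
  Every argument about the choice goes through this rule and then speaks of an ordinary
  representative.\<close>

lemma T_cases:
  assumes "t \<in> carrier T"
  obtains f where "f \<in> carrier F" "t = R +>\<^bsub>F\<^esub> f" "(SOME f. f \<in> t) = f"
proof -
  obtain g where g: "g \<in> carrier F" "t = R +>\<^bsub>F\<^esub> g" using assms by (auto simp: T_simps Q.cosets)
  have "(SOME f. f \<in> t) \<in> t" using Q.R.a_rcos_self[OF g(1)] g(2) by (metis someI)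
  then show thesis using that[of "SOME f. f \<in> t"] g Q.R.a_repr_independence'[OF _ g(1)]
      Q.R.a_elemrcos_carrier[OF g(1)] by auto
qed

lemma relation_null: "r \<in> tensor_relations K M N \<Longrightarrow> r \<in> R"
  unfolding tensor_null_def using F.in_own_span[OF relations_closed] by auto

lemma pure_eqI:
  assumes "f \<in> carrier F" "g \<in> carrier F" "f \<ominus>\<^bsub>F\<^esub> g \<in> tensor_relations K M N"
  shows "R +>\<^bsub>F\<^esub> f = R +>\<^bsub>F\<^esub> g"
  using assms Q.coset_eq relation_null by auto

text \<open>For each of the four laws the difference of the two representatives is literally one of
  the generators in \<open>tensor_relations\<close>.\<close>

lemma bilin_pure: "bilin K M N T (pure K M N)"
proof (intro bilinI linI)
  fix m m' n n' a
  note in_rel = tensor_relations_def Let_def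
  note cl = gen_closed F.M.add.m_closed F.smult_closed
  note pr = lin_add[OF lin_proj, symmetric] lin_smult[OF lin_proj, symmetric] gen_closed
  show "m \<in> carrier M \<Longrightarrow> n \<in> carrier N \<Longrightarrow> pure K M N m n \<in> carrier T"
    unfolding pure_def by (rule lin_closed[OF lin_proj]) (rule gen_closed)
  then show "m \<in> carrier M \<Longrightarrow> n \<in> carrier N \<Longrightarrow> pure K M N m n \<in> carrier T" .
  show "n \<in> carrier N \<Longrightarrow> m \<in> carrier M \<Longrightarrow> m' \<in> carrier M \<Longrightarrow>
      pure K M N (m \<oplus>\<^bsub>M\<^esub> m') n = pure K M N m n \<oplus>\<^bsub>T\<^esub> pure K M N m' n"
    unfolding pure_def by (simp add: pr) (rule pure_eqI, auto simp: in_rel intro: cl)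
  show "m \<in> carrier M \<Longrightarrow> n \<in> carrier N \<Longrightarrow> n' \<in> carrier N \<Longrightarrow>
      pure K M N m (n \<oplus>\<^bsub>N\<^esub> n') = pure K M N m n \<oplus>\<^bsub>T\<^esub> pure K M N m n'"
    unfolding pure_def by (simp add: pr) (rule pure_eqI, auto simp: in_rel intro: cl)
  show "n \<in> carrier N \<Longrightarrow> a \<in> carrier K \<Longrightarrow> m \<in> carrier M \<Longrightarrow>
      pure K M N (a \<odot>\<^bsub>M\<^esub> m) n = a \<odot>\<^bsub>T\<^esub> pure K M N m n"
    unfolding pure_def by (simp add: pr) (rule pure_eqI, auto simp: in_rel intro: cl)
  show "m \<in> carrier M \<Longrightarrow> a \<in> carrier K \<Longrightarrow> n \<in> carrier N \<Longrightarrow>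
      pure K M N m (a \<odot>\<^bsub>N\<^esub> n) = a \<odot>\<^bsub>T\<^esub> pure K M N m n"
    unfolding pure_def by (simp add: pr) (rule pure_eqI, auto simp: in_rel intro: cl)
qed

end

context tensor_product
begin

context
  fixes P :: "('k, 'p, 'v) module_scheme" assumes P: "vectorspace K P"
begin

interpretation P: vectorspace K P by (rule P)

lemma cut_closed:
  "(\<And>a b. a \<in> carrier M \<Longrightarrow> b \<in> carrier N \<Longrightarrow> B a b \<in> carrier P) \<Longrightarrow> cut M N P B p \<in> carrier P"
  by (auto simp: cut_def)

text \<open>The kernel of the linear extension is a subspace. By bilinearity it contains the
  generating relations, hence also their span.\<close>

lemma lin_ext_relations:
  assumes B: "bilin K M N P B" and r: "r \<in> R"
  shows "lin_ext K P (cut M N P B) r = \<zero>\<^bsub>P\<^esub>"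
proof -
  let ?L = "lin_ext K P (cut M N P B)"
  have cl: "cut M N P B p \<in> carrier P" for p by (rule cut_closed) (rule bilin_closed[OF B])
  have L: "lin K F P ?L" by (rule lin_lin_ext[OF P cl])
  interpret L: linear_map K F P ?L using L P F.vectorspace_axioms by (simp add: linear_map_iff_lin)
  have gen: "?L (free_gen K (m, n)) = B m n" if "m \<in> carrier M" "n \<in> carrier N" for m n
    using that by (simp add: lin_ext_free_gen[OF P cl] cut_def)
  have Bl: "lin K M P (\<lambda>a. B a b)" if "b \<in> carrier N" for b using B that by (simp add: bilin_def)
  have Br: "lin K N P (\<lambda>b. B a b)" if "a \<in> carrier M" for a using B that by (simp add: bilin_def)
  have "tensor_relations K M N \<subseteq> L.ker"
    unfolding L.ker_def using relations_closed
    by (auto simp: tensor_relations_def Let_def gen gen_closed lin_add[OF Bl] lin_add[OF Br]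
        lin_smult[OF Bl] lin_smult[OF Br] bilin_closed[OF B] P.M.minus_eq P.M.r_neg)
  then have "R \<subseteq> L.ker"
    unfolding tensor_null_def by (intro span_least F.vectorspace_axioms relations_closed L.ker_is_submodule)
  then show ?thesis using r by (auto simp: L.ker_def)
qed

text \<open>Independence of the representative: the chosen one differs from \<open>f\<close> by an
  element of \<open>R\<close>, on which the linear extension vanishes.\<close>

lemma sw_coset:
  assumes B: "bilin K M N P B" and f: "f \<in> carrier F"
  shows "sw K M N P B (R +>\<^bsub>F\<^esub> f) = lin_ext K P (cut M N P B) f"
proof -
  let ?L = "lin_ext K P (cut M N P B)"
  have cl: "cut M N P B p \<in> carrier P" for p by (rule cut_closed) (rule bilin_closed[OF B])
  have L: "lin K F P ?L" by (rule lin_lin_ext[OF P cl])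
  have "R +>\<^bsub>F\<^esub> f \<in> carrier T" by (rule lin_closed[OF lin_proj f])
  then obtain g where g: "g \<in> carrier F" "R +>\<^bsub>F\<^esub> f = R +>\<^bsub>F\<^esub> g" "(SOME h. h \<in> R +>\<^bsub>F\<^esub> f) = g"
    by (rule T_cases)
  have r: "f \<ominus>\<^bsub>F\<^esub> g \<in> R" using g f Q.coset_eq by auto
  interpret L: linear_map K F P ?L using L P F.vectorspace_axioms by (simp add: linear_map_iff_lin)
  have "?L f \<oplus>\<^bsub>P\<^esub> \<ominus>\<^bsub>P\<^esub> ?L g = \<zero>\<^bsub>P\<^esub>"
    using lin_ext_relations[OF B r] f g by (simp add: P.M.minus_eq)
  then have "?L f = ?L g" using f g P.M.minus_equality[of "?L f" "\<ominus>\<^bsub>P\<^esub> ?L g"] by simp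
  then show ?thesis by (simp add: sw_lin_ext g(3))
qed

lemma sw_pure_T:
  assumes B: "bilin K M N P B" and "m \<in> carrier M" "n \<in> carrier N"
  shows "sw K M N P B (pure K M N m n) = B m n"
  unfolding pure_def using assms
  by (simp add: sw_coset gen_closed lin_ext_free_gen[OF P] cut_closed bilin_closed[OF B])
    (simp add: cut_def)

lemma lin_sw_T:
  assumes B: "bilin K M N P B" shows "lin K T P (\<lambda>t. sw K M N P B t)"
proof (rule linI)
  have cl: "cut M N P B p \<in> carrier P" for p by (rule cut_closed) (rule bilin_closed[OF B])
  note L = lin_lin_ext[where B = "cut M N P B", OF P cl, where A = "carrier M \<times> carrier N"]
  fix s assume "s \<in> carrier T"
  then obtain f where f: "f \<in> carrier F" "s = R +>\<^bsub>F\<^esub> f" by (rule T_cases)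
  show "sw K M N P B s \<in> carrier P"
    unfolding f(2) sw_coset[OF B f(1)] by (rule lin_closed[OF L f(1)])
  show "sw K M N P B (a \<odot>\<^bsub>T\<^esub> s) = a \<odot>\<^bsub>P\<^esub> sw K M N P B s" if "a \<in> carrier K" for a
    using f that
    by (simp add: sw_coset[OF B] lin_smult[OF L] f(2) flip: lin_smult[OF lin_proj])
  fix t assume "t \<in> carrier T"
  then obtain g where g: "g \<in> carrier F" "t = R +>\<^bsub>F\<^esub> g" by (rule T_cases)
  show "sw K M N P B (s \<oplus>\<^bsub>T\<^esub> t) = sw K M N P B s \<oplus>\<^bsub>P\<^esub> sw K M N P B t"
    using f g
    by (simp add: sw_coset[OF B] lin_add[OF L] flip: lin_add[OF lin_proj])
qed

lemma sw_closed_T: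
  assumes "t \<in> carrier T" "\<And>a b. a \<in> carrier M \<Longrightarrow> b \<in> carrier N \<Longrightarrow> B a b \<in> carrier P"
  shows "sw K M N P B t \<in> carrier P"
proof -
  obtain f where f: "f \<in> carrier F" "(SOME f. f \<in> t) = f" using assms(1) by (rule T_cases)
  show ?thesis unfolding sw_lin_ext f(2)
    by (rule lin_closed[OF lin_lin_ext[OF P] f(1)]) (rule cut_closed[OF assms(2)])
qed

text \<open>Both sides sum over the same chosen representative of \<open>t\<close>, so the linear
  map passes through term by term.\<close>

lemma sw_image_T:
  fixes P' :: "('k, 'q, 'v') module_scheme"
  assumes P': "vectorspace K P'" and g: "lin K P P' g" and t: "t \<in> carrier T"
    and B: "\<And>a b. a \<in> carrier M \<Longrightarrow> b \<in> carrier N \<Longrightarrow> B a b \<in> carrier P"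
  shows "g (sw K M N P B t) = sw K M N P' (\<lambda>a b. g (B a b)) t"
proof -
  obtain f where f: "f \<in> carrier F" "(SOME f. f \<in> t) = f" using t by (rule T_cases)
  have "g (cut M N P B p) = cut M N P' (\<lambda>a b. g (B a b)) p" for p
    using lin_zero[OF P P' g] by (simp add: cut_def)
  moreover have "f p \<in> carrier K" for p using f(1) by (auto simp: free_space_simps[OF M.R.ring_axioms])
  ultimately show ?thesis unfolding sw_lin_ext f(2)
    using lin_lin_ext_image[OF P P' g, where B = "cut M N P B" and f = f] cut_closed[OF B] by simp
qed

text \<open>With \<open>t\<close> fixed its chosen representative is fixed, so the value is a finite
  linear combination of maps that are linear in the parameter.\<close>

lemma lin_sw_param_T:
  fixes V :: "('k, 'q, 'v') module_scheme"
  assumes t: "t \<in> carrier T"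
    and B: "\<And>a b. a \<in> carrier M \<Longrightarrow> b \<in> carrier N \<Longrightarrow> lin K V P (\<lambda>x. B x a b)"
  shows "lin K V P (\<lambda>x. sw K M N P (B x) t)"
proof -
  obtain f where f: "f \<in> carrier F" "(SOME f. f \<in> t) = f" using t by (rule T_cases)
  have fK: "f p \<in> carrier K" for p using f(1) by (auto simp: free_space_simps[OF M.R.ring_axioms])
  let ?A = "{p. f p \<noteq> \<zero>\<^bsub>K\<^esub>}"
  have A: "fst p \<in> carrier M" "snd p \<in> carrier N" if "p \<in> ?A" for p
  proof -
    have "p \<in> carrier M \<times> carrier N"
      using f(1) that by (cases p) (auto simp: free_space_simps[OF M.R.ring_axioms])
    then show "fst p \<in> carrier M" "snd p \<in> carrier N" by auto
  qed
  have c: "B x (fst p) (snd p) \<in> carrier P" if "x \<in> carrier V" "p \<in> ?A" for x p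
    using lin_closed[OF B] A that by blast
  have eq: "sw K M N P (B x) t = finsum P (\<lambda>p. f p \<odot>\<^bsub>P\<^esub> B x (fst p) (snd p)) ?A" for x
    unfolding sw_lin_ext f(2) lin_ext_def
    by (rule finsum_cong_weak) (use A in \<open>auto simp: cut_def mem_Times_iff\<close>)
  show ?thesis unfolding eq
  proof (rule linI)
    fix x assume x: "x \<in> carrier V"
    show "finsum P (\<lambda>p. f p \<odot>\<^bsub>P\<^esub> B x (fst p) (snd p)) ?A \<in> carrier P"
      by (rule P.M.finsum_closed) (use c[OF x] fK in auto)
    show "finsum P (\<lambda>p. f p \<odot>\<^bsub>P\<^esub> B (a \<odot>\<^bsub>V\<^esub> x) (fst p) (snd p)) ?A =
        a \<odot>\<^bsub>P\<^esub> finsum P (\<lambda>p. f p \<odot>\<^bsub>P\<^esub> B x (fst p) (snd p)) ?A" if a: "a \<in> carrier K" for a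
      using c[OF x] fK a x A lin_smult[OF B]
      by (subst P.finsum_smult)
        (auto intro!: P.M.finsum_cong' simp: P.smult_assoc1[symmetric] M.R.m_comm)
    fix y assume y: "y \<in> carrier V"
    show "finsum P (\<lambda>p. f p \<odot>\<^bsub>P\<^esub> B (x \<oplus>\<^bsub>V\<^esub> y) (fst p) (snd p)) ?A =
        finsum P (\<lambda>p. f p \<odot>\<^bsub>P\<^esub> B x (fst p) (snd p)) ?A \<oplus>\<^bsub>P\<^esub>
        finsum P (\<lambda>p. f p \<odot>\<^bsub>P\<^esub> B y (fst p) (snd p)) ?A"
    proof -
      have "f p \<odot>\<^bsub>P\<^esub> B (x \<oplus>\<^bsub>V\<^esub> y) (fst p) (snd p) =
          f p \<odot>\<^bsub>P\<^esub> B x (fst p) (snd p) \<oplus>\<^bsub>P\<^esub> f p \<odot>\<^bsub>P\<^esub> B y (fst p) (snd p)" if "p \<in> ?A" for p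
        using c[OF x that] c[OF y that] fK lin_add[OF B[OF A[OF that]] x y]
        by (simp add: P.smult_r_distr)
      then have "finsum P (\<lambda>p. f p \<odot>\<^bsub>P\<^esub> B (x \<oplus>\<^bsub>V\<^esub> y) (fst p) (snd p)) ?A =
        finsum P (\<lambda>p. f p \<odot>\<^bsub>P\<^esub> B x (fst p) (snd p) \<oplus>\<^bsub>P\<^esub> f p \<odot>\<^bsub>P\<^esub> B y (fst p) (snd p)) ?A"
        by (rule finsum_cong_weak)
      also have "\<dots> = finsum P (\<lambda>p. f p \<odot>\<^bsub>P\<^esub> B x (fst p) (snd p)) ?A \<oplus>\<^bsub>P\<^esub>
        finsum P (\<lambda>p. f p \<odot>\<^bsub>P\<^esub> B y (fst p) (snd p)) ?A"
        by (rule P.M.finsum_addf) (use c[OF x] c[OF y] fK in auto)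
      finally show ?thesis .
    qed
  qed
qed

end

text \<open>The chosen representative is a combination of generators by \<open>lin_ext_id\<close>,
  and the projection to cosets sends generators to pure tensors. This is the fact that pure tensors
  span.\<close>

lemma sw_eta_T:
  assumes "t \<in> carrier T" shows "sw K M N T (pure K M N) t = t"
proof -
  obtain f where f: "f \<in> carrier F" "t = R +>\<^bsub>F\<^esub> f" using assms by (rule T_cases)
  have fK: "f p \<in> carrier K" for p using f(1) by (auto simp: free_space_simps[OF M.R.ring_axioms])
  let ?B = "\<lambda>p. if p \<in> carrier M \<times> carrier N then free_gen K p else \<zero>\<^bsub>F\<^esub>"
  have "sw K M N T (pure K M N) t = lin_ext K T (cut M N T (pure K M N)) f"
    unfolding f(2) by (rule sw_coset[OF vectorspace_T bilin_pure f(1)])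
  also have "cut M N T (pure K M N) = (\<lambda>p. R +>\<^bsub>F\<^esub> ?B p)"
    using lin_zero[OF F.vectorspace_axioms vectorspace_T lin_proj]
    by (auto simp: fun_eq_iff cut_def pure_def)
  also have "lin_ext K T (\<lambda>p. R +>\<^bsub>F\<^esub> ?B p) f = R +>\<^bsub>F\<^esub> lin_ext K F ?B f"
    by (rule lin_lin_ext_image[OF F.vectorspace_axioms vectorspace_T lin_proj, symmetric])
      (auto simp: fK free_gen_closed[OF K_field])
  also have "\<dots> = t" by (simp only: lin_ext_id[OF K_field f(1)] f(2))
  finally show ?thesis .
qed

text \<open>A representative vanishes off the product of the carriers, so cutting off
  \<open>B\<close> there does not affect the sum.\<close>

lemma sweedler_eq_sw_T:
  assumes "t \<in> carrier T" shows "sweedler K P B t = sw K M N P B t"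
proof -
  obtain f where f: "f \<in> carrier F" "(SOME f. f \<in> t) = f" using assms by (rule T_cases)
  then show ?thesis unfolding sw_lin_ext lin_ext_def sweedler_def Let_def
    by (intro finsum_cong_weak) (auto simp: free_space_simps[OF M.R.ring_axioms] cut_def mem_Times_iff)
qed

end

subsection \<open>Calculation rules\<close>

lemma tensor_productI: "vectorspace K M \<Longrightarrow> vectorspace K N \<Longrightarrow> tensor_product K M N"
  by (simp add: tensor_product_def)

lemmas vs_tensor = tensor_product.vectorspace_T[OF tensor_productI]
lemmas sw_pure = tensor_product.sw_pure_T[OF tensor_productI]
lemmas sw_closed = tensor_product.sw_closed_T[OF tensor_productI]
lemmas sw_eta = tensor_product.sw_eta_T[OF tensor_productI]
lemmas sweedler_eq_sw = tensor_product.sweedler_eq_sw_T[OF tensor_productI]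
lemmas bilin_pure = tensor_product.bilin_pure[OF tensor_productI]

text \<open>As a congruence rule this keeps the simplifier from rewriting inside the map. Linearity
  goals thus retain the form in which they were produced, to which the linearity rules
  apply.\<close>

lemma lin_cong_weak: "V = V' \<Longrightarrow> W = W' \<Longrightarrow> lin K V W f = lin K V' W' f"
  by simp

lemma lin_id: "lin K V V (\<lambda>x. x)"
  by (simp add: linI)

text \<open>Each structure map has an instance of this as a rewrite rule. Maps are driven inwards
  and Sweedler sums outwards until both sides of an identity are iterated sums of pure
  tensors.\<close>

lemma sw_push:
  assumes "lin K P Q g" "vectorspace K M" "vectorspace K N" "vectorspace K P" "vectorspace K Q"
    "t \<in> carrier (tensor K M N)" "\<And>a b. a \<in> carrier M \<Longrightarrow> b \<in> carrier N \<Longrightarrow> B a b \<in> carrier P"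
  shows "g (sw K M N P B t) = sw K M N Q (\<lambda>a b. g (B a b)) t"
  using tensor_product.sw_image_T[OF tensor_productI, of K M N P Q g t B] assms by simp

lemma lin_sw_body:
  assumes "vectorspace K M" "vectorspace K N" "vectorspace K P" "t \<in> carrier (tensor K M N)"
    "\<And>a b. a \<in> carrier M \<Longrightarrow> b \<in> carrier N \<Longrightarrow> lin K V P (\<lambda>x. B x a b)"
  shows "lin K V P (\<lambda>x. sw K M N P (\<lambda>a b. B x a b) t)"
  using tensor_product.lin_sw_param_T[OF tensor_productI, of K M N P t V B] assms by simp

lemma lin_sw:
  assumes "vectorspace K M" "vectorspace K N" "vectorspace K P" "bilin K M N P B"
  shows "lin K (tensor K M N) P (\<lambda>t. sw K M N P B t)"
  using tensor_product.lin_sw_T[OF tensor_productI, of K M N P B] assms by simp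

lemma lin_sw_arg:
  assumes "vectorspace K M" "vectorspace K N" "vectorspace K P" "bilin K M N P B"
    "lin K V (tensor K M N) F"
  shows "lin K V P (\<lambda>x. sw K M N P B (F x))"
  by (rule lin_comp[OF assms(5) lin_sw[OF assms(1-4)]])

text \<open>The linear map that is pushed inwards is here itself a Sweedler sum; this flattens a sum
  over the result of another sum.\<close>

lemma sw_sw:
  assumes "vectorspace K M" "vectorspace K N" "vectorspace K P" "bilin K M N P B"
    "vectorspace K A" "vectorspace K C" "t \<in> carrier (tensor K A C)"
    "\<And>a c. a \<in> carrier A \<Longrightarrow> c \<in> carrier C \<Longrightarrow> F a c \<in> carrier (tensor K M N)"
  shows "sw K M N P B (sw K A C (tensor K M N) F t) = sw K A C P (\<lambda>a c. sw K M N P B (F a c)) t"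
  by (rule sw_push[OF lin_sw[OF assms(1-4)]]) (use assms in \<open>auto intro: vs_tensor\<close>)

lemma sw_smult:
  assumes "vectorspace K M" "vectorspace K N" "vectorspace K P" "bilin K M N P B"
    "c \<in> carrier K" "t \<in> carrier (tensor K M N)"
  shows "sw K M N P B (c \<odot>\<^bsub>tensor K M N\<^esub> t) = c \<odot>\<^bsub>P\<^esub> sw K M N P B t"
  by (rule lin_smult[OF lin_sw[OF assms(1-4)] assms(5,6)])

lemma lin_smult_right:
  assumes "vectorspace K W" "c \<in> carrier K" "lin K V W F"
  shows "lin K V W (\<lambda>x. c \<odot>\<^bsub>W\<^esub> F x)"
proof -
  interpret vectorspace K W by fact
  show ?thesis
    by (rule linI) (simp_all add: lin_closed[OF assms(3)] lin_add[OF assms(3)] lin_smult[OF assms(3)]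
        assms(2) smult_r_distr smult_assoc1[symmetric] R.m_comm)
qed

lemma lin_smult_left:
  assumes "vectorspace K W" "w \<in> carrier W" "lin K V (scalars K) F"
  shows "lin K V W (\<lambda>x. F x \<odot>\<^bsub>W\<^esub> w)"
proof -
  interpret vectorspace K W by fact
  show ?thesis
    using lin_closed[OF assms(3)] lin_add[OF assms(3)] lin_smult[OF assms(3)] assms(2)
    by (intro linI) (simp_all add: smult_l_distr smult_assoc1)
qed

lemma
  assumes "field K" "lin K V (scalars K) F" "c \<in> carrier K"
  shows lin_mult_left: "lin K V (scalars K) (\<lambda>x. F x \<otimes>\<^bsub>K\<^esub> c)"
    and lin_mult_right: "lin K V (scalars K) (\<lambda>x. c \<otimes>\<^bsub>K\<^esub> F x)"
proof -
  show "lin K V (scalars K) (\<lambda>x. c \<otimes>\<^bsub>K\<^esub> F x)"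
    using lin_smult_right[OF vectorspace_scalars[OF assms(1)] assms(3,2)] by simp
  show "lin K V (scalars K) (\<lambda>x. F x \<otimes>\<^bsub>K\<^esub> c)"
    using lin_smult_left[OF vectorspace_scalars[OF assms(1)] _ assms(2), of c] assms(3) by simp
qed

lemma lin_finsum_maps:
  assumes "vectorspace K W" "\<And>i. i \<in> A \<Longrightarrow> lin K V W (\<lambda>x. F i x)"
  shows "lin K V W (\<lambda>x. finsum W (\<lambda>i. F i x) A)"
proof -
  interpret vectorspace K W by fact
  note F = lin_closed[OF assms(2)] lin_add[OF assms(2)] lin_smult[OF assms(2)]
  show ?thesis
  proof (rule linI)
    fix x assume x: "x \<in> carrier V"
    show "finsum W (\<lambda>i. F i x) A \<in> carrier W" using F(1) x by (intro M.finsum_closed) auto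
    show "finsum W (\<lambda>i. F i (c \<odot>\<^bsub>V\<^esub> x)) A = c \<odot>\<^bsub>W\<^esub> finsum W (\<lambda>i. F i x) A" if "c \<in> carrier K" for c
      using F x that by (subst finsum_smult) (auto intro!: finsum_cong_weak)
    fix y assume y: "y \<in> carrier V"
    have "finsum W (\<lambda>i. F i (x \<oplus>\<^bsub>V\<^esub> y)) A = finsum W (\<lambda>i. F i x \<oplus>\<^bsub>W\<^esub> F i y) A"
      using F x y by (intro finsum_cong_weak) auto
    also have "\<dots> = finsum W (\<lambda>i. F i x) A \<oplus>\<^bsub>W\<^esub> finsum W (\<lambda>i. F i y) A"
      using F(1) x y by (intro M.finsum_addf) auto
    finally show "finsum W (\<lambda>i. F i (x \<oplus>\<^bsub>V\<^esub> y)) A = finsum W (\<lambda>i. F i x) A \<oplus>\<^bsub>W\<^esub> finsum W (\<lambda>i. F i y) A" .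
  qed
qed

lemma
  assumes "vectorspace K M" "vectorspace K N"
  shows pure_closed: "m \<in> carrier M \<Longrightarrow> n \<in> carrier N \<Longrightarrow> pure K M N m n \<in> carrier (tensor K M N)"
    and lin_pure_left: "n \<in> carrier N \<Longrightarrow> lin K M (tensor K M N) (\<lambda>m. pure K M N m n)"
    and lin_pure_right: "m \<in> carrier M \<Longrightarrow> lin K N (tensor K M N) (\<lambda>n. pure K M N m n)"
  using bilin_pure[OF assms] bilin_closed[OF bilin_pure[OF assms]] by (auto simp: bilin_def)

text \<open>\<open>sw_eta\<close> presents the argument as a sum of pure tensors, into which both
  linear maps can be pushed.\<close>

lemma tensor_eqI:
  assumes vs: "vectorspace K M" "vectorspace K N" "vectorspace K P"
    and fg: "lin K (tensor K M N) P f" "lin K (tensor K M N) P g"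
    and eq: "\<And>m n. m \<in> carrier M \<Longrightarrow> n \<in> carrier N \<Longrightarrow> f (pure K M N m n) = g (pure K M N m n)"
    and t: "t \<in> carrier (tensor K M N)"
  shows "f t = g t"
proof -
  have *: "h t = sw K M N P (\<lambda>m n. h (pure K M N m n)) t" if h: "lin K (tensor K M N) P h" for h
    using sw_push[OF h vs(1,2) vs_tensor[OF vs(1,2)] vs(3) t, of "pure K M N"]
    by (simp add: pure_closed vs sw_eta t)
  have "f t = sw K M N P (\<lambda>m n. f (pure K M N m n)) t" by (rule *[OF fg(1)])
  also have "\<dots> = sw K M N P (\<lambda>m n. g (pure K M N m n)) t" by (simp add: eq)
  also have "\<dots> = g t" by (rule *[OF fg(2), symmetric])
  finally show ?thesis .
qed

text \<open>Neither tensor depends on the variables bound by the other sum, so both sides are one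
  double sum over two fixed representatives.\<close>

lemma sw_swap:
  assumes vs: "vectorspace K M" "vectorspace K N" "vectorspace K A" "vectorspace K C" "vectorspace K P"
    and t: "t \<in> carrier (tensor K M N)" "s \<in> carrier (tensor K A C)"
    and B: "\<And>m n a c. m \<in> carrier M \<Longrightarrow> n \<in> carrier N \<Longrightarrow> a \<in> carrier A \<Longrightarrow> c \<in> carrier C \<Longrightarrow>
      B m n a c \<in> carrier P"
  shows "sw K M N P (\<lambda>m n. sw K A C P (\<lambda>a c. B m n a c) s) t =
    sw K A C P (\<lambda>a c. sw K M N P (\<lambda>m n. B m n a c) t) s"
proof -
  interpret P: vectorspace K P by fact
  interpret T: tensor_product K M N using vs by (rule_tac tensor_productI)
  interpret S: tensor_product K A C using vs by (rule_tac tensor_productI)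
  obtain f where f: "f \<in> carrier T.F" "(SOME f. f \<in> t) = f" using t(1) by (rule T.T_cases)
  obtain g where g: "g \<in> carrier S.F" "(SOME f. f \<in> s) = g" using t(2) by (rule S.T_cases)
  have fK: "f p \<in> carrier K" "g q \<in> carrier K" for p q
    using f(1) g(1) by (auto simp: free_space_simps[OF P.R.ring_axioms])
  let ?I = "{p. f p \<noteq> \<zero>\<^bsub>K\<^esub>}" and ?J = "{p. g p \<noteq> \<zero>\<^bsub>K\<^esub>}"
  have I: "fst p \<in> carrier M" "snd p \<in> carrier N" if "p \<in> ?I" for p
  proof -
    have "p \<in> carrier M \<times> carrier N"
      using f(1) that by (cases p) (auto simp: free_space_simps[OF P.R.ring_axioms])
    then show "fst p \<in> carrier M" "snd p \<in> carrier N" by auto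
  qed
  have J: "fst p \<in> carrier A" "snd p \<in> carrier C" if "p \<in> ?J" for p
  proof -
    have "p \<in> carrier A \<times> carrier C"
      using g(1) that by (cases p) (auto simp: free_space_simps[OF P.R.ring_axioms])
    then show "fst p \<in> carrier A" "snd p \<in> carrier C" by auto
  qed
  let ?b = "\<lambda>p q. B (fst p) (snd p) (fst q) (snd q)"
  have b: "?b p q \<in> carrier P" if "p \<in> ?I" "q \<in> ?J" for p q
    using B I[OF that(1)] J[OF that(2)] by blast
  have eq1: "sw K M N P X t = finsum P (\<lambda>p. f p \<odot>\<^bsub>P\<^esub> X (fst p) (snd p)) ?I" for X
    unfolding sw_lin_ext f(2) lin_ext_def
    by (rule finsum_cong_weak) (use I in \<open>auto simp: cut_def mem_Times_iff\<close>)
  have eq2: "sw K A C P X s = finsum P (\<lambda>p. g p \<odot>\<^bsub>P\<^esub> X (fst p) (snd p)) ?J" for X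
    unfolding sw_lin_ext g(2) lin_ext_def
    by (rule finsum_cong_weak) (use J in \<open>auto simp: cut_def mem_Times_iff\<close>)
  have "sw K M N P (\<lambda>m n. sw K A C P (\<lambda>a c. B m n a c) s) t =
      finsum P (\<lambda>p. finsum P (\<lambda>q. f p \<odot>\<^bsub>P\<^esub> (g q \<odot>\<^bsub>P\<^esub> ?b p q)) ?J) ?I"
    unfolding eq1 eq2 by (rule finsum_cong_weak, rule P.finsum_smult) (use b fK in auto)
  also have "\<dots> = finsum P (\<lambda>q. finsum P (\<lambda>p. f p \<odot>\<^bsub>P\<^esub> (g q \<odot>\<^bsub>P\<^esub> ?b p q)) ?I) ?J"
    by (rule P.M.finsum_swap) (use b fK in auto)
  also have "\<dots> = finsum P (\<lambda>q. finsum P (\<lambda>p. g q \<odot>\<^bsub>P\<^esub> (f p \<odot>\<^bsub>P\<^esub> ?b p q)) ?I) ?J"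
    by (intro finsum_cong_weak) (use b fK in \<open>simp add: P.smult_assoc1[symmetric] P.R.m_comm\<close>)
  also have "\<dots> = finsum P (\<lambda>q. g q \<odot>\<^bsub>P\<^esub> finsum P (\<lambda>p. f p \<odot>\<^bsub>P\<^esub> ?b p q) ?I) ?J"
    by (rule finsum_cong_weak, rule P.finsum_smult[symmetric]) (use b fK in auto)
  also have "\<dots> = sw K A C P (\<lambda>a c. sw K M N P (\<lambda>m n. B m n a c) t) s"
    unfolding eq1 eq2 ..
  finally show ?thesis .
qed

subsection \<open>Finite-dimensional spaces and dual bases\<close>

definition fdv :: "('k, 'y) ring_scheme \<Rightarrow> ('k, 'm, 'u) module_scheme \<Rightarrow> bool" where
  "fdv K V \<longleftrightarrow> vectorspace K V \<and> vectorspace.fin_dim K V"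

lemma fdv_vs: "fdv K V \<Longrightarrow> vectorspace K V"
  by (simp add: fdv_def)

text \<open>Finite dimensionality follows from a finite spanning family. Repetitions and linear
  dependence are allowed, so families such as all pure tensors of two bases can be used as they
  stand.\<close>

lemma fdvI:
  assumes "vectorspace K V" "finite I" "\<And>i. i \<in> I \<Longrightarrow> e i \<in> carrier V"
    and "\<And>v. v \<in> carrier V \<Longrightarrow> \<exists>c \<in> I \<rightarrow> carrier K. v = finsum V (\<lambda>i. c i \<odot>\<^bsub>V\<^esub> e i) I"
  shows "fdv K V"
proof -
  interpret vectorspace K V by fact
  have "e ` I \<subseteq> carrier V" using assms(3) by auto
  then have sub: "submodule K (span (e ` I)) V" by (rule span_is_submodule)
  interpret S: submodule K "span (e ` I)" V by (rule sub)
  have e: "e i \<in> span (e ` I)" if "i \<in> I" for i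
    using in_own_span[OF \<open>e ` I \<subseteq> carrier V\<close>] that by auto
  have "v \<in> span (e ` I)" if v: "v \<in> carrier V" for v
  proof -
    obtain c where c: "c \<in> I \<rightarrow> carrier K" "v = finsum V (\<lambda>i. c i \<odot>\<^bsub>V\<^esub> e i) I"
      using assms(4)[OF v] by blast
    have "finsum V (\<lambda>i. c i \<odot>\<^bsub>V\<^esub> e i) J \<in> span (e ` I)" if "finite J" "J \<subseteq> I" for J
      using that
    proof (induct J rule: finite_induct)
      case (insert j J)
      then have "finsum V (\<lambda>i. c i \<odot>\<^bsub>V\<^esub> e i) (insert j J) =
          c j \<odot>\<^bsub>V\<^esub> e j \<oplus>\<^bsub>V\<^esub> finsum V (\<lambda>i. c i \<odot>\<^bsub>V\<^esub> e i) J"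
        using c assms(3) by (intro M.finsum_insert) auto
      then show ?case using insert e c by (auto intro!: S.m_closed S.smult_closed)
    qed (use S.zero_closed in simp)
    then show ?thesis using assms(2) c by auto
  qed
  then have "gen_set (e ` I)" using S.subset by blast
  then have "fin_dim" unfolding fin_dim_def using assms(2,3) by (intro exI[of _ "e ` I"]) auto
  then show ?thesis by (simp add: fdv_def vectorspace_axioms)
qed

lemma dual_space_simps:
  assumes "ring K"
  shows "carrier (dual_space K V) = {f \<in> extensional (carrier V). linear_map K V (scalars K) f}"
    and "f \<oplus>\<^bsub>dual_space K V\<^esub> g = (\<lambda>v \<in> carrier V. f v \<oplus>\<^bsub>K\<^esub> g v)"
    and "a \<odot>\<^bsub>dual_space K V\<^esub> f = (\<lambda>v \<in> carrier V. a \<otimes>\<^bsub>K\<^esub> f v)"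
    and "\<zero>\<^bsub>dual_space K V\<^esub> = (\<lambda>v \<in> carrier V. \<zero>\<^bsub>K\<^esub>)"
  by (simp_all add: dual_space_def ring.func_space_def[OF assms])

lemma dual_space_iff:
  assumes "vectorspace K V"
  shows "f \<in> carrier (dual_space K V) \<longleftrightarrow> f \<in> extensional (carrier V) \<and> lin K V (scalars K) f"
proof -
  interpret vectorspace K V by fact
  have "field K" by unfold_locales
  then show ?thesis
    by (simp add: dual_space_simps[OF R.ring_axioms] linear_map_iff_lin assms vectorspace_scalars)
qed

lemma vectorspace_dual_space: assumes "vectorspace K V" shows "vectorspace K (dual_space K V)"
proof -
  interpret vectorspace K V by fact
  have K: "field K" by unfold_locales
  note s = dual_space_iff[OF assms] dual_space_simps(2-4)[OF R.ring_axioms]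
  have cl: "f x \<in> carrier K" if "lin K V (scalars K) f" "x \<in> carrier V" for f x
    using lin_closed[OF that(1)] that(2) by simp
  have cong: "lin K V (scalars K) (restrict f (carrier V)) \<longleftrightarrow> lin K V (scalars K) f" for f
    by (rule lin_cong[OF assms]) simp
  have add: "lin K V (scalars K) (\<lambda>v. f v \<oplus>\<^bsub>K\<^esub> g v)"
    if "lin K V (scalars K) f" "lin K V (scalars K) g" for f g
    using lin_add[OF that(1)] lin_add[OF that(2)] lin_smult[OF that(1)] lin_smult[OF that(2)]
      cl[OF that(1)] cl[OF that(2)]
    by (intro linI) (auto simp: R.a_ac R.r_distr)
  have smult: "lin K V (scalars K) (\<lambda>v. a \<otimes>\<^bsub>K\<^esub> f v)"
    if "lin K V (scalars K) f" "a \<in> carrier K" for f a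
    by (rule lin_mult_right[OF K that])
  have zero: "lin K V (scalars K) (\<lambda>v. \<zero>\<^bsub>K\<^esub>)" by (rule linI) auto
  have ext: "f = g \<longleftrightarrow> (\<forall>x \<in> carrier V. f x = g x)"
    if "f \<in> extensional (carrier V)" "g \<in> extensional (carrier V)" for f g :: "'c \<Rightarrow> 'a"
    using that by (auto intro: extensionalityI)
  show ?thesis
  proof (rule vs_criteria)
    show "\<forall>v\<in>carrier (dual_space K V). \<exists>neg_v\<in>carrier (dual_space K V).
        v \<oplus>\<^bsub>dual_space K V\<^esub> neg_v = \<zero>\<^bsub>dual_space K V\<^esub>"
    proof
      fix f assume f: "f \<in> carrier (dual_space K V)"
      show "\<exists>neg_v\<in>carrier (dual_space K V). f \<oplus>\<^bsub>dual_space K V\<^esub> neg_v = \<zero>\<^bsub>dual_space K V\<^esub>"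
        using f by (intro bexI[of _ "\<lambda>v \<in> carrier V. \<ominus>\<^bsub>K\<^esub> \<one>\<^bsub>K\<^esub> \<otimes>\<^bsub>K\<^esub> f v"])
          (auto simp: s cong cl R.l_minus R.r_neg intro!: smult restrict_ext)
    qed
  qed (auto simp: K s cong cl ext R.a_ac R.m_assoc R.l_distr R.r_distr intro!: add smult zero)
qed

text \<open>\<open>dual_vector\<close> is a definite description. The coordinate function at
  \<open>e\<close> satisfies it, and expanding vectors in \<open>B\<close> shows that a functional
  is determined by its values on \<open>B\<close>.\<close>

lemma
  assumes B: "vectorspace.basis K V B" "finite B" and V: "vectorspace K V" and e: "e \<in> B"
  shows dual_vector_closed: "dual_vector K V B e \<in> carrier (dual_space K V)"
    and dual_vector_apply: "e' \<in> B \<Longrightarrow> dual_vector K V B e e' = (if e' = e then \<one>\<^bsub>K\<^esub> else \<zero>\<^bsub>K\<^esub>)"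
proof -
  interpret vectorspace K V by fact
  have BV: "B \<subseteq> carrier V" using B(1) by (simp add: basis_def)
  \<comment> \<open>The coordinates of \<open>v\<close>. Extensional coefficient families make them
    unique, and \<open>ceq\<close> then allows the coordinates of a sum or a multiple to be read off
    from any expansion of it.\<close>
  define c where "c v = (THE a. a \<in> B \<rightarrow>\<^sub>E carrier K \<and> lincomb a B = v)" for v
  have ex1: "\<exists>!a. a \<in> B \<rightarrow>\<^sub>E carrier K \<and> lincomb a B = v" if "v \<in> carrier V" for v
    using basis_criterion[OF B(2) BV] B(1) that by blast
  have c: "c v \<in> B \<rightarrow>\<^sub>E carrier K" "lincomb (c v) B = v" if "v \<in> carrier V" for v
    using theI'[OF ex1[OF that]] by (auto simp: c_def)
  have cK: "c v i \<in> carrier K" if "v \<in> carrier V" "i \<in> B" for v i using c(1) that by auto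
  have ceq: "c v i = a i" if "a \<in> B \<rightarrow> carrier K" "lincomb a B = v" "v \<in> carrier V" "i \<in> B" for a v i
  proof -
    have "lincomb (restrict a B) B = lincomb a B"
      unfolding lincomb_def by (rule finsum_cong_weak) simp
    then have "c v = restrict a B" using ex1[OF that(3)] c[OF that(3)] that(1,2) by (metis restrict_PiE_iff PiE_restrict restrict_PiE)
    then show ?thesis using that by simp
  qed
  let ?f = "\<lambda>v \<in> carrier V. c v e"
  have "lin K V (scalars K) ?f"
  proof (subst lin_cong[OF V], rule restrict_apply', assumption, rule linI)
    fix x assume x: "x \<in> carrier V"
    show "c x e \<in> carrier (scalars K)" using cK x e by simp
    show "c (a \<odot>\<^bsub>V\<^esub> x) e = a \<odot>\<^bsub>scalars K\<^esub> c x e" if a: "a \<in> carrier K" for a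
    proof (subst ceq[of "\<lambda>i. a \<otimes>\<^bsub>K\<^esub> c x i" "a \<odot>\<^bsub>V\<^esub> x" e])
      show "lincomb (\<lambda>i. a \<otimes>\<^bsub>K\<^esub> c x i) B = a \<odot>\<^bsub>V\<^esub> x"
        using lincomb_smult[of B "c x" a] BV c[OF x] a by (auto simp: PiE_def)
    qed (use a x e cK in auto)
    fix y assume y: "y \<in> carrier V"
    show "c (x \<oplus>\<^bsub>V\<^esub> y) e = c x e \<oplus>\<^bsub>scalars K\<^esub> c y e"
    proof (subst ceq[of "\<lambda>i. c x i \<oplus>\<^bsub>K\<^esub> c y i" "x \<oplus>\<^bsub>V\<^esub> y" e])
      show "lincomb (\<lambda>i. c x i \<oplus>\<^bsub>K\<^esub> c y i) B = x \<oplus>\<^bsub>V\<^esub> y"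
        using lincomb_sum[of B "c x" "c y"] B(2) BV c[OF x] c[OF y] by (auto simp: PiE_def)
    qed (use x y e cK in auto)
  qed
  then have fD: "?f \<in> carrier (dual_space K V)" by (simp add: dual_space_iff[OF V])
  have fB: "?f e' = (if e' = e then \<one>\<^bsub>K\<^esub> else \<zero>\<^bsub>K\<^esub>)" if e': "e' \<in> B" for e'
  proof -
    have "lincomb (\<lambda>i. if i = e' then \<one>\<^bsub>K\<^esub> else \<zero>\<^bsub>K\<^esub>) B = e'"
      unfolding lincomb_def using BV e' B(2) by (subst M.finsum_delta[of _ e']) auto
    then show ?thesis
      using e' e BV ceq[of "\<lambda>i. if i = e' then \<one>\<^bsub>K\<^esub> else \<zero>\<^bsub>K\<^esub>" e' e] by auto
  qed
  have uniq: "g = ?f" if g: "g \<in> carrier (dual_space K V)"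
    and gB: "\<forall>e' \<in> B. g e' = (if e' = e then \<one>\<^bsub>K\<^esub> else \<zero>\<^bsub>K\<^esub>)" for g
  proof (rule extensionalityI)
    show "g \<in> extensional (carrier V)" "?f \<in> extensional (carrier V)"
      using g by (auto simp: dual_space_iff[OF V])
    have val: "h v = finsum K (\<lambda>i. c v i \<otimes>\<^bsub>K\<^esub> h i) B" if "lin K V (scalars K) h" "v \<in> carrier V" for h v
    proof -
      have "h v = h (lincomb (c v) B)" using c that by simp
      also have "\<dots> = finsum (scalars K) (\<lambda>i. h (c v i \<odot>\<^bsub>V\<^esub> i)) B"
        unfolding lincomb_def using BV cK that
        by (intro lin_finsum[OF V vectorspace_scalars]) (auto intro: field_axioms)
      also have "\<dots> = finsum K (\<lambda>i. c v i \<otimes>\<^bsub>K\<^esub> h i) B"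
        unfolding finsum_scalars using BV cK that lin_smult[OF that(1)] by (intro finsum_cong_weak) auto
      finally show ?thesis .
    qed
    fix v assume v: "v \<in> carrier V"
    have "g v = finsum K (\<lambda>i. c v i \<otimes>\<^bsub>K\<^esub> g i) B" using val[OF _ v] g by (simp add: dual_space_iff[OF V])
    also have "\<dots> = finsum K (\<lambda>i. c v i \<otimes>\<^bsub>K\<^esub> ?f i) B"
      by (rule finsum_cong_weak) (simp only: gB fB)
    also have "\<dots> = ?f v" by (rule val[OF _ v, symmetric]) (use fD in \<open>simp only: dual_space_iff[OF V]\<close>)
    finally show "g v = ?f v" .
  qed
  have "?f \<in> carrier (dual_space K V) \<and>
      (\<forall>e' \<in> B. ?f e' = (if e' = e then \<one>\<^bsub>K\<^esub> else \<zero>\<^bsub>K\<^esub>))"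
    by (intro conjI ballI fD fB)
  then have eq: "dual_vector K V B e = ?f"
    unfolding dual_vector_def by (rule the_equality[where a = ?f]) (erule conjE, rule uniq)
  show "dual_vector K V B e \<in> carrier (dual_space K V)" unfolding eq by (rule fD)
  show "dual_vector K V B e e' = (if e' = e then \<one>\<^bsub>K\<^esub> else \<zero>\<^bsub>K\<^esub>)" if "e' \<in> B"
    unfolding eq by (rule fB[OF that])
qed

text \<open>Applied to an arbitrary expansion of \<open>v\<close>, the dual vector of
  \<open>e\<close> picks out the coefficient of \<open>e\<close>.\<close>

lemma basis_expansion:
  assumes B: "vectorspace.basis K V B" "finite B" and V: "vectorspace K V" and v: "v \<in> carrier V"
  shows "finsum V (\<lambda>e. dual_vector K V B e v \<odot>\<^bsub>V\<^esub> e) B = v"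
proof -
  interpret vectorspace K V by fact
  have BV: "B \<subseteq> carrier V" using B(1) by (simp add: basis_def)
  have dl: "lin K V (scalars K) (dual_vector K V B e)" if "e \<in> B" for e
    using dual_vector_closed[OF B V that] by (simp add: dual_space_iff[OF V])
  have "v \<in> span B" using B(1) v by (simp add: basis_def)
  then obtain a where a: "a \<in> B \<rightarrow> carrier K" "v = lincomb a B"
    using finite_span[OF B(2) BV] by auto
  have "dual_vector K V B e v = a e" if e: "e \<in> B" for e
  proof -
    have "dual_vector K V B e v = finsum (scalars K) (\<lambda>i. dual_vector K V B e (a i \<odot>\<^bsub>V\<^esub> i)) B"
      unfolding a(2) lincomb_def using BV a(1)
      by (intro lin_finsum[OF V vectorspace_scalars _ ] dl e) (auto intro: field_axioms)
    also have "\<dots> = finsum K (\<lambda>i. a i \<otimes>\<^bsub>K\<^esub> (if i = e then \<one>\<^bsub>K\<^esub> else \<zero>\<^bsub>K\<^esub>)) B"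
      unfolding finsum_scalars using subsetD[OF BV] funcset_mem[OF a(1)] lin_smult[OF dl[OF e]]
        dual_vector_apply[OF B V e]
      by (intro finsum_cong_weak) simp
    also have "\<dots> = a e" using funcset_mem[OF a(1)] e B(2) by (subst R.finsum_delta[of _ e]) auto
    finally show ?thesis .
  qed
  then have "finsum V (\<lambda>e. dual_vector K V B e v \<odot>\<^bsub>V\<^esub> e) B = lincomb a B"
    unfolding lincomb_def by (intro finsum_cong_weak) simp
  then show ?thesis using a by simp
qed

text \<open>Evaluated at a vector, the left-hand side is \<open>f\<close> applied to the basis
  expansion of that vector.\<close>

lemma dual_basis_expansion:
  assumes B: "vectorspace.basis K V B" "finite B" and V: "vectorspace K V"
    and f: "f \<in> carrier (dual_space K V)"
  shows "finsum (dual_space K V) (\<lambda>e. f e \<odot>\<^bsub>dual_space K V\<^esub> dual_vector K V B e) B = f"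
    (is "?g = f")
proof -
  interpret vectorspace K V by fact
  interpret D: vectorspace K "dual_space K V" by (rule vectorspace_dual_space[OF V])
  have BV: "B \<subseteq> carrier V" using B(1) by (simp add: basis_def)
  note s = dual_space_iff[OF V] dual_space_simps(2-4)[OF R.ring_axioms]
  have fl: "lin K V (scalars K) f" "f \<in> extensional (carrier V)" using f by (auto simp: s)
  have fK: "f e \<in> carrier K" if "e \<in> B" for e using lin_closed[OF fl(1), of e] BV that by auto
  note dc = dual_vector_closed[OF B V]
  have dv: "dual_vector K V B e v \<in> carrier K" if "e \<in> B" "v \<in> carrier V" for e v
    using dc[OF that(1)] lin_closed[of K V "scalars K" "dual_vector K V B e" v] that by (simp add: s)
  have gD: "?g \<in> carrier (dual_space K V)" using fK dc by (intro D.M.finsum_closed) auto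
  show ?thesis
  proof (rule extensionalityI)
    show "?g \<in> extensional (carrier V)" "f \<in> extensional (carrier V)" using gD f by (auto simp: s)
    fix v assume v: "v \<in> carrier V"
    have ev: "lin K (dual_space K V) (scalars K) (\<lambda>f. f v)"
      by (rule linI) (use v in \<open>auto simp: s lin_closed\<close>, metis lin_closed scalars_simps(1))
    have "?g v = finsum (scalars K) (\<lambda>e. (f e \<odot>\<^bsub>dual_space K V\<^esub> dual_vector K V B e) v) B"
      by (rule lin_finsum[OF D.vectorspace_axioms vectorspace_scalars ev])
        (use fK dc in \<open>auto intro: field_axioms\<close>)
    also have "\<dots> = finsum (scalars K) (\<lambda>e. f (dual_vector K V B e v \<odot>\<^bsub>V\<^esub> e)) B"
      using lin_smult[OF fl(1)] BV dv[OF _ v] fK v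
      by (intro finsum_cong_weak) (auto simp: s R.m_comm)
    also have "\<dots> = f (finsum V (\<lambda>e. dual_vector K V B e v \<odot>\<^bsub>V\<^esub> e) B)"
      by (rule lin_finsum[OF V vectorspace_scalars fl(1), symmetric])
        (use BV dv[OF _ v] in \<open>auto intro: field_axioms\<close>)
    also have "\<dots> = f v" by (simp add: basis_expansion[OF B V v])
    finally show "?g v = f v" .
  qed
qed

lemma fdv_basis_finite:
  assumes V: "fdv K V" and B: "vectorspace.basis K V B" shows "finite B"
proof -
  interpret vectorspace K V using V by (rule fdv_vs)
  show ?thesis using V B unfolding fdv_def basis_def by (intro fin_dim_li_fin) blast+
qed

lemma fdv_basis_exists:
  assumes V: "fdv K V" shows "\<exists>B. vectorspace.basis K V B"
proof -
  interpret vectorspace K V using V by (rule fdv_vs)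
  show ?thesis using V finite_basis_exists unfolding fdv_def by blast
qed

lemma fdv_dual_space:
  assumes "fdv K V" shows "fdv K (dual_space K V)"
proof -
  obtain B where B: "vectorspace.basis K V B" using fdv_basis_exists[OF assms] by auto
  have V: "vectorspace K V" and fin: "finite B"
    using fdv_vs[OF assms] fdv_basis_finite[OF assms B] by auto
  have BV: "B \<subseteq> carrier V" using B unfolding vectorspace.basis_def[OF V] by blast
  show ?thesis
  proof (rule fdvI[OF vectorspace_dual_space[OF V] fin dual_vector_closed[OF B fin V]])
    fix f assume f: "f \<in> carrier (dual_space K V)"
    then have "f e \<in> carrier K" if "e \<in> B" for e
      using BV that lin_closed[of K V "scalars K" f e] by (auto simp: dual_space_iff[OF V])
    then show "\<exists>c\<in>B \<rightarrow> carrier K. f = finsum (dual_space K V) (\<lambda>i. c i \<odot>\<^bsub>dual_space K V\<^esub> dual_vector K V B i) B"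
      using dual_basis_expansion[OF B fin V f] by (intro bexI[of _ f]) auto
  qed
qed

lemma (in abelian_monoid) finsum_Times:
  assumes "finite A" "finite B" "\<And>a b. a \<in> A \<Longrightarrow> b \<in> B \<Longrightarrow> g a b \<in> carrier G"
  shows "finsum G (\<lambda>p. g (fst p) (snd p)) (A \<times> B) = finsum G (\<lambda>a. finsum G (g a) B) A"
  using assms(1,3)
proof (induct A rule: finite_induct)
  case (insert a A)
  have "insert a A \<times> B = (Pair a ` B) \<union> A \<times> B" by auto
  then have "finsum G (\<lambda>p. g (fst p) (snd p)) (insert a A \<times> B) =
      finsum G (\<lambda>p. g (fst p) (snd p)) (Pair a ` B) \<oplus> finsum G (\<lambda>p. g (fst p) (snd p)) (A \<times> B)"
    using insert assms(2) by (simp only:, intro finsum_Un_disjoint) auto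
  also have "finsum G (\<lambda>p. g (fst p) (snd p)) (Pair a ` B) = finsum G (g a) B"
    using insert by (subst finsum_reindex) (auto simp: inj_on_def)
  also have "finsum G (\<lambda>p. g (fst p) (snd p)) (A \<times> B) = finsum G (\<lambda>a. finsum G (g a) B) A"
    using insert by auto
  finally show ?case using insert by auto
qed simp

text \<open>The pure tensors of basis vectors span. The coefficient of a pair is the value of the
  product of two dual vectors, extended to the tensor product; being linear in the tensor, it
  permits checking the expansion on pure tensors only.\<close>

lemma fdv_tensor:
  assumes M: "fdv K M" and N: "fdv K N" shows "fdv K (tensor K M N)"
proof -
  obtain A where A: "vectorspace.basis K M A" using fdv_basis_exists[OF M] by blast
  obtain B where B: "vectorspace.basis K N B" using fdv_basis_exists[OF N] by blast
  note vM = fdv_vs[OF M] and vN = fdv_vs[OF N]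
  note fA = fdv_basis_finite[OF M A] and fB = fdv_basis_finite[OF N B]
  let ?T = "tensor K M N"
  have vT: "vectorspace K ?T" by (rule vs_tensor[OF vM vN])
  interpret T: vectorspace K ?T by (rule vT)
  have AM: "a \<in> carrier M" if "a \<in> A" for a using A that unfolding vectorspace.basis_def[OF vM] by blast
  have BN: "b \<in> carrier N" if "b \<in> B" for b using B that unfolding vectorspace.basis_def[OF vN] by blast
  let ?a = "dual_vector K M A" and ?b = "dual_vector K N B"
  have la: "lin K M (scalars K) (?a a)" if "a \<in> A" for a
    using dual_vector_closed[OF A fA vM that] by (simp add: dual_space_iff[OF vM])
  have lb: "lin K N (scalars K) (?b b)" if "b \<in> B" for b
    using dual_vector_closed[OF B fB vN that] by (simp add: dual_space_iff[OF vN])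
  note ca = lin_closed[OF la, simplified] and cb = lin_closed[OF lb, simplified]
  have K: "field K" by unfold_locales
  note vK = vectorspace_scalars[OF K]
  let ?c = "\<lambda>p t. sw K M N (scalars K) (\<lambda>m n. ?a (fst p) m \<otimes>\<^bsub>K\<^esub> ?b (snd p) n) t"
  have bil: "bilin K M N (scalars K) (\<lambda>m n. ?a (fst p) m \<otimes>\<^bsub>K\<^esub> ?b (snd p) n)" if p: "p \<in> A \<times> B" for p
    using p by (intro bilinI lin_mult_left lin_mult_right K ca cb la lb) auto
  have lc: "lin K ?T (scalars K) (?c p)" if "p \<in> A \<times> B" for p
    by (rule lin_sw[OF vM vN vK bil[OF that]])
  show ?thesis
  proof (rule fdvI[OF vT finite_cartesian_product[OF fA fB]])
    show "pure K M N (fst p) (snd p) \<in> carrier ?T" if "p \<in> A \<times> B" for p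
      using that AM BN by (intro pure_closed vM vN) auto
    fix t assume t: "t \<in> carrier ?T"
    have "t = finsum ?T (\<lambda>p. ?c p t \<odot>\<^bsub>?T\<^esub> pure K M N (fst p) (snd p)) (A \<times> B)"
    proof (rule tensor_eqI[OF vM vN vT lin_id _ _ t])
      show "lin K ?T ?T (\<lambda>t. finsum ?T (\<lambda>p. ?c p t \<odot>\<^bsub>?T\<^esub> pure K M N (fst p) (snd p)) (A \<times> B))"
        using AM BN by (intro lin_finsum_maps lin_smult_left vT lc pure_closed vM vN) auto
      fix m n assume mn: "m \<in> carrier M" "n \<in> carrier N"
      have "pure K M N m n =
          pure K M N (finsum M (\<lambda>a. ?a a m \<odot>\<^bsub>M\<^esub> a) A) (finsum N (\<lambda>b. ?b b n \<odot>\<^bsub>N\<^esub> b) B)"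
        by (simp only: basis_expansion[OF A fA vM mn(1)] basis_expansion[OF B fB vN mn(2)])
      also have "\<dots> = finsum ?T (\<lambda>a. pure K M N (?a a m \<odot>\<^bsub>M\<^esub> a) (finsum N (\<lambda>b. ?b b n \<odot>\<^bsub>N\<^esub> b) B)) A"
        using AM BN ca mn
        by (intro lin_finsum[OF vM vT lin_pure_left] vM vN)
          (auto simp: basis_expansion[OF B fB vN mn(2)]
            intro!: module.smult_closed vectorspace.axioms(1)[OF vM])
      also have "\<dots> = finsum ?T (\<lambda>a. finsum ?T (\<lambda>b. (?a a m \<otimes>\<^bsub>K\<^esub> ?b b n) \<odot>\<^bsub>?T\<^esub> pure K M N a b) B) A"
      proof (rule finsum_cong_weak)
        fix a assume a: "a \<in> A"
        note cl = AM[OF a] ca[OF a mn(1)] module.smult_closed[OF vectorspace.axioms(1)[OF vM]]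
          module.smult_closed[OF vectorspace.axioms(1)[OF vN]]
        have "pure K M N (?a a m \<odot>\<^bsub>M\<^esub> a) (finsum N (\<lambda>b. ?b b n \<odot>\<^bsub>N\<^esub> b) B) =
            finsum ?T (\<lambda>b. pure K M N (?a a m \<odot>\<^bsub>M\<^esub> a) (?b b n \<odot>\<^bsub>N\<^esub> b)) B"
          by (rule lin_finsum[OF vN vT lin_pure_right]) (use cl BN cb mn in \<open>auto intro: vM vN\<close>)
        also have "\<dots> = finsum ?T (\<lambda>b. (?a a m \<otimes>\<^bsub>K\<^esub> ?b b n) \<odot>\<^bsub>?T\<^esub> pure K M N a b) B"
          using cl BN cb[OF _ mn(2)] pure_closed[OF vM vN]
          by (intro finsum_cong_weak)
            (simp add: lin_smult[OF lin_pure_left[OF vM vN]] lin_smult[OF lin_pure_right[OF vM vN]]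
              T.smult_assoc1[symmetric] T.R.m_comm)
        finally show "pure K M N (?a a m \<odot>\<^bsub>M\<^esub> a) (finsum N (\<lambda>b. ?b b n \<odot>\<^bsub>N\<^esub> b) B) =
            finsum ?T (\<lambda>b. (?a a m \<otimes>\<^bsub>K\<^esub> ?b b n) \<odot>\<^bsub>?T\<^esub> pure K M N a b) B" .
      qed
      also have "\<dots> = finsum ?T (\<lambda>p. (?a (fst p) m \<otimes>\<^bsub>K\<^esub> ?b (snd p) n) \<odot>\<^bsub>?T\<^esub> pure K M N (fst p) (snd p)) (A \<times> B)"
        by (rule T.M.finsum_Times[OF fA fB, symmetric])
          (use ca[OF _ mn(1)] cb[OF _ mn(2)] AM BN pure_closed[OF vM vN] in auto)
      also have "\<dots> = finsum ?T (\<lambda>p. ?c p (pure K M N m n) \<odot>\<^bsub>?T\<^esub> pure K M N (fst p) (snd p)) (A \<times> B)"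
        by (rule finsum_cong_weak) (simp only: sw_pure[OF vM vN vK bil mn])
      finally show "pure K M N m n =
          finsum ?T (\<lambda>p. ?c p (pure K M N m n) \<odot>\<^bsub>?T\<^esub> pure K M N (fst p) (snd p)) (A \<times> B)" .
    qed
    then show "\<exists>c\<in>A \<times> B \<rightarrow> carrier K. t = finsum ?T (\<lambda>p. c p \<odot>\<^bsub>?T\<^esub> pure K M N (fst p) (snd p)) (A \<times> B)"
      using lin_closed[OF lc t] by (intro bexI[of _ "\<lambda>p. ?c p t"]) auto
  qed
qed

lemma fdv_scalars: assumes "field K" shows "fdv K (scalars K)"
proof (rule fdvI[OF vectorspace_scalars[OF assms], of "{()}" "\<lambda>_. \<one>\<^bsub>K\<^esub>"])
  interpret field K by fact
  interpret S: vectorspace K "scalars K" by (rule vectorspace_scalars[OF assms])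
  show "\<one>\<^bsub>K\<^esub> \<in> carrier (scalars K)" by simp
  show "\<exists>c\<in>{()} \<rightarrow> carrier K. v = finsum (scalars K) (\<lambda>i. c i \<odot>\<^bsub>scalars K\<^esub> \<one>\<^bsub>K\<^esub>) {()}"
    if "v \<in> carrier (scalars K)" for v
    using that by (intro bexI[of _ "\<lambda>_. v"]) (auto simp: finsum_scalars)
qed simp

subsection \<open>Realizing spaces on the fixed type\<close>

text \<open>An infinite set is in bijection with its square. The values at the indices are absorbed
  by this bijection one at a time.\<close>

lemma inj_on_PiE_infinite:
  assumes K: "infinite (X :: 'k set)" and A: "finite (A :: 'a set)"
  shows "\<exists>r. inj_on r (A \<rightarrow>\<^sub>E X) \<and> r ` (A \<rightarrow>\<^sub>E X) \<subseteq> X"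
  using A
proof (induct A rule: finite_induct)
  case empty
  obtain x where "x \<in> X" using K by (metis finite.emptyI equals0I)
  then show ?case by (intro exI[of _ "\<lambda>_. x"]) auto
next
  case (insert a A)
  then obtain r where r: "inj_on r (A \<rightarrow>\<^sub>E X)" "r ` (A \<rightarrow>\<^sub>E X) \<subseteq> X" by auto
  obtain q where q: "bij_betw q (X \<times> X) X"
    using card_of_Times_same_infinite[OF K] card_of_ordIso[of "X \<times> X" X] by blast
  have qi: "inj_on q (X \<times> X)" "q ` (X \<times> X) = X" using q by (auto simp: bij_betw_def)
  let ?s = "\<lambda>f. q (f a, r (restrict f A))"
  have in_X: "f a \<in> X" "r (restrict f A) \<in> X" "restrict f A \<in> A \<rightarrow>\<^sub>E X" if "f \<in> insert a A \<rightarrow>\<^sub>E X" for f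
  proof -
    show f: "restrict f A \<in> A \<rightarrow>\<^sub>E X" and "f a \<in> X" using that by auto
    show "r (restrict f A) \<in> X" using r(2) imageI[OF f, of r] by blast
  qed
  have "inj_on ?s (insert a A \<rightarrow>\<^sub>E X)"
  proof (rule inj_onI)
    fix f g assume f: "f \<in> insert a A \<rightarrow>\<^sub>E X" and g: "g \<in> insert a A \<rightarrow>\<^sub>E X" and eq: "?s f = ?s g"
    have "(f a, r (restrict f A)) = (g a, r (restrict g A))"
      by (rule inj_onD[OF qi(1) eq]) (use in_X[OF f] in_X[OF g] in auto)
    then have "f a = g a" "restrict f A = restrict g A"
      using inj_onD[OF r(1), of "restrict f A" "restrict g A"] in_X[OF f] in_X[OF g] by auto
    then show "f = g" using f g
      by (intro PiE_ext[OF f g]) (metis insertE restrict_apply')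
  qed
  moreover have "?s ` (insert a A \<rightarrow>\<^sub>E X) \<subseteq> X"
  proof (rule image_subsetI)
    fix f assume "f \<in> insert a A \<rightarrow>\<^sub>E X"
    then have "(f a, r (restrict f A)) \<in> X \<times> X" using in_X by (intro SigmaI)
    then show "?s f \<in> X" using qi(2) by (metis image_eqI)
  qed
  ultimately show ?case by (intro exI[of _ ?s] conjI)
qed

text \<open>One preimage is chosen for every point of the image.\<close>

lemma inj_on_image_exists:
  assumes "inj_on r A" shows "\<exists>s. inj_on s (f ` A) \<and> s ` f ` A \<subseteq> r ` A"
proof (intro exI conjI)
  show "inj_on (\<lambda>y. r (inv_into A f y)) (f ` A)"
    using assms by (intro inj_onI) (metis inj_on_contraD inv_into_into inv_into_injective)
  show "(\<lambda>y. r (inv_into A f y)) ` f ` A \<subseteq> r ` A" by (auto intro: inv_into_into)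
qed

locale big_type =
  fixes K :: "('k, 'y) ring_scheme" and ty :: "'v itself"
  assumes K_field: "field K"
    and infinite_type: "infinite (UNIV :: 'v set)"
    and scalars_embed: "\<exists>r :: 'k \<Rightarrow> 'v. inj_on r (carrier K)"
begin

text \<open>The carrier is the image of the coordinate families over a finite basis. Over an
  infinite field these embed into the field and from there into \<open>'v\<close>; over a finite
  field the carrier is finite and fits into any infinite type.\<close>

lemma fdv_realizable:
  assumes V: "fdv K (V :: ('k, 'x, 'u) module_scheme)"
  shows "\<exists>r :: 'x \<Rightarrow> 'v. inj_on r (carrier V)"
proof -
  interpret vectorspace K V by (rule fdv_vs[OF V])
  obtain B where B: "basis B" using fdv_basis_exists[OF V] by auto
  have fB: "finite B" by (rule fdv_basis_finite[OF V B])
  have BV: "B \<subseteq> carrier V" "span B = carrier V" using B unfolding basis_def by auto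
  have eq: "carrier V = (\<lambda>a. lincomb a B) ` (B \<rightarrow>\<^sub>E carrier K)"
  proof -
    have "lincomb a B = lincomb (restrict a B) B" for a
      unfolding lincomb_def by (rule finsum_cong_weak) simp
    moreover have "restrict a B \<in> B \<rightarrow>\<^sub>E carrier K" if "a \<in> B \<rightarrow> carrier K" for a
      using that by auto
    ultimately show ?thesis unfolding BV(2)[symmetric] finite_span[OF fB BV(1)] by (fastforce simp: PiE_def)
  qed
  show ?thesis
  proof (cases "finite (carrier K)")
    case True
    then have "finite (carrier V)" unfolding eq using fB by (auto intro: finite_PiE)
    moreover obtain S :: "'v set" where "finite S" "card S = card (carrier V)"
      using infinite_arbitrarily_large[OF infinite_type] by blast
    ultimately obtain r where "bij_betw r (carrier V) S" using finite_same_card_bij by metis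
    then show ?thesis by (auto simp: bij_betw_def)
  next
    case False
    obtain r where "inj_on r (B \<rightarrow>\<^sub>E carrier K)" "r ` (B \<rightarrow>\<^sub>E carrier K) \<subseteq> carrier K"
      using inj_on_PiE_infinite[OF False fB] by blast
    note r = this
    have "\<exists>s. inj_on s (carrier V) \<and> s ` carrier V \<subseteq> r ` (B \<rightarrow>\<^sub>E carrier K)"
      unfolding eq by (rule inj_on_image_exists[OF r(1)])
    then obtain s where s: "inj_on s (carrier V)" "s ` carrier V \<subseteq> carrier K"
      using r(2) by (metis subset_trans)
    obtain q :: "'k \<Rightarrow> 'v" where "inj_on q (carrier K)" using scalars_embed by blast
    then have "inj_on (q \<circ> s) (carrier V)" using s by (intro comp_inj_on) (auto intro: inj_on_subset)
    then show ?thesis by blast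
  qed
qed

context
  fixes V :: "('k, 'x, 'u) module_scheme" assumes V: "fdv K V"
begin

lemma inj_on_realize: "inj_on (realize (carrier V) :: 'x \<Rightarrow> 'v) (carrier V)"
  unfolding realize_def using fdv_realizable[OF V] by (rule someI_ex)

lemma unrealize_realize:
  "x \<in> carrier V \<Longrightarrow> unrealize (carrier V) (realize (carrier V) x :: 'v) = x"
  unfolding unrealize_def by (rule inv_into_f_f[OF inj_on_realize])

lemma realize_carrier: "carrier (realize_space V :: ('k, 'v) module) = realize (carrier V) ` carrier V"
  by (simp add: realize_space_def Let_def)

lemma realize_unrealize:
  "y \<in> carrier (realize_space V :: ('k, 'v) module) \<Longrightarrow> realize (carrier V) (unrealize (carrier V) y) = y"
  by (auto simp: realize_carrier unrealize_realize)

lemma vs_realize_space: "vectorspace K (realize_space V :: ('k, 'v) module)"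
proof -
  interpret vectorspace K V by (rule fdv_vs[OF V])
  show ?thesis
    by (rule vs_criteria)
      (auto simp: K_field realize_space_def Let_def unrealize_realize smult_l_distr smult_r_distr
        smult_assoc1 M.a_ac intro!: bexI[of _ "\<ominus>\<^bsub>V\<^esub> _"] arg_cong[of _ _ "realize (carrier V)"] M.r_neg)
qed

lemma lin_realize: "lin K V (realize_space V) (realize (carrier V) :: 'x \<Rightarrow> 'v)"
  by (rule linI) (auto simp: realize_space_def Let_def unrealize_realize)

lemma lin_unrealize: "lin K (realize_space V) V (unrealize (carrier V) :: 'v \<Rightarrow> 'x)"
proof -
  interpret vectorspace K V by (rule fdv_vs[OF V])
  show ?thesis by (rule linI) (auto simp: realize_space_def Let_def unrealize_realize)
qed

lemma fdv_realize_space: "fdv K (realize_space V :: ('k, 'v) module)"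
proof -
  interpret vectorspace K V by (rule fdv_vs[OF V])
  obtain B where B: "basis B" using fdv_basis_exists[OF V] by auto
  have fB: "finite B" by (rule fdv_basis_finite[OF V B])
  have BV: "b \<in> carrier V" if "b \<in> B" for b using B that unfolding basis_def by auto
  let ?r = "realize (carrier V) :: 'x \<Rightarrow> 'v" and ?u = "unrealize (carrier V) :: 'v \<Rightarrow> 'x"
  show ?thesis
  proof (rule fdvI[OF vs_realize_space fB, of ?r])
    show "?r b \<in> carrier (realize_space V)" if "b \<in> B" for b
      using lin_closed[OF lin_realize] BV that by blast
    fix y :: 'v assume y: "y \<in> carrier (realize_space V)"
    have uy: "?u y \<in> carrier V" by (rule lin_closed[OF lin_unrealize y])
    let ?c = "\<lambda>b. dual_vector K V B b (?u y)"
    have c: "?c \<in> B \<rightarrow> carrier K"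
      using dual_vector_closed[OF B fB vectorspace_axioms] lin_closed[OF _ uy, of K "scalars K"]
      by (auto simp: dual_space_iff[OF vectorspace_axioms])
    have "y = ?r (finsum V (\<lambda>b. ?c b \<odot>\<^bsub>V\<^esub> b) B)"
      by (simp add: basis_expansion[OF B fB vectorspace_axioms uy] realize_unrealize y)
    also have "\<dots> = finsum (realize_space V) (\<lambda>b. ?r (?c b \<odot>\<^bsub>V\<^esub> b)) B"
      by (rule lin_finsum[OF vectorspace_axioms vs_realize_space lin_realize]) (use c BV in auto)
    also have "\<dots> = finsum (realize_space V) (\<lambda>b. ?c b \<odot>\<^bsub>realize_space V\<^esub> ?r b) B"
      by (rule finsum_cong_weak) (use c BV lin_smult[OF lin_realize] in auto)
    finally show "\<exists>c\<in>B \<rightarrow> carrier K. y = finsum (realize_space V) (\<lambda>b. c b \<odot>\<^bsub>realize_space V\<^esub> ?r b) B"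
      using c by (intro bexI[of _ ?c])
  qed
qed

end

end

subsection \<open>Calculating in the Hopf algebra\<close>

text \<open>The simplifier does not beta-normalize the instances of conditions such as
  \<open>lin K V P (\<lambda>x. B x a b)\<close>; it does normalize right-hand sides of rewrite rules, so
  these conditions are wrapped in predicates that are unfolded by rewriting.\<close>

definition plin ::
    "('k, 'y) ring_scheme \<Rightarrow> ('k, 'x, 't) module_scheme \<Rightarrow> ('k, 'm, 'u) module_scheme
      \<Rightarrow> ('k, 'n, 'w) module_scheme \<Rightarrow> ('k, 'p, 'v) module_scheme \<Rightarrow> ('x \<Rightarrow> 'm \<Rightarrow> 'n \<Rightarrow> 'p) \<Rightarrow> bool" where
  "plin K V M N P B \<longleftrightarrow> (\<forall>a \<in> carrier M. \<forall>b \<in> carrier N. lin K V P (\<lambda>x. B x a b))"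

definition trilin ::
    "('k, 'y) ring_scheme \<Rightarrow> ('k, 'x, 't) module_scheme \<Rightarrow> ('k, 'm, 'u) module_scheme
      \<Rightarrow> ('k, 'n, 'w) module_scheme \<Rightarrow> ('k, 'p, 'v) module_scheme \<Rightarrow> ('x \<Rightarrow> 'm \<Rightarrow> 'n \<Rightarrow> 'p) \<Rightarrow> bool" where
  "trilin K L M N P T \<longleftrightarrow>
     (\<forall>b \<in> carrier M. \<forall>c \<in> carrier N. lin K L P (\<lambda>a. T a b c)) \<and>
     (\<forall>a \<in> carrier L. \<forall>c \<in> carrier N. lin K M P (\<lambda>b. T a b c)) \<and>
     (\<forall>a \<in> carrier L. \<forall>b \<in> carrier M. lin K N P (\<lambda>c. T a b c))"

lemma trilinD:
  assumes "trilin K L M N P T"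
  shows "b \<in> carrier M \<Longrightarrow> c \<in> carrier N \<Longrightarrow> lin K L P (\<lambda>a. T a b c)"
    and "a \<in> carrier L \<Longrightarrow> c \<in> carrier N \<Longrightarrow> lin K M P (\<lambda>b. T a b c)"
    and "a \<in> carrier L \<Longrightarrow> b \<in> carrier M \<Longrightarrow> lin K N P (\<lambda>c. T a b c)"
    and "a \<in> carrier L \<Longrightarrow> b \<in> carrier M \<Longrightarrow> c \<in> carrier N \<Longrightarrow> T a b c \<in> carrier P"
  using assms by (auto simp: trilin_def dest: lin_closed)

lemma lin_sw_body':
  assumes "vectorspace K M" "vectorspace K N" "vectorspace K P" "t \<in> carrier (tensor K M N)"
    "plin K V M N P B"
  shows "lin K V P (\<lambda>x. sw K M N P (\<lambda>a b. B x a b) t)"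
  using assms by (intro lin_sw_body) (auto simp: plin_def)

locale hopf_setting = big_type K ty + hopf: hopf_algebra K H
  for K :: "('k, 'y) ring_scheme" and ty :: "'v itself" and H :: "('k, 'h, 'z) hopf_scheme" +
  assumes antipode_bij: "bij_betw (antipode H) (carrier H) (carrier H)"
begin

declare lin_cong_weak [cong]

abbreviation "HH \<equiv> tensor K H H"

lemma vs_scalars [simp]: "vectorspace K (scalars K)" by (rule vectorspace_scalars[OF K_field])
lemma vs_H [simp]: "vectorspace K H" by (rule hopf.space)

sublocale Kf: field K by (rule K_field)
sublocale Hr: ring H by (rule hopf.ring)
sublocale Hv: module K H using vs_H by (simp add: vectorspace_def)

lemma vs_fdv [simp]: "fdv K V \<Longrightarrow> vectorspace K V" by (rule fdv_vs)

declare vs_tensor [simp] fdv_tensor [simp] fdv_dual_space [simp] fdv_realize_space [simp]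
  fdv_scalars [OF K_field, simp] vectorspace_dual_space [simp]

declare lin_id [simp] bilin_def [simp] plin_def [simp] trilin_def [simp] lin_sw_body' [simp] lin_sw_arg [simp] lin_smult_right [simp]
  lin_smult_left [simp] lin_mult_left [OF K_field, simp] lin_mult_right [OF K_field, simp]

text \<open>With the outer map instantiated this reduces linearity of a composite to linearity of
  its argument. Every structure map contributes such an instance, so that linearity is settled by
  recursion on the term.\<close>

lemmas lin_arg = lin_comp[rotated]

context
  fixes M :: "('k, 'm, 'u) module_scheme" and N :: "('k, 'n, 'w) module_scheme"
  assumes M [simp]: "vectorspace K M" and N [simp]: "vectorspace K N"
begin

lemmas pure_rules [simp] = pure_closed[OF M N]
  lin_arg[OF lin_pure_left[OF M N]] lin_arg[OF lin_pure_right[OF M N]]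
  lin_smult[OF lin_pure_left[OF M N]] lin_smult[OF lin_pure_right[OF M N]]
  sw_push[OF lin_pure_left[OF M N] _ _ M vs_tensor[OF M N]]
  sw_push[OF lin_pure_right[OF M N] _ _ N vs_tensor[OF M N]]

end

context
  fixes M :: "('k, 'm, 'u) module_scheme"
  assumes M [simp]: "vectorspace K M"
begin

lemma smult_closed_vs [simp]: "c \<in> carrier K \<Longrightarrow> m \<in> carrier M \<Longrightarrow> c \<odot>\<^bsub>M\<^esub> m \<in> carrier M"
  by (rule module.smult_closed[OF vectorspace.axioms(1)[OF M]])

lemma smult_smult [simp]: "c \<in> carrier K \<Longrightarrow> d \<in> carrier K \<Longrightarrow> m \<in> carrier M \<Longrightarrow>
    c \<odot>\<^bsub>M\<^esub> (d \<odot>\<^bsub>M\<^esub> m) = (c \<otimes>\<^bsub>K\<^esub> d) \<odot>\<^bsub>M\<^esub> m"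
  by (simp add: module.smult_assoc1[OF vectorspace.axioms(1)[OF M]])

lemma smult_one_vs [simp]: "m \<in> carrier M \<Longrightarrow> \<one>\<^bsub>K\<^esub> \<odot>\<^bsub>M\<^esub> m = m"
  by (simp add: module.smult_one[OF vectorspace.axioms(1)[OF M]])

end

declare sw_closed [simp] sw_pure [simp] sw_sw [simp] sw_smult [simp] sw_eta [simp]

lemma sw_smult_body [simp]:
  assumes "vectorspace K M" "vectorspace K N" "vectorspace K P" "t \<in> carrier (tensor K M N)"
    "c \<in> carrier K" "\<And>a b. a \<in> carrier M \<Longrightarrow> b \<in> carrier N \<Longrightarrow> F a b \<in> carrier P"
  shows "sw K M N P (\<lambda>a b. c \<odot>\<^bsub>P\<^esub> F a b) t = c \<odot>\<^bsub>P\<^esub> sw K M N P F t"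
  by (rule sw_push[symmetric, OF lin_smult_right[OF assms(3,5) lin_id]]) (use assms in auto)

lemma lin_H_mult_left: "c \<in> carrier H \<Longrightarrow> lin K H H (\<lambda>x. x \<otimes>\<^bsub>H\<^esub> c)"
  by (rule linI) (auto simp: Hr.l_distr hopf.smult_mult_left)

lemma lin_H_mult_right: "c \<in> carrier H \<Longrightarrow> lin K H H (\<lambda>x. c \<otimes>\<^bsub>H\<^esub> x)"
  by (rule linI) (auto simp: Hr.r_distr hopf.smult_mult_right)

lemmas H_mult_rules [simp] = lin_arg[OF lin_H_mult_left] lin_arg[OF lin_H_mult_right]
  hopf.smult_mult_left hopf.smult_mult_right
  sw_push[OF lin_H_mult_left _ _ vs_H vs_H] sw_push[OF lin_H_mult_right _ _ vs_H vs_H]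

lemma lin_comult: "lin K H HH (comult H)"
  and lin_counit: "lin K H (scalars K) (counit H)"
  and lin_antipode: "lin K H H (antipode H)"
  using hopf.comult_linear hopf.counit_linear hopf.antipode_linear
  by (simp_all add: linear_map_iff_lin)

lemma counit_closed [simp]: "h \<in> carrier H \<Longrightarrow> counit H h \<in> carrier K"
  using lin_closed[OF lin_counit] by simp

lemmas hopf_map_rules [simp] =
  lin_closed[OF lin_comult] lin_arg[OF lin_comult] lin_smult[OF lin_comult]
  sw_push[OF lin_comult _ _ vs_H vs_tensor[OF vs_H vs_H]]
  lin_arg[OF lin_counit] sw_push[OF lin_counit _ _ vs_H vs_scalars]
  lin_closed[OF lin_antipode] lin_arg[OF lin_antipode] lin_smult[OF lin_antipode]
  sw_push[OF lin_antipode _ _ vs_H vs_H]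

lemma sweedler_comult [simp]:
  "h \<in> carrier H \<Longrightarrow> sweedler K P B (comult H h) = sw K H H P B (comult H h)"
  by (rule sweedler_eq_sw) simp_all

declare hopf.counit_mult [simp] hopf.counit_one [simp] hopf.comult_one [simp]

lemma comult_mult [simp]:
  "g \<in> carrier H \<Longrightarrow> h \<in> carrier H \<Longrightarrow> comult H (g \<otimes>\<^bsub>H\<^esub> h) =
    sw K H H HH (\<lambda>g1 g2. sw K H H HH (\<lambda>h1 h2. pure K H H (g1 \<otimes>\<^bsub>H\<^esub> h1) (g2 \<otimes>\<^bsub>H\<^esub> h2)) (comult H h)) (comult H g)"
  using hopf.comult_mult[of g h] by simp

lemma antipode_left: "h \<in> carrier H \<Longrightarrow>
    sw K H H H (\<lambda>a b. antipode H a \<otimes>\<^bsub>H\<^esub> b) (comult H h) = counit H h \<odot>\<^bsub>H\<^esub> \<one>\<^bsub>H\<^esub>"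
  and antipode_right: "h \<in> carrier H \<Longrightarrow>
    sw K H H H (\<lambda>a b. a \<otimes>\<^bsub>H\<^esub> antipode H b) (comult H h) = counit H h \<odot>\<^bsub>H\<^esub> \<one>\<^bsub>H\<^esub>"
  using hopf.antipode_left[of h] hopf.antipode_right[of h] by simp_all

text \<open>The counit axiom followed by a linear map \<open>G\<close>. In this form it applies
  inside a larger Sweedler expression; the other axioms are treated in the same way below.\<close>

lemma counit_sw_left:
  assumes "vectorspace K P" "lin K H P G" "h \<in> carrier H"
  shows "sw K H H P (\<lambda>a b. counit H a \<odot>\<^bsub>P\<^esub> G b) (comult H h) = G h"
proof -
  have "G (sw K H H H (\<lambda>a b. counit H a \<odot>\<^bsub>H\<^esub> b) (comult H h)) = sw K H H P (\<lambda>a b. G (counit H a \<odot>\<^bsub>H\<^esub> b)) (comult H h)"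
    using assms by (intro sw_push) simp_all
  then show ?thesis using hopf.counit_left[of h] assms by (simp add: lin_smult[OF assms(2)])
qed

lemma counit_sw_right:
  assumes "vectorspace K P" "lin K H P G" "h \<in> carrier H"
  shows "sw K H H P (\<lambda>a b. counit H b \<odot>\<^bsub>P\<^esub> G a) (comult H h) = G h"
proof -
  have "G (sw K H H H (\<lambda>a b. counit H b \<odot>\<^bsub>H\<^esub> a) (comult H h)) = sw K H H P (\<lambda>a b. G (counit H b \<odot>\<^bsub>H\<^esub> a)) (comult H h)"
    using assms by (intro sw_push) simp_all
  then show ?thesis using hopf.counit_right[of h] assms by (simp add: lin_smult[OF assms(2)])
qed

text \<open>The axiom is an identity in H \<otimes> (H \<otimes> H); applying the linear map induced
  by \<open>T\<close> gives it under any trilinear expression. As a rewrite rule it moves iterated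
  comultiplications to the second leg.\<close>

lemma coassoc:
  assumes P [simp]: "vectorspace K P"
    and T: "trilin K H H H P T" and h [simp]: "h \<in> carrier H"
  shows "sw K H H P (\<lambda>a b. sw K H H P (\<lambda>c d. T c d b) (comult H a)) (comult H h) =
    sw K H H P (\<lambda>a b. sw K H H P (\<lambda>c d. T a c d) (comult H b)) (comult H h)"
proof -
  note [simp] = trilinD[OF T]
  let ?L = "\<lambda>t. sw K H HH P (\<lambda>a u. sw K H H P (\<lambda>b c. T a b c) u) t"
  have "?L (sw K H H (tensor K H HH) (\<lambda>h1 h2. sw K H H (tensor K H HH)
          (\<lambda>h11 h12. pure K H HH h11 (pure K H H h12 h2)) (comult H h1)) (comult H h)) =
      ?L (sw K H H (tensor K H HH) (\<lambda>h1 h2. pure K H HH h1 (comult H h2)) (comult H h))"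
    using hopf.coassoc[OF h] by simp
  then show ?thesis by simp
qed

text \<open>Common pattern of the antipode axioms, for the antipode and its inverse, under a linear
  map \<open>G\<close>.\<close>

lemma push_comult:
  assumes "vectorspace K P" "lin K H P G" "h \<in> carrier H"
    "\<And>a b. a \<in> carrier H \<Longrightarrow> b \<in> carrier H \<Longrightarrow> B a b \<in> carrier H"
    and eq: "sw K H H H B (comult H h) = c \<odot>\<^bsub>H\<^esub> \<one>\<^bsub>H\<^esub>" and c: "c \<in> carrier K"
  shows "sw K H H P (\<lambda>a b. G (B a b)) (comult H h) = c \<odot>\<^bsub>P\<^esub> G \<one>\<^bsub>H\<^esub>"
proof -
  have "sw K H H P (\<lambda>a b. G (B a b)) (comult H h) = G (sw K H H H B (comult H h))"
    by (rule sw_push[symmetric]) (use assms in auto)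
  also have "\<dots> = c \<odot>\<^bsub>P\<^esub> G \<one>\<^bsub>H\<^esub>" unfolding eq by (rule lin_smult[OF assms(2) c]) simp
  finally show ?thesis .
qed

lemma
  assumes "vectorspace K P" "lin K H P G" "h \<in> carrier H"
  shows antipode_left_lin:
      "sw K H H P (\<lambda>a b. G (antipode H a \<otimes>\<^bsub>H\<^esub> b)) (comult H h) = counit H h \<odot>\<^bsub>P\<^esub> G \<one>\<^bsub>H\<^esub>"
    and antipode_right_lin:
      "sw K H H P (\<lambda>a b. G (a \<otimes>\<^bsub>H\<^esub> antipode H b)) (comult H h) = counit H h \<odot>\<^bsub>P\<^esub> G \<one>\<^bsub>H\<^esub>"
  using assms by (auto intro!: push_comult antipode_left antipode_right)

lemma antipode_one [simp]: "antipode H \<one>\<^bsub>H\<^esub> = \<one>\<^bsub>H\<^esub>"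
  using antipode_left[of "\<one>\<^bsub>H\<^esub>"] by simp

text \<open>The counit is applied to the antipode axiom, after which the counit axiom removes one
  leg.\<close>

lemma counit_antipode [simp]: assumes h: "h \<in> carrier H" shows "counit H (antipode H h) = counit H h"
proof -
  have "counit H h = sw K H H (scalars K) (\<lambda>a b. counit H (antipode H a \<otimes>\<^bsub>H\<^esub> b)) (comult H h)"
    using antipode_left_lin[OF vs_scalars lin_counit h] h by simp
  also have "\<dots> = sw K H H (scalars K) (\<lambda>a b. counit H b \<odot>\<^bsub>scalars K\<^esub> counit H (antipode H a)) (comult H h)"
    by (rule sw_cong) (simp_all add: Kf.m_comm)
  also have "\<dots> = counit H (antipode H h)"
    by (rule counit_sw_right) (simp_all add: h)
  finally show ?thesis by simp
qed

text \<open>S(gh) and S(h) S(g) are a left and a right convolution inverse of the multiplication as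
  a map on the coalgebra H \<otimes> H, hence equal. The argument is written out with two
  independent comultiplications, as \<open>convolution_unique\<close> below concerns maps on H
  itself.\<close>

lemma antipode_mult:
  assumes g [simp]: "g \<in> carrier H" and h [simp]: "h \<in> carrier H"
  shows "antipode H (g \<otimes>\<^bsub>H\<^esub> h) = antipode H h \<otimes>\<^bsub>H\<^esub> antipode H g"
proof -
  let ?S = "antipode H"
  have left: "sw K H H H (\<lambda>g1 g2. sw K H H H (\<lambda>h1 h2. ?S (g1 \<otimes>\<^bsub>H\<^esub> h1) \<otimes>\<^bsub>H\<^esub> (g2 \<otimes>\<^bsub>H\<^esub> (h2 \<otimes>\<^bsub>H\<^esub> x))) (comult H b))
      (comult H a) = (counit H a \<otimes>\<^bsub>K\<^esub> counit H b) \<odot>\<^bsub>H\<^esub> x"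
    if "a \<in> carrier H" "b \<in> carrier H" "x \<in> carrier H" for a b x
  proof -
    have "sw K H H H (\<lambda>c d. ?S c \<otimes>\<^bsub>H\<^esub> d) (comult H (a \<otimes>\<^bsub>H\<^esub> b)) \<otimes>\<^bsub>H\<^esub> x =
        (counit H (a \<otimes>\<^bsub>H\<^esub> b) \<odot>\<^bsub>H\<^esub> \<one>\<^bsub>H\<^esub>) \<otimes>\<^bsub>H\<^esub> x"
      using that by (simp only: antipode_left Hr.m_closed)
    then show ?thesis using that by (simp add: Hr.m_assoc)
  qed
  have right: "sw K H H H (\<lambda>g2 g3. sw K H H H (\<lambda>h2 h3. g2 \<otimes>\<^bsub>H\<^esub> (h2 \<otimes>\<^bsub>H\<^esub> (?S h3 \<otimes>\<^bsub>H\<^esub> ?S g3))) (comult H b))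
      (comult H a) = (counit H b \<otimes>\<^bsub>K\<^esub> counit H a) \<odot>\<^bsub>H\<^esub> \<one>\<^bsub>H\<^esub>"
    if "a \<in> carrier H" "b \<in> carrier H" for a b
  proof -
    have "sw K H H H (\<lambda>h2 h3. g2 \<otimes>\<^bsub>H\<^esub> (h2 \<otimes>\<^bsub>H\<^esub> (?S h3 \<otimes>\<^bsub>H\<^esub> ?S g3))) (comult H b) =
        counit H b \<odot>\<^bsub>H\<^esub> (g2 \<otimes>\<^bsub>H\<^esub> ?S g3)" if "g2 \<in> carrier H" "g3 \<in> carrier H" for g2 g3
      using antipode_right_lin[of H "\<lambda>z. g2 \<otimes>\<^bsub>H\<^esub> (z \<otimes>\<^bsub>H\<^esub> ?S g3)" b] that \<open>b \<in> carrier H\<close>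
      by (simp add: Hr.m_assoc)
    then show ?thesis using that antipode_right[of a] by simp
  qed
  \<comment> \<open>The triple convolution product of S(gh), gh and S(h) S(g). Grouping the last two
    factors leaves S(gh), and grouping the first two leaves S(h) S(g).\<close>
  let ?E = "sw K H H H (\<lambda>g1 g'. sw K H H H (\<lambda>g2 g3. sw K H H H (\<lambda>h1 h'. sw K H H H (\<lambda>h2 h3.
      ?S (g1 \<otimes>\<^bsub>H\<^esub> h1) \<otimes>\<^bsub>H\<^esub> (g2 \<otimes>\<^bsub>H\<^esub> (h2 \<otimes>\<^bsub>H\<^esub> (?S h3 \<otimes>\<^bsub>H\<^esub> ?S g3)))) (comult H h')) (comult H h)) (comult H g')) (comult H g)"
  have "?E = sw K H H H (\<lambda>g1 g'. sw K H H H (\<lambda>h1 h'. ?S (g1 \<otimes>\<^bsub>H\<^esub> h1) \<otimes>\<^bsub>H\<^esub>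
      sw K H H H (\<lambda>g2 g3. sw K H H H (\<lambda>h2 h3.
      (g2 \<otimes>\<^bsub>H\<^esub> (h2 \<otimes>\<^bsub>H\<^esub> (?S h3 \<otimes>\<^bsub>H\<^esub> ?S g3)))) (comult H h')) (comult H g')) (comult H h)) (comult H g)"
    by (rule sw_cong, simp, subst sw_swap) simp_all
  also have "\<dots> = sw K H H H (\<lambda>g1 g'. sw K H H H (\<lambda>h1 h'.
      counit H g' \<odot>\<^bsub>H\<^esub> (counit H h' \<odot>\<^bsub>H\<^esub> ?S (g1 \<otimes>\<^bsub>H\<^esub> h1))) (comult H h)) (comult H g)"
    by (simp add: right Kf.m_comm)
  \<comment> \<open>\<open>smult_smult\<close> would merge the two counits into a single scalar, to
    which the counit rule no longer applies.\<close>
  also have "\<dots> = ?S (g \<otimes>\<^bsub>H\<^esub> h)"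
    by (simp add: counit_sw_right del: smult_smult)
  finally have E1: "?E = ?S (g \<otimes>\<^bsub>H\<^esub> h)" .
  have "?E = sw K H H H (\<lambda>a c. sw K H H H (\<lambda>g1 g2. sw K H H H (\<lambda>b d. sw K H H H (\<lambda>h1 h2.
      ?S (g1 \<otimes>\<^bsub>H\<^esub> h1) \<otimes>\<^bsub>H\<^esub> (g2 \<otimes>\<^bsub>H\<^esub> (h2 \<otimes>\<^bsub>H\<^esub> (?S d \<otimes>\<^bsub>H\<^esub> ?S c)))) (comult H b)) (comult H h)) (comult H a)) (comult H g)"
    by (simp add: coassoc)
  also have "\<dots> = sw K H H H (\<lambda>a c. sw K H H H (\<lambda>b d. sw K H H H (\<lambda>g1 g2. sw K H H H (\<lambda>h1 h2.
      ?S (g1 \<otimes>\<^bsub>H\<^esub> h1) \<otimes>\<^bsub>H\<^esub> (g2 \<otimes>\<^bsub>H\<^esub> (h2 \<otimes>\<^bsub>H\<^esub> (?S d \<otimes>\<^bsub>H\<^esub> ?S c)))) (comult H b)) (comult H a)) (comult H h)) (comult H g)"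
    by (rule sw_cong, simp, subst sw_swap) simp_all
  also have "\<dots> = sw K H H H (\<lambda>a c. sw K H H H (\<lambda>b d. counit H a \<odot>\<^bsub>H\<^esub> (counit H b \<odot>\<^bsub>H\<^esub> (?S d \<otimes>\<^bsub>H\<^esub> ?S c)))
      (comult H h)) (comult H g)"
    by (simp add: left)
  also have "\<dots> = ?S h \<otimes>\<^bsub>H\<^esub> ?S g"
    by (simp add: counit_sw_left del: smult_smult)
  finally show ?thesis using E1 by simp
qed

text \<open>A left and a right inverse of \<open>D\<close> under convolution coincide. The product
  of the target is the separate parameter \<open>\<mu>\<close>, because \<open>A\<close> is also
  instantiated with H \<otimes> H, whose record leaves the multiplication undefined.\<close>

lemma convolution_unique:
  fixes A :: "('k, 'a, 'w) module_scheme"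
  assumes A [simp]: "vectorspace K A"
    and F [simp]: "lin K H A F" and G [simp]: "lin K H A G" and D [simp]: "lin K H A D"
    and mu: "\<And>y. y \<in> carrier A \<Longrightarrow> lin K A A (\<lambda>x. \<mu> x y)" "\<And>x. x \<in> carrier A \<Longrightarrow> lin K A A (\<lambda>y. \<mu> x y)"
    and assoc: "\<And>x y z. x \<in> carrier A \<Longrightarrow> y \<in> carrier A \<Longrightarrow> z \<in> carrier A \<Longrightarrow> \<mu> (\<mu> x y) z = \<mu> x (\<mu> y z)"
    and e: "e \<in> carrier A" "\<And>x. x \<in> carrier A \<Longrightarrow> \<mu> x e = x" "\<And>x. x \<in> carrier A \<Longrightarrow> \<mu> e x = x"
    and FD: "\<And>h. h \<in> carrier H \<Longrightarrow> sw K H H A (\<lambda>a b. \<mu> (F a) (D b)) (comult H h) = counit H h \<odot>\<^bsub>A\<^esub> e"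
    and DG: "\<And>h. h \<in> carrier H \<Longrightarrow> sw K H H A (\<lambda>a b. \<mu> (D a) (G b)) (comult H h) = counit H h \<odot>\<^bsub>A\<^esub> e"
    and h [simp]: "h \<in> carrier H"
  shows "F h = G h"
proof -
  note [simp] = lin_closed[OF F] lin_closed[OF G] lin_closed[OF D] lin_closed[OF mu(1)]
    lin_arg[OF mu(1)] lin_arg[OF mu(2)] lin_arg[OF F] lin_arg[OF G] lin_arg[OF D]
  have r: "sw K H H A (\<lambda>c d. \<mu> x (\<mu> (D c) (G d))) (comult H b) = counit H b \<odot>\<^bsub>A\<^esub> x"
    if "x \<in> carrier A" "b \<in> carrier H" for x b
    using sw_push[OF mu(2)[OF that(1)], of H H "comult H b" "\<lambda>c d. \<mu> (D c) (G d)"] that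
    by (simp add: DG lin_smult[OF mu(2)] e)
  have l: "sw K H H A (\<lambda>c d. \<mu> (F c) (\<mu> (D d) x)) (comult H b) = counit H b \<odot>\<^bsub>A\<^esub> x"
    if "x \<in> carrier A" "b \<in> carrier H" for x b
    using sw_push[OF mu(1)[OF that(1)], of H H "comult H b" "\<lambda>c d. \<mu> (F c) (D d)"] that
    by (simp add: FD lin_smult[OF mu(1)] e assoc)
  have "F h = sw K H H A (\<lambda>a b. counit H b \<odot>\<^bsub>A\<^esub> F a) (comult H h)"
    by (simp add: counit_sw_right)
  also have "\<dots> = sw K H H A (\<lambda>a b. sw K H H A (\<lambda>c d. \<mu> (F a) (\<mu> (D c) (G d))) (comult H b)) (comult H h)"
    by (simp add: r)
  also have "\<dots> = sw K H H A (\<lambda>a b. sw K H H A (\<lambda>c d. \<mu> (F c) (\<mu> (D d) (G b))) (comult H a)) (comult H h)"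
    by (rule coassoc[symmetric]) simp_all
  also have "\<dots> = G h" by (simp add: l counit_sw_left)
  finally show ?thesis .
qed

definition HH_mult :: "('h \<times> 'h \<Rightarrow> 'k) set \<Rightarrow> ('h \<times> 'h \<Rightarrow> 'k) set \<Rightarrow> ('h \<times> 'h \<Rightarrow> 'k) set" where
  "HH_mult = (\<lambda>s t. sw K H H HH (\<lambda>a b. sw K H H HH (\<lambda>c d.
     pure K H H (a \<otimes>\<^bsub>H\<^esub> c) (b \<otimes>\<^bsub>H\<^esub> d)) t) s)"

lemma lin_HH_mult:
  "t \<in> carrier HH \<Longrightarrow> lin K HH HH (\<lambda>s. HH_mult s t)"
  "s \<in> carrier HH \<Longrightarrow> lin K HH HH (\<lambda>t. HH_mult s t)"
  unfolding HH_mult_def by simp_all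

text \<open>Both sides are convolution inverses of the comultiplication, as maps from H to H
  \<otimes> H.\<close>

lemma comult_antipode:
  assumes h [simp]: "h \<in> carrier H"
  shows "comult H (antipode H h) =
    sw K H H HH (\<lambda>a b. pure K H H (antipode H b) (antipode H a)) (comult H h)"
proof -
  let ?S = "antipode H" and ?e = "pure K H H \<one>\<^bsub>H\<^esub> \<one>\<^bsub>H\<^esub>"
  let ?G = "\<lambda>h. sw K H H HH (\<lambda>a b. pure K H H (?S b) (?S a)) (comult H h)"
  show ?thesis
  proof (rule convolution_unique[where F = "\<lambda>h. comult H (?S h)" and G = ?G and D = "comult H"
        and A = HH and \<mu> = HH_mult and e = ?e])
    fix x y z assume xyz: "x \<in> carrier HH" "y \<in> carrier HH" "z \<in> carrier HH"
    then show "HH_mult (HH_mult x y) z = HH_mult x (HH_mult y z)"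
      by (simp add: HH_mult_def Hr.m_assoc)
  next
    fix h assume h [simp]: "h \<in> carrier H"
    show "sw K H H HH (\<lambda>a b. HH_mult (comult H (?S a)) (comult H b)) (comult H h) = counit H h \<odot>\<^bsub>HH\<^esub> ?e"
      using antipode_left_lin[of HH "comult H" h] by (simp add: HH_mult_def lin_comult)
    have "sw K H H HH (\<lambda>a b. HH_mult (comult H a) (?G b)) (comult H h) =
        sw K H H HH (\<lambda>p b. sw K H H HH (\<lambda>q c. sw K H H HH (\<lambda>x y.
          pure K H H (p \<otimes>\<^bsub>H\<^esub> ?S y) (q \<otimes>\<^bsub>H\<^esub> ?S x)) (comult H c)) (comult H b)) (comult H h)"
      by (simp add: HH_mult_def coassoc)
    \<comment> \<open>Reassociation makes \<open>q\<close> and \<open>x\<close> the two legs of one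
      factor, so that q S(x) collapses to a counit; after that p S(y) collapses as well.\<close>
    also have "\<dots> = sw K H H HH (\<lambda>p b. sw K H H HH (\<lambda>c y. sw K H H HH (\<lambda>q x.
          pure K H H (p \<otimes>\<^bsub>H\<^esub> ?S y) (q \<otimes>\<^bsub>H\<^esub> ?S x)) (comult H c)) (comult H b)) (comult H h)"
      by (rule sw_cong, simp, rule coassoc[symmetric]) simp_all
    also have "\<dots> = sw K H H HH (\<lambda>p b. sw K H H HH (\<lambda>c y. counit H c \<odot>\<^bsub>HH\<^esub>
          pure K H H (p \<otimes>\<^bsub>H\<^esub> ?S y) \<one>\<^bsub>H\<^esub>) (comult H b)) (comult H h)"
      by (intro sw_cong refl antipode_right_lin) simp_all
    also have "\<dots> = sw K H H HH (\<lambda>p b. pure K H H (p \<otimes>\<^bsub>H\<^esub> ?S b) \<one>\<^bsub>H\<^esub>) (comult H h)"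
      by (simp add: counit_sw_left)
    also have "\<dots> = counit H h \<odot>\<^bsub>HH\<^esub> ?e"
      by (rule antipode_right_lin[where G = "\<lambda>z. pure K H H z \<one>\<^bsub>H\<^esub>"]) simp_all
    finally show "sw K H H HH (\<lambda>a b. HH_mult (comult H a) (?G b)) (comult H h) = counit H h \<odot>\<^bsub>HH\<^esub> ?e" .
  qed (simp_all add: lin_HH_mult, simp_all add: HH_mult_def lin_comult)
qed

abbreviation "Sinv \<equiv> antipode_inv H"

lemma Sinv_closed: "h \<in> carrier H \<Longrightarrow> Sinv h \<in> carrier H"
  using antipode_bij by (auto simp: bij_betw_def intro: inv_into_into)

lemma S_Sinv: "h \<in> carrier H \<Longrightarrow> antipode H (Sinv h) = h"
  using antipode_bij by (auto simp: bij_betw_def f_inv_into_f)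

lemma Sinv_S: "h \<in> carrier H \<Longrightarrow> Sinv (antipode H h) = h"
  using antipode_bij by (auto simp: bij_betw_def)

lemma Sinv_eqI: "k \<in> carrier H \<Longrightarrow> antipode H k = h \<Longrightarrow> Sinv h = k"
  using Sinv_S by auto

declare Sinv_closed [simp] S_Sinv [simp] Sinv_S [simp]

lemma lin_Sinv: "lin K H H Sinv"
  by (rule linI) (auto intro!: Sinv_eqI simp: lin_add[OF lin_antipode])

lemma Sinv_one: "Sinv \<one>\<^bsub>H\<^esub> = \<one>\<^bsub>H\<^esub>"
  by (rule Sinv_eqI) simp_all

lemma counit_Sinv: "h \<in> carrier H \<Longrightarrow> counit H (Sinv h) = counit H h"
  using counit_antipode[of "Sinv h"] by simp

lemma Sinv_mult:
  "g \<in> carrier H \<Longrightarrow> h \<in> carrier H \<Longrightarrow> Sinv (g \<otimes>\<^bsub>H\<^esub> h) = Sinv h \<otimes>\<^bsub>H\<^esub> Sinv g"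
  by (rule Sinv_eqI) (simp_all add: antipode_mult)

lemmas Sinv_rules [simp] = lin_arg[OF lin_Sinv] lin_smult[OF lin_Sinv]
  sw_push[OF lin_Sinv _ _ vs_H vs_H]

lemma comult_Sinv:
  assumes h [simp]: "h \<in> carrier H"
  shows "comult H (Sinv h) = sw K H H HH (\<lambda>a b. pure K H H (Sinv b) (Sinv a)) (comult H h)"
proof -
  have "sw K H H HH (\<lambda>a b. pure K H H (Sinv b) (Sinv a)) (comult H (antipode H (Sinv h))) = comult H (Sinv h)"
    unfolding comult_antipode[OF Sinv_closed[OF h]] by simp
  then show ?thesis by simp
qed

text \<open>The inverse antipode is applied to the antipode axioms. It reverses products and turns
  S(a) b into S^-1(b) a.\<close>

lemma Sinv_left: "h \<in> carrier H \<Longrightarrow>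
    sw K H H H (\<lambda>a b. Sinv b \<otimes>\<^bsub>H\<^esub> a) (comult H h) = counit H h \<odot>\<^bsub>H\<^esub> \<one>\<^bsub>H\<^esub>"
  and Sinv_right: "h \<in> carrier H \<Longrightarrow>
    sw K H H H (\<lambda>a b. b \<otimes>\<^bsub>H\<^esub> Sinv a) (comult H h) = counit H h \<odot>\<^bsub>H\<^esub> \<one>\<^bsub>H\<^esub>"
  using antipode_left_lin[of H Sinv h] antipode_right_lin[of H Sinv h]
  by (simp_all add: lin_Sinv Sinv_mult Sinv_one)

lemma
  assumes "vectorspace K P" "lin K H P G" "h \<in> carrier H"
  shows Sinv_left_lin:
      "sw K H H P (\<lambda>a b. G (Sinv b \<otimes>\<^bsub>H\<^esub> a)) (comult H h) = counit H h \<odot>\<^bsub>P\<^esub> G \<one>\<^bsub>H\<^esub>"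
    and Sinv_right_lin:
      "sw K H H P (\<lambda>a b. G (b \<otimes>\<^bsub>H\<^esub> Sinv a)) (comult H h) = counit H h \<odot>\<^bsub>P\<^esub> G \<one>\<^bsub>H\<^esub>"
  using assms by (auto intro!: push_comult Sinv_left Sinv_right)

subsection \<open>Automorphisms and the index group\<close>

abbreviation "Aut \<equiv> hopf_auto K H"
abbreviation "A \<equiv> hopf_auto_group K H"
abbreviation "G \<equiv> yd_group K H"

lemma hopf_auto_iff:
  "a \<in> Aut \<longleftrightarrow> a \<in> Bij (carrier H) \<and> lin K H H a \<and>
     (\<forall>x \<in> carrier H. \<forall>y \<in> carrier H. a (x \<otimes>\<^bsub>H\<^esub> y) = a x \<otimes>\<^bsub>H\<^esub> a y) \<and> a \<one>\<^bsub>H\<^esub> = \<one>\<^bsub>H\<^esub> \<and>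
     (\<forall>h \<in> carrier H. comult H (a h) = sw K H H HH (\<lambda>h1 h2. pure K H H (a h1) (a h2)) (comult H h) \<and>
        counit H (a h) = counit H h)"
  by (auto simp: hopf_auto_def linear_map_iff_lin ring_hom_def lin_closed lin_add)

context
  fixes a assumes a: "a \<in> Aut"
begin

lemma auto_bij: "bij_betw a (carrier H) (carrier H)" and lin_auto: "lin K H H a"
  and auto_ext: "a \<in> extensional (carrier H)"
  using a by (auto simp: hopf_auto_iff Bij_def)

lemma auto_mult: "x \<in> carrier H \<Longrightarrow> y \<in> carrier H \<Longrightarrow> a (x \<otimes>\<^bsub>H\<^esub> y) = a x \<otimes>\<^bsub>H\<^esub> a y"
  and auto_one: "a \<one>\<^bsub>H\<^esub> = \<one>\<^bsub>H\<^esub>"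
  and auto_counit: "x \<in> carrier H \<Longrightarrow> counit H (a x) = counit H x"
  and auto_comult: "x \<in> carrier H \<Longrightarrow>
    comult H (a x) = sw K H H HH (\<lambda>h1 h2. pure K H H (a h1) (a h2)) (comult H x)"
  using a by (auto simp: hopf_auto_iff)

lemmas auto_closed = lin_closed[OF lin_auto]

text \<open>Both sides are convolution inverses of the automorphism \<open>a\<close>.\<close>

lemma auto_antipode:
  assumes h: "h \<in> carrier H" shows "antipode H (a h) = a (antipode H h)"
proof (rule convolution_unique[where F = "\<lambda>h. antipode H (a h)" and G = "\<lambda>h. a (antipode H h)"
      and D = a and A = H and \<mu> = "mult H" and e = "\<one>\<^bsub>H\<^esub>"])
  fix h assume h: "h \<in> carrier H"
  note [simp] = auto_closed lin_arg[OF lin_auto]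
  show "sw K H H H (\<lambda>x b. antipode H (a x) \<otimes>\<^bsub>H\<^esub> a b) (comult H h) = counit H h \<odot>\<^bsub>H\<^esub> \<one>\<^bsub>H\<^esub>"
    using antipode_left[of "a h"] h by (simp add: auto_comult auto_counit)
  show "sw K H H H (\<lambda>x b. a x \<otimes>\<^bsub>H\<^esub> a (antipode H b)) (comult H h) = counit H h \<odot>\<^bsub>H\<^esub> \<one>\<^bsub>H\<^esub>"
    using antipode_right_lin[of H a h] h by (simp add: auto_mult auto_one lin_auto)
qed (use lin_auto h in \<open>simp_all add: lin_arg[OF lin_auto] Hr.m_assoc\<close>)

lemma auto_Sinv: assumes h: "h \<in> carrier H" shows "Sinv (a h) = a (Sinv h)"
  by (rule Sinv_eqI) (use h in \<open>simp_all add: auto_closed auto_antipode\<close>)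

end

lemma subgroup_hopf_auto: "subgroup Aut (BijGroup (carrier H))"
proof
  show "Aut \<subseteq> carrier (BijGroup (carrier H))" by (auto simp: hopf_auto_iff BijGroup_def)
  show "\<one>\<^bsub>BijGroup (carrier H)\<^esub> \<in> Aut"
    by (auto simp: hopf_auto_iff BijGroup_def id_Bij lin_cong[OF vs_H, of "\<lambda>x\<in>carrier H. x" "\<lambda>x. x"])
  fix a b assume a: "a \<in> Aut" and b: "b \<in> Aut"
  have ab: "a \<in> Bij (carrier H)" "b \<in> Bij (carrier H)" using a b by (auto simp: hopf_auto_iff)
  note [simp] = auto_closed[OF a] auto_closed[OF b] lin_arg[OF lin_auto[OF a]] lin_arg[OF lin_auto[OF b]]
    auto_mult[OF a] auto_mult[OF b] auto_one[OF a] auto_one[OF b] auto_counit[OF a] auto_counit[OF b]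
    auto_comult[OF a] auto_comult[OF b]
  have "lin K H H (\<lambda>h. a (b h))" using lin_auto[OF b] by simp
  then have "lin K H H (\<lambda>h \<in> carrier H. a (b h))"
    by (subst lin_cong[OF vs_H, of _ "\<lambda>h. a (b h)"]) simp_all
  moreover have "(\<lambda>h \<in> carrier H. a (b h)) \<in> Bij (carrier H)"
    using compose_Bij[OF ab] by (simp add: compose_def)
  ultimately show "a \<otimes>\<^bsub>BijGroup (carrier H)\<^esub> b \<in> Aut"
    using ab by (auto simp: hopf_auto_iff BijGroup_def compose_def)
next
  fix a assume a: "a \<in> Aut"
  have aB: "a \<in> Bij (carrier H)" using a by (auto simp: hopf_auto_iff)
  let ?i = "\<lambda>x \<in> carrier H. inv_into (carrier H) a x"
  have inv: "inv\<^bsub>BijGroup (carrier H)\<^esub> a = ?i" by (rule inv_BijGroup[OF aB])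
  have i_cl [simp]: "inv_into (carrier H) a h \<in> carrier H" if "h \<in> carrier H" for h
    by (rule Bij_inv_into_mem[OF aB that])
  have a_i [simp]: "a (inv_into (carrier H) a h) = h" if "h \<in> carrier H" for h
    using auto_bij[OF a] that by (auto simp: bij_betw_def f_inv_into_f)
  have i_a [simp]: "inv_into (carrier H) a (a h) = h" if "h \<in> carrier H" for h
    using auto_bij[OF a] that by (auto simp: bij_betw_def)
  have i_eq: "inv_into (carrier H) a h = k" if "k \<in> carrier H" "a k = h" for h k
    using i_a[OF that(1)] that(2) by simp
  have lin_i: "lin K H H (inv_into (carrier H) a)"
    by (rule linI) (auto intro!: i_eq simp: lin_add[OF lin_auto[OF a]] lin_smult[OF lin_auto[OF a]])
  note [simp] = auto_closed[OF a] lin_arg[OF lin_auto[OF a]] lin_arg[OF lin_i]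
  have comult_i: "comult H (inv_into (carrier H) a h) =
      sw K H H HH (\<lambda>h1 h2. pure K H H (inv_into (carrier H) a h1) (inv_into (carrier H) a h2)) (comult H h)"
    if h: "h \<in> carrier H" for h
  proof -
    let ?k = "inv_into (carrier H) a h"
    have "sw K H H HH (\<lambda>h1 h2. pure K H H (inv_into (carrier H) a h1) (inv_into (carrier H) a h2))
        (comult H (a ?k)) = comult H ?k"
      unfolding auto_comult[OF a i_cl[OF h]] using h by simp
    then show ?thesis using h by simp
  qed
  show "inv\<^bsub>BijGroup (carrier H)\<^esub> a \<in> Aut"
    unfolding inv hopf_auto_iff
  proof (intro conjI ballI)
    show "?i \<in> Bij (carrier H)" by (rule restrict_inv_into_Bij[OF aB])
    show "lin K H H ?i" by (subst lin_cong[OF vs_H, of ?i "inv_into (carrier H) a"]) (simp_all add: lin_i)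
    show "?i \<one>\<^bsub>H\<^esub> = \<one>\<^bsub>H\<^esub>" by (auto intro!: i_eq simp: auto_one[OF a])
    fix x assume x: "x \<in> carrier H"
    { fix y assume y: "y \<in> carrier H"
      show "?i (x \<otimes>\<^bsub>H\<^esub> y) = ?i x \<otimes>\<^bsub>H\<^esub> ?i y"
      using x y by (auto intro!: i_eq simp: auto_mult[OF a]) }
    show "comult H (?i x) = sw K H H HH (\<lambda>h1 h2. pure K H H (?i h1) (?i h2)) (comult H x)"
      using x by (simp add: comult_i)
    show "counit H (?i x) = counit H x" using auto_counit[OF a, of "?i x"] x by simp
  qed
qed

lemma A_carrier [simp]: "carrier A = Aut"
  by (simp add: hopf_auto_group_def)

sublocale Ag: group A
  unfolding hopf_auto_group_def by (rule subgroup.subgroup_is_group[OF subgroup_hopf_auto group_BijGroup])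

lemma A_mult_apply [simp]:
  assumes "a \<in> Aut" "b \<in> Aut" "h \<in> carrier H" shows "(a \<otimes>\<^bsub>A\<^esub> b) h = a (b h)"
proof -
  have "a \<in> Bij (carrier H)" "b \<in> Bij (carrier H)" using assms by (auto simp: hopf_auto_iff)
  then show ?thesis using assms(3) by (simp add: hopf_auto_group_def BijGroup_def compose_def)
qed

lemma A_one_apply [simp]: "h \<in> carrier H \<Longrightarrow> \<one>\<^bsub>A\<^esub> h = h"
  by (simp add: hopf_auto_group_def BijGroup_def)

lemma A_inv_closed [simp]: "a \<in> Aut \<Longrightarrow> inv\<^bsub>A\<^esub> a \<in> Aut"
  and A_mult_closed [simp]: "a \<in> Aut \<Longrightarrow> b \<in> Aut \<Longrightarrow> a \<otimes>\<^bsub>A\<^esub> b \<in> Aut"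
  and A_one_closed [simp]: "\<one>\<^bsub>A\<^esub> \<in> Aut"
  using Ag.inv_closed Ag.m_closed Ag.one_closed by auto

lemma
  assumes a: "a \<in> Aut" and h: "h \<in> carrier H"
  shows A_inv_left [simp]: "(inv\<^bsub>A\<^esub> a) (a h) = h" and A_inv_right [simp]: "a ((inv\<^bsub>A\<^esub> a) h) = h"
  using a h A_mult_apply[of "inv\<^bsub>A\<^esub> a" a h] A_mult_apply[of a "inv\<^bsub>A\<^esub> a" h] Ag.l_inv[of a] Ag.r_inv[of a]
  by simp_all

lemma A_inv_mult [simp]: "a \<in> Aut \<Longrightarrow> b \<in> Aut \<Longrightarrow> inv\<^bsub>A\<^esub> (a \<otimes>\<^bsub>A\<^esub> b) = inv\<^bsub>A\<^esub> b \<otimes>\<^bsub>A\<^esub> inv\<^bsub>A\<^esub> a"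
  and A_inv_inv [simp]: "a \<in> Aut \<Longrightarrow> inv\<^bsub>A\<^esub> (inv\<^bsub>A\<^esub> a) = a"
  using Ag.inv_mult_group Ag.inv_inv by simp_all

lemma A_simps [simp]:
  "a \<in> Aut \<Longrightarrow> b \<in> Aut \<Longrightarrow> c \<in> Aut \<Longrightarrow> a \<otimes>\<^bsub>A\<^esub> b \<otimes>\<^bsub>A\<^esub> c = a \<otimes>\<^bsub>A\<^esub> (b \<otimes>\<^bsub>A\<^esub> c)"
  "a \<in> Aut \<Longrightarrow> inv\<^bsub>A\<^esub> a \<otimes>\<^bsub>A\<^esub> a = \<one>\<^bsub>A\<^esub>" "a \<in> Aut \<Longrightarrow> a \<otimes>\<^bsub>A\<^esub> inv\<^bsub>A\<^esub> a = \<one>\<^bsub>A\<^esub>"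
  "a \<in> Aut \<Longrightarrow> \<one>\<^bsub>A\<^esub> \<otimes>\<^bsub>A\<^esub> a = a" "a \<in> Aut \<Longrightarrow> a \<otimes>\<^bsub>A\<^esub> \<one>\<^bsub>A\<^esub> = a"
  "inv\<^bsub>A\<^esub> \<one>\<^bsub>A\<^esub> = \<one>\<^bsub>A\<^esub>"
  by (simp_all add: Ag.m_assoc)

text \<open>With right association these cancellations let the simplifier normalize words in
  automorphisms and inverses. The index computations that occur later rely on it.\<close>

lemma A_cancel [simp]:
  assumes "a \<in> Aut" "b \<in> Aut"
  shows "inv\<^bsub>A\<^esub> a \<otimes>\<^bsub>A\<^esub> (a \<otimes>\<^bsub>A\<^esub> b) = b" "a \<otimes>\<^bsub>A\<^esub> (inv\<^bsub>A\<^esub> a \<otimes>\<^bsub>A\<^esub> b) = b"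
  using assms A_simps(1)[of "inv\<^bsub>A\<^esub> a" a b] A_simps(1)[of a "inv\<^bsub>A\<^esub> a" b] by (simp_all del: A_simps(1))

lemma G_simps:
  "carrier G = Aut \<times> Aut"
  "x \<otimes>\<^bsub>G\<^esub> y = (fst x \<otimes>\<^bsub>A\<^esub> fst y, snd y \<otimes>\<^bsub>A\<^esub> inv\<^bsub>A\<^esub> (fst y) \<otimes>\<^bsub>A\<^esub> snd x \<otimes>\<^bsub>A\<^esub> fst y)"
  "\<one>\<^bsub>G\<^esub> = (\<one>\<^bsub>A\<^esub>, \<one>\<^bsub>A\<^esub>)"
  by (simp_all add: yd_group_def Let_def split_beta)

lemma G_group: "group G"
proof (rule groupI)
  \<comment> \<open>A left inverse of (\<alpha>, \<beta>) must be of the form (\<alpha>^-1, x) with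
    \<beta> \<alpha>^-1 x \<alpha> = 1, which forces x = \<alpha> \<beta>^-1 \<alpha>^-1.\<close>
  show "\<exists>y\<in>carrier G. y \<otimes>\<^bsub>G\<^esub> x = \<one>\<^bsub>G\<^esub>" if "x \<in> carrier G" for x
    using that by (intro bexI[of _ "(inv\<^bsub>A\<^esub> (fst x), fst x \<otimes>\<^bsub>A\<^esub> inv\<^bsub>A\<^esub> (snd x) \<otimes>\<^bsub>A\<^esub> inv\<^bsub>A\<^esub> (fst x))"])
      (auto simp: G_simps)
qed (auto simp: G_simps)

sublocale Gg: group G by (rule G_group)

lemma G_inv:
  assumes "x \<in> carrier G"
  shows "inv\<^bsub>G\<^esub> x = (inv\<^bsub>A\<^esub> (fst x), fst x \<otimes>\<^bsub>A\<^esub> inv\<^bsub>A\<^esub> (snd x) \<otimes>\<^bsub>A\<^esub> inv\<^bsub>A\<^esub> (fst x))"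
  by (rule Gg.inv_equality) (use assms in \<open>auto simp: G_simps\<close>)

text \<open>The rules for a generic automorphism cannot be rewrite rules, as their left-hand sides would
  be headed by a variable; only the shapes that occur in the definitions are covered.\<close>

context
  fixes a assumes a: "a \<in> Aut"
begin

lemmas auto_rules = auto_closed[OF a] lin_arg[OF lin_auto[OF a]] lin_smult[OF lin_auto[OF a]]
  sw_push[OF lin_auto[OF a] _ _ vs_H vs_H] auto_mult[OF a] auto_one[OF a] auto_counit[OF a]
  auto_comult[OF a] auto_antipode[OF a] auto_Sinv[OF a]

end

lemmas inv_auto_rules [simp] = auto_rules[of "inv\<^bsub>A\<^esub> a" for a, OF A_inv_closed]
lemmas fst_auto_rules [simp] = auto_rules[of "fst x" for x]
lemmas snd_auto_rules [simp] = auto_rules[of "snd x" for x]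

context
  fixes V :: "('k, 'x, 'u) module_scheme" assumes V: "fdv K V"
begin

lemmas realize_rules [simp] =
  lin_closed[OF lin_realize[OF V]] lin_arg[OF lin_realize[OF V]] lin_smult[OF lin_realize[OF V]]
  sw_push[OF lin_realize[OF V] _ _ vs_fdv[OF V] vs_realize_space[OF V]]
  lin_closed[OF lin_unrealize[OF V]] lin_arg[OF lin_unrealize[OF V]] lin_smult[OF lin_unrealize[OF V]]
  sw_push[OF lin_unrealize[OF V] _ _ vs_realize_space[OF V] vs_fdv[OF V]]
  unrealize_realize[OF V] realize_unrealize[OF V]

end

lemmas realize_rules_K [simp] =
  realize_rules[of "scalars K", OF fdv_scalars[OF K_field], unfolded scalars_simps]

section \<open>Comodule identities and the compatibility condition\<close>

lemma comodule_coassoc: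
  fixes V :: "('k, 'v) module"
  assumes V [simp]: "vectorspace K V" and \<rho>: "right_comodule K H V \<rho>"
    and P [simp]: "vectorspace K P" and T: "trilin K V H H P T" and m [simp]: "m \<in> carrier V"
  shows "sw K V H P (\<lambda>a b. sw K V H P (\<lambda>c d. T c d b) (\<rho> a)) (\<rho> m) =
    sw K V H P (\<lambda>a b. sw K H H P (\<lambda>c d. T a c d) (comult H b)) (\<rho> m)"
proof -
  have lin: "lin K V (tensor K V H) \<rho>"
    using \<rho> by (simp add: right_comodule_def linear_map_iff_lin)
  note [simp] = trilinD[OF T] lin_closed[OF lin]
  let ?L = "\<lambda>t. sw K V HH P (\<lambda>a u. sw K H H P (\<lambda>b c. T a b c) u) t"
  have sws: "sweedler K Q B (\<rho> x) = sw K V H Q B (\<rho> x)" if "x \<in> carrier V"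
    for x and Q :: "('k, ('v \<times> ('h \<times> 'h \<Rightarrow> 'k) set \<Rightarrow> 'k) set) module" and B
    using that by (intro sweedler_eq_sw) simp_all
  have "?L (sw K V H (tensor K V HH) (\<lambda>h1 h2. sw K V H (tensor K V HH)
          (\<lambda>h11 h12. pure K V HH h11 (pure K H H h12 h2)) (\<rho> h1)) (\<rho> m)) =
      ?L (sw K V H (tensor K V HH) (\<lambda>h1 h2. pure K V HH h1 (comult H h2)) (\<rho> m))"
    using right_comodule.coact_coassoc[OF \<rho> m] by (simp add: sws)
  then show ?thesis by simp
qed

lemma comodule_counit:
  fixes V :: "('k, 'v) module"
  assumes V [simp]: "vectorspace K V" and \<rho>: "right_comodule K H V \<rho>"
    and P [simp]: "vectorspace K P" and T: "lin K V P T" and m [simp]: "m \<in> carrier V"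
  shows "sw K V H P (\<lambda>a b. counit H b \<odot>\<^bsub>P\<^esub> T a) (\<rho> m) = T m"
proof -
  have lin: "lin K V (tensor K V H) \<rho>"
    using \<rho> by (simp add: right_comodule_def linear_map_iff_lin)
  have "T (sw K V H V (\<lambda>a b. counit H b \<odot>\<^bsub>V\<^esub> a) (\<rho> m)) = sw K V H P (\<lambda>a b. T (counit H b \<odot>\<^bsub>V\<^esub> a)) (\<rho> m)"
    by (rule sw_push[OF T]) (simp_all add: lin_closed[OF lin])
  moreover have "sw K V H V (\<lambda>a b. counit H b \<odot>\<^bsub>V\<^esub> a) (\<rho> m) = m"
    using right_comodule.coact_counit[OF \<rho> m] unfolding sweedler_eq_sw[OF V vs_H lin_closed[OF lin m]] .
  ultimately show ?thesis by (simp add: lin_smult[OF T])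
qed

text \<open>The compatibility condition of Yetter-Drinfeld modules is equivalent to
  \<open>h\<^sub>1 m\<^sub>0 \<otimes> \<beta>(h\<^sub>2) m\<^sub>1 = (h\<^sub>2 m)\<^sub>0 \<otimes> (h\<^sub>2 m)\<^sub>1 \<alpha>(h\<^sub>1)\<close>, which is free of the antipode.\<close>

definition yd_compat where
  "yd_compat V op \<rho> \<alpha> \<beta> \<longleftrightarrow> (\<forall>h \<in> carrier H. \<forall>m \<in> carrier V.
     sw K H H (tensor K V H) (\<lambda>h1 h2. sw K V H (tensor K V H) (\<lambda>m0 m1.
       pure K V H (op h1 m0) (\<beta> h2 \<otimes>\<^bsub>H\<^esub> m1)) (\<rho> m)) (comult H h) =
     sw K H H (tensor K V H) (\<lambda>h1 h2. sw K V H (tensor K V H) (\<lambda>m0 m1.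
       pure K V H m0 (m1 \<otimes>\<^bsub>H\<^esub> \<alpha> h1)) (\<rho> (op h2 m))) (comult H h))"

context
  fixes V :: "('k, 'v) module" and op :: "'h \<Rightarrow> 'v \<Rightarrow> 'v" and \<rho> and \<alpha> \<beta> :: "'h \<Rightarrow> 'h"
  assumes V [simp]: "vectorspace K V"
    and op: "\<And>h. h \<in> carrier H \<Longrightarrow> lin K V V (\<lambda>m. op h m)"
      "\<And>m. m \<in> carrier V \<Longrightarrow> lin K H V (\<lambda>h. op h m)"
    and \<rho>: "lin K V (tensor K V H) \<rho>"
    and \<alpha>: "\<alpha> \<in> Aut" and \<beta>: "\<beta> \<in> Aut"
begin

lemmas op_rules = lin_closed[OF op(1)] lin_arg[OF op(1)] lin_arg[OF op(2)]
  lin_smult[OF op(1)] lin_smult[OF op(2)] sw_push[OF op(1) _ _ V V] sw_push[OF op(2) _ _ vs_H V]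
  lin_closed[OF \<rho>] lin_arg[OF \<rho>] lin_smult[OF \<rho>] sw_push[OF \<rho> _ _ V vs_tensor[OF V vs_H]]
  auto_rules[OF \<alpha>] auto_rules[OF \<beta>]

text \<open>The condition is an identity in V \<otimes> H, so it persists under the linear map
  induced by a bilinear \<open>B\<close>. This is the form in which it is used inside longer
  computations.\<close>

lemma yd_compat_lin:
  assumes compat: "yd_compat V op \<rho> \<alpha> \<beta>" and P [simp]: "vectorspace K P" and B: "bilin K V H P B"
    and h [simp]: "h \<in> carrier H" and m [simp]: "m \<in> carrier V"
  shows "sw K H H P (\<lambda>h1 h2. sw K V H P (\<lambda>m0 m1. B (op h1 m0) (\<beta> h2 \<otimes>\<^bsub>H\<^esub> m1)) (\<rho> m)) (comult H h) =
     sw K H H P (\<lambda>h1 h2. sw K V H P (\<lambda>m0 m1. B m0 (m1 \<otimes>\<^bsub>H\<^esub> \<alpha> h1)) (\<rho> (op h2 m))) (comult H h)"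
proof -
  note [simp] = op_rules
  have [simp]: "lin K V P (\<lambda>x. B x y)" if "y \<in> carrier H" for y
    using B that by (simp add: bilin_def)
  have [simp]: "lin K H P (\<lambda>y. B x y)" if "x \<in> carrier V" for x
    using B that by (simp add: bilin_def)
  note [simp] = bilin_closed[OF B]
  let ?L = "\<lambda>t. sw K V H P (\<lambda>x y. B x y) t"
  have "?L (sw K H H (tensor K V H) (\<lambda>h1 h2. sw K V H (tensor K V H) (\<lambda>m0 m1.
       pure K V H (op h1 m0) (\<beta> h2 \<otimes>\<^bsub>H\<^esub> m1)) (\<rho> m)) (comult H h)) =
     ?L (sw K H H (tensor K V H) (\<lambda>h1 h2. sw K V H (tensor K V H) (\<lambda>m0 m1.
       pure K V H m0 (m1 \<otimes>\<^bsub>H\<^esub> \<alpha> h1)) (\<rho> (op h2 m))) (comult H h))"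
    using compat by (simp add: yd_compat_def)
  then show ?thesis by simp
qed

lemma yd_compat_iff:
  "yd_compat V op \<rho> \<alpha> \<beta> \<longleftrightarrow> (\<forall>h \<in> carrier H. \<forall>m \<in> carrier V. \<rho> (op h m) =
      sweedler K (tensor K V H) (\<lambda>h1 h23. sweedler K (tensor K V H) (\<lambda>h2 h3.
        sweedler K (tensor K V H) (\<lambda>m0 m1.
          pure K V H (op h2 m0) (\<beta> h3 \<otimes>\<^bsub>H\<^esub> m1 \<otimes>\<^bsub>H\<^esub> \<alpha> (Sinv h1)))
        (\<rho> m)) (comult H h23)) (comult H h))"
    (is "?L \<longleftrightarrow> (\<forall>h \<in> _. \<forall>m \<in> _. ?R h m)")
proof
  note [simp] = op_rules
  have sw\<rho>: "sweedler K P B (\<rho> x) = sw K V H P B (\<rho> x)" if "x \<in> carrier V"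
    for x and P :: "('k, ('v \<times> 'h \<Rightarrow> 'k) set) module" and B
    using that by (intro sweedler_eq_sw) simp_all
  let ?T = "tensor K V H"
  { assume L: ?L
    show "\<forall>h \<in> carrier H. \<forall>m \<in> carrier V. ?R h m"
    proof (intro ballI)
      fix h m assume h [simp]: "h \<in> carrier H" and m [simp]: "m \<in> carrier V"
      \<comment> \<open>The antipode-free identity is applied to the last two legs of h. Then
        \<alpha>(h_2) meets \<alpha>(S^-1(h_1)), and the two legs cancel to a counit.\<close>
      have "sw K H H ?T (\<lambda>h1 h23. sw K H H ?T (\<lambda>h2 h3. sw K V H ?T (\<lambda>m0 m1.
            pure K V H (op h2 m0) (\<beta> h3 \<otimes>\<^bsub>H\<^esub> m1 \<otimes>\<^bsub>H\<^esub> \<alpha> (Sinv h1))) (\<rho> m)) (comult H h23)) (comult H h) =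
          sw K H H ?T (\<lambda>h1 h23. sw K H H ?T (\<lambda>h2 h3. sw K V H ?T (\<lambda>m0 m1.
            pure K V H m0 (m1 \<otimes>\<^bsub>H\<^esub> \<alpha> h2 \<otimes>\<^bsub>H\<^esub> \<alpha> (Sinv h1))) (\<rho> (op h3 m))) (comult H h23)) (comult H h)"
        by (intro sw_cong refl yd_compat_lin[OF L]) simp_all
      also have "\<dots> = sw K H H ?T (\<lambda>a h3. sw K H H ?T (\<lambda>h1 h2. sw K V H ?T (\<lambda>m0 m1.
            pure K V H m0 (m1 \<otimes>\<^bsub>H\<^esub> \<alpha> (h2 \<otimes>\<^bsub>H\<^esub> Sinv h1))) (\<rho> (op h3 m))) (comult H a)) (comult H h)"
        by (simp add: coassoc Hr.m_assoc)
      also have "\<dots> = sw K H H ?T (\<lambda>a h3. counit H a \<odot>\<^bsub>?T\<^esub> sw K V H ?T (\<lambda>m0 m1.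
            pure K V H m0 (m1 \<otimes>\<^bsub>H\<^esub> \<alpha> \<one>\<^bsub>H\<^esub>)) (\<rho> (op h3 m))) (comult H h)"
        by (intro sw_cong refl
            Sinv_right_lin[where G = "\<lambda>z. sw K V H ?T (\<lambda>m0 m1. pure K V H m0 (m1 \<otimes>\<^bsub>H\<^esub> \<alpha> z)) (\<rho> (op _ m))"])
          simp_all
      also have "\<dots> = \<rho> (op h m)" by (simp add: counit_sw_left)
      finally show "?R h m" by (simp add: sw\<rho>)
    qed }
  { assume "\<forall>h \<in> carrier H. \<forall>m \<in> carrier V. ?R h m"
    then have R: "\<rho> (op h m) = sw K H H ?T (\<lambda>h1 h23. sw K H H ?T (\<lambda>h2 h3. sw K V H ?T (\<lambda>m0 m1.
            pure K V H (op h2 m0) (\<beta> h3 \<otimes>\<^bsub>H\<^esub> m1 \<otimes>\<^bsub>H\<^esub> \<alpha> (Sinv h1))) (\<rho> m)) (comult H h23)) (comult H h)"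
      if "h \<in> carrier H" "m \<in> carrier V" for h m
      using that by (simp add: sw\<rho>)
    show ?L unfolding yd_compat_def
    proof (intro ballI)
      fix h m assume h [simp]: "h \<in> carrier H" and m [simp]: "m \<in> carrier V"
      \<comment> \<open>Inserting the given formula for \<rho>(h_2 m) puts \<alpha>(S^-1(a)) next to
        \<alpha>(h_1), where h_1 and a are consecutive legs of h, so that they cancel.\<close>
      have "sw K H H ?T (\<lambda>h1 h2. sw K V H ?T (\<lambda>m0 m1. pure K V H m0 (m1 \<otimes>\<^bsub>H\<^esub> \<alpha> h1)) (\<rho> (op h2 m))) (comult H h) =
          sw K H H ?T (\<lambda>h1 h2. sw K H H ?T (\<lambda>a b. sw K H H ?T (\<lambda>c d. sw K V H ?T (\<lambda>m0 m1.
            pure K V H (op c m0) (\<beta> d \<otimes>\<^bsub>H\<^esub> (m1 \<otimes>\<^bsub>H\<^esub> (\<alpha> (Sinv a \<otimes>\<^bsub>H\<^esub> h1)))))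
            (\<rho> m)) (comult H b)) (comult H h2)) (comult H h)"
        by (simp add: R Hr.m_assoc)
      also have "\<dots> = sw K H H ?T (\<lambda>x b. sw K H H ?T (\<lambda>h1 a. sw K H H ?T (\<lambda>c d. sw K V H ?T (\<lambda>m0 m1.
            pure K V H (op c m0) (\<beta> d \<otimes>\<^bsub>H\<^esub> (m1 \<otimes>\<^bsub>H\<^esub> (\<alpha> (Sinv a \<otimes>\<^bsub>H\<^esub> h1)))))
            (\<rho> m)) (comult H b)) (comult H x)) (comult H h)"
        by (rule coassoc[symmetric]) simp_all
      also have "\<dots> = sw K H H ?T (\<lambda>x b. counit H x \<odot>\<^bsub>?T\<^esub> sw K H H ?T (\<lambda>c d. sw K V H ?T (\<lambda>m0 m1.
            pure K V H (op c m0) (\<beta> d \<otimes>\<^bsub>H\<^esub> (m1 \<otimes>\<^bsub>H\<^esub> (\<alpha> \<one>\<^bsub>H\<^esub>))))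
            (\<rho> m)) (comult H b)) (comult H h)"
        by (intro sw_cong refl
            Sinv_left_lin[where G = "\<lambda>z. sw K H H ?T (\<lambda>c d. sw K V H ?T (\<lambda>m0 m1.
              pure K V H (op c m0) (\<beta> d \<otimes>\<^bsub>H\<^esub> (m1 \<otimes>\<^bsub>H\<^esub> \<alpha> z))) (\<rho> m)) (comult H _)"])
          simp_all
      also have "\<dots> = sw K H H ?T (\<lambda>h1 h2. sw K V H ?T (\<lambda>m0 m1.
          pure K V H (op h1 m0) (\<beta> h2 \<otimes>\<^bsub>H\<^esub> m1)) (\<rho> m)) (comult H h)"
        by (simp add: counit_sw_left)
      finally show "sw K H H ?T (\<lambda>h1 h2. sw K V H ?T (\<lambda>m0 m1.
          pure K V H (op h1 m0) (\<beta> h2 \<otimes>\<^bsub>H\<^esub> m1)) (\<rho> m)) (comult H h) =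
        sw K H H ?T (\<lambda>h1 h2. sw K V H ?T (\<lambda>m0 m1. pure K V H m0 (m1 \<otimes>\<^bsub>H\<^esub> \<alpha> h1)) (\<rho> (op h2 m))) (comult H h)" ..
    qed }
qed

end

section \<open>Finite dimensional Yetter-Drinfeld modules and their calculation rules\<close>

definition ydm :: "('k, 'h, 'v) yd \<Rightarrow> bool" where
  "ydm M \<longleftrightarrow> M \<in> yd_objects K H \<and> fdv K (Space M)"

text \<open>The action and coaction may be given by total formulas; restricting them to the carriers
  makes them extensional and leaves the axioms intact. The compatibility is asked for in its
  antipode-free form.\<close>

lemma ydmI:
  fixes V :: "('k, 'v) module"
  assumes V: "fdv K V" and a: "a \<in> carrier G"
    and op: "\<And>h. h \<in> carrier H \<Longrightarrow> lin K V V (\<lambda>m. op h m)"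
      "\<And>m. m \<in> carrier V \<Longrightarrow> lin K H V (\<lambda>h. op h m)"
      "\<And>m. m \<in> carrier V \<Longrightarrow> op \<one>\<^bsub>H\<^esub> m = m"
      "\<And>g h m. g \<in> carrier H \<Longrightarrow> h \<in> carrier H \<Longrightarrow> m \<in> carrier V \<Longrightarrow> op (g \<otimes>\<^bsub>H\<^esub> h) m = op g (op h m)"
    and \<rho>: "lin K V (tensor K V H) \<rho>"
    and coassoc_V: "\<And>m. m \<in> carrier V \<Longrightarrow>
      sw K V H (tensor K V HH) (\<lambda>m0 m1. sw K V H (tensor K V HH) (\<lambda>m00 m01. pure K V HH m00 (pure K H H m01 m1)) (\<rho> m0)) (\<rho> m) =
      sw K V H (tensor K V HH) (\<lambda>m0 m1. pure K V HH m0 (comult H m1)) (\<rho> m)"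
    and counit_V: "\<And>m. m \<in> carrier V \<Longrightarrow> sw K V H V (\<lambda>m0 m1. counit H m1 \<odot>\<^bsub>V\<^esub> m0) (\<rho> m) = m"
    and compat: "yd_compat V op \<rho> (fst a) (snd a)"
  shows "ydm \<lparr>Space = V, act = (\<lambda>h \<in> carrier H. \<lambda>m \<in> carrier V. op h m),
    coact = (\<lambda>m \<in> carrier V. \<rho> m), idx = a\<rparr>"
proof -
  let ?op = "\<lambda>h \<in> carrier H. \<lambda>m \<in> carrier V. op h m" and ?\<rho> = "\<lambda>m \<in> carrier V. \<rho> m"
  note V' [simp] = vs_fdv[OF V]
  have ab: "fst a \<in> Aut" "snd a \<in> Aut" using a by (auto simp: G_simps)
  have [simp]: "op h m \<in> carrier V" if "h \<in> carrier H" "m \<in> carrier V" for h m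
    by (rule lin_closed[OF op(1)]) (use that in auto)
  have [simp]: "\<rho> m \<in> carrier (tensor K V H)" if "m \<in> carrier V" for m
    by (rule lin_closed[OF \<rho> that])
  have r: "lin K V V (?op h)" if "h \<in> carrier H" for h
    by (subst lin_cong[OF V', of _ "\<lambda>m. op h m"]) (use op(1) that in auto)
  have l: "lin K H V (\<lambda>h. ?op h m)" if "m \<in> carrier V" for m
    by (subst lin_cong[OF vs_H, of _ "\<lambda>h. op h m"]) (use op(2) that in auto)
  have \<rho>': "lin K V (tensor K V H) ?\<rho>"
    by (subst lin_cong[OF V', of _ \<rho>]) (use \<rho> in auto)
  have sw\<rho>: "sweedler K P B (\<rho> x) = sw K V H P B (\<rho> x)" if "x \<in> carrier V"
    for x and P :: "('k, 'p, 'u) module_scheme" and B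
    by (rule sweedler_eq_sw[OF V' vs_H lin_closed[OF \<rho> that]])
  have sw\<rho>1: "sweedler K P B (\<rho> x) = sw K V H P B (\<rho> x)" if "x \<in> carrier V"
    for x and P :: "('k, ('v \<times> ('h \<times> 'h \<Rightarrow> 'k) set \<Rightarrow> 'k) set) module" and B
    by (rule sweedler_eq_sw[OF V' vs_H lin_closed[OF \<rho> that]])
  have sw\<rho>2: "sweedler K P B (\<rho> x) = sw K V H P B (\<rho> x)" if "x \<in> carrier V"
    for x and P :: "('k, 'v) module" and B
    by (rule sweedler_eq_sw[OF V' vs_H lin_closed[OF \<rho> that]])
  have co: "yd_compat V ?op ?\<rho> (fst a) (snd a)"
    using compat by (simp add: yd_compat_def)
  have "left_module K H V ?op"
    by (rule left_module.intro) (simp_all add: linear_map_iff_lin r l op(3,4) del: restrict_apply, simp_all add: op(3,4))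
  moreover have "right_comodule K H V ?\<rho>"
    by (intro right_comodule.intro)
      (simp_all add: \<rho>' linear_map_iff_lin sw\<rho>1 sw\<rho>2 counit_V coassoc_V)
  moreover have "yd_module_axioms K H (fst a) (snd a) V ?op ?\<rho>"
    unfolding yd_module_axioms_def using co yd_compat_iff[OF V' r l \<rho>' ab] by blast
  ultimately show ?thesis
    unfolding ydm_def yd_objects_def yd_module_def using a V by auto
qed

context
  fixes M :: "('k, 'h, 'v) yd" assumes M: "ydm M"
begin

lemma ydm_yd_module: "yd_module K H (fst (idx M)) (snd (idx M)) (Space M) (act M) (coact M)"
  using M by (simp add: ydm_def yd_objects_def)

lemma ydm_fdv: "fdv K (Space M)" using M by (simp add: ydm_def)

lemma ydm_idx: "idx M \<in> carrier G" "fst (idx M) \<in> Aut" "snd (idx M) \<in> Aut"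
  using M by (auto simp: ydm_def yd_objects_def G_simps)

lemma ydm_extensional:
  "act M \<in> extensional (carrier H)" "h \<in> carrier H \<Longrightarrow> act M h \<in> extensional (carrier (Space M))"
  "coact M \<in> extensional (carrier (Space M))"
  using M by (auto simp: ydm_def yd_objects_def)

lemmas ydm_left_module = yd_module.axioms(1)[OF ydm_yd_module]
lemmas ydm_right_comodule = yd_module.axioms(2)[OF ydm_yd_module]
lemmas ydm_vs = vs_fdv[OF ydm_fdv]

lemma lin_act: "h \<in> carrier H \<Longrightarrow> lin K (Space M) (Space M) (\<lambda>m. act M h m)"
  and lin_act_left: "m \<in> carrier (Space M) \<Longrightarrow> lin K H (Space M) (\<lambda>h. act M h m)"
  and act_one: "m \<in> carrier (Space M) \<Longrightarrow> act M \<one>\<^bsub>H\<^esub> m = m"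
  and act_mult: "g \<in> carrier H \<Longrightarrow> h \<in> carrier H \<Longrightarrow> m \<in> carrier (Space M) \<Longrightarrow>
    act M (g \<otimes>\<^bsub>H\<^esub> h) m = act M g (act M h m)"
  using left_module.op_linear_right[OF ydm_left_module] left_module.op_linear_left[OF ydm_left_module]
    left_module.op_one[OF ydm_left_module] left_module.op_mult[OF ydm_left_module]
  by (auto simp: linear_map_iff_lin)

lemma lin_coact: "lin K (Space M) (tensor K (Space M) H) (coact M)"
  using right_comodule.coact_linear[OF ydm_right_comodule] by (simp add: linear_map_iff_lin)

lemma coact_closed: "m \<in> carrier (Space M) \<Longrightarrow> coact M m \<in> carrier (tensor K (Space M) H)"
  by (rule lin_closed[OF lin_coact])

lemma sweedler_coact: "m \<in> carrier (Space M) \<Longrightarrow> sweedler K P B (coact M m) = sw K (Space M) H P B (coact M m)"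
  by (rule sweedler_eq_sw[OF ydm_vs vs_H coact_closed])

lemmas ydm_rules = ydm_fdv ydm_idx act_one act_mult coact_closed sweedler_coact
  lin_closed[OF lin_act] lin_arg[OF lin_act] lin_arg[OF lin_act_left]
  lin_smult[OF lin_act] lin_smult[OF lin_act_left]
  sw_push[OF lin_act _ _ ydm_vs ydm_vs] sw_push[OF lin_act_left _ _ vs_H ydm_vs]
  lin_arg[OF lin_coact] lin_smult[OF lin_coact]
  sw_push[OF lin_coact _ _ ydm_vs vs_tensor[OF ydm_vs vs_H]]

lemmas coact_coassoc = comodule_coassoc[OF ydm_vs ydm_right_comodule]
lemmas coact_counit = comodule_counit[OF ydm_vs ydm_right_comodule]

lemma compat:
  "vectorspace K P \<Longrightarrow> bilin K (Space M) H P B \<Longrightarrow> h \<in> carrier H \<Longrightarrow> m \<in> carrier (Space M) \<Longrightarrow>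
    sw K H H P (\<lambda>h1 h2. sw K (Space M) H P (\<lambda>m0 m1. B (act M h1 m0) (snd (idx M) h2 \<otimes>\<^bsub>H\<^esub> m1)) (coact M m)) (comult H h) =
    sw K H H P (\<lambda>h1 h2. sw K (Space M) H P (\<lambda>m0 m1. B m0 (m1 \<otimes>\<^bsub>H\<^esub> fst (idx M) h1)) (coact M (act M h2 m))) (comult H h)"
proof (rule yd_compat_lin[OF ydm_vs lin_act lin_act_left lin_coact ydm_idx(2,3)])
  show "yd_compat (Space M) (act M) (coact M) (fst (idx M)) (snd (idx M))"
    using yd_module.compatibility[OF ydm_yd_module]
    by (subst yd_compat_iff[OF ydm_vs lin_act lin_act_left lin_coact ydm_idx(2,3)]) auto
qed

end

declare ydm_rules [simp]

lemma G_mem [simp]: "(a, b) \<in> carrier G \<longleftrightarrow> a \<in> Aut \<and> b \<in> Aut"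
  by (simp add: G_simps)

lemma G_fst_snd [simp]: "a \<in> carrier G \<Longrightarrow> fst a \<in> Aut" "a \<in> carrier G \<Longrightarrow> snd a \<in> Aut"
  by (auto simp: G_simps)

subsection \<open>Conjugates\<close>

lemma yd_phi_simps [simp]:
  "Space (yd_phi K H a N) = Space N"
  "idx (yd_phi K H a N) = a \<otimes>\<^bsub>G\<^esub> idx N \<otimes>\<^bsub>G\<^esub> inv\<^bsub>G\<^esub> a"
  by (simp_all add: yd_phi_def Let_def)

lemma act_yd_phi [simp]:
  assumes "ydm N" "a \<in> carrier G" "h \<in> carrier H" "n \<in> carrier (Space N)"
  shows "act (yd_phi K H a N) h n =
    act N ((inv\<^bsub>A\<^esub> (fst (idx N))) (snd a (fst (idx N) ((inv\<^bsub>A\<^esub> (fst a)) h)))) n"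
  using assms by (simp add: yd_phi_def Let_def)

lemma coact_yd_phi [simp]:
  assumes "ydm N" "a \<in> carrier G" "n \<in> carrier (Space N)"
  shows "coact (yd_phi K H a N) n =
    sw K (Space N) H (tensor K (Space N) H)
      (\<lambda>n0 n1. pure K (Space N) H n0 (fst a ((inv\<^bsub>A\<^esub> (snd a)) n1))) (coact N n)"
  using assms by (simp add: yd_phi_def Let_def)

lemma yd_eqI:
  fixes M N :: "('k, 'h, 'v) yd"
  assumes "Space M = Space N" "idx M = idx N"
    and "act M \<in> extensional (carrier H)" "act N \<in> extensional (carrier H)"
    and "\<And>h. h \<in> carrier H \<Longrightarrow> act M h \<in> extensional (carrier (Space M))"
    and "\<And>h. h \<in> carrier H \<Longrightarrow> act N h \<in> extensional (carrier (Space N))"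
    and "coact M \<in> extensional (carrier (Space M))" "coact N \<in> extensional (carrier (Space N))"
    and "\<And>h m. h \<in> carrier H \<Longrightarrow> m \<in> carrier (Space N) \<Longrightarrow> act M h m = act N h m"
    and "\<And>m. m \<in> carrier (Space N) \<Longrightarrow> coact M m = coact N m"
  shows "M = N"
proof (rule yd.equality)
  show "act M = act N"
  proof (rule extensionalityI[OF assms(3,4)])
    fix h assume h: "h \<in> carrier H"
    show "act M h = act N h"
      by (rule extensionalityI[OF assms(5)[OF h] assms(6)[OF h, folded assms(1)]])
        (use assms(1,9) h in simp)
  qed
  show "coact M = coact N"
    by (rule extensionalityI[OF assms(7) assms(8)[folded assms(1)]]) (use assms(1,10) in simp)
qed (use assms in auto)

lemma yd_restrict_extensional:
  fixes M :: "('k, 'h, 'v) yd"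
  assumes "M = \<lparr>Space = V, act = (\<lambda>h \<in> carrier H. \<lambda>m \<in> carrier V. op h m),
    coact = (\<lambda>m \<in> carrier V. \<rho> m), idx = a\<rparr>"
  shows "act M \<in> extensional (carrier H)"
    "\<And>h. h \<in> carrier H \<Longrightarrow> act M h \<in> extensional (carrier (Space M))"
    "coact M \<in> extensional (carrier (Space M))"
  unfolding assms by auto

text \<open>\<open>op'\<close> and \<open>\<rho>'\<close> are the expressions of the definition of
  \<open>M\<close>, while \<open>op\<close> and \<open>\<rho>\<close> are simplified formulas that
  agree with its action and coaction on the carriers. The axioms are then checked on the
  latter.\<close>

lemma ydmI':
  fixes M :: "('k, 'h, 'v) yd"
  assumes V: "fdv K (Space M)" "idx M \<in> carrier G"
    and M: "M = \<lparr>Space = V, act = (\<lambda>h \<in> carrier H. \<lambda>m \<in> carrier V. op' h m),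
      coact = (\<lambda>m \<in> carrier V. \<rho>' m), idx = a\<rparr>"
    and eq: "\<And>h m. h \<in> carrier H \<Longrightarrow> m \<in> carrier (Space M) \<Longrightarrow> act M h m = op h m"
      "\<And>m. m \<in> carrier (Space M) \<Longrightarrow> coact M m = \<rho> m"
    and op: "\<And>h. h \<in> carrier H \<Longrightarrow> lin K (Space M) (Space M) (\<lambda>m. op h m)"
      "\<And>m. m \<in> carrier (Space M) \<Longrightarrow> lin K H (Space M) (\<lambda>h. op h m)"
      "\<And>m. m \<in> carrier (Space M) \<Longrightarrow> op \<one>\<^bsub>H\<^esub> m = m"
      "\<And>g h m. g \<in> carrier H \<Longrightarrow> h \<in> carrier H \<Longrightarrow> m \<in> carrier (Space M) \<Longrightarrow>
        op (g \<otimes>\<^bsub>H\<^esub> h) m = op g (op h m)"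
    and \<rho>: "lin K (Space M) (tensor K (Space M) H) \<rho>"
      "\<And>m. m \<in> carrier (Space M) \<Longrightarrow>
        sw K (Space M) H (tensor K (Space M) HH) (\<lambda>m0 m1. sw K (Space M) H (tensor K (Space M) HH)
          (\<lambda>m00 m01. pure K (Space M) HH m00 (pure K H H m01 m1)) (\<rho> m0)) (\<rho> m) =
        sw K (Space M) H (tensor K (Space M) HH) (\<lambda>m0 m1. pure K (Space M) HH m0 (comult H m1)) (\<rho> m)"
      "\<And>m. m \<in> carrier (Space M) \<Longrightarrow>
        sw K (Space M) H (Space M) (\<lambda>m0 m1. counit H m1 \<odot>\<^bsub>Space M\<^esub> m0) (\<rho> m) = m"
    and compat: "yd_compat (Space M) op \<rho> (fst (idx M)) (snd (idx M))"
  shows "ydm M"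
proof -
  have "ydm \<lparr>Space = Space M, act = (\<lambda>h \<in> carrier H. \<lambda>m \<in> carrier (Space M). op h m),
    coact = (\<lambda>m \<in> carrier (Space M). \<rho> m), idx = idx M\<rparr>"
    by (rule ydmI[OF V]) (use op \<rho> compat in auto)
  also have "\<lparr>Space = Space M, act = (\<lambda>h \<in> carrier H. \<lambda>m \<in> carrier (Space M). op h m),
    coact = (\<lambda>m \<in> carrier (Space M). \<rho> m), idx = idx M\<rparr> = M"
    by (rule yd_eqI) (use yd_restrict_extensional[OF M] eq in auto)
  finally show ?thesis .
qed

text \<open>With w = \<gamma>^-1 \<beta> \<gamma> \<alpha>^-1 and c = \<alpha> \<beta>^-1, the
  compatibility of \<open>N\<close> at w(h), followed by c on the H-leg, is the claim: c \<gamma> w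
  = \<alpha> \<gamma> \<alpha>^-1 and c \<delta> w are the two components of the conjugated
  index.\<close>

lemma ydm_yd_phi [simp]:
  assumes N [simp]: "ydm N" and a [simp]: "a \<in> carrier G"
  shows "ydm (yd_phi K H a N)"
proof (rule ydmI'[OF _ _ yd_phi_def[unfolded Let_def]])
  let ?\<gamma> = "fst (idx N)"
  let ?w = "\<lambda>h. (inv\<^bsub>A\<^esub> ?\<gamma>) (snd a (?\<gamma> ((inv\<^bsub>A\<^esub> (fst a)) h)))"
  let ?c = "\<lambda>h. fst a ((inv\<^bsub>A\<^esub> (snd a)) h)"
  let ?V = "Space N"
  let ?\<rho> = "\<lambda>n. sw K ?V H (tensor K ?V H) (\<lambda>n0 n1. pure K ?V H n0 (?c n1)) (coact N n)"
  show "act (yd_phi K H a N) h m = act N (?w h) m"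
    if "h \<in> carrier H" "m \<in> carrier (Space (yd_phi K H a N))" for h m
    using that by simp
  show "coact (yd_phi K H a N) m = ?\<rho> m" if "m \<in> carrier (Space (yd_phi K H a N))" for m
    using that by simp
  show "yd_compat (Space (yd_phi K H a N)) (\<lambda>h. act N (?w h)) ?\<rho>
      (fst (idx (yd_phi K H a N))) (snd (idx (yd_phi K H a N)))"
    unfolding yd_compat_def
  proof (intro ballI)
    fix h m assume h [simp]: "h \<in> carrier H" and "m \<in> carrier (Space (yd_phi K H a N))"
    then have m [simp]: "m \<in> carrier ?V" by simp
    show "sw K H H (tensor K (Space (yd_phi K H a N)) H) (\<lambda>h1 h2. sw K (Space (yd_phi K H a N)) H (tensor K (Space (yd_phi K H a N)) H) (\<lambda>m0 m1.
       pure K (Space (yd_phi K H a N)) H (act N (?w h1) m0) (snd (idx (yd_phi K H a N)) h2 \<otimes>\<^bsub>H\<^esub> m1)) (?\<rho> m)) (comult H h) =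
     sw K H H (tensor K (Space (yd_phi K H a N)) H) (\<lambda>h1 h2. sw K (Space (yd_phi K H a N)) H (tensor K (Space (yd_phi K H a N)) H) (\<lambda>m0 m1.
       pure K (Space (yd_phi K H a N)) H m0 (m1 \<otimes>\<^bsub>H\<^esub> fst (idx (yd_phi K H a N)) h1)) (?\<rho> (act N (?w h2) m))) (comult H h)"
      using compat[OF N, of "tensor K ?V H" "\<lambda>x y. pure K ?V H x (?c y)" "?w h" m]
      by (simp add: G_simps(2) G_inv)
  qed
qed (simp_all add: coact_coassoc coact_counit)

subsection \<open>The unit object\<close>

lemma yd_unit_simps [simp]:
  "Space (yd_unit K H :: ('k, 'h, 'v) yd) = realize_space (scalars K)"
  "idx (yd_unit K H :: ('k, 'h, 'v) yd) = \<one>\<^bsub>G\<^esub>"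
  by (simp_all add: yd_unit_def Let_def)

lemma act_yd_unit [simp]:
  "h \<in> carrier H \<Longrightarrow> x \<in> carrier (realize_space (scalars K)) \<Longrightarrow>
    act (yd_unit K H) h (x :: 'v) = counit H h \<odot>\<^bsub>realize_space (scalars K)\<^esub> x"
  by (simp add: yd_unit_def Let_def)

lemma coact_yd_unit [simp]:
  "x \<in> carrier (realize_space (scalars K)) \<Longrightarrow>
    coact (yd_unit K H) (x :: 'v) = pure K (realize_space (scalars K)) H x \<one>\<^bsub>H\<^esub>"
  by (simp add: yd_unit_def Let_def)

lemma ydm_yd_unit [simp]: "ydm (yd_unit K H)"
proof (rule ydmI'[OF _ _ yd_unit_def[unfolded Let_def]])
  let ?V = "realize_space (scalars K) :: ('k, 'v) module"
  show "yd_compat (Space (yd_unit K H)) (\<lambda>h x. counit H h \<odot>\<^bsub>?V\<^esub> x)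
      (\<lambda>x. pure K ?V H x \<one>\<^bsub>H\<^esub>) (fst (idx (yd_unit K H :: ('k, 'h, 'v) yd)))
      (snd (idx (yd_unit K H :: ('k, 'h, 'v) yd)))"
    by (simp add: yd_compat_def G_simps(3) counit_sw_left counit_sw_right)
qed (simp_all add: G_simps(3))

subsection \<open>Tensor products of objects\<close>

lemma coact_counit_mult:
  assumes M [simp]: "ydm M" and P [simp]: "vectorspace K P" and T: "lin K (Space M) P T"
    and m [simp]: "m \<in> carrier (Space M)" and c [simp]: "c \<in> carrier K"
  shows "sw K (Space M) H P (\<lambda>a b. (counit H b \<otimes>\<^bsub>K\<^esub> c) \<odot>\<^bsub>P\<^esub> T a) (coact M m) = c \<odot>\<^bsub>P\<^esub> T m"
    and "sw K (Space M) H P (\<lambda>a b. (c \<otimes>\<^bsub>K\<^esub> counit H b) \<odot>\<^bsub>P\<^esub> T a) (coact M m) = c \<odot>\<^bsub>P\<^esub> T m"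
proof -
  note [simp] = lin_closed[OF T]
  have "sw K (Space M) H P (\<lambda>a b. counit H b \<odot>\<^bsub>P\<^esub> (c \<odot>\<^bsub>P\<^esub> T a)) (coact M m) = c \<odot>\<^bsub>P\<^esub> T m"
    by (rule coact_counit) (simp_all add: T)
  then show "sw K (Space M) H P (\<lambda>a b. (counit H b \<otimes>\<^bsub>K\<^esub> c) \<odot>\<^bsub>P\<^esub> T a) (coact M m) = c \<odot>\<^bsub>P\<^esub> T m"
    by simp
  then show "sw K (Space M) H P (\<lambda>a b. (c \<otimes>\<^bsub>K\<^esub> counit H b) \<odot>\<^bsub>P\<^esub> T a) (coact M m) = c \<odot>\<^bsub>P\<^esub> T m"
    by (simp add: Kf.m_comm)
qed

text \<open>The compatibility at the image of \<open>k\<close> under an automorphism. Composite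
  automorphisms show up as nested applications \<open>\<tau>\<close>, which agree with the group
  element \<open>\<tau>'\<close> only on the carrier; hence the two names.\<close>

lemma compat_auto:
  assumes M [simp]: "ydm M" and \<tau>: "\<tau>' \<in> Aut" "\<And>h. h \<in> carrier H \<Longrightarrow> \<tau> h = \<tau>' h"
    and P [simp]: "vectorspace K P" and B: "bilin K (Space M) H P B"
    and k [simp]: "k \<in> carrier H" and m [simp]: "m \<in> carrier (Space M)"
  shows "sw K H H P (\<lambda>h1 h2. sw K (Space M) H P (\<lambda>m0 m1.
      B (act M (\<tau> h1) m0) (snd (idx M) (\<tau> h2) \<otimes>\<^bsub>H\<^esub> m1)) (coact M m)) (comult H k) =
    sw K H H P (\<lambda>h1 h2. sw K (Space M) H P (\<lambda>m0 m1.
      B m0 (m1 \<otimes>\<^bsub>H\<^esub> fst (idx M) (\<tau> h1))) (coact M (act M (\<tau> h2) m))) (comult H k)"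
proof -
  note [simp] = auto_rules[OF \<tau>(1)] \<tau>(2) bilin_closed[OF B]
  have [simp]: "lin K U P (\<lambda>x. B (F x) y)" if "y \<in> carrier H" "lin K U (Space M) F"
    for y F and U :: "('k, 'h, 'z) hopf_scheme"
    by (rule lin_comp[OF that(2)]) (use B that(1) in \<open>simp add: bilin_def\<close>)
  have [simp]: "lin K (Space M) P (\<lambda>x. B (F x) y)" if "y \<in> carrier H" "lin K (Space M) (Space M) F" for y F
    by (rule lin_comp[OF that(2)]) (use B that(1) in \<open>simp add: bilin_def\<close>)
  have [simp]: "lin K H P (\<lambda>y. B x (F y))" if "x \<in> carrier (Space M)" "lin K H H F" for x F
    by (rule lin_comp[OF that(2)]) (use B that(1) in \<open>simp add: bilin_def\<close>)
  show ?thesis using compat[OF M P B, of "\<tau>' k" m] by simp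
qed

lemma fdv_ten_space [simp]: "ydm M \<Longrightarrow> ydm N \<Longrightarrow> fdv K (tensor K (Space M) (Space N))"
  by simp

lemma ten_sweedler_sw [simp]:
  "ydm M \<Longrightarrow> ydm N \<Longrightarrow> x \<in> carrier (realize_space (tensor K (Space M) (Space N))) \<Longrightarrow>
    ten_sweedler K M N P B (x :: 'v) =
    sw K (Space M) (Space N) P B (unrealize (carrier (tensor K (Space M) (Space N))) x)"
  unfolding ten_sweedler_def by (rule sweedler_eq_sw) simp_all

lemma yd_tensor_simps [simp]:
  "Space (yd_tensor K H M N) = realize_space (tensor K (Space M) (Space N))"
  "idx (yd_tensor K H M N) = idx M \<otimes>\<^bsub>G\<^esub> idx N"
  by (simp_all add: yd_tensor_def Let_def ten_space_def)

context
  fixes M N :: "('k, 'h, 'v) yd"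
  assumes M [simp]: "ydm M" and N [simp]: "ydm N"
begin

abbreviation (input) "TT \<equiv> tensor K (Space M) (Space N)"
abbreviation (input) "RT \<equiv> realize_space (tensor K (Space M) (Space N)) :: ('k, 'v) module"
abbreviation (input) "tpure m n \<equiv> realize (carrier TT) (pure K (Space M) (Space N) m n) :: 'v"

lemma act_yd_tensor [simp]:
  assumes [simp]: "h \<in> carrier H" "x \<in> carrier RT"
  shows "act (yd_tensor K H M N) h x =
    sw K H H RT (\<lambda>h1 h2. sw K (Space M) (Space N) RT (\<lambda>m n. tpure (act M (fst (idx N) h1) m)
      (act N ((inv\<^bsub>A\<^esub> (fst (idx N))) (snd (idx M) (fst (idx N) h2))) n))
      (unrealize (carrier TT) x)) (comult H h)"
  by (simp add: yd_tensor_def Let_def ten_space_def ten_pure_def)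

lemma coact_yd_tensor [simp]:
  assumes [simp]: "x \<in> carrier RT"
  shows "coact (yd_tensor K H M N) x =
    sw K (Space M) (Space N) (tensor K RT H) (\<lambda>m n.
      sw K (Space M) H (tensor K RT H) (\<lambda>m0 m1.
        sw K (Space N) H (tensor K RT H) (\<lambda>n0 n1. pure K RT H (tpure m0 n0) (n1 \<otimes>\<^bsub>H\<^esub> m1))
          (coact N n)) (coact M m)) (unrealize (carrier TT) x)"
  by (simp add: yd_tensor_def Let_def ten_space_def ten_pure_def)

lemma ydm_yd_tensor [simp]: "ydm (yd_tensor K H M N)"
proof -
  let ?M = "Space M" and ?N = "Space N" and ?V = RT
  let ?g = "fst (idx N)" and ?\<theta> = "\<lambda>h. (inv\<^bsub>A\<^esub> (fst (idx N))) (snd (idx M) (fst (idx N) h))"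
  let ?u = "unrealize (carrier TT) :: 'v \<Rightarrow> _"
  let ?op = "\<lambda>h x. sw K H H ?V (\<lambda>h1 h2. sw K ?M ?N ?V (\<lambda>m n. tpure (act M (?g h1) m) (act N (?\<theta> h2) n))
      (?u x)) (comult H h)"
  let ?\<rho> = "\<lambda>x. sw K ?M ?N (tensor K ?V H) (\<lambda>m n. sw K ?M H (tensor K ?V H) (\<lambda>m0 m1.
        sw K ?N H (tensor K ?V H) (\<lambda>n0 n1. pure K ?V H (tpure m0 n0) (n1 \<otimes>\<^bsub>H\<^esub> m1))
          (coact N n)) (coact M m)) (?u x)"
  \<comment> \<open>Each instance moves the inner sum out, so that the sums get sorted: from the
    outside, the element of the tensor product, the coaction of M, the coaction of N, the
    comultiplication. Without such an orientation the interchange rule could be applied back and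
    forth.\<close>
  note swaps = sw_swap[where t = "coact N n" and s = "coact M m" for n m]
    sw_swap[where t = "comult H h" and s = "coact M m" for h m]
    sw_swap[where t = "comult H h" and s = "coact N n" for h n]
    sw_swap[where t = "comult H h" and s = "unrealize c x" for h c x]
    sw_swap[where t = "coact M m" and s = "unrealize c x" for m c x]
    sw_swap[where t = "coact N n" and s = "unrealize c x" for n c x]
  note swaps' = swaps(1,2,4-)
  have eta: "sw K ?M ?N ?V (\<lambda>m n. tpure m n) (?u x) = x" if "x \<in> carrier ?V" for x
    using that sw_push[OF lin_realize[OF fdv_ten_space[OF M N]], of ?M ?N "?u x" "pure K ?M ?N", symmetric] by simp
  show ?thesis
  proof (rule ydmI'[OF _ _ yd_tensor_def[unfolded Let_def ten_space_def]])
    show "act (yd_tensor K H M N) h m = ?op h m"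
      if "h \<in> carrier H" "m \<in> carrier (Space (yd_tensor K H M N))" for h m
      using that by simp
    show "coact (yd_tensor K H M N) m = ?\<rho> m" if "m \<in> carrier (Space (yd_tensor K H M N))" for m
      using that by simp
    show "?op \<one>\<^bsub>H\<^esub> x = x" if "x \<in> carrier (Space (yd_tensor K H M N))" for x
      using that by (simp add: eta)
    show "?op (g \<otimes>\<^bsub>H\<^esub> h) x = ?op g (?op h x)"
      if "g \<in> carrier H" "h \<in> carrier H" "x \<in> carrier (Space (yd_tensor K H M N))" for g h x
      using that by simp
    let ?W = "Space (yd_tensor K H M N)"
    show "sw K ?W H ?W (\<lambda>x0 x1. counit H x1 \<odot>\<^bsub>?W\<^esub> x0) (?\<rho> x) = x" if "x \<in> carrier ?W" for x
      using that by (simp add: coact_counit_mult coact_counit eta)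
    show "sw K ?W H (tensor K ?W HH) (\<lambda>m0 m1. sw K ?W H (tensor K ?W HH)
          (\<lambda>m00 m01. pure K ?W HH m00 (pure K H H m01 m1)) (?\<rho> m0)) (?\<rho> x) =
        sw K ?W H (tensor K ?W HH) (\<lambda>m0 m1. pure K ?W HH m0 (comult H m1)) (?\<rho> x)" (is "?lhs = ?rhs")
      if "x \<in> carrier ?W" for x
    proof -
      let ?T = "tensor K ?V HH"
      have x [simp]: "x \<in> carrier ?V" using that by simp
      have "?lhs = sw K ?M ?N ?T (\<lambda>m n. sw K ?M H ?T (\<lambda>m0 m1. sw K ?N H ?T (\<lambda>n0 n1.
          sw K H H ?T (\<lambda>a b. sw K H H ?T (\<lambda>c d. pure K ?V HH (tpure m0 n0) (pure K H H (c \<otimes>\<^bsub>H\<^esub> a) (d \<otimes>\<^bsub>H\<^esub> b)))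
          (comult H n1)) (comult H m1)) (coact N n)) (coact M m)) (?u x)"
        by (simp add: coact_coassoc swaps)
      \<comment> \<open>The comultiplications of m_1 and n_1 are interchanged by hand, as the
        oriented rules do not rank two sums of the same kind.\<close>
      also have "\<dots> = sw K ?M ?N ?T (\<lambda>m n. sw K ?M H ?T (\<lambda>m0 m1. sw K ?N H ?T (\<lambda>n0 n1.
          sw K H H ?T (\<lambda>c d. sw K H H ?T (\<lambda>a b. pure K ?V HH (tpure m0 n0) (pure K H H (c \<otimes>\<^bsub>H\<^esub> a) (d \<otimes>\<^bsub>H\<^esub> b)))
          (comult H m1)) (comult H n1)) (coact N n)) (coact M m)) (?u x)"
        by (rule sw_cong[OF refl], rule sw_cong[OF refl], rule sw_cong[OF refl], rule sw_swap) simp_all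
      also have "\<dots> = ?rhs" by simp
      finally show ?thesis .
    qed
    show "yd_compat ?W ?op ?\<rho> (fst (idx (yd_tensor K H M N))) (snd (idx (yd_tensor K H M N)))"
      unfolding yd_compat_def
    proof (intro ballI)
      fix h x assume h [simp]: "h \<in> carrier H" and "x \<in> carrier ?W"
      then have x [simp]: "x \<in> carrier ?V" by simp
      let ?T = "tensor K ?V H" and ?b = "\<lambda>h. snd (idx N) (?\<theta> h)" and ?c = "\<lambda>h. fst (idx N) (?\<theta> h)"
      let ?a = "\<lambda>h. fst (idx M) (?g h)"
      \<comment> \<open>With \<theta> = \<gamma>^-1 \<beta> \<gamma> one has \<gamma> \<theta> =
        \<beta> \<gamma>. So the factor that N leaves to the right of n_1, when its compatibility is
        applied to the last two legs of h, is the one that M needs to the left of m_1 for its own,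
        applied to the first two legs.\<close>
      have bc: "?c h = snd (idx M) (?g h)" if "h \<in> carrier H" for h using that by simp
      have compatN: "sw K H H ?T (\<lambda>h2 h3. sw K ?N H ?T (\<lambda>n0 n1. B (act N (?\<theta> h2) n0) (?b h3 \<otimes>\<^bsub>H\<^esub> n1)) (coact N n)) (comult H k) =
          sw K H H ?T (\<lambda>h2 h3. sw K ?N H ?T (\<lambda>n0 n1. B n0 (n1 \<otimes>\<^bsub>H\<^esub> snd (idx M) (?g h2))) (coact N (act N (?\<theta> h3) n))) (comult H k)"
        if "bilin K ?N H ?T B" "k \<in> carrier H" "n \<in> carrier ?N" for B k n
        by (rule trans[OF compat_auto[OF N, of "inv\<^bsub>A\<^esub> (fst (idx N)) \<otimes>\<^bsub>A\<^esub> snd (idx M) \<otimes>\<^bsub>A\<^esub> fst (idx N)" ?\<theta>, OF _ _ _ that]])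
          (simp_all cong: sw_cong_simp)
      have compatM: "sw K H H ?T (\<lambda>h1 h2. sw K ?M H ?T (\<lambda>m0 m1. B (act M (?g h1) m0) (snd (idx M) (?g h2) \<otimes>\<^bsub>H\<^esub> m1)) (coact M m)) (comult H k) =
          sw K H H ?T (\<lambda>h1 h2. sw K ?M H ?T (\<lambda>m0 m1. B m0 (m1 \<otimes>\<^bsub>H\<^esub> ?a h1)) (coact M (act M (?g h2) m))) (comult H k)"
        if "bilin K ?M H ?T B" "k \<in> carrier H" "m \<in> carrier ?M" for B k m
        by (rule trans[OF _ compat_auto[OF M, of ?g ?g, OF _ _ _ that]]) (simp_all cong: sw_cong_simp)
      have L1: "sw K H H ?T (\<lambda>h1 h2. sw K ?V H ?T (\<lambda>m0 m1. pure K ?V H (?op h1 m0) (?b h2 \<otimes>\<^bsub>H\<^esub> m1)) (?\<rho> x)) (comult H h) =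
        sw K ?M ?N ?T (\<lambda>m n. sw K ?M H ?T (\<lambda>m0 m1. sw K H H ?T (\<lambda>h1 h'. sw K H H ?T (\<lambda>h2 h3. sw K ?N H ?T (\<lambda>n0 n1.
          pure K ?V H (tpure (act M (?g h1) m0) (act N (?\<theta> h2) n0)) (?b h3 \<otimes>\<^bsub>H\<^esub> n1 \<otimes>\<^bsub>H\<^esub> m1))
            (coact N n)) (comult H h')) (comult H h)) (coact M m)) (?u x)"
        by (simp add: coassoc swaps Hr.m_assoc)
      have L2: "\<dots> = sw K ?M ?N ?T (\<lambda>m n. sw K ?M H ?T (\<lambda>m0 m1. sw K H H ?T (\<lambda>h1 h'. sw K H H ?T (\<lambda>h2 h3. sw K ?N H ?T (\<lambda>n0 n1.
          pure K ?V H (tpure (act M (?g h1) m0) n0) (n1 \<otimes>\<^bsub>H\<^esub> snd (idx M) (?g h2) \<otimes>\<^bsub>H\<^esub> m1))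
            (coact N (act N (?\<theta> h3) n))) (comult H h')) (comult H h)) (coact M m)) (?u x)"
        by (intro sw_cong refl compatN) simp_all
      have L3: "\<dots> = sw K ?M ?N ?T (\<lambda>m n. sw K H H ?T (\<lambda>a h3. sw K H H ?T (\<lambda>h1 h2. sw K ?M H ?T (\<lambda>m0 m1. sw K ?N H ?T (\<lambda>n0 n1.
          pure K ?V H (tpure (act M (?g h1) m0) n0) (n1 \<otimes>\<^bsub>H\<^esub> (snd (idx M) (?g h2) \<otimes>\<^bsub>H\<^esub> m1)))
            (coact N (act N (?\<theta> h3) n))) (coact M m)) (comult H a)) (comult H h)) (?u x)"
        by (simp add: coassoc swaps' Hr.m_assoc)
      have L4: "\<dots> = sw K ?M ?N ?T (\<lambda>m n. sw K H H ?T (\<lambda>a h3. sw K H H ?T (\<lambda>h1 h2. sw K ?M H ?T (\<lambda>m0 m1. sw K ?N H ?T (\<lambda>n0 n1.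
          pure K ?V H (tpure m0 n0) (n1 \<otimes>\<^bsub>H\<^esub> (m1 \<otimes>\<^bsub>H\<^esub> ?a h1)))
            (coact N (act N (?\<theta> h3) n))) (coact M (act M (?g h2) m))) (comult H a)) (comult H h)) (?u x)"
        by (intro sw_cong refl compatM) simp_all
      have L5: "\<dots> = sw K H H ?T (\<lambda>h1 h2. sw K ?V H ?T (\<lambda>m0 m1. pure K ?V H m0 (m1 \<otimes>\<^bsub>H\<^esub> ?a h1)) (?\<rho> (?op h2 x))) (comult H h)"
        by (simp add: coassoc swaps' Hr.m_assoc)
      show "sw K H H (tensor K ?W H) (\<lambda>h1 h2. sw K ?W H (tensor K ?W H) (\<lambda>m0 m1. pure K ?W H (?op h1 m0)
            (snd (idx (yd_tensor K H M N)) h2 \<otimes>\<^bsub>H\<^esub> m1)) (?\<rho> x)) (comult H h) =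
          sw K H H (tensor K ?W H) (\<lambda>h1 h2. sw K ?W H (tensor K ?W H) (\<lambda>m0 m1. pure K ?W H m0
            (m1 \<otimes>\<^bsub>H\<^esub> fst (idx (yd_tensor K H M N)) h1)) (?\<rho> (?op h2 x))) (comult H h)"
      proof -
        have s: "snd (idx (yd_tensor K H M N)) k = ?b k" "fst (idx (yd_tensor K H M N)) k = ?a k"
          if "k \<in> carrier H" for k using that by (simp_all add: G_simps(2))
        show ?thesis unfolding yd_tensor_simps(1)
          using trans[OF L1 trans[OF L2 trans[OF L3 trans[OF L4 L5]]]]
          by (simp only: s cong: sw_cong_simp)
      qed
    qed
  qed (simp_all add: G_simps(2))
qed

end

subsection \<open>The category\<close>

abbreviation "C \<equiv> (YD_fd K H :: (('k, 'h, 'v) yd, ('k, 'h, 'v) yd_arrow, ('h \<Rightarrow> 'h) \<times> ('h \<Rightarrow> 'h)) t_data)"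

definition yd_id :: "('k, 'h, 'v) yd \<Rightarrow> ('k, 'h, 'v) yd_arrow" where
  "yd_id M = \<lparr>source = M, target = M, mapping = (\<lambda>m \<in> carrier (Space M). m)\<rparr>"

definition yd_comp :: "('k, 'h, 'v) yd_arrow \<Rightarrow> ('k, 'h, 'v) yd_arrow \<Rightarrow> ('k, 'h, 'v) yd_arrow" where
  "yd_comp g f = \<lparr>source = source f, target = target g,
     mapping = compose (carrier (Space (source f))) (mapping g) (mapping f)\<rparr>"

lemma C_simps [simp]:
  "Dom C = source" "Cod C = target" "Ident C = yd_id" "Comp C = yd_comp"
  "TenO C = yd_tensor K H" "TenA C = yd_tensor_arrow K H" "UnitO C = yd_unit K H"
  "Assoc C = yd_assoc K H" "LUnit C = yd_lunit K H" "RUnit C = yd_runit K H"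
  "Deg C = idx" "PhiO C = yd_phi K H" "PhiA C = yd_phi_arrow K H" "Braid C = yd_braid K H"
  by (simp_all add: YD_fd_def full_subcategory_def YD_def fun_eq_iff yd_id_def yd_comp_def)

lemma ydm_iff: "ydm M \<longleftrightarrow> M \<in> yd_objects K H \<and> vectorspace.fin_dim K (Space M)"
proof -
  have "vectorspace K (Space M)" if "M \<in> yd_objects K H"
  proof -
    have "yd_module K H (fst (idx M)) (snd (idx M)) (Space M) (act M) (coact M)"
      using that unfolding yd_objects_def by blast
    then show ?thesis by (rule left_module.space[OF yd_module.axioms(1)])
  qed
  then show ?thesis unfolding ydm_def fdv_def by blast
qed

lemma C_Obj [simp]: "M \<in> Obj C \<longleftrightarrow> ydm M"
  unfolding ydm_iff by (simp add: YD_fd_def full_subcategory_def YD_def)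

definition hom :: "('k, 'h, 'v) yd_arrow \<Rightarrow> ('k, 'h, 'v) yd \<Rightarrow> ('k, 'h, 'v) yd \<Rightarrow> bool" where
  "hom f M N \<longleftrightarrow> ydm M \<and> ydm N \<and> source f = M \<and> target f = N \<and> idx M = idx N \<and>
     mapping f \<in> extensional (carrier (Space M)) \<and> lin K (Space M) (Space N) (mapping f) \<and>
     (\<forall>h \<in> carrier H. \<forall>m \<in> carrier (Space M). mapping f (act M h m) = act N h (mapping f m)) \<and>
     (\<forall>m \<in> carrier (Space M). coact N (mapping f m) =
        sw K (Space M) H (tensor K (Space N) H) (\<lambda>m0 m1. pure K (Space N) H (mapping f m0) m1) (coact M m))"

lemma C_homset [simp]: "f \<in> homset C M N \<longleftrightarrow> hom f M N"
proof -
  have sweedler: "sweedler K (tensor K (Space N) H) (\<lambda>m0 m1. pure K (Space N) H (mapping f m0) m1) (coact M m) =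
      sw K (Space M) H (tensor K (Space N) H) (\<lambda>m0 m1. pure K (Space N) H (mapping f m0) m1) (coact M m)"
    if "ydm M" "m \<in> carrier (Space M)" for m using that by simp
  have "f \<in> Arr C \<longleftrightarrow> f \<in> yd_arrows K H \<and> vectorspace.fin_dim K (Space (source f)) \<and>
      vectorspace.fin_dim K (Space (target f))"
    by (simp add: YD_fd_def full_subcategory_def YD_def)
  also have "\<dots> \<longleftrightarrow> ydm (source f) \<and> ydm (target f) \<and> f \<in> yd_arrows K H"
    unfolding ydm_iff yd_arrows_def Let_def by blast
  finally have Arr: "f \<in> Arr C \<longleftrightarrow> ydm (source f) \<and> ydm (target f) \<and> f \<in> yd_arrows K H" .
  have "f \<in> homset C M N \<longleftrightarrow> ydm M \<and> ydm N \<and> source f = M \<and> target f = N \<and> f \<in> yd_arrows K H"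
    unfolding homset_def mem_Collect_eq Arr C_simps by blast
  also have "\<dots> \<longleftrightarrow> hom f M N"
  proof (cases "ydm M \<and> ydm N \<and> source f = M \<and> target f = N")
    case True
    then have "ydm M" "ydm N" "source f = M" "target f = N" by auto
    then show ?thesis
      using sweedler ydm_vs[of M] ydm_vs[of N]
      unfolding hom_def yd_arrows_def Let_def mem_Collect_eq linear_map_iff_lin
      by (auto simp: ydm_iff)
  qed (auto simp: hom_def)
  finally show ?thesis .
qed

lemma C_Arr: "f \<in> Arr C \<longleftrightarrow> hom f (source f) (target f)"
  using C_homset[of f "source f" "target f"] by (simp add: homset_def del: C_homset)

text \<open>The conditions are imposed on a formula \<open>F\<close> that agrees with
  \<open>mapping f\<close> on the carrier, so that no restricted functions occur in the
  computations.\<close>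

lemma homI:
  assumes "ydm M" "ydm N" "idx M = idx N" "lin K (Space M) (Space N) F"
    and "source f = M" "target f = N" "mapping f \<in> extensional (carrier (Space M))"
    and eq: "\<And>m. m \<in> carrier (Space M) \<Longrightarrow> mapping f m = F m"
    and "\<And>h m. h \<in> carrier H \<Longrightarrow> m \<in> carrier (Space M) \<Longrightarrow> F (act M h m) = act N h (F m)"
    and co: "\<And>m. m \<in> carrier (Space M) \<Longrightarrow> coact N (F m) =
        sw K (Space M) H (tensor K (Space N) H) (\<lambda>m0 m1. pure K (Space N) H (F m0) m1) (coact M m)"
  shows "hom f M N"
proof -
  have "lin K (Space M) (Space N) (mapping f)"
    by (rule iffD2[OF lin_cong[OF ydm_vs[OF assms(1)]] assms(4)]) (rule eq)
  moreover have "coact N (mapping f m) =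
      sw K (Space M) H (tensor K (Space N) H) (\<lambda>m0 m1. pure K (Space N) H (mapping f m0) m1) (coact M m)"
    if "m \<in> carrier (Space M)" for m
    using co[OF that] by (simp add: eq that)
  moreover have "mapping f (act M h m) = act N h (mapping f m)"
    if "h \<in> carrier H" "m \<in> carrier (Space M)" for h m
    using assms(1,9) that by (simp add: eq)
  ultimately show ?thesis unfolding hom_def using assms(1-7) by blast
qed

context
  fixes f M N assumes f: "hom f M N"
begin

lemma hom_objs: "ydm M" "ydm N" "source f = M" "target f = N" "idx N = idx M"
  "mapping f \<in> extensional (carrier (Space M))"
  and lin_mapping: "lin K (Space M) (Space N) (mapping f)"
  and mapping_act: "h \<in> carrier H \<Longrightarrow> m \<in> carrier (Space M) \<Longrightarrow> mapping f (act M h m) = act N h (mapping f m)"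
  and coact_mapping: "m \<in> carrier (Space M) \<Longrightarrow> coact N (mapping f m) =
        sw K (Space M) H (tensor K (Space N) H) (\<lambda>m0 m1. pure K (Space N) H (mapping f m0) m1) (coact M m)"
  using f by (auto simp: hom_def)

lemmas hom_rules = hom_objs lin_closed[OF lin_mapping] lin_arg[OF lin_mapping] lin_smult[OF lin_mapping]
  sw_push[OF lin_mapping _ _ ydm_vs[OF hom_objs(1)] ydm_vs[OF hom_objs(2)]] mapping_act coact_mapping

end

lemma arrow_eqI:
  fixes f g :: "('k, 'h, 'v) yd_arrow"
  assumes "source f = source g" "target f = target g"
    "mapping f \<in> extensional (carrier (Space (source f)))"
    "mapping g \<in> extensional (carrier (Space (source g)))"
    "\<And>x. x \<in> carrier (Space (source g)) \<Longrightarrow> mapping f x = mapping g x"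
  shows "f = g"
  using assms by (intro yd_arrow.equality extensionalityI[of _ "carrier (Space (source g))"]) auto

lemma yd_id_simps [simp]:
  "source (yd_id M) = M" "target (yd_id M) = M" "mapping (yd_id M) \<in> extensional (carrier (Space M))"
  "x \<in> carrier (Space M) \<Longrightarrow> mapping (yd_id M) x = x"
  by (simp_all add: yd_id_def)

lemma yd_comp_simps [simp]:
  "source (yd_comp g f) = source f" "target (yd_comp g f) = target g"
  "source f = M \<Longrightarrow> mapping (yd_comp g f) \<in> extensional (carrier (Space M))"
  "x \<in> carrier (Space (source f)) \<Longrightarrow> mapping (yd_comp g f) x = mapping g (mapping f x)"
  by (simp_all add: yd_comp_def compose_def)

lemma hom_id: assumes [simp]: "ydm M" shows "hom (yd_id M) M M"
  by (rule homI[where F = "\<lambda>x. x"]) simp_all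

lemma hom_comp: assumes f: "hom f L M" and g: "hom g M N" shows "hom (yd_comp g f) L N"
proof (rule homI[where F = "\<lambda>x. mapping g (mapping f x)"])
  note [simp] = hom_rules[OF f] hom_rules[OF g]
  show "lin K (Space L) (Space N) (\<lambda>x. mapping g (mapping f x))" by (simp add: lin_mapping[OF f])
qed (simp_all add: hom_rules[OF f] hom_rules[OF g])

text \<open>The set-theoretic inverse of a bijective morphism is automatically linear, H-linear and
  colinear. To exhibit an isomorphism it is enough to give a two-sided inverse function
  \<open>k\<close>.\<close>

lemma
  assumes f: "hom f M N"
    and k: "\<And>y. y \<in> carrier (Space N) \<Longrightarrow> k y \<in> carrier (Space M)"
      "\<And>x. x \<in> carrier (Space M) \<Longrightarrow> k (mapping f x) = x"
      "\<And>y. y \<in> carrier (Space N) \<Longrightarrow> mapping f (k y) = y"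
  shows iso_arrowI: "iso_arrow C f"
    and inv_arrow_eq: "inv_arrow C f = \<lparr>source = N, target = M, mapping = (\<lambda>y \<in> carrier (Space N). k y)\<rparr>"
    and hom_inv_arrow: "hom (inv_arrow C f) N M"
proof -
  let ?g = "\<lparr>source = N, target = M, mapping = (\<lambda>y \<in> carrier (Space N). k y)\<rparr> :: ('k, 'h, 'v) yd_arrow"
  note [simp] = hom_rules[OF f] k
  interpret VM: vectorspace K "Space M" by simp
  interpret VN: vectorspace K "Space N" by simp
  have inj: "x = y" if "mapping f x = mapping f y" "x \<in> carrier (Space M)" "y \<in> carrier (Space M)" for x y
    using that k(2) by metis
  have lin_k: "lin K (Space N) (Space M) k"
  proof (rule linI)
    fix x y assume [simp]: "x \<in> carrier (Space N)" "y \<in> carrier (Space N)"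
    show "k (x \<oplus>\<^bsub>Space N\<^esub> y) = k x \<oplus>\<^bsub>Space M\<^esub> k y"
      by (rule inj) (simp_all add: lin_add[OF lin_mapping[OF f]])
  next
    fix c x assume [simp]: "c \<in> carrier K" "x \<in> carrier (Space N)"
    show "k (c \<odot>\<^bsub>Space N\<^esub> x) = c \<odot>\<^bsub>Space M\<^esub> k x" by (rule inj) simp_all
  qed simp
  have g: "hom ?g N M"
  proof (rule homI[where F = k])
    show "k (act N h m) = act M h (k m)" if "h \<in> carrier H" "m \<in> carrier (Space N)" for h m
      by (rule inj) (use that in simp_all)
    fix m assume m [simp]: "m \<in> carrier (Space N)"
    have "coact N m = sw K (Space M) H (tensor K (Space N) H)
        (\<lambda>m0 m1. pure K (Space N) H (mapping f m0) m1) (coact M (k m))"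
      using coact_mapping[OF f k(1)[OF m]] by simp
    then show "coact M (k m) = sw K (Space N) H (tensor K (Space M) H)
        (\<lambda>m0 m1. pure K (Space M) H (k m0) m1) (coact N m)"
      by (simp add: lin_arg[OF lin_k])
  qed (use lin_k in simp_all)
  have inv: "inverse_arrows C f ?g"
    unfolding inverse_arrows_def using f g hom_rules[OF f]
    by (auto simp: C_Arr intro!: arrow_eqI)
  have uniq: "g' = ?g" if "inverse_arrows C f g'" for g'
  proof -
    have g': "hom g' N M" and gf: "yd_comp g' f = yd_id M" and fg: "yd_comp f g' = yd_id N"
      using that unfolding inverse_arrows_def by auto
    have gx: "mapping g' y \<in> carrier (Space M)" if "y \<in> carrier (Space N)" for y
      using that hom_rules(7)[OF g'] by simp
    have "mapping g' y = k y" if "y \<in> carrier (Space N)" for y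
    proof -
      have "mapping (yd_comp g' f) (k y) = k y" unfolding gf using that by simp
      then show ?thesis using that by simp
    qed
    then show ?thesis using hom_objs[OF g'] by (intro arrow_eqI) auto
  qed
  show "iso_arrow C f" using inv by (auto simp: iso_arrow_def)
  show "inv_arrow C f = ?g" unfolding inv_arrow_def using inv uniq by (rule the_equality)
  then show "hom (inv_arrow C f) N M" using g by simp
qed

lemma mapping_inv_arrow:
  assumes "hom f M N"
    and "\<And>y. y \<in> carrier (Space N) \<Longrightarrow> k y \<in> carrier (Space M)"
      "\<And>x. x \<in> carrier (Space M) \<Longrightarrow> k (mapping f x) = x"
      "\<And>y. y \<in> carrier (Space N) \<Longrightarrow> mapping f (k y) = y"
  shows "source (inv_arrow C f) = N" "target (inv_arrow C f) = M"
    "y \<in> carrier (Space N) \<Longrightarrow> mapping (inv_arrow C f) y = k y"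
    "mapping (inv_arrow C f) \<in> extensional (carrier (Space N))"
  using inv_arrow_eq[where f = f and k = k, OF assms] by simp_all

subsection \<open>Tensor products and conjugates of arrows\<close>

lemma yd_tensor_arrow_simps [simp]:
  "source (yd_tensor_arrow K H f g) = yd_tensor K H (source f) (source g)"
  "target (yd_tensor_arrow K H f g) = yd_tensor K H (target f) (target g)"
  "source f = M \<Longrightarrow> source g = N \<Longrightarrow> mapping (yd_tensor_arrow K H f g) \<in>
    extensional (carrier (realize_space (tensor K (Space M) (Space N))))"
  by (auto simp: yd_tensor_arrow_def ten_space_def)

lemma mapping_tensor_arrow [simp]:
  assumes "ydm (source f)" "ydm (source g)"
    "x \<in> carrier (realize_space (tensor K (Space (source f)) (Space (source g))))"
  shows "mapping (yd_tensor_arrow K H f g) x =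
    sw K (Space (source f)) (Space (source g)) (realize_space (tensor K (Space (target f)) (Space (target g))))
      (\<lambda>m n. realize (carrier (tensor K (Space (target f)) (Space (target g))))
         (pure K (Space (target f)) (Space (target g)) (mapping f m) (mapping g n)))
      (unrealize (carrier (tensor K (Space (source f)) (Space (source g)))) x)"
  using assms by (simp add: yd_tensor_arrow_def ten_space_def ten_pure_def)

lemma hom_tensor:
  assumes f: "hom f M M'" and g: "hom g N N'"
  shows "hom (yd_tensor_arrow K H f g) (yd_tensor K H M N) (yd_tensor K H M' N')"
proof (rule homI)
  note [simp] = hom_rules[OF f] hom_rules[OF g]
  let ?F = "\<lambda>x. sw K (Space M) (Space N) (realize_space (tensor K (Space M') (Space N')))
      (\<lambda>m n. realize (carrier (tensor K (Space M') (Space N')))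
         (pure K (Space M') (Space N') (mapping f m) (mapping g n)))
      (unrealize (carrier (tensor K (Space M) (Space N))) x) :: 'v"
  show "lin K (Space (yd_tensor K H M N)) (Space (yd_tensor K H M' N')) ?F" by simp
  show "mapping (yd_tensor_arrow K H f g) x = ?F x" if "x \<in> carrier (Space (yd_tensor K H M N))" for x
    using that by simp
  show "?F (act (yd_tensor K H M N) h x) = act (yd_tensor K H M' N') h (?F x)"
    if "h \<in> carrier H" "x \<in> carrier (Space (yd_tensor K H M N))" for h x
    using that by simp
  show "coact (yd_tensor K H M' N') (?F x) = sw K (Space (yd_tensor K H M N)) H
      (tensor K (Space (yd_tensor K H M' N')) H)
      (\<lambda>m0 m1. pure K (Space (yd_tensor K H M' N')) H (?F m0) m1) (coact (yd_tensor K H M N) x)"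
    if "x \<in> carrier (Space (yd_tensor K H M N))" for x
    using that by simp
qed (simp_all add: hom_objs[OF f] hom_objs[OF g])

subsection \<open>Linear maps on realized tensor products\<close>

abbreviation tsp :: "('k, 'v) module \<Rightarrow> ('k, 'v) module \<Rightarrow> ('k, 'v) module" where
  "tsp U V \<equiv> realize_space (tensor K U V)"

abbreviation tp :: "('k, 'v) module \<Rightarrow> ('k, 'v) module \<Rightarrow> 'v \<Rightarrow> 'v \<Rightarrow> 'v" where
  "tp U V u v \<equiv> realize (carrier (tensor K U V)) (pure K U V u v)"

text \<open>\<open>tensor_eqI\<close>, transported along \<open>realize\<close>. The versions for
  three and four factors iterate it, fixing one argument at a time.\<close>

lemma tsp_ext:
  assumes U [simp]: "fdv K U" and V [simp]: "fdv K V" and P [simp]: "vectorspace K P"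
    and f: "lin K (tsp U V) P f" and g: "lin K (tsp U V) P g"
    and eq: "\<And>u v. u \<in> carrier U \<Longrightarrow> v \<in> carrier V \<Longrightarrow> f (tp U V u v) = g (tp U V u v)"
  shows "\<forall>x \<in> carrier (tsp U V). f x = g x"
proof
  fix x assume x: "x \<in> carrier (tsp U V)"
  let ?T = "tensor K U V" and ?r = "realize (carrier (tensor K U V)) :: _ \<Rightarrow> 'v"
  have "f (?r (unrealize (carrier ?T) x)) = g (?r (unrealize (carrier ?T) x))"
    by (rule tensor_eqI[of K U V P "\<lambda>t. f (?r t)" "\<lambda>t. g (?r t)"])
      (use x eq in \<open>simp_all add: lin_arg[OF f] lin_arg[OF g]\<close>)
  then show "f x = g x" using x by simp
qed

lemma tsp_ext3:
  assumes [simp]: "fdv K U" "fdv K V" "fdv K W" "vectorspace K P"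
    and f: "lin K (tsp (tsp U V) W) P f" and g: "lin K (tsp (tsp U V) W) P g"
    and eq: "\<And>u v w. u \<in> carrier U \<Longrightarrow> v \<in> carrier V \<Longrightarrow> w \<in> carrier W \<Longrightarrow>
      f (tp (tsp U V) W (tp U V u v) w) = g (tp (tsp U V) W (tp U V u v) w)"
  shows "\<forall>x \<in> carrier (tsp (tsp U V) W). f x = g x"
proof (rule tsp_ext[OF _ _ _ f g])
  fix y w assume y: "y \<in> carrier (tsp U V)" and w: "w \<in> carrier W"
  have "\<forall>y \<in> carrier (tsp U V). f (tp (tsp U V) W y w) = g (tp (tsp U V) W y w)"
    by (rule tsp_ext[where P = P]) (use eq w in \<open>simp_all add: lin_arg[OF f] lin_arg[OF g]\<close>)
  then show "f (tp (tsp U V) W y w) = g (tp (tsp U V) W y w)" using y by blast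
qed simp_all

lemma tsp_ext3':
  assumes [simp]: "fdv K U" "fdv K V" "fdv K W" "vectorspace K P"
    and f: "lin K (tsp U (tsp V W)) P f" and g: "lin K (tsp U (tsp V W)) P g"
    and eq: "\<And>u v w. u \<in> carrier U \<Longrightarrow> v \<in> carrier V \<Longrightarrow> w \<in> carrier W \<Longrightarrow>
      f (tp U (tsp V W) u (tp V W v w)) = g (tp U (tsp V W) u (tp V W v w))"
  shows "\<forall>x \<in> carrier (tsp U (tsp V W)). f x = g x"
proof (rule tsp_ext[OF _ _ _ f g])
  fix u y assume u: "u \<in> carrier U" and y: "y \<in> carrier (tsp V W)"
  have "\<forall>y \<in> carrier (tsp V W). f (tp U (tsp V W) u y) = g (tp U (tsp V W) u y)"
    by (rule tsp_ext[where P = P]) (use eq u in \<open>simp_all add: lin_arg[OF f] lin_arg[OF g]\<close>)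
  then show "f (tp U (tsp V W) u y) = g (tp U (tsp V W) u y)" using y by blast
qed simp_all

lemma tsp_ext4:
  assumes [simp]: "fdv K U" "fdv K V" "fdv K W" "fdv K X" "vectorspace K P"
    and f: "lin K (tsp (tsp (tsp U V) W) X) P f" and g: "lin K (tsp (tsp (tsp U V) W) X) P g"
    and eq: "\<And>u v w x. u \<in> carrier U \<Longrightarrow> v \<in> carrier V \<Longrightarrow> w \<in> carrier W \<Longrightarrow> x \<in> carrier X \<Longrightarrow>
      f (tp (tsp (tsp U V) W) X (tp (tsp U V) W (tp U V u v) w) x) =
      g (tp (tsp (tsp U V) W) X (tp (tsp U V) W (tp U V u v) w) x)"
  shows "\<forall>y \<in> carrier (tsp (tsp (tsp U V) W) X). f y = g y"
proof (rule tsp_ext[OF _ _ _ f g])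
  fix y x assume y: "y \<in> carrier (tsp (tsp U V) W)" and x: "x \<in> carrier X"
  have "\<forall>y \<in> carrier (tsp (tsp U V) W). f (tp (tsp (tsp U V) W) X y x) = g (tp (tsp (tsp U V) W) X y x)"
    by (rule tsp_ext3[where P = P]) (use eq x in \<open>simp_all add: lin_arg[OF f] lin_arg[OF g]\<close>)
  then show "f (tp (tsp (tsp U V) W) X y x) = g (tp (tsp (tsp U V) W) X y x)" using y by blast
qed simp_all

text \<open>The universal property on realized tensor products. Structure maps are defined through
  it, computed on pure tensors by \<open>lift_tp\<close>, and otherwise treated as opaque linear
  maps.\<close>

definition lift :: "('k, 'v) module \<Rightarrow> ('k, 'v) module \<Rightarrow> ('k, 'p, 'u) module_scheme \<Rightarrow> ('v \<Rightarrow> 'v \<Rightarrow> 'p) \<Rightarrow> 'v \<Rightarrow> 'p" where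
  "lift U V P B x = sw K U V P B (unrealize (carrier (tensor K U V)) x)"

lemma
  assumes [simp]: "fdv K U" "fdv K V" "vectorspace K P" and B: "bilin K U V P B"
  shows lin_lift: "lin K (tsp U V) P (\<lambda>x. lift U V P B x)"
    and lift_closed: "x \<in> carrier (tsp U V) \<Longrightarrow> lift U V P B x \<in> carrier P"
    and lift_tp: "u \<in> carrier U \<Longrightarrow> v \<in> carrier V \<Longrightarrow> lift U V P B (tp U V u v) = B u v"
proof -
  show *: "lin K (tsp U V) P (\<lambda>x. lift U V P B x)"
    unfolding lift_def by (rule lin_sw_arg) (simp_all add: B del: bilin_def)
  show "x \<in> carrier (tsp U V) \<Longrightarrow> lift U V P B x \<in> carrier P" by (rule lin_closed[OF *])
  show "u \<in> carrier U \<Longrightarrow> v \<in> carrier V \<Longrightarrow> lift U V P B (tp U V u v) = B u v"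
    using sw_pure[of K U V P B u v] B by (simp add: lift_def del: bilin_def sw_pure)
qed

text \<open>Both sides of the H-linearity and of the colinearity condition are linear in the element
  of the tensor product, which leaves pure tensors to be checked.\<close>

lemma homI_tensor:
  assumes M [simp]: "ydm M" and N [simp]: "ydm N" and P [simp]: "ydm P" and idx: "idx M \<otimes>\<^bsub>G\<^esub> idx N = idx P"
    and F: "lin K (tsp (Space M) (Space N)) (Space P) F"
    and f: "source f = yd_tensor K H M N" "target f = P"
      "mapping f \<in> extensional (carrier (tsp (Space M) (Space N)))"
      "\<And>x. x \<in> carrier (tsp (Space M) (Space N)) \<Longrightarrow> mapping f x = F x"
    and act: "\<And>h m n. h \<in> carrier H \<Longrightarrow> m \<in> carrier (Space M) \<Longrightarrow> n \<in> carrier (Space N) \<Longrightarrow>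
      F (act (yd_tensor K H M N) h (tp (Space M) (Space N) m n)) = act P h (F (tp (Space M) (Space N) m n))"
    and coact: "\<And>m n. m \<in> carrier (Space M) \<Longrightarrow> n \<in> carrier (Space N) \<Longrightarrow>
      coact P (F (tp (Space M) (Space N) m n)) =
      sw K (tsp (Space M) (Space N)) H (tensor K (Space P) H) (\<lambda>x h. pure K (Space P) H (F x) h)
        (coact (yd_tensor K H M N) (tp (Space M) (Space N) m n))"
  shows "hom f (yd_tensor K H M N) P"
proof (rule homI[where F = F])
  note [simp] = lin_closed[OF F] lin_arg[OF F]
  have T: "ydm (yd_tensor K H M N)" by simp
  have T_lin: "lin K (tsp (Space M) (Space N)) (tsp (Space M) (Space N)) (\<lambda>x. act (yd_tensor K H M N) h x)"
    if "h \<in> carrier H" for h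
    using lin_act[OF T that] by simp
  have T_colin: "lin K (tsp (Space M) (Space N)) (tensor K (tsp (Space M) (Space N)) H) (\<lambda>x. coact (yd_tensor K H M N) x)"
    using lin_coact[OF T] by simp
  show "F (act (yd_tensor K H M N) h x) = act P h (F x)"
    if h [simp]: "h \<in> carrier H" and x: "x \<in> carrier (Space (yd_tensor K H M N))" for h x
  proof -
    have "\<forall>x \<in> carrier (tsp (Space M) (Space N)). F (act (yd_tensor K H M N) h x) = act P h (F x)"
    proof (rule tsp_ext)
      show "lin K (tsp (Space M) (Space N)) (Space P) (\<lambda>x. F (act (yd_tensor K H M N) h x))"
        by (rule lin_comp[OF T_lin[OF h] F])
      show "lin K (tsp (Space M) (Space N)) (Space P) (\<lambda>x. act P h (F x))"
        by (rule lin_comp[OF F lin_act[OF P h]])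
    qed (use act in \<open>auto simp del: act_yd_tensor\<close>)
    then show ?thesis using x by simp
  qed
  show "coact P (F x) = sw K (Space (yd_tensor K H M N)) H (tensor K (Space P) H)
      (\<lambda>x h. pure K (Space P) H (F x) h) (coact (yd_tensor K H M N) x)"
    if x: "x \<in> carrier (Space (yd_tensor K H M N))" for x
  proof -
    have "\<forall>x \<in> carrier (tsp (Space M) (Space N)). coact P (F x) =
      sw K (tsp (Space M) (Space N)) H (tensor K (Space P) H) (\<lambda>x h. pure K (Space P) H (F x) h)
        (coact (yd_tensor K H M N) x)"
    proof (rule tsp_ext)
      show "lin K (tsp (Space M) (Space N)) (tensor K (Space P) H) (\<lambda>x. coact P (F x))"
        by (rule lin_comp[OF F lin_coact[OF P]])
      show "lin K (tsp (Space M) (Space N)) (tensor K (Space P) H) (\<lambda>x.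
          sw K (tsp (Space M) (Space N)) H (tensor K (Space P) H) (\<lambda>x h. pure K (Space P) H (F x) h)
        (coact (yd_tensor K H M N) x))"
        by (rule lin_sw_arg[OF _ _ _ _ T_colin]) (simp_all add: F)
    qed (use coact in \<open>auto simp del: coact_yd_tensor\<close>)
    then show ?thesis using x by simp
  qed
qed (use assms in \<open>simp_all\<close>)

declare lift_tp [simp]

lemma lin_lift_arg [simp]:
  "fdv K U \<Longrightarrow> fdv K V \<Longrightarrow> vectorspace K P \<Longrightarrow> bilin K U V P B \<Longrightarrow> lin K X (tsp U V) F \<Longrightarrow>
    lin K X P (\<lambda>x. lift U V P B (F x))"
  by (rule lin_comp[OF _ lin_lift])

lemma lin_lift_body [simp]:
  "fdv K U \<Longrightarrow> fdv K V \<Longrightarrow> vectorspace K P \<Longrightarrow> plin K X U V P B \<Longrightarrow> y \<in> carrier (tsp U V) \<Longrightarrow>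
    lin K X P (\<lambda>x. lift U V P (\<lambda>u v. B x u v) y)"
  unfolding lift_def by (rule lin_sw_body') simp_all

lemma lift_cong [cong]:
  "U = U' \<Longrightarrow> V = V' \<Longrightarrow> P = P' \<Longrightarrow> x = x' \<Longrightarrow>
    (\<And>u v. u \<in> carrier U' \<Longrightarrow> v \<in> carrier V' \<Longrightarrow> B u v = B' u v) \<Longrightarrow> lift U V P B x = lift U' V' P' B' x'"
  unfolding lift_def by simp

lemma inv_arrow_ball:
  assumes "hom f M N" "\<forall>y \<in> carrier (Space N). k y \<in> carrier (Space M)"
    "\<forall>x \<in> carrier (Space M). k (mapping f x) = x" "\<forall>y \<in> carrier (Space N). mapping f (k y) = y"
  shows "iso_arrow C f" "source (inv_arrow C f) = N" "target (inv_arrow C f) = M"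
    "mapping (inv_arrow C f) \<in> extensional (carrier (Space N))"
    "\<forall>y \<in> carrier (Space N). mapping (inv_arrow C f) y = k y"
    "hom (inv_arrow C f) N M"
  using iso_arrowI[where f = f and k = k and M = M and N = N]
    hom_inv_arrow[where f = f and k = k and M = M and N = N]
    mapping_inv_arrow[where f = f and k = k and M = M and N = N] assms
  by blast+

subsection \<open>The associator\<close>

definition assoc_map :: "('k, 'v) module \<Rightarrow> ('k, 'v) module \<Rightarrow> ('k, 'v) module \<Rightarrow> 'v \<Rightarrow> 'v" where
  "assoc_map U V W = (\<lambda>x. lift (tsp U V) W (tsp U (tsp V W))
     (\<lambda>y w. lift U V (tsp U (tsp V W)) (\<lambda>u v. tp U (tsp V W) u (tp V W v w)) y) x)"

definition assoc_inv_map :: "('k, 'v) module \<Rightarrow> ('k, 'v) module \<Rightarrow> ('k, 'v) module \<Rightarrow> 'v \<Rightarrow> 'v" where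
  "assoc_inv_map U V W = (\<lambda>x. lift U (tsp V W) (tsp (tsp U V) W)
     (\<lambda>u y. lift V W (tsp (tsp U V) W) (\<lambda>v w. tp (tsp U V) W (tp U V u v) w) y) x)"

context
  fixes U V W :: "('k, 'v) module"
  assumes U [simp]: "fdv K U" and V [simp]: "fdv K V" and W [simp]: "fdv K W"
begin

lemma lin_assoc_map: "lin K (tsp (tsp U V) W) (tsp U (tsp V W)) (assoc_map U V W)"
  unfolding assoc_map_def by simp

lemma lin_assoc_inv_map: "lin K (tsp U (tsp V W)) (tsp (tsp U V) W) (assoc_inv_map U V W)"
  unfolding assoc_inv_map_def by simp

lemmas assoc_map_rules = lin_closed[OF lin_assoc_map] lin_arg[OF lin_assoc_map]
  sw_push[OF lin_assoc_map _ _ vs_fdv[OF fdv_realize_space[OF fdv_tensor[OF fdv_realize_space[OF fdv_tensor[OF U V]] W]]]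
    vs_fdv[OF fdv_realize_space[OF fdv_tensor[OF U fdv_realize_space[OF fdv_tensor[OF V W]]]]]]
  lin_closed[OF lin_assoc_inv_map] lin_arg[OF lin_assoc_inv_map]

lemma assoc_map_tp: "u \<in> carrier U \<Longrightarrow> v \<in> carrier V \<Longrightarrow> w \<in> carrier W \<Longrightarrow>
    assoc_map U V W (tp (tsp U V) W (tp U V u v) w) = tp U (tsp V W) u (tp V W v w)"
  by (simp add: assoc_map_def)

lemma assoc_inv_map_tp: "u \<in> carrier U \<Longrightarrow> v \<in> carrier V \<Longrightarrow> w \<in> carrier W \<Longrightarrow>
    assoc_inv_map U V W (tp U (tsp V W) u (tp V W v w)) = tp (tsp U V) W (tp U V u v) w"
  by (simp add: assoc_inv_map_def)

end

declare assoc_map_rules [simp] assoc_map_tp [simp] assoc_inv_map_tp [simp]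

lemma assoc_inverse:
  assumes [simp]: "fdv K U" "fdv K V" "fdv K W"
  shows "\<forall>x \<in> carrier (tsp (tsp U V) W). assoc_inv_map U V W (assoc_map U V W x) = x"
    and "\<forall>x \<in> carrier (tsp U (tsp V W)). assoc_map U V W (assoc_inv_map U V W x) = x"
proof -
  show "\<forall>x \<in> carrier (tsp (tsp U V) W). assoc_inv_map U V W (assoc_map U V W x) = x"
    by (rule tsp_ext3[where P = "tsp (tsp U V) W"]) (simp_all add: lin_assoc_map)
  show "\<forall>x \<in> carrier (tsp U (tsp V W)). assoc_map U V W (assoc_inv_map U V W x) = x"
    by (rule tsp_ext3'[where P = "tsp U (tsp V W)"]) (simp_all add: lin_assoc_inv_map)
qed

lemma yd_assoc_simps [simp]:
  fixes M N P :: "('k, 'h, 'v) yd"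
  shows "source (yd_assoc K H M N P) = yd_tensor K H (yd_tensor K H M N) P"
  "target (yd_assoc K H M N P) = yd_tensor K H M (yd_tensor K H N P)"
  "mapping (yd_assoc K H M N P) \<in> extensional (carrier (tsp (tsp (Space M) (Space N)) (Space P)))"
  by (auto simp: yd_assoc_def ten_space_def Let_def)

lemma mapping_assoc [simp]:
  assumes [simp]: "ydm M" "ydm N" "ydm P" "x \<in> carrier (tsp (tsp (Space M) (Space N)) (Space P))"
  shows "mapping (yd_assoc K H M N P) x = assoc_map (Space M) (Space N) (Space P) x"
  by (simp add: yd_assoc_def ten_space_def Let_def ten_pure_def ten_sweedler_sw[of "yd_tensor K H M N", simplified]
      assoc_map_def lift_def)

text \<open>On pure tensors H-linearity is coassociativity of H combined with the index formula, and
  colinearity is associativity of H.\<close>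

lemma hom_assoc:
  assumes [simp]: "ydm M" "ydm N" "ydm P"
  shows "hom (yd_assoc K H M N P) (yd_tensor K H (yd_tensor K H M N) P) (yd_tensor K H M (yd_tensor K H N P))"
proof (rule homI[where F = "assoc_map (Space M) (Space N) (Space P)"])
  let ?X = "yd_tensor K H (yd_tensor K H M N) P" and ?Y = "yd_tensor K H M (yd_tensor K H N P)"
  let ?F = "assoc_map (Space M) (Space N) (Space P)"
  let ?x = "\<lambda>m n p. tp (tsp (Space M) (Space N)) (Space P) (tp (Space M) (Space N) m n) p"
  have X: "ydm ?X" and Y: "ydm ?Y" by simp_all
  have F: "lin K (Space ?X) (Space ?Y) ?F" by (simp add: lin_assoc_map)
  then show "lin K (Space ?X) (Space ?Y) ?F" .
  show "?F (act ?X h x) = act ?Y h (?F x)" if h [simp]: "h \<in> carrier H" and x: "x \<in> carrier (Space ?X)" for h x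
  proof -
    have "\<forall>x \<in> carrier (tsp (tsp (Space M) (Space N)) (Space P)). ?F (act ?X h x) = act ?Y h (?F x)"
    proof (rule tsp_ext3[where P = "Space ?Y"])
      show "lin K (tsp (tsp (Space M) (Space N)) (Space P)) (Space ?Y) (\<lambda>x. ?F (act ?X h x))"
        using lin_comp[OF lin_act[OF X h] F] by simp
      show "lin K (tsp (tsp (Space M) (Space N)) (Space P)) (Space ?Y) (\<lambda>x. act ?Y h (?F x))"
        using lin_comp[OF F lin_act[OF Y h]] by simp
      fix m n p assume [simp]: "m \<in> carrier (Space M)" "n \<in> carrier (Space N)" "p \<in> carrier (Space P)"
      show "?F (act ?X h (?x m n p)) = act ?Y h (?F (?x m n p))"
        by (simp add: coassoc G_simps(2))
    qed simp_all
    then show ?thesis using x by simp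
  qed
  show "coact ?Y (?F x) = sw K (Space ?X) H (tensor K (Space ?Y) H) (\<lambda>m0 m1. pure K (Space ?Y) H (?F m0) m1) (coact ?X x)"
    if x: "x \<in> carrier (Space ?X)" for x
  proof -
    have "\<forall>x \<in> carrier (tsp (tsp (Space M) (Space N)) (Space P)). coact ?Y (?F x) =
        sw K (Space ?X) H (tensor K (Space ?Y) H) (\<lambda>m0 m1. pure K (Space ?Y) H (?F m0) m1) (coact ?X x)"
    proof (rule tsp_ext3[where P = "tensor K (Space ?Y) H"])
      show "lin K (tsp (tsp (Space M) (Space N)) (Space P)) (tensor K (Space ?Y) H) (\<lambda>x. coact ?Y (?F x))"
        using lin_comp[OF F lin_coact[OF Y]] by simp
      show "lin K (tsp (tsp (Space M) (Space N)) (Space P)) (tensor K (Space ?Y) H)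
          (\<lambda>x. sw K (Space ?X) H (tensor K (Space ?Y) H) (\<lambda>m0 m1. pure K (Space ?Y) H (?F m0) m1) (coact ?X x))"
        using lin_coact[OF X] by (intro lin_sw_arg) (simp_all add: lin_assoc_map)
      fix m n p assume [simp]: "m \<in> carrier (Space M)" "n \<in> carrier (Space N)" "p \<in> carrier (Space P)"
      show "coact ?Y (?F (?x m n p)) = sw K (Space ?X) H (tensor K (Space ?Y) H)
          (\<lambda>m0 m1. pure K (Space ?Y) H (?F m0) m1) (coact ?X (?x m n p))"
        by (simp add: Hr.m_assoc)
    qed simp_all
    then show ?thesis using x by simp
  qed
qed (simp_all add: Gg.m_assoc)

lemma
  assumes [simp]: "ydm M" "ydm N" "ydm P"
  shows iso_assoc: "iso_arrow C (yd_assoc K H M N P)"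
    and hom_inv_assoc: "hom (inv_arrow C (yd_assoc K H M N P))
      (yd_tensor K H M (yd_tensor K H N P)) (yd_tensor K H (yd_tensor K H M N) P)"
    and inv_assoc [simp]:
      "source (inv_arrow C (yd_assoc K H M N P)) = yd_tensor K H M (yd_tensor K H N P)"
      "target (inv_arrow C (yd_assoc K H M N P)) = yd_tensor K H (yd_tensor K H M N) P"
      "mapping (inv_arrow C (yd_assoc K H M N P)) \<in> extensional (carrier (tsp (Space M) (tsp (Space N) (Space P))))"
      "y \<in> carrier (tsp (Space M) (tsp (Space N) (Space P))) \<Longrightarrow>
        mapping (inv_arrow C (yd_assoc K H M N P)) y = assoc_inv_map (Space M) (Space N) (Space P) y"
proof -
  let ?k = "assoc_inv_map (Space M) (Space N) (Space P)"
  have k: "\<forall>y \<in> carrier (Space (yd_tensor K H M (yd_tensor K H N P))). ?k y \<in> carrier (Space (yd_tensor K H (yd_tensor K H M N) P))"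
    "\<forall>x \<in> carrier (Space (yd_tensor K H (yd_tensor K H M N) P)). ?k (mapping (yd_assoc K H M N P) x) = x"
    "\<forall>y \<in> carrier (Space (yd_tensor K H M (yd_tensor K H N P))). mapping (yd_assoc K H M N P) (?k y) = y"
    using assoc_inverse[of "Space M" "Space N" "Space P"] by simp_all
  note eq = inv_arrow_ball[OF hom_assoc[OF assms] k]
  show "iso_arrow C (yd_assoc K H M N P)" by (rule eq(1))
  show "hom (inv_arrow C (yd_assoc K H M N P))
      (yd_tensor K H M (yd_tensor K H N P)) (yd_tensor K H (yd_tensor K H M N) P)" by (rule eq(6))
  show "source (inv_arrow C (yd_assoc K H M N P)) = yd_tensor K H M (yd_tensor K H N P)" by (rule eq(2))
  show "target (inv_arrow C (yd_assoc K H M N P)) = yd_tensor K H (yd_tensor K H M N) P" by (rule eq(3))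
  show "mapping (inv_arrow C (yd_assoc K H M N P)) \<in> extensional (carrier (tsp (Space M) (tsp (Space N) (Space P))))"
    using eq(4) by simp
  show "mapping (inv_arrow C (yd_assoc K H M N P)) y = ?k y"
    if "y \<in> carrier (tsp (Space M) (tsp (Space N) (Space P)))"
    using eq(5) that by simp
qed

subsection \<open>The unitors\<close>

abbreviation "KK \<equiv> realize_space (scalars K) :: ('k, 'v) module"
abbreviation "rK \<equiv> realize (carrier K) :: 'k \<Rightarrow> 'v"
abbreviation "uK \<equiv> unrealize (carrier K) :: 'v \<Rightarrow> 'k"

definition lunit_map :: "('k, 'v) module \<Rightarrow> 'v \<Rightarrow> 'v" where
  "lunit_map V = (\<lambda>x. lift KK V V (\<lambda>a v. uK a \<odot>\<^bsub>V\<^esub> v) x)"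

definition runit_map :: "('k, 'v) module \<Rightarrow> 'v \<Rightarrow> 'v" where
  "runit_map V = (\<lambda>x. lift V KK V (\<lambda>v a. uK a \<odot>\<^bsub>V\<^esub> v) x)"

context
  fixes V :: "('k, 'v) module"
  assumes V [simp]: "fdv K V"
begin

lemma lin_lunit_map: "lin K (tsp KK V) V (lunit_map V)"
  unfolding lunit_map_def by simp

lemma lin_runit_map: "lin K (tsp V KK) V (runit_map V)"
  unfolding runit_map_def by simp

lemmas unit_map_rules = lin_smult[OF lin_lunit_map] lin_smult[OF lin_runit_map] lin_closed[OF lin_lunit_map] lin_arg[OF lin_lunit_map]
  sw_push[OF lin_lunit_map _ _ vs_fdv[OF fdv_realize_space[OF fdv_tensor[OF fdv_realize_space[OF fdv_scalars[OF K_field]] V]]] vs_fdv[OF V]]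
  lin_closed[OF lin_runit_map] lin_arg[OF lin_runit_map]
  sw_push[OF lin_runit_map _ _ vs_fdv[OF fdv_realize_space[OF fdv_tensor[OF V fdv_realize_space[OF fdv_scalars[OF K_field]]]]] vs_fdv[OF V]]

lemma lunit_map_tp: "a \<in> carrier KK \<Longrightarrow> v \<in> carrier V \<Longrightarrow> lunit_map V (tp KK V a v) = uK a \<odot>\<^bsub>V\<^esub> v"
  by (simp add: lunit_map_def)

lemma runit_map_tp: "a \<in> carrier KK \<Longrightarrow> v \<in> carrier V \<Longrightarrow> runit_map V (tp V KK v a) = uK a \<odot>\<^bsub>V\<^esub> v"
  by (simp add: runit_map_def)

end

declare unit_map_rules [simp] lunit_map_tp [simp] runit_map_tp [simp]

text \<open>An element \<open>a\<close> of the realized ground field is \<open>uK a\<close> times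
  the image of one, and this scalar can be moved out of the tensor. It yields that inserting the
  image of one inverts the unitors.\<close>

lemma tp_scalar:
  assumes [simp]: "fdv K V" "a \<in> carrier KK" "v \<in> carrier V"
  shows "uK a \<odot>\<^bsub>tsp KK V\<^esub> tp KK V (rK \<one>\<^bsub>K\<^esub>) v = tp KK V a v"
    and "uK a \<odot>\<^bsub>tsp V KK\<^esub> tp V KK v (rK \<one>\<^bsub>K\<^esub>) = tp V KK v a"
proof -
  have lin: "lin K (scalars K) KK rK"
    using lin_realize[OF fdv_scalars[OF K_field]] by (simp add: scalars_simps)
  have a: "a = uK a \<odot>\<^bsub>KK\<^esub> rK \<one>\<^bsub>K\<^esub>"
    using lin_smult[OF lin, of "uK a" "\<one>\<^bsub>K\<^esub>"] by simp
  show "uK a \<odot>\<^bsub>tsp KK V\<^esub> tp KK V (rK \<one>\<^bsub>K\<^esub>) v = tp KK V a v"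
    by (subst (2) a) simp
  show "uK a \<odot>\<^bsub>tsp V KK\<^esub> tp V KK v (rK \<one>\<^bsub>K\<^esub>) = tp V KK v a"
    by (subst (2) a) simp
qed

lemma unit_inverse:
  assumes [simp]: "fdv K V"
  shows "\<forall>x \<in> carrier (tsp KK V). tp KK V (rK \<one>\<^bsub>K\<^esub>) (lunit_map V x) = x"
    and "\<forall>x \<in> carrier (tsp V KK). tp V KK (runit_map V x) (rK \<one>\<^bsub>K\<^esub>) = x"
proof -
  show "\<forall>x \<in> carrier (tsp KK V). tp KK V (rK \<one>\<^bsub>K\<^esub>) (lunit_map V x) = x"
    by (rule tsp_ext[where P = "tsp KK V"]) (simp_all add: lin_lunit_map tp_scalar)
  show "\<forall>x \<in> carrier (tsp V KK). tp V KK (runit_map V x) (rK \<one>\<^bsub>K\<^esub>) = x"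
    by (rule tsp_ext[where P = "tsp V KK"]) (simp_all add: lin_runit_map tp_scalar)
qed

lemma yd_unitor_simps [simp]:
  fixes M :: "('k, 'h, 'v) yd"
  shows "source (yd_lunit K H M) = yd_tensor K H (yd_unit K H) M" "target (yd_lunit K H M) = M"
  "mapping (yd_lunit K H M) \<in> extensional (carrier (tsp KK (Space M)))"
  "source (yd_runit K H M) = yd_tensor K H M (yd_unit K H)" "target (yd_runit K H M) = M"
  "mapping (yd_runit K H M) \<in> extensional (carrier (tsp (Space M) KK))"
  by (auto simp: yd_lunit_def yd_runit_def ten_space_def Let_def)

lemma mapping_unitor [simp]:
  assumes [simp]: "ydm M"
  shows "x \<in> carrier (tsp KK (Space M)) \<Longrightarrow> mapping (yd_lunit K H M) x = lunit_map (Space M) x"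
    and "x \<in> carrier (tsp (Space M) KK) \<Longrightarrow> mapping (yd_runit K H M) x = runit_map (Space M) x"
  by (simp_all add: yd_lunit_def yd_runit_def ten_space_def lunit_map_def runit_map_def lift_def
      ten_sweedler_sw[of "yd_unit K H", simplified] ten_sweedler_sw[of _ "yd_unit K H", simplified])

lemma hom_lunit:
  assumes [simp]: "ydm M" shows "hom (yd_lunit K H M) (yd_tensor K H (yd_unit K H) M) M"
proof (rule homI_tensor[where F = "lunit_map (Space M)"])
  fix h a m assume [simp]: "h \<in> carrier H" "a \<in> carrier (Space (yd_unit K H :: ('k, 'h, 'v) yd))" "m \<in> carrier (Space M)"
  have [simp]: "a \<in> carrier KK" using \<open>a \<in> carrier (Space _)\<close> by simp
  show "lunit_map (Space M) (act (yd_tensor K H (yd_unit K H) M) h (tp (Space (yd_unit K H)) (Space M) a m)) =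
      act M h (lunit_map (Space M) (tp (Space (yd_unit K H)) (Space M) a m))"
    by (simp add: G_simps(3) counit_sw_left counit_sw_right)
qed (simp_all add: lin_lunit_map)

lemma hom_runit:
  assumes [simp]: "ydm M" shows "hom (yd_runit K H M) (yd_tensor K H M (yd_unit K H)) M"
  by (rule homI_tensor[where F = "runit_map (Space M)"]) (simp_all add: lin_runit_map G_simps(3) counit_sw_left counit_sw_right)

lemma
  assumes [simp]: "ydm M"
  shows iso_lunit: "iso_arrow C (yd_lunit K H M)" and iso_runit: "iso_arrow C (yd_runit K H M)"
    and inv_unitor [simp]:
      "source (inv_arrow C (yd_lunit K H M)) = M"
      "target (inv_arrow C (yd_lunit K H M)) = yd_tensor K H (yd_unit K H) M"
      "mapping (inv_arrow C (yd_lunit K H M)) \<in> extensional (carrier (Space M))"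
      "y \<in> carrier (Space M) \<Longrightarrow>
        mapping (inv_arrow C (yd_lunit K H M)) y = tp KK (Space M) (rK \<one>\<^bsub>K\<^esub>) y"
      "source (inv_arrow C (yd_runit K H M)) = M"
      "target (inv_arrow C (yd_runit K H M)) = yd_tensor K H M (yd_unit K H)"
      "mapping (inv_arrow C (yd_runit K H M)) \<in> extensional (carrier (Space M))"
      "y \<in> carrier (Space M) \<Longrightarrow>
        mapping (inv_arrow C (yd_runit K H M)) y = tp (Space M) KK y (rK \<one>\<^bsub>K\<^esub>)"
proof -
  let ?l = "\<lambda>y. tp KK (Space M) (rK \<one>\<^bsub>K\<^esub>) y" and ?r = "\<lambda>y. tp (Space M) KK y (rK \<one>\<^bsub>K\<^esub>)"
  have l: "\<forall>y \<in> carrier (Space M). ?l y \<in> carrier (Space (yd_tensor K H (yd_unit K H) M))"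
    "\<forall>x \<in> carrier (Space (yd_tensor K H (yd_unit K H) M)). ?l (mapping (yd_lunit K H M) x) = x"
    "\<forall>y \<in> carrier (Space M). mapping (yd_lunit K H M) (?l y) = y"
    using unit_inverse[of "Space M"] by simp_all
  have r: "\<forall>y \<in> carrier (Space M). ?r y \<in> carrier (Space (yd_tensor K H M (yd_unit K H)))"
    "\<forall>x \<in> carrier (Space (yd_tensor K H M (yd_unit K H))). ?r (mapping (yd_runit K H M) x) = x"
    "\<forall>y \<in> carrier (Space M). mapping (yd_runit K H M) (?r y) = y"
    using unit_inverse[of "Space M"] by simp_all
  note eql = inv_arrow_ball[OF hom_lunit[OF assms] l]
  note eqr = inv_arrow_ball[OF hom_runit[OF assms] r]
  show "iso_arrow C (yd_lunit K H M)" by (rule eql(1))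
  show "iso_arrow C (yd_runit K H M)" by (rule eqr(1))
  show "source (inv_arrow C (yd_lunit K H M)) = M" by (rule eql(2))
  show "target (inv_arrow C (yd_lunit K H M)) = yd_tensor K H (yd_unit K H) M" by (rule eql(3))
  show "mapping (inv_arrow C (yd_lunit K H M)) \<in> extensional (carrier (Space M))" by (rule eql(4))
  show "source (inv_arrow C (yd_runit K H M)) = M" by (rule eqr(2))
  show "target (inv_arrow C (yd_runit K H M)) = yd_tensor K H M (yd_unit K H)" by (rule eqr(3))
  show "mapping (inv_arrow C (yd_runit K H M)) \<in> extensional (carrier (Space M))" by (rule eqr(4))
  show "mapping (inv_arrow C (yd_lunit K H M)) y = ?l y" if "y \<in> carrier (Space M)"
    using eql(5) that by blast
  show "mapping (inv_arrow C (yd_runit K H M)) y = ?r y" if "y \<in> carrier (Space M)"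
    using eqr(5) that by blast
qed

subsection \<open>Conjugation functors\<close>

lemma G_mult_apply:
  assumes "a \<in> carrier G" "b \<in> carrier G" "h \<in> carrier H"
  shows "fst (a \<otimes>\<^bsub>G\<^esub> b) h = fst a (fst b h)"
    and "snd (a \<otimes>\<^bsub>G\<^esub> b) h = snd b ((inv\<^bsub>A\<^esub> (fst b)) (snd a (fst b h)))"
    and "(inv\<^bsub>A\<^esub> (fst (a \<otimes>\<^bsub>G\<^esub> b))) h = (inv\<^bsub>A\<^esub> (fst b)) ((inv\<^bsub>A\<^esub> (fst a)) h)"
    and "(inv\<^bsub>A\<^esub> (snd (a \<otimes>\<^bsub>G\<^esub> b))) h = (inv\<^bsub>A\<^esub> (fst b)) ((inv\<^bsub>A\<^esub> (snd a)) (fst b ((inv\<^bsub>A\<^esub> (snd b)) h)))"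
  using assms by (simp_all add: G_simps(2) Ag.inv_mult_group)

lemma G_inv_apply:
  assumes "a \<in> carrier G" "h \<in> carrier H"
  shows "fst (inv\<^bsub>G\<^esub> a) h = (inv\<^bsub>A\<^esub> (fst a)) h"
    and "snd (inv\<^bsub>G\<^esub> a) h = fst a ((inv\<^bsub>A\<^esub> (snd a)) ((inv\<^bsub>A\<^esub> (fst a)) h))"
    and "(inv\<^bsub>A\<^esub> (fst (inv\<^bsub>G\<^esub> a))) h = fst a h"
    and "(inv\<^bsub>A\<^esub> (snd (inv\<^bsub>G\<^esub> a))) h = fst a (snd a ((inv\<^bsub>A\<^esub> (fst a)) h))"
  using assms by (simp_all add: G_inv Ag.inv_mult_group)

lemma G_one_apply:
  assumes "h \<in> carrier H"
  shows "fst \<one>\<^bsub>G\<^esub> h = h" "snd \<one>\<^bsub>G\<^esub> h = h"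
    "(inv\<^bsub>A\<^esub> (fst \<one>\<^bsub>G\<^esub>)) h = h" "(inv\<^bsub>A\<^esub> (snd \<one>\<^bsub>G\<^esub>)) h = h"
  using assms by (simp_all add: G_simps(3))

lemma ydm_eqI:
  assumes "ydm M" "ydm N" "Space M = Space N" "idx M = idx N"
    and "\<And>h m. h \<in> carrier H \<Longrightarrow> m \<in> carrier (Space N) \<Longrightarrow> act M h m = act N h m"
    and "\<And>m. m \<in> carrier (Space N) \<Longrightarrow> coact M m = coact N m"
  shows "M = N"
  by (rule yd_eqI) (use assms ydm_extensional[OF assms(1)] ydm_extensional[OF assms(2)] in auto)

lemma yd_phi_mult:
  assumes [simp]: "a \<in> carrier G" "b \<in> carrier G" "ydm N"
  shows "yd_phi K H (a \<otimes>\<^bsub>G\<^esub> b) N = yd_phi K H a (yd_phi K H b N)"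
proof (rule ydm_eqI)
  show "idx (yd_phi K H (a \<otimes>\<^bsub>G\<^esub> b) N) = idx (yd_phi K H a (yd_phi K H b N))"
    by (simp add: Gg.m_assoc Gg.inv_mult_group)
qed (simp_all add: G_mult_apply G_inv_apply)

lemma yd_phi_one:
  assumes [simp]: "ydm N" shows "yd_phi K H \<one>\<^bsub>G\<^esub> N = N"
  by (rule ydm_eqI) (simp_all add: G_one_apply sw_eta)

lemma yd_phi_inv:
  assumes "a \<in> carrier G" "ydm N"
  shows "yd_phi K H a (yd_phi K H (inv\<^bsub>G\<^esub> a) N) = N" "yd_phi K H (inv\<^bsub>G\<^esub> a) (yd_phi K H a N) = N"
  using assms yd_phi_mult[of a "inv\<^bsub>G\<^esub> a" N] yd_phi_mult[of "inv\<^bsub>G\<^esub> a" a N]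
  by (simp_all add: yd_phi_one)

text \<open>The underlying spaces agree literally, so only index, action and coaction are compared;
  the twist \<alpha> \<beta>^-1 of the coaction is compatible with products because it is an algebra
  map.\<close>

lemma yd_phi_tensor:
  assumes [simp]: "a \<in> carrier G" "ydm M" "ydm N"
  shows "yd_phi K H a (yd_tensor K H M N) = yd_tensor K H (yd_phi K H a M) (yd_phi K H a N)"
proof (rule ydm_eqI)
  show "idx (yd_phi K H a (yd_tensor K H M N)) = idx (yd_tensor K H (yd_phi K H a M) (yd_phi K H a N))"
    by (simp add: Gg.m_assoc Gg.inv_solve_left)
qed (simp_all add: G_mult_apply G_inv_apply)

lemma yd_phi_unit:
  assumes [simp]: "a \<in> carrier G"
  shows "yd_phi K H a (yd_unit K H) = (yd_unit K H :: ('k, 'h, 'v) yd)"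
  by (rule ydm_eqI) (simp_all add: G_one_apply)

lemma yd_phi_arrow_simps [simp]:
  "source (yd_phi_arrow K H a f) = yd_phi K H a (source f)"
  "target (yd_phi_arrow K H a f) = yd_phi K H a (target f)"
  "mapping (yd_phi_arrow K H a f) = mapping f"
  by (simp_all add: yd_phi_arrow_def)

lemma hom_phi:
  assumes a [simp]: "a \<in> carrier G" and f: "hom f M N"
  shows "hom (yd_phi_arrow K H a f) (yd_phi K H a M) (yd_phi K H a N)"
proof -
  note [simp] = hom_rules[OF f]
  show ?thesis
    by (rule homI[where F = "mapping f"]) (simp_all add: lin_mapping[OF f])
qed

lemma yd_phi_arrow_mult:
  assumes "a \<in> carrier G" "b \<in> carrier G" "ydm (source f)" "ydm (target f)"
  shows "yd_phi_arrow K H (a \<otimes>\<^bsub>G\<^esub> b) f = yd_phi_arrow K H a (yd_phi_arrow K H b f)"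
  using assms by (simp add: yd_phi_arrow_def yd_phi_mult)

lemma yd_phi_arrow_inv:
  assumes "a \<in> carrier G" "ydm (source f)" "ydm (target f)"
  shows "yd_phi_arrow K H a (yd_phi_arrow K H (inv\<^bsub>G\<^esub> a) f) = f"
    "yd_phi_arrow K H (inv\<^bsub>G\<^esub> a) (yd_phi_arrow K H a f) = f"
  using assms by (simp_all add: yd_phi_arrow_def yd_phi_inv)

lemma yd_phi_id: "yd_phi_arrow K H a (yd_id M) = yd_id (yd_phi K H a M)"
  by (simp add: yd_phi_arrow_def yd_id_def)

lemma yd_phi_comp: "yd_phi_arrow K H a (yd_comp g f) = yd_comp (yd_phi_arrow K H a g) (yd_phi_arrow K H a f)"
  by (simp add: yd_phi_arrow_def yd_comp_def)

lemma yd_phi_tensor_arrow: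
  assumes a [simp]: "a \<in> carrier G" and f: "hom f M M'" and g: "hom g N N'"
  shows "yd_phi_arrow K H a (yd_tensor_arrow K H f g) =
    yd_tensor_arrow K H (yd_phi_arrow K H a f) (yd_phi_arrow K H a g)"
proof -
  note [simp] = hom_rules[OF f] hom_rules[OF g]
  show ?thesis proof (rule arrow_eqI)
    show "mapping (yd_tensor_arrow K H (yd_phi_arrow K H a f) (yd_phi_arrow K H a g)) \<in>
      extensional (carrier (Space (source (yd_tensor_arrow K H (yd_phi_arrow K H a f) (yd_phi_arrow K H a g)))))"
      using yd_tensor_arrow_simps(3)[OF refl refl, of "yd_phi_arrow K H a f" "yd_phi_arrow K H a g"] by simp
  qed (simp_all add: yd_phi_tensor)
qed

lemma yd_phi_assoc:
  assumes [simp]: "a \<in> carrier G" "ydm M" "ydm N" "ydm P"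
  shows "yd_phi_arrow K H a (yd_assoc K H M N P) =
    yd_assoc K H (yd_phi K H a M) (yd_phi K H a N) (yd_phi K H a P)"
  using yd_assoc_simps(3)[of "yd_phi K H a M" "yd_phi K H a N" "yd_phi K H a P"]
  by (intro arrow_eqI) (simp_all add: yd_phi_tensor)

lemma yd_phi_unitors:
  assumes [simp]: "a \<in> carrier G" "ydm M"
  shows "yd_phi_arrow K H a (yd_lunit K H M) = yd_lunit K H (yd_phi K H a M)"
    and "yd_phi_arrow K H a (yd_runit K H M) = yd_runit K H (yd_phi K H a M)"
  using yd_unitor_simps(3,6)[of "yd_phi K H a M"]
  by (auto intro!: arrow_eqI simp: yd_phi_tensor yd_phi_unit)

lemma hom_eqI:
  assumes f: "hom f (yd_tensor K H U V) Y" and g: "hom g (yd_tensor K H U V) Y" and [simp]: "ydm U" "ydm V"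
    and eq: "\<And>u v. u \<in> carrier (Space U) \<Longrightarrow> v \<in> carrier (Space V) \<Longrightarrow>
      mapping f (tp (Space U) (Space V) u v) = mapping g (tp (Space U) (Space V) u v)"
  shows "f = g"
proof -
  note h = hom_rules[OF f] hom_rules[OF g]
  have "\<forall>x \<in> carrier (tsp (Space U) (Space V)). mapping f x = mapping g x"
    by (rule tsp_ext[where P = "Space Y"]) (use lin_mapping[OF f] lin_mapping[OF g] eq hom_objs[OF f] in simp_all)
  then show ?thesis using hom_objs[OF f] hom_objs[OF g] by (intro arrow_eqI) auto
qed

lemma hom_eqI3:
  assumes f: "hom f (yd_tensor K H (yd_tensor K H U V) W) Y" and g: "hom g (yd_tensor K H (yd_tensor K H U V) W) Y"
    and [simp]: "ydm U" "ydm V" "ydm W"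
    and eq: "\<And>u v w. u \<in> carrier (Space U) \<Longrightarrow> v \<in> carrier (Space V) \<Longrightarrow> w \<in> carrier (Space W) \<Longrightarrow>
      mapping f (tp (tsp (Space U) (Space V)) (Space W) (tp (Space U) (Space V) u v) w) =
      mapping g (tp (tsp (Space U) (Space V)) (Space W) (tp (Space U) (Space V) u v) w)"
  shows "f = g"
proof -
  have "\<forall>x \<in> carrier (tsp (tsp (Space U) (Space V)) (Space W)). mapping f x = mapping g x"
    by (rule tsp_ext3[where P = "Space Y"]) (use lin_mapping[OF f] lin_mapping[OF g] eq hom_objs[OF f] in simp_all)
  then show ?thesis using hom_objs[OF f] hom_objs[OF g] by (intro arrow_eqI) auto
qed

lemma hom_eqI3':
  assumes f: "hom f (yd_tensor K H U (yd_tensor K H V W)) Y" and g: "hom g (yd_tensor K H U (yd_tensor K H V W)) Y"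
    and [simp]: "ydm U" "ydm V" "ydm W"
    and eq: "\<And>u v w. u \<in> carrier (Space U) \<Longrightarrow> v \<in> carrier (Space V) \<Longrightarrow> w \<in> carrier (Space W) \<Longrightarrow>
      mapping f (tp (Space U) (tsp (Space V) (Space W)) u (tp (Space V) (Space W) v w)) =
      mapping g (tp (Space U) (tsp (Space V) (Space W)) u (tp (Space V) (Space W) v w))"
  shows "f = g"
proof -
  have "\<forall>x \<in> carrier (tsp (Space U) (tsp (Space V) (Space W))). mapping f x = mapping g x"
    by (rule tsp_ext3'[where P = "Space Y"]) (use lin_mapping[OF f] lin_mapping[OF g] eq hom_objs[OF f] in simp_all)
  then show ?thesis using hom_objs[OF f] hom_objs[OF g] by (intro arrow_eqI) auto
qed

lemma hom_eqI4:
  assumes f: "hom f (yd_tensor K H (yd_tensor K H (yd_tensor K H U V) W) X) Y"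
    and g: "hom g (yd_tensor K H (yd_tensor K H (yd_tensor K H U V) W) X) Y"
    and [simp]: "ydm U" "ydm V" "ydm W" "ydm X"
    and eq: "\<And>u v w x. u \<in> carrier (Space U) \<Longrightarrow> v \<in> carrier (Space V) \<Longrightarrow> w \<in> carrier (Space W) \<Longrightarrow>
      x \<in> carrier (Space X) \<Longrightarrow>
      mapping f (tp (tsp (tsp (Space U) (Space V)) (Space W)) (Space X)
        (tp (tsp (Space U) (Space V)) (Space W) (tp (Space U) (Space V) u v) w) x) =
      mapping g (tp (tsp (tsp (Space U) (Space V)) (Space W)) (Space X)
        (tp (tsp (Space U) (Space V)) (Space W) (tp (Space U) (Space V) u v) w) x)"
  shows "f = g"
proof -
  have "\<forall>x \<in> carrier (tsp (tsp (tsp (Space U) (Space V)) (Space W)) (Space X)). mapping f x = mapping g x"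
    by (rule tsp_ext4[where P = "Space Y"]) (use lin_mapping[OF f] lin_mapping[OF g] eq hom_objs[OF f] in simp_all)
  then show ?thesis using hom_objs[OF f] hom_objs[OF g] by (intro arrow_eqI) auto
qed

subsection \<open>The braiding\<close>

definition braid_map :: "('k, 'h, 'v) yd \<Rightarrow> ('k, 'h, 'v) yd \<Rightarrow> 'v \<Rightarrow> 'v" where
  "braid_map M N = (\<lambda>x. lift (Space M) (Space N) (tsp (Space N) (Space M))
     (\<lambda>m n. sw K (Space N) H (tsp (Space N) (Space M))
       (\<lambda>n0 n1. tp (Space N) (Space M) n0 (act M ((inv\<^bsub>A\<^esub> (snd (idx M))) n1) m)) (coact N n)) x)"

definition braid_inv_map :: "('k, 'h, 'v) yd \<Rightarrow> ('k, 'h, 'v) yd \<Rightarrow> 'v \<Rightarrow> 'v" where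
  "braid_inv_map M N = (\<lambda>x. lift (Space N) (Space M) (tsp (Space M) (Space N))
     (\<lambda>n m. sw K (Space N) H (tsp (Space M) (Space N))
       (\<lambda>n0 n1. tp (Space M) (Space N) (act M ((inv\<^bsub>A\<^esub> (snd (idx M))) (antipode H n1)) m) n0) (coact N n)) x)"

context
  fixes M N :: "('k, 'h, 'v) yd"
  assumes M [simp]: "ydm M" and N [simp]: "ydm N"
begin

lemma lin_braid_map: "lin K (tsp (Space M) (Space N)) (tsp (Space N) (Space M)) (braid_map M N)"
  unfolding braid_map_def by simp

lemma lin_braid_inv_map: "lin K (tsp (Space N) (Space M)) (tsp (Space M) (Space N)) (braid_inv_map M N)"
  unfolding braid_inv_map_def by simp

lemmas braid_map_rules = lin_closed[OF lin_braid_map] lin_arg[OF lin_braid_map]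
  sw_push[OF lin_braid_map _ _ vs_fdv[OF fdv_realize_space[OF fdv_tensor[OF ydm_fdv[OF M] ydm_fdv[OF N]]]]
    vs_fdv[OF fdv_realize_space[OF fdv_tensor[OF ydm_fdv[OF N] ydm_fdv[OF M]]]]]
  lin_closed[OF lin_braid_inv_map] lin_arg[OF lin_braid_inv_map]
  sw_push[OF lin_braid_inv_map _ _ vs_fdv[OF fdv_realize_space[OF fdv_tensor[OF ydm_fdv[OF N] ydm_fdv[OF M]]]]
    vs_fdv[OF fdv_realize_space[OF fdv_tensor[OF ydm_fdv[OF M] ydm_fdv[OF N]]]]]

lemma braid_map_tp: "m \<in> carrier (Space M) \<Longrightarrow> n \<in> carrier (Space N) \<Longrightarrow>
    braid_map M N (tp (Space M) (Space N) m n) = sw K (Space N) H (tsp (Space N) (Space M))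
       (\<lambda>n0 n1. tp (Space N) (Space M) n0 (act M ((inv\<^bsub>A\<^esub> (snd (idx M))) n1) m)) (coact N n)"
  by (simp add: braid_map_def)

lemma braid_inv_map_tp: "m \<in> carrier (Space M) \<Longrightarrow> n \<in> carrier (Space N) \<Longrightarrow>
    braid_inv_map M N (tp (Space N) (Space M) n m) = sw K (Space N) H (tsp (Space M) (Space N))
       (\<lambda>n0 n1. tp (Space M) (Space N) (act M ((inv\<^bsub>A\<^esub> (snd (idx M))) (antipode H n1)) m) n0) (coact N n)"
  by (simp add: braid_inv_map_def)

end

declare braid_map_rules [simp] braid_map_tp [simp] braid_inv_map_tp [simp]

text \<open>In both composites comodule coassociativity makes the two acting elements legs of one
  comultiplication, where the antipode axiom applies; the counit axiom of the comodule
  finishes.\<close>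

lemma braid_inverse:
  assumes M [simp]: "ydm M" and N [simp]: "ydm N"
  shows "\<forall>x \<in> carrier (tsp (Space M) (Space N)). braid_inv_map M N (braid_map M N x) = x"
    and "\<forall>x \<in> carrier (tsp (Space N) (Space M)). braid_map M N (braid_inv_map M N x) = x"
proof -
  let ?i = "\<lambda>h. (inv\<^bsub>A\<^esub> (snd (idx M))) h"
  let ?P = "tsp (Space M) (Space N)" and ?Q = "tsp (Space N) (Space M)"
  have l: "sw K H H ?P (\<lambda>a b. tp (Space M) (Space N) (act M (?i (antipode H a)) (act M (?i b) m)) n) (comult H h) =
      counit H h \<odot>\<^bsub>?P\<^esub> tp (Space M) (Space N) m n"
    if [simp]: "h \<in> carrier H" "m \<in> carrier (Space M)" "n \<in> carrier (Space N)" for h m n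
    using antipode_left_lin[of ?P "\<lambda>z. tp (Space M) (Space N) (act M (?i z) m) n" h] by simp
  have r: "sw K H H ?Q (\<lambda>a b. tp (Space N) (Space M) n (act M (?i a) (act M (?i (antipode H b)) m))) (comult H h) =
      counit H h \<odot>\<^bsub>?Q\<^esub> tp (Space N) (Space M) n m"
    if [simp]: "h \<in> carrier H" "m \<in> carrier (Space M)" "n \<in> carrier (Space N)" for h m n
    using antipode_right_lin[of ?Q "\<lambda>z. tp (Space N) (Space M) n (act M (?i z) m)" h] by simp
  show "\<forall>x \<in> carrier ?P. braid_inv_map M N (braid_map M N x) = x"
    by (rule tsp_ext[where P = ?P]) (simp_all add: lin_braid_map coact_coassoc l coact_counit)
  show "\<forall>x \<in> carrier ?Q. braid_map M N (braid_inv_map M N x) = x"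
    by (rule tsp_ext[where P = ?Q]) (simp_all add: lin_braid_inv_map coact_coassoc r coact_counit)
qed

lemma yd_braid_simps [simp]:
  fixes M N :: "('k, 'h, 'v) yd"
  shows "source (yd_braid K H M N) = yd_tensor K H M N"
  "target (yd_braid K H M N) = yd_tensor K H (yd_phi K H (idx M) N) M"
  "mapping (yd_braid K H M N) \<in> extensional (carrier (tsp (Space M) (Space N)))"
  by (auto simp: yd_braid_def ten_space_def Let_def)

lemma mapping_braid [simp]:
  assumes [simp]: "ydm M" "ydm N" "x \<in> carrier (tsp (Space M) (Space N))"
  shows "mapping (yd_braid K H M N) x = braid_map M N x"
  by (simp add: yd_braid_def ten_space_def Let_def ten_pure_def braid_map_def lift_def)

lemma hom_braid:
  assumes M [simp]: "ydm M" and N [simp]: "ydm N"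
  shows "hom (yd_braid K H M N) (yd_tensor K H M N) (yd_tensor K H (yd_phi K H (idx M) N) M)"
proof (rule homI_tensor[where F = "braid_map M N"])
  let ?P = "yd_tensor K H (yd_phi K H (idx M) N) M" and ?i = "\<lambda>h. (inv\<^bsub>A\<^esub> (snd (idx M))) h"
  let ?M = "Space M" and ?N = "Space N"
  let ?\<theta> = "\<lambda>h. (inv\<^bsub>A\<^esub> (fst (idx N))) (snd (idx M) (fst (idx N) h))"
  \<comment> \<open>Since \<gamma> \<theta> = \<beta> \<gamma>, the element \<gamma>(h_1) equals
    \<beta>^-1(\<gamma> \<theta>(h_1)). The claim is thus the compatibility of N at \<theta>(h)
    under the map that sends x \<otimes> y to x \<otimes> \<beta>^-1(y) m.\<close>
  show "braid_map M N (act (yd_tensor K H M N) h (tp ?M ?N m n)) = act ?P h (braid_map M N (tp ?M ?N m n))"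
    if [simp]: "h \<in> carrier H" "m \<in> carrier ?M" "n \<in> carrier ?N" for h m n
    using compat_auto[OF N, of "inv\<^bsub>A\<^esub> (fst (idx N)) \<otimes>\<^bsub>A\<^esub> snd (idx M) \<otimes>\<^bsub>A\<^esub> fst (idx N)" ?\<theta> "tsp ?N ?M"
        "\<lambda>x y. tp ?N ?M x (act M (?i y) m)" h n]
    by (simp add: G_mult_apply G_inv_apply)
  show "coact ?P (braid_map M N (tp ?M ?N m n)) =
      sw K (tsp ?M ?N) H (tensor K (Space ?P) H) (\<lambda>x h. pure K (Space ?P) H (braid_map M N x) h)
        (coact (yd_tensor K H M N) (tp ?M ?N m n))"
    if [simp]: "m \<in> carrier ?M" "n \<in> carrier ?N" for m n
  proof -
    let ?T = "tensor K (tsp ?N ?M) H"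
    \<comment> \<open>The coaction of the conjugate contributes \<alpha> \<beta>^-1 of a leg of n_1.
      This is the factor \<alpha>(k_1) in the compatibility of M at k = \<beta>^-1(n_1); on its
      other side \<beta> \<beta>^-1 cancels.\<close>
    have c: "sw K H H ?T (\<lambda>h1 h2. sw K ?M H ?T (\<lambda>m0 m1. pure K (tsp ?N ?M) H (tp ?N ?M x m0)
          (m1 \<otimes>\<^bsub>H\<^esub> fst (idx M) (?i h1))) (coact M (act M (?i h2) m))) (comult H h) =
        sw K H H ?T (\<lambda>h1 h2. sw K ?M H ?T (\<lambda>m0 m1. pure K (tsp ?N ?M) H (tp ?N ?M x (act M (?i h1) m0))
          (h2 \<otimes>\<^bsub>H\<^esub> m1)) (coact M m)) (comult H h)"
      if [simp]: "h \<in> carrier H" "x \<in> carrier ?N" for x h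
      using compat_auto[OF M, of "inv\<^bsub>A\<^esub> (snd (idx M))" ?i ?T "\<lambda>y z. pure K (tsp ?N ?M) H (tp ?N ?M x y) z" h m]
      by simp
    have "coact ?P (braid_map M N (tp ?M ?N m n)) =
      sw K ?N H ?T (\<lambda>n0 n1. sw K H H ?T (\<lambda>h1 h2. sw K ?M H ?T (\<lambda>m0 m1. pure K (tsp ?N ?M) H (tp ?N ?M n0 m0)
          (m1 \<otimes>\<^bsub>H\<^esub> fst (idx M) (?i h1))) (coact M (act M (?i h2) m))) (comult H n1)) (coact N n)"
      by (simp add: coact_coassoc)
    also have "\<dots> = sw K ?N H ?T (\<lambda>n0 n1. sw K H H ?T (\<lambda>h1 h2. sw K ?M H ?T (\<lambda>m0 m1.
        pure K (tsp ?N ?M) H (tp ?N ?M n0 (act M (?i h1) m0)) (h2 \<otimes>\<^bsub>H\<^esub> m1)) (coact M m)) (comult H n1)) (coact N n)"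
      by (intro sw_cong refl c) simp_all
    also have "\<dots> = sw K (tsp ?M ?N) H (tensor K (Space ?P) H) (\<lambda>x h. pure K (Space ?P) H (braid_map M N x) h)
        (coact (yd_tensor K H M N) (tp ?M ?N m n))"
      by (simp add: coact_coassoc sw_swap[where t = "coact M m"])
    finally show ?thesis .
  qed
  show "idx M \<otimes>\<^bsub>G\<^esub> idx N = idx ?P" by (simp add: Gg.m_assoc)
qed (simp_all add: lin_braid_map)

lemma iso_braid:
  assumes [simp]: "ydm M" "ydm N" shows "iso_arrow C (yd_braid K H M N)"
  by (rule inv_arrow_ball(1)[OF hom_braid[OF assms], where k = "braid_inv_map M N"])
    (use braid_inverse[OF assms] in simp_all)

lemma braid_natural:
  assumes f: "hom f M M'" and g: "hom g N N'"
  shows "yd_comp (yd_tensor_arrow K H (yd_phi_arrow K H (idx M) g) f) (yd_braid K H M N) =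
    yd_comp (yd_braid K H M' N') (yd_tensor_arrow K H f g)"
proof -
  note [simp] = hom_rules[OF f] hom_rules[OF g]
  have a: "idx M \<in> carrier G" by simp
  show ?thesis
  proof (rule hom_eqI)
    show "hom (yd_comp (yd_tensor_arrow K H (yd_phi_arrow K H (idx M) g) f) (yd_braid K H M N))
        (yd_tensor K H M N) (yd_tensor K H (yd_phi K H (idx M) N') M')"
      by (rule hom_comp[OF hom_braid hom_tensor[OF hom_phi[OF a g] f]]) simp_all
    show "hom (yd_comp (yd_braid K H M' N') (yd_tensor_arrow K H f g))
        (yd_tensor K H M N) (yd_tensor K H (yd_phi K H (idx M) N') M')"
      using hom_comp[OF hom_tensor[OF f g] hom_braid] by simp
  qed simp_all
qed

text \<open>The targets are identified first, by \<open>e\<close>: conjugating by a (\<alpha>,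
  \<beta>) a^-1 after a is conjugating by a after (\<alpha>, \<beta>), where (\<alpha>, \<beta>) is
  the index of M.\<close>

lemma braid_phi:
  assumes [simp]: "a \<in> carrier G" "ydm M" "ydm N"
  shows "yd_phi_arrow K H a (yd_braid K H M N) = yd_braid K H (yd_phi K H a M) (yd_phi K H a N)"
proof (rule hom_eqI)
  have e: "yd_phi K H (idx (yd_phi K H a M)) (yd_phi K H a N) = yd_phi K H a (yd_phi K H (idx M) N)"
    by (simp add: yd_phi_mult[symmetric] Gg.m_assoc)
  show "hom (yd_phi_arrow K H a (yd_braid K H M N)) (yd_tensor K H (yd_phi K H a M) (yd_phi K H a N))
      (yd_tensor K H (yd_phi K H a (yd_phi K H (idx M) N)) (yd_phi K H a M))"
    using hom_phi[OF _ hom_braid, of a M N] by (simp add: yd_phi_tensor)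
  show "hom (yd_braid K H (yd_phi K H a M) (yd_phi K H a N)) (yd_tensor K H (yd_phi K H a M) (yd_phi K H a N))
      (yd_tensor K H (yd_phi K H a (yd_phi K H (idx M) N)) (yd_phi K H a M))"
    using hom_braid[of "yd_phi K H a M" "yd_phi K H a N"] unfolding e by simp
  show "mapping (yd_phi_arrow K H a (yd_braid K H M N)) (tp (Space (yd_phi K H a M)) (Space (yd_phi K H a N)) u v) =
      mapping (yd_braid K H (yd_phi K H a M) (yd_phi K H a N)) (tp (Space (yd_phi K H a M)) (Space (yd_phi K H a N)) u v)"
    if "u \<in> carrier (Space (yd_phi K H a M))" "v \<in> carrier (Space (yd_phi K H a N))" for u v
    using that mapping_braid[of "yd_phi K H a M" "yd_phi K H a N"] braid_map_tp[of "yd_phi K H a M" "yd_phi K H a N"]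
    by (simp add: G_mult_apply G_inv_apply)
qed simp_all

lemma assoc_inv_push [simp]:
  assumes [simp]: "fdv K U" "fdv K V" "fdv K W" and "vectorspace K X" "vectorspace K Y" "t \<in> carrier (tensor K X Y)"
    "\<And>a b. a \<in> carrier X \<Longrightarrow> b \<in> carrier Y \<Longrightarrow> B a b \<in> carrier (tsp U (tsp V W))"
  shows "assoc_inv_map U V W (sw K X Y (tsp U (tsp V W)) B t) =
    sw K X Y (tsp (tsp U V) W) (\<lambda>a b. assoc_inv_map U V W (B a b)) t"
  by (rule sw_push[OF lin_assoc_inv_map]) (use assms in auto)

text \<open>The simplifier normalises \<open>Space (yd_phi K H a N)\<close> to \<open>Space N\<close>, hence the shape of these rules.\<close>

lemma
  assumes M: "ydm M" "Space M = X" and N: "ydm N" "Space N = Y"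
  shows braid_map_tp' [simp]: "m \<in> carrier X \<Longrightarrow> n \<in> carrier Y \<Longrightarrow> braid_map M N (tp X Y m n) =
      sw K Y H (tsp Y X) (\<lambda>n0 n1. tp Y X n0 (act M ((inv\<^bsub>A\<^esub> (snd (idx M))) n1) m)) (coact N n)"
    and braid_map_closed' [simp]: "x \<in> carrier (tsp X Y) \<Longrightarrow> braid_map M N x \<in> carrier (tsp Y X)"
    and braid_map_push' [simp]: "vectorspace K V \<Longrightarrow> vectorspace K W \<Longrightarrow> t \<in> carrier (tensor K V W) \<Longrightarrow>
      (\<And>a b. a \<in> carrier V \<Longrightarrow> b \<in> carrier W \<Longrightarrow> B a b \<in> carrier (tsp X Y)) \<Longrightarrow>
      braid_map M N (sw K V W (tsp X Y) B t) = sw K V W (tsp Y X) (\<lambda>a b. braid_map M N (B a b)) t"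
    and lin_braid_arg' [simp]: "lin K Z (tsp X Y) F \<Longrightarrow> lin K Z (tsp Y X) (\<lambda>x. braid_map M N (F x))"
  using braid_map_tp[OF M(1) N(1)] lin_closed[OF lin_braid_map[OF M(1) N(1)]]
    lin_arg[OF lin_braid_map[OF M(1) N(1)]] M(2) N(2) ydm_fdv[OF M(1)] ydm_fdv[OF N(1)]
    sw_push[OF lin_braid_map[OF M(1) N(1)], of V W t B]
  by auto

text \<open>The second component of the index of U \<otimes> V has inverse \<gamma>^-1 \<beta>^-1
  \<gamma> \<delta>^-1. Through the action on U \<otimes> V it reaches u as \<beta>^-1 \<gamma>
  \<delta>^-1 and v as \<delta>^-1. On the other side \<gamma> \<delta>^-1 comes from the coaction
  of the conjugate of W, and comodule coassociativity splits the H-leg.\<close>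

lemma hexagon1:
  assumes [simp]: "ydm U" "ydm V" "ydm W"
  shows "yd_braid K H (yd_tensor K H U V) W =
    yd_comp (yd_assoc K H (yd_phi K H (idx U) (yd_phi K H (idx V) W)) U V)
    (yd_comp (yd_tensor_arrow K H (yd_braid K H U (yd_phi K H (idx V) W)) (yd_id V))
    (yd_comp (inv_arrow C (yd_assoc K H U (yd_phi K H (idx V) W) V))
    (yd_comp (yd_tensor_arrow K H (yd_id U) (yd_braid K H V W)) (yd_assoc K H U V W))))"
    (is "?f = ?g")
proof (rule hom_eqI3)
  let ?Y = "yd_tensor K H (yd_phi K H (idx U) (yd_phi K H (idx V) W)) (yd_tensor K H U V)"
  show "hom ?f (yd_tensor K H (yd_tensor K H U V) W) ?Y"
    using hom_braid[of "yd_tensor K H U V" W] by (simp add: yd_phi_mult)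
  show "hom ?g (yd_tensor K H (yd_tensor K H U V) W) ?Y"
    by (rule hom_comp hom_assoc hom_inv_assoc hom_tensor hom_id hom_braid | simp)+
  show "mapping ?f (tp (tsp (Space U) (Space V)) (Space W) (tp (Space U) (Space V) u v) w) =
      mapping ?g (tp (tsp (Space U) (Space V)) (Space W) (tp (Space U) (Space V) u v) w)"
    if [simp]: "u \<in> carrier (Space U)" "v \<in> carrier (Space V)" "w \<in> carrier (Space W)" for u v w
  proof -
    let ?T = "tsp (Space W) (tsp (Space U) (Space V))" and ?b = "snd (idx U)" and ?d = "snd (idx V)" and ?c = "fst (idx V)"
    have "mapping ?g (tp (tsp (Space U) (Space V)) (Space W) (tp (Space U) (Space V) u v) w) =
        sw K (Space W) H ?T (\<lambda>a b. sw K H H ?T (\<lambda>h1 h2. tp (Space W) (tsp (Space U) (Space V)) a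
          (tp (Space U) (Space V) (act U ((inv\<^bsub>A\<^esub> ?b) (?c ((inv\<^bsub>A\<^esub> ?d) h1))) u) (act V ((inv\<^bsub>A\<^esub> ?d) h2) v)))
          (comult H b)) (coact W w)"
      by (simp add: coact_coassoc)
    moreover have "mapping ?f (tp (tsp (Space U) (Space V)) (Space W) (tp (Space U) (Space V) u v) w) =
        sw K (Space W) H ?T (\<lambda>a b. sw K H H ?T (\<lambda>h1 h2. tp (Space W) (tsp (Space U) (Space V)) a
          (tp (Space U) (Space V) (act U ((inv\<^bsub>A\<^esub> ?b) (?c ((inv\<^bsub>A\<^esub> ?d) h1))) u) (act V ((inv\<^bsub>A\<^esub> ?d) h2) v)))
          (comult H b)) (coact W w)"
      by (simp add: G_mult_apply)
    ultimately show ?thesis by simp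
  qed
qed simp_all

text \<open>The coaction of V \<otimes> W has w_1 v_1 in its H-leg, in the order that lets v_1 act
  on u before w_1. This is also the order in which V and W pass U in the composite.\<close>

lemma hexagon2:
  assumes [simp]: "ydm U" "ydm V" "ydm W"
  shows "yd_braid K H U (yd_tensor K H V W) =
    yd_comp (inv_arrow C (yd_assoc K H (yd_phi K H (idx U) V) (yd_phi K H (idx U) W) U))
    (yd_comp (yd_tensor_arrow K H (yd_id (yd_phi K H (idx U) V)) (yd_braid K H U W))
    (yd_comp (yd_assoc K H (yd_phi K H (idx U) V) U W)
    (yd_comp (yd_tensor_arrow K H (yd_braid K H U V) (yd_id W)) (inv_arrow C (yd_assoc K H U V W)))))"
    (is "?f = ?g")
proof (rule hom_eqI3')
  let ?Y = "yd_tensor K H (yd_tensor K H (yd_phi K H (idx U) V) (yd_phi K H (idx U) W)) U"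
  show "hom ?f (yd_tensor K H U (yd_tensor K H V W)) ?Y"
    using hom_braid[of U "yd_tensor K H V W"] by (simp add: yd_phi_tensor)
  show "hom ?g (yd_tensor K H U (yd_tensor K H V W)) ?Y"
    by (rule hom_comp hom_assoc hom_inv_assoc hom_tensor hom_id hom_braid | simp)+
  show "mapping ?f (tp (Space U) (tsp (Space V) (Space W)) u (tp (Space V) (Space W) v w)) =
      mapping ?g (tp (Space U) (tsp (Space V) (Space W)) u (tp (Space V) (Space W) v w))"
    if [simp]: "u \<in> carrier (Space U)" "v \<in> carrier (Space V)" "w \<in> carrier (Space W)" for u v w
    by simp
qed simp_all

subsection \<open>The braided T-category\<close>

lemma C_category: "category_ax C"
proof (rule category_ax.intro)
  fix f X Y assume "f \<in> homset C X Y"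
  then have f: "hom f X Y" by simp
  note [simp] = hom_rules[OF f]
  show "Comp C f (Ident C X) = f"
    by (auto intro!: arrow_eqI)
  show "Comp C (Ident C Y) f = f"
    by (auto intro!: arrow_eqI)
next
  fix f g h W X Y Z assume "f \<in> homset C W X" "g \<in> homset C X Y" "h \<in> homset C Y Z"
  then have f: "hom f W X" and g: "hom g X Y" and h: "hom h Y Z" by simp_all
  note [simp] = hom_rules[OF f] hom_rules[OF g] hom_rules[OF h]
  show "Comp C (Comp C h g) f = Comp C h (Comp C g f)"
    by (auto intro!: arrow_eqI)
qed (auto simp: C_Arr hom_id intro: hom_comp dest: hom_objs)

lemma tensor_id: "ydm X \<Longrightarrow> ydm Y \<Longrightarrow> yd_tensor_arrow K H (yd_id X) (yd_id Y) = yd_id (yd_tensor K H X Y)"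
  by (rule hom_eqI[OF hom_tensor[OF hom_id hom_id] hom_id]) simp_all

lemma tensor_comp:
  assumes f: "hom f X X'" and f': "hom f' X' X''" and g: "hom g Y Y'" and g': "hom g' Y' Y''"
  shows "yd_tensor_arrow K H (yd_comp f' f) (yd_comp g' g) =
    yd_comp (yd_tensor_arrow K H f' g') (yd_tensor_arrow K H f g)"
proof -
  note [simp] = hom_rules[OF f] hom_rules[OF g] hom_rules[OF f'] hom_rules[OF g']
  show ?thesis
    by (rule hom_eqI[OF hom_tensor[OF hom_comp[OF f f'] hom_comp[OF g g']]
      hom_comp[OF hom_tensor[OF f g] hom_tensor[OF f' g']]]) simp_all
qed

lemma assoc_natural:
  assumes f: "hom f X X'" and g: "hom g Y Y'" and h: "hom h Z Z'"
  shows "yd_comp (yd_assoc K H X' Y' Z') (yd_tensor_arrow K H (yd_tensor_arrow K H f g) h) =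
    yd_comp (yd_tensor_arrow K H f (yd_tensor_arrow K H g h)) (yd_assoc K H X Y Z)"
proof -
  note [simp] = hom_rules[OF f] hom_rules[OF g] hom_rules[OF h]
  show ?thesis
    by (rule hom_eqI3[OF hom_comp[OF hom_tensor[OF hom_tensor[OF f g] h] hom_assoc]
      hom_comp[OF hom_assoc hom_tensor[OF f hom_tensor[OF g h]]]]) simp_all
qed

lemma lunit_natural:
  assumes f: "hom f X Y"
  shows "yd_comp (yd_lunit K H Y) (yd_tensor_arrow K H (yd_id (yd_unit K H)) f) = yd_comp f (yd_lunit K H X)"
proof -
  note [simp] = hom_rules[OF f]
  show ?thesis
    by (rule hom_eqI[OF hom_comp[OF hom_tensor[OF hom_id f] hom_lunit] hom_comp[OF hom_lunit f]]) simp_all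
qed

lemma runit_natural:
  assumes f: "hom f X Y"
  shows "yd_comp (yd_runit K H Y) (yd_tensor_arrow K H f (yd_id (yd_unit K H))) = yd_comp f (yd_runit K H X)"
proof -
  note [simp] = hom_rules[OF f]
  show ?thesis
    by (rule hom_eqI[OF hom_comp[OF hom_tensor[OF f hom_id] hom_runit] hom_comp[OF hom_runit f]]) simp_all
qed

lemma yd_pentagon:
  assumes [simp]: "ydm W" "ydm X" "ydm Y" "ydm Z"
  shows "yd_comp (yd_tensor_arrow K H (yd_id W) (yd_assoc K H X Y Z))
      (yd_comp (yd_assoc K H W (yd_tensor K H X Y) Z) (yd_tensor_arrow K H (yd_assoc K H W X Y) (yd_id Z))) =
    yd_comp (yd_assoc K H W X (yd_tensor K H Y Z)) (yd_assoc K H (yd_tensor K H W X) Y Z)" (is "?f = ?g")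
proof (rule hom_eqI4)
  let ?D = "yd_tensor K H (yd_tensor K H (yd_tensor K H W X) Y) Z" and
    ?Y = "yd_tensor K H W (yd_tensor K H X (yd_tensor K H Y Z))"
  show "hom ?f ?D ?Y" "hom ?g ?D ?Y"
    by (rule hom_comp hom_assoc hom_tensor hom_id | simp)+
qed simp_all

lemma yd_triangle:
  assumes [simp]: "ydm X" "ydm Y"
  shows "yd_comp (yd_tensor_arrow K H (yd_id X) (yd_lunit K H Y)) (yd_assoc K H X (yd_unit K H) Y) =
    yd_tensor_arrow K H (yd_runit K H X) (yd_id Y)" (is "?f = ?g")
proof (rule hom_eqI3)
  let ?D = "yd_tensor K H (yd_tensor K H X (yd_unit K H)) Y" and ?Y = "yd_tensor K H X Y"
  show "hom ?f ?D ?Y" "hom ?g ?D ?Y"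
    by (rule hom_comp hom_assoc hom_tensor hom_id hom_lunit hom_runit | simp)+
qed simp_all

lemma C_monoidal: "monoidal_category C"
proof (rule monoidal_category.intro[OF C_category monoidal_category_axioms.intro])
  show "Assoc C X' Y' Z' \<cdot>\<^bsub>C\<^esub> ((f \<bullet>\<^bsub>C\<^esub> g) \<bullet>\<^bsub>C\<^esub> h) = (f \<bullet>\<^bsub>C\<^esub> (g \<bullet>\<^bsub>C\<^esub> h)) \<cdot>\<^bsub>C\<^esub> Assoc C X Y Z"
    if "f \<in> homset C X X'" "g \<in> homset C Y Y'" "h \<in> homset C Z Z'" for f X X' g Y Y' h Z Z'
    using that by (simp add: assoc_natural)
  show "(f' \<cdot>\<^bsub>C\<^esub> f) \<bullet>\<^bsub>C\<^esub> (g' \<cdot>\<^bsub>C\<^esub> g) = (f' \<bullet>\<^bsub>C\<^esub> g') \<cdot>\<^bsub>C\<^esub> (f \<bullet>\<^bsub>C\<^esub> g)"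
    if "f \<in> homset C X X'" "f' \<in> homset C X' X''" "g \<in> homset C Y Y'" "g' \<in> homset C Y' Y''"
    for f X X' f' X'' g Y Y' g' Y''
    using that by (simp add: tensor_comp)
qed (simp_all add: tensor_id hom_tensor hom_assoc iso_assoc hom_lunit hom_runit iso_lunit iso_runit
    lunit_natural runit_natural yd_pentagon yd_triangle)

lemma C_arr_objs: "f \<in> Arr C \<Longrightarrow> ydm (source f)" "f \<in> Arr C \<Longrightarrow> ydm (target f)"
  by (auto simp: C_Arr hom_def)

lemma phi_auto:
  assumes a [simp]: "a \<in> carrier G"
  shows "strict_monoidal_auto C (PhiO C a) (PhiA C a)"
proof -
  have i [simp]: "inv\<^bsub>G\<^esub> a \<in> carrier G" by (rule Gg.inv_closed[OF a])
  have "bij_betw (yd_phi K H a) (Obj C) (Obj C)"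
    by (rule bij_betw_byWitness[where f' = "yd_phi K H (inv\<^bsub>G\<^esub> a)"]) (auto simp: yd_phi_inv)
  moreover have "bij_betw (yd_phi_arrow K H a) (Arr C) (Arr C)"
  proof (rule bij_betw_byWitness[where f' = "yd_phi_arrow K H (inv\<^bsub>G\<^esub> a)"])
    show "\<forall>f \<in> Arr C. yd_phi_arrow K H (inv\<^bsub>G\<^esub> a) (yd_phi_arrow K H a f) = f"
      "\<forall>f \<in> Arr C. yd_phi_arrow K H a (yd_phi_arrow K H (inv\<^bsub>G\<^esub> a) f) = f"
      by (simp_all add: yd_phi_arrow_inv C_arr_objs)
    show "yd_phi_arrow K H a ` Arr C \<subseteq> Arr C" "yd_phi_arrow K H (inv\<^bsub>G\<^esub> a) ` Arr C \<subseteq> Arr C"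
      by (auto simp: C_Arr intro: hom_phi[OF a] hom_phi[OF i])
  qed
  ultimately show ?thesis
    unfolding strict_monoidal_auto_def
    by (auto simp: C_Arr yd_phi_id yd_phi_comp yd_phi_tensor yd_phi_unit yd_phi_assoc yd_phi_unitors
        intro!: yd_phi_tensor_arrow)
qed

text \<open>An object or arrow of the conjugated degree is the image of its own conjugate by the
  inverse of b, whose degree is a by \<open>e\<close>.\<close>

lemma phi_component:
  assumes a [simp]: "a \<in> carrier G" and b [simp]: "b \<in> carrier G"
  shows "yd_phi K H b ` {X. ydm X \<and> idx X = a} = {X. ydm X \<and> idx X = b \<otimes>\<^bsub>G\<^esub> a \<otimes>\<^bsub>G\<^esub> inv\<^bsub>G\<^esub> b}"
    and "yd_phi_arrow K H b ` {f. hom f (source f) (target f) \<and> idx (source f) = a} =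
      {f. hom f (source f) (target f) \<and> idx (source f) = b \<otimes>\<^bsub>G\<^esub> a \<otimes>\<^bsub>G\<^esub> inv\<^bsub>G\<^esub> b}"
proof -
  have i [simp]: "inv\<^bsub>G\<^esub> b \<in> carrier G" by (rule Gg.inv_closed[OF b])
  have e: "inv\<^bsub>G\<^esub> b \<otimes>\<^bsub>G\<^esub> (b \<otimes>\<^bsub>G\<^esub> a \<otimes>\<^bsub>G\<^esub> inv\<^bsub>G\<^esub> b) \<otimes>\<^bsub>G\<^esub> inv\<^bsub>G\<^esub> (inv\<^bsub>G\<^esub> b) = a"
    by (simp add: Gg.m_assoc Gg.inv_solve_left')
  show "yd_phi K H b ` {X. ydm X \<and> idx X = a} = {X. ydm X \<and> idx X = b \<otimes>\<^bsub>G\<^esub> a \<otimes>\<^bsub>G\<^esub> inv\<^bsub>G\<^esub> b}"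
  proof (intro equalityI subsetI)
    fix X assume "X \<in> {X. ydm X \<and> idx X = b \<otimes>\<^bsub>G\<^esub> a \<otimes>\<^bsub>G\<^esub> inv\<^bsub>G\<^esub> b}"
    then have X: "ydm X" "idx X = b \<otimes>\<^bsub>G\<^esub> a \<otimes>\<^bsub>G\<^esub> inv\<^bsub>G\<^esub> b" by auto
    then have "X = yd_phi K H b (yd_phi K H (inv\<^bsub>G\<^esub> b) X)" by (simp only: yd_phi_inv[OF b])
    moreover have "yd_phi K H (inv\<^bsub>G\<^esub> b) X \<in> {X. ydm X \<and> idx X = a}" using X e by simp
    ultimately show "X \<in> yd_phi K H b ` {X. ydm X \<and> idx X = a}" by (rule image_eqI)
  qed auto
  show "yd_phi_arrow K H b ` {f. hom f (source f) (target f) \<and> idx (source f) = a} =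
      {f. hom f (source f) (target f) \<and> idx (source f) = b \<otimes>\<^bsub>G\<^esub> a \<otimes>\<^bsub>G\<^esub> inv\<^bsub>G\<^esub> b}"
  proof (intro equalityI subsetI)
    fix f assume "f \<in> {f. hom f (source f) (target f) \<and> idx (source f) = b \<otimes>\<^bsub>G\<^esub> a \<otimes>\<^bsub>G\<^esub> inv\<^bsub>G\<^esub> b}"
    then have f: "hom f (source f) (target f)" "idx (source f) = b \<otimes>\<^bsub>G\<^esub> a \<otimes>\<^bsub>G\<^esub> inv\<^bsub>G\<^esub> b" by auto
    then have "f = yd_phi_arrow K H b (yd_phi_arrow K H (inv\<^bsub>G\<^esub> b) f)"
      by (simp only: yd_phi_arrow_inv[OF b hom_objs(1,2)[OF f(1)]])
    moreover have "yd_phi_arrow K H (inv\<^bsub>G\<^esub> b) f \<in> {f. hom f (source f) (target f) \<and> idx (source f) = a}"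
      using f e hom_phi[OF i f(1)] by simp
    ultimately show "f \<in> yd_phi_arrow K H b ` {f. hom f (source f) (target f) \<and> idx (source f) = a}"
      by (rule image_eqI)
  next
    fix f assume "f \<in> yd_phi_arrow K H b ` {f. hom f (source f) (target f) \<and> idx (source f) = a}"
    then show "f \<in> {f. hom f (source f) (target f) \<and> idx (source f) = b \<otimes>\<^bsub>G\<^esub> a \<otimes>\<^bsub>G\<^esub> inv\<^bsub>G\<^esub> b}"
      by (auto intro: hom_phi[OF b])
  qed
qed

lemma C_T_category: "T_category G C"
proof (rule T_category.intro[OF Gg.is_group C_monoidal T_category_axioms.intro])
  have O: "{X \<in> Obj C. Deg C X = a} = {X. ydm X \<and> idx X = a}"
    and A: "{f \<in> Arr C. Deg C (Dom C f) = a} = {f. hom f (source f) (target f) \<and> idx (source f) = a}" for a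
    by (simp_all add: C_Arr)
  show "PhiO C b ` {X \<in> Obj C. Deg C X = a} = {X \<in> Obj C. Deg C X = b \<otimes>\<^bsub>G\<^esub> a \<otimes>\<^bsub>G\<^esub> inv\<^bsub>G\<^esub> b}"
    "PhiA C b ` {f \<in> Arr C. Deg C (Dom C f) = a} =
      {f \<in> Arr C. Deg C (Dom C f) = b \<otimes>\<^bsub>G\<^esub> a \<otimes>\<^bsub>G\<^esub> inv\<^bsub>G\<^esub> b}"
    if "a \<in> carrier G" "b \<in> carrier G" for a b
    unfolding O A using phi_component[OF that] by simp_all
  show "strict_monoidal_auto C (PhiO C a) (PhiA C a)" if "a \<in> carrier G" for a
    by (rule phi_auto[OF that])
  show "PhiA C (a \<otimes>\<^bsub>G\<^esub> b) f = PhiA C a (PhiA C b f)" if "a \<in> carrier G" "b \<in> carrier G" "f \<in> Arr C" for a b f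
    using that by (simp add: yd_phi_arrow_mult C_arr_objs)
qed (auto simp: C_Arr yd_phi_mult dest: hom_objs)

lemma C_braided: "braided_T_category G C"
  by (rule braided_T_category.intro[OF C_T_category braided_T_category_axioms.intro])
    (simp_all add: hom_braid iso_braid braid_natural hexagon1 hexagon2 braid_phi hom_objs)

lemma sw_smult_right_factor [simp]:
  assumes [simp]: "vectorspace K M" "vectorspace K N" "vectorspace K P" "t \<in> carrier (tensor K M N)"
    "c \<in> carrier K" "\<And>a b. a \<in> carrier M \<Longrightarrow> b \<in> carrier N \<Longrightarrow> k a b \<in> carrier K"
    "\<And>a b. a \<in> carrier M \<Longrightarrow> b \<in> carrier N \<Longrightarrow> F a b \<in> carrier P"
  shows "sw K M N P (\<lambda>a b. (k a b \<otimes>\<^bsub>K\<^esub> c) \<odot>\<^bsub>P\<^esub> F a b) t = c \<odot>\<^bsub>P\<^esub> sw K M N P (\<lambda>a b. k a b \<odot>\<^bsub>P\<^esub> F a b) t"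
proof -
  have "sw K M N P (\<lambda>a b. (k a b \<otimes>\<^bsub>K\<^esub> c) \<odot>\<^bsub>P\<^esub> F a b) t = sw K M N P (\<lambda>a b. c \<odot>\<^bsub>P\<^esub> (k a b \<odot>\<^bsub>P\<^esub> F a b)) t"
    by (rule sw_cong[OF refl]) (simp add: Kf.m_comm)
  also have "\<dots> = c \<odot>\<^bsub>P\<^esub> sw K M N P (\<lambda>a b. k a b \<odot>\<^bsub>P\<^esub> F a b) t"
    by (rule sw_smult_body) simp_all
  finally show ?thesis .
qed

subsection \<open>Realized dual spaces\<close>

abbreviation DV :: "('k, 'v) module \<Rightarrow> ('k, 'v) module" where
  "DV U \<equiv> realize_space (dual_space K U)"

definition ev :: "('k, 'v) module \<Rightarrow> 'v \<Rightarrow> 'v \<Rightarrow> 'k" where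
  "ev U f = unrealize (carrier (dual_space K U)) f"

definition mk :: "('k, 'v) module \<Rightarrow> ('v \<Rightarrow> 'k) \<Rightarrow> 'v" where
  "mk U \<phi> = realize (carrier (dual_space K U)) (\<lambda>m \<in> carrier U. \<phi> m)"

definition dvec :: "('k, 'v) module \<Rightarrow> 'v set \<Rightarrow> 'v \<Rightarrow> 'v" where
  "dvec U B e = realize (carrier (dual_space K U)) (dual_vector K U B e)"

context
  fixes U :: "('k, 'v) module"
  assumes U [simp]: "fdv K U"
begin

lemma fdv_DV [simp]: "fdv K (DV U)" by simp

lemma dual_iff: "f \<in> carrier (dual_space K U) \<longleftrightarrow> f \<in> extensional (carrier U) \<and> lin K U (scalars K) f"
  by (rule dual_space_iff) simp

lemma ev_dual: "f \<in> carrier (DV U) \<Longrightarrow> ev U f \<in> carrier (dual_space K U)"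
  unfolding ev_def by (rule lin_closed[OF lin_unrealize]) simp_all

lemma lin_ev_right: "f \<in> carrier (DV U) \<Longrightarrow> lin K U (scalars K) (\<lambda>m. ev U f m)"
  using ev_dual[of f] by (simp add: dual_iff)

lemma lin_ev_left: "m \<in> carrier U \<Longrightarrow> lin K (DV U) (scalars K) (\<lambda>f. ev U f m)"
proof -
  assume m: "m \<in> carrier U"
  have "g m \<in> carrier K" if "g \<in> carrier (dual_space K U)" for g
    using that lin_closed[of K U "scalars K" g m] m by (simp add: dual_iff)
  then have "lin K (dual_space K U) (scalars K) (\<lambda>g. g m)"
    by (intro linI) (use m in \<open>simp_all add: dual_space_simps(2-4)[OF Kf.ring_axioms] scalars_simps\<close>)
  from lin_comp[OF lin_unrealize[OF fdv_dual_space[OF U]] this] show ?thesis unfolding ev_def by simp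
qed

lemma ev_ext:
  assumes "f \<in> carrier (DV U)" "g \<in> carrier (DV U)" "\<And>m. m \<in> carrier U \<Longrightarrow> ev U f m = ev U g m"
  shows "f = g"
proof -
  have "ev U f = ev U g"
    by (rule extensionalityI[where A = "carrier U"]) (use assms ev_dual in \<open>auto simp: dual_iff\<close>)
  then have "realize (carrier (dual_space K U)) (ev U f) = (realize (carrier (dual_space K U)) (ev U g) :: 'v)"
    by simp
  then show ?thesis using assms(1,2) by (simp add: ev_def)
qed

lemma
  assumes "lin K U (scalars K) \<phi>"
  shows mk_closed: "mk U \<phi> \<in> carrier (DV U)" and ev_mk: "m \<in> carrier U \<Longrightarrow> ev U (mk U \<phi>) m = \<phi> m"
proof -
  have *: "(\<lambda>m \<in> carrier U. \<phi> m) \<in> carrier (dual_space K U)"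
    using iffD2[OF lin_cong[OF vs_fdv[OF U], of "\<lambda>m \<in> carrier U. \<phi> m" \<phi>] assms] by (simp add: dual_iff)
  then show "mk U \<phi> \<in> carrier (DV U)"
    unfolding mk_def by (intro lin_closed[OF lin_realize]) simp_all
  show "m \<in> carrier U \<Longrightarrow> ev U (mk U \<phi>) m = \<phi> m"
    using * by (simp add: ev_def mk_def)
qed

lemmas ev_rules = lin_closed[OF lin_ev_right, unfolded scalars_simps] lin_arg[OF lin_ev_right] lin_arg[OF lin_ev_left]
  lin_smult[OF lin_ev_right, unfolded scalars_simps] lin_smult[OF lin_ev_left, unfolded scalars_simps]
  sw_push[OF lin_ev_right _ _ vs_fdv[OF U] vs_scalars]
  sw_push[OF lin_ev_left _ _ vs_fdv[OF fdv_DV] vs_scalars]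
  mk_closed ev_mk

text \<open>\<open>ev_ext\<close> reduces the identities to evaluations at vectors, where they are
  the linearity of \<Phi> in its first argument.\<close>

lemma lin_mk:
  assumes [simp]: "vectorspace K X"
    and r: "\<And>x. x \<in> carrier X \<Longrightarrow> lin K U (scalars K) (\<Phi> x)"
    and l: "\<And>m. m \<in> carrier U \<Longrightarrow> lin K X (scalars K) (\<lambda>x. \<Phi> x m)"
  shows "lin K X (DV U) (\<lambda>x. mk U (\<Phi> x))"
proof (rule linI)
  interpret X: vectorspace K X by simp
  interpret DV: vectorspace K "DV U" by simp
  note [simp] = ev_rules r
  note add = lin_add[OF lin_ev_left, unfolded scalars_simps] lin_add[OF l, unfolded scalars_simps]
    lin_smult[OF l, unfolded scalars_simps]
  show "mk U (\<Phi> x) \<in> carrier (DV U)" if "x \<in> carrier X" for x using that by simp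
  show "mk U (\<Phi> (x \<oplus>\<^bsub>X\<^esub> y)) = mk U (\<Phi> x) \<oplus>\<^bsub>DV U\<^esub> mk U (\<Phi> y)"
    if "x \<in> carrier X" "y \<in> carrier X" for x y
    by (rule ev_ext) (use that in \<open>simp_all add: add\<close>)
  show "mk U (\<Phi> (c \<odot>\<^bsub>X\<^esub> x)) = c \<odot>\<^bsub>DV U\<^esub> mk U (\<Phi> x)"
    if "c \<in> carrier K" "x \<in> carrier X" for c x
    by (rule ev_ext) (use that in \<open>simp_all add: add\<close>)
qed

context
  fixes B assumes B: "vectorspace.basis K U B"
begin

lemma basis_finite: "finite B" by (rule fdv_basis_finite[OF U B])

lemma basis_closed: "e \<in> B \<Longrightarrow> e \<in> carrier U"
  using B vectorspace.basis_def[OF vs_fdv[OF U]] by blast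

lemma dvec_closed: "e \<in> B \<Longrightarrow> dvec U B e \<in> carrier (DV U)"
  unfolding dvec_def
  by (rule lin_closed[OF lin_realize]) (simp_all add: dual_vector_closed[OF B basis_finite])

lemma ev_dvec: "e \<in> B \<Longrightarrow> ev U (dvec U B e) = dual_vector K U B e"
  unfolding dvec_def ev_def
  by (rule unrealize_realize) (simp_all add: dual_vector_closed[OF B basis_finite])

lemma expand_vector:
  assumes P [simp]: "vectorspace K P" and F: "lin K U P F" and m [simp]: "m \<in> carrier U"
  shows "finsum P (\<lambda>e. ev U (dvec U B e) m \<odot>\<^bsub>P\<^esub> F e) B = F m"
proof -
  note [simp] = ev_rules dvec_closed basis_closed
  have "F (finsum U (\<lambda>e. ev U (dvec U B e) m \<odot>\<^bsub>U\<^esub> e) B) = finsum P (\<lambda>e. F (ev U (dvec U B e) m \<odot>\<^bsub>U\<^esub> e)) B"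
    by (rule lin_finsum[OF _ _ F]) simp_all
  also have "\<dots> = finsum P (\<lambda>e. ev U (dvec U B e) m \<odot>\<^bsub>P\<^esub> F e) B"
    by (rule finsum_cong_weak) (simp add: lin_smult[OF F])
  also have "finsum U (\<lambda>e. ev U (dvec U B e) m \<odot>\<^bsub>U\<^esub> e) B = finsum U (\<lambda>e. dual_vector K U B e m \<odot>\<^bsub>U\<^esub> e) B"
    by (rule finsum_cong_weak) (simp add: ev_dvec)
  also have "\<dots> = m" by (rule basis_expansion[OF B basis_finite]) simp_all
  finally show ?thesis ..
qed

lemma expand_functional:
  assumes P [simp]: "vectorspace K P" and F: "lin K (DV U) P F" and f [simp]: "f \<in> carrier (DV U)"
  shows "finsum P (\<lambda>e. ev U f e \<odot>\<^bsub>P\<^esub> F (dvec U B e)) B = F f"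
proof -
  note [simp] = ev_rules dvec_closed basis_closed
  let ?D = "dual_space K U" and ?r = "realize (carrier (dual_space K U)) :: _ \<Rightarrow> 'v"
  have r: "lin K ?D P (\<lambda>g. F (?r g))" by (rule lin_comp[OF lin_realize F]) simp
  have d [simp]: "dual_vector K U B e \<in> carrier ?D" if "e \<in> B" for e
    using that by (simp add: dual_vector_closed[OF B basis_finite])
  have "F (?r (finsum ?D (\<lambda>e. ev U f e \<odot>\<^bsub>?D\<^esub> dual_vector K U B e) B)) =
      finsum P (\<lambda>e. F (?r (ev U f e \<odot>\<^bsub>?D\<^esub> dual_vector K U B e))) B"
    by (rule lin_finsum[OF _ _ r]) simp_all
  also have "\<dots> = finsum P (\<lambda>e. ev U f e \<odot>\<^bsub>P\<^esub> F (dvec U B e)) B"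
    by (rule finsum_cong_weak) (simp add: lin_smult[OF r] dvec_def del: realize_rules)
  also have "finsum ?D (\<lambda>e. ev U f e \<odot>\<^bsub>?D\<^esub> dual_vector K U B e) B = ev U f"
    by (rule dual_basis_expansion[OF B basis_finite]) (simp_all add: ev_dual)
  also have "?r (ev U f) = f" by (simp add: ev_def)
  finally show ?thesis ..
qed

end

lemma dual_tensor_ext:
  assumes W [simp]: "vectorspace K W"
    and t [simp]: "t \<in> carrier (tensor K (DV U) W)" "t' \<in> carrier (tensor K (DV U) W)"
    and eq: "\<And>m. m \<in> carrier U \<Longrightarrow> sw K (DV U) W W (\<lambda>f w. ev U f m \<odot>\<^bsub>W\<^esub> w) t = sw K (DV U) W W (\<lambda>f w. ev U f m \<odot>\<^bsub>W\<^esub> w) t'"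
  shows "t = t'"
proof -
  obtain B where B: "vectorspace.basis K U B" using fdv_basis_exists[OF U] by blast
  note [simp] = ev_rules dvec_closed[OF B] basis_closed[OF B]
  let ?T = "tensor K (DV U) W"
  \<comment> \<open>An element of the tensor product is recovered from its evaluations at the basis
    vectors e, by tensoring each value with the dual vector of e and summing.\<close>
  have exp: "finsum ?T (\<lambda>e. pure K (DV U) W (dvec U B e) (sw K (DV U) W W (\<lambda>f w. ev U f e \<odot>\<^bsub>W\<^esub> w) s)) B = s"
    if "s \<in> carrier ?T" for s
  proof (rule tensor_eqI[of K "DV U" W ?T _ "\<lambda>s. s"])
    show "lin K ?T ?T (\<lambda>s. finsum ?T (\<lambda>e. pure K (DV U) W (dvec U B e) (sw K (DV U) W W (\<lambda>f w. ev U f e \<odot>\<^bsub>W\<^esub> w) s)) B)"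
      by (rule lin_finsum_maps) simp_all
    fix f w assume [simp]: "f \<in> carrier (DV U)" "w \<in> carrier W"
    have "finsum ?T (\<lambda>e. pure K (DV U) W (dvec U B e) (sw K (DV U) W W (\<lambda>f w. ev U f e \<odot>\<^bsub>W\<^esub> w) (pure K (DV U) W f w))) B =
      finsum ?T (\<lambda>e. ev U f e \<odot>\<^bsub>?T\<^esub> pure K (DV U) W (dvec U B e) w) B"
      by (rule finsum_cong_weak) simp
    also have "\<dots> = pure K (DV U) W f w" by (rule expand_functional[OF B]) simp_all
    finally show "finsum ?T (\<lambda>e. pure K (DV U) W (dvec U B e) (sw K (DV U) W W (\<lambda>f w. ev U f e \<odot>\<^bsub>W\<^esub> w) (pure K (DV U) W f w))) B =
      pure K (DV U) W f w" .
  qed (use that in simp_all)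
  have "finsum ?T (\<lambda>e. pure K (DV U) W (dvec U B e) (sw K (DV U) W W (\<lambda>f w. ev U f e \<odot>\<^bsub>W\<^esub> w) t)) B =
    finsum ?T (\<lambda>e. pure K (DV U) W (dvec U B e) (sw K (DV U) W W (\<lambda>f w. ev U f e \<odot>\<^bsub>W\<^esub> w) t')) B"
    by (rule finsum_cong_weak) (simp add: eq)
  then show ?thesis by (simp add: exp)
qed

end

declare ev_rules [simp]

lemma lin_mk_arg [simp]:
  "fdv K U \<Longrightarrow> vectorspace K X \<Longrightarrow> (\<And>x. x \<in> carrier X \<Longrightarrow> lin K U (scalars K) (\<lambda>m. \<Phi> x m)) \<Longrightarrow>
    (\<And>m. m \<in> carrier U \<Longrightarrow> lin K X (scalars K) (\<lambda>x. \<Phi> x m)) \<Longrightarrow> lin K X (DV U) (\<lambda>x. mk U (\<lambda>m. \<Phi> x m))"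
  by (rule lin_mk)

subsection \<open>Dual objects\<close>

text \<open>The antipode and its inverse enter the construction of the duals only through the following
  properties, which treats the left and the right dual at once.\<close>

definition anti_auto :: "('h \<Rightarrow> 'h) \<Rightarrow> bool" where
  "anti_auto S \<longleftrightarrow> lin K H H S \<and> (\<forall>g \<in> carrier H. \<forall>h \<in> carrier H. S (g \<otimes>\<^bsub>H\<^esub> h) = S h \<otimes>\<^bsub>H\<^esub> S g) \<and>
     S \<one>\<^bsub>H\<^esub> = \<one>\<^bsub>H\<^esub> \<and> (\<forall>h \<in> carrier H. counit H (S h) = counit H h) \<and>
     (\<forall>h \<in> carrier H. comult H (S h) = sw K H H HH (\<lambda>a b. pure K H H (S b) (S a)) (comult H h)) \<and>
     (\<forall>a \<in> Aut. \<forall>h \<in> carrier H. S (a h) = a (S h))"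

lemma anti_auto_antipode: "anti_auto (antipode H)"
  by (simp add: anti_auto_def lin_antipode antipode_mult comult_antipode auto_antipode)

lemma anti_auto_Sinv: "anti_auto Sinv"
  by (simp add: anti_auto_def lin_Sinv Sinv_mult Sinv_one counit_Sinv comult_Sinv auto_Sinv)

context
  fixes S assumes S: "anti_auto S"
begin

lemma anti_lin: "lin K H H S" using S by (simp add: anti_auto_def)

lemma anti_props:
  "g \<in> carrier H \<Longrightarrow> h \<in> carrier H \<Longrightarrow> S (g \<otimes>\<^bsub>H\<^esub> h) = S h \<otimes>\<^bsub>H\<^esub> S g" "S \<one>\<^bsub>H\<^esub> = \<one>\<^bsub>H\<^esub>"
  "h \<in> carrier H \<Longrightarrow> counit H (S h) = counit H h"
  "h \<in> carrier H \<Longrightarrow> comult H (S h) = sw K H H HH (\<lambda>a b. pure K H H (S b) (S a)) (comult H h)"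
  "h \<in> carrier H \<Longrightarrow> x \<in> carrier G \<Longrightarrow> S (fst x h) = fst x (S h)"
  "h \<in> carrier H \<Longrightarrow> x \<in> carrier G \<Longrightarrow> S (snd x h) = snd x (S h)"
  "h \<in> carrier H \<Longrightarrow> a \<in> Aut \<Longrightarrow> S ((inv\<^bsub>A\<^esub> a) h) = (inv\<^bsub>A\<^esub> a) (S h)"
  using S by (simp_all add: anti_auto_def)

lemmas anti_rules = lin_closed[OF anti_lin] lin_arg[OF anti_lin] lin_smult[OF anti_lin]
  sw_push[OF anti_lin _ _ vs_H vs_H] anti_props

end

lemma yd_dual_simps [simp]:
  assumes "ydm M"
  shows "Space (yd_dual K H S T M) = DV (Space M)" "idx (yd_dual K H S T M) = inv\<^bsub>G\<^esub> (idx M)"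
  using assms by (simp_all add: yd_dual_def Let_def G_inv)

context
  fixes S T :: "'h \<Rightarrow> 'h" and M :: "('k, 'h, 'v) yd"
  assumes S: "anti_auto S" and T: "anti_auto T" and TS: "\<forall>h \<in> carrier H. T (S h) = h"
    and M [simp]: "ydm M"
begin

lemma act_yd_dual:
  assumes [simp]: "h \<in> carrier H" "f \<in> carrier (DV (Space M))"
  shows "act (yd_dual K H S T M) h f =
    mk (Space M) (\<lambda>m. ev (Space M) f (act M ((inv\<^bsub>A\<^esub> (snd (idx M))) ((inv\<^bsub>A\<^esub> (fst (idx M))) (S h))) m))"
  using anti_rules(1)[OF S]
  by (simp add: yd_dual_def Let_def mk_def functional_def ev_def)

text \<open>The coaction of a dual is defined by a condition in k \<otimes> H. Together with the
  next lemma this identifies k \<otimes> H with H, where the condition is easier to use.\<close>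

lemma pure_scalars:
  "a \<in> carrier K \<Longrightarrow> h \<in> carrier H \<Longrightarrow>
    pure K (scalars K) H a h = pure K (scalars K) H \<one>\<^bsub>K\<^esub> (a \<odot>\<^bsub>H\<^esub> h)"
  using lin_smult[OF lin_pure_left[OF vs_scalars vs_H, of h], of a "\<one>\<^bsub>K\<^esub>"] by simp

lemma pure_scalars_inj:
  assumes [simp]: "x \<in> carrier H" "y \<in> carrier H"
  shows "pure K (scalars K) H \<one>\<^bsub>K\<^esub> x = pure K (scalars K) H \<one>\<^bsub>K\<^esub> y \<longleftrightarrow> x = y"
proof
  assume "pure K (scalars K) H \<one>\<^bsub>K\<^esub> x = pure K (scalars K) H \<one>\<^bsub>K\<^esub> y"
  then have "sw K (scalars K) H H (\<lambda>a h. a \<odot>\<^bsub>H\<^esub> h) (pure K (scalars K) H \<one>\<^bsub>K\<^esub> x) =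
    sw K (scalars K) H H (\<lambda>a h. a \<odot>\<^bsub>H\<^esub> h) (pure K (scalars K) H \<one>\<^bsub>K\<^esub> y)" by simp
  then show "x = y" by simp
qed simp

lemma coact_yd_dual:
  assumes f [simp]: "f \<in> carrier (DV (Space M))"
  shows "\<exists>!t. t \<in> carrier (tensor K (DV (Space M)) H) \<and> (\<forall>m \<in> carrier (Space M).
      sw K (DV (Space M)) H H (\<lambda>f0 f1. ev (Space M) f0 m \<odot>\<^bsub>H\<^esub> f1) t =
      sw K (Space M) H H (\<lambda>m0 m1. ev (Space M) f m0 \<odot>\<^bsub>H\<^esub> T m1) (coact M m))" (is "\<exists>!t. ?Q t")
    and "coact (yd_dual K H S T M) f = (THE t. t \<in> carrier (tensor K (DV (Space M)) H) \<and> (\<forall>m \<in> carrier (Space M).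
      sw K (DV (Space M)) H H (\<lambda>f0 f1. ev (Space M) f0 m \<odot>\<^bsub>H\<^esub> f1) t =
      sw K (Space M) H H (\<lambda>m0 m1. ev (Space M) f m0 \<odot>\<^bsub>H\<^esub> T m1) (coact M m)))"
proof -
  let ?U = "Space M" let ?DV = "DV ?U" and ?kH = "tensor K (scalars K) H"
  note [simp] = anti_rules[OF T]
  obtain B where B: "vectorspace.basis K ?U B" using fdv_basis_exists[of K ?U] by auto
  note [simp] = dvec_closed[OF ydm_fdv[OF M] B] basis_closed[OF ydm_fdv[OF M] B]
  let ?g = "\<lambda>m. sw K ?U H H (\<lambda>m0 m1. ev ?U f m0 \<odot>\<^bsub>H\<^esub> T m1) (coact M m)"
  \<comment> \<open>The witness for existence: the prescribed evaluations at the basis vectors, each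
    tensored with the corresponding dual vector. Uniqueness is
    \<open>dual_tensor_ext\<close>.\<close>
  let ?t = "finsum (tensor K ?DV H) (\<lambda>e. pure K ?DV H (dvec ?U B e) (?g e)) B"
  have ring_DV: "vectorspace K (tensor K ?DV H)" by simp
  interpret TD: vectorspace K "tensor K ?DV H" by (rule ring_DV)
  have t: "?t \<in> carrier (tensor K ?DV H)" by (rule TD.M.finsum_closed) simp
  have "sw K ?DV H H (\<lambda>f0 f1. ev ?U f0 m \<odot>\<^bsub>H\<^esub> f1) ?t = ?g m" if m [simp]: "m \<in> carrier ?U" for m
  proof -
    have l: "lin K (tensor K ?DV H) H (\<lambda>t. sw K ?DV H H (\<lambda>f0 f1. ev ?U f0 m \<odot>\<^bsub>H\<^esub> f1) t)" by simp
    have "sw K ?DV H H (\<lambda>f0 f1. ev ?U f0 m \<odot>\<^bsub>H\<^esub> f1) ?t = finsum H (\<lambda>e. ev ?U (dvec ?U B e) m \<odot>\<^bsub>H\<^esub> ?g e) B"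
      by (subst lin_finsum[OF ring_DV vs_H l]) (auto intro!: finsum_cong_weak)
    also have "\<dots> = ?g m" by (rule expand_vector[OF ydm_fdv[OF M] B]) simp_all
    finally show ?thesis .
  qed
  then have "?Q ?t" using t by blast
  moreover have "s = s'" if "?Q s" "?Q s'" for s s'
    by (rule dual_tensor_ext[of ?U H]) (use that in auto)
  ultimately show "\<exists>!t. ?Q t" by blast
  \<comment> \<open>Translation of the defining condition from k \<otimes> H to H: each side is one
    tensored with an element of H, and this embedding is injective.\<close>
  have Q: "(\<forall>m \<in> carrier ?U. sweedler K ?kH (\<lambda>f0 f1. pure K (scalars K) H (functional K M f0 m) f1) t =
          sweedler K ?kH (\<lambda>m0 m1. pure K (scalars K) H (functional K M f m0) (T m1)) (coact M m)) \<longleftrightarrow>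
    (\<forall>m \<in> carrier ?U. sw K ?DV H H (\<lambda>f0 f1. ev ?U f0 m \<odot>\<^bsub>H\<^esub> f1) t = ?g m)"
    if t [simp]: "t \<in> carrier (tensor K ?DV H)" for t
  proof (intro ball_cong refl)
    fix m assume m [simp]: "m \<in> carrier ?U"
    have fn: "functional K M f0 = ev ?U f0" for f0 by (simp add: functional_def ev_def)
    have "sweedler K ?kH (\<lambda>f0 f1. pure K (scalars K) H (functional K M f0 m) f1) t =
        sw K ?DV H ?kH (\<lambda>f0 f1. pure K (scalars K) H (ev ?U f0 m) f1) t"
      unfolding fn by (rule sweedler_eq_sw) simp_all
    also have "\<dots> = sw K ?DV H ?kH (\<lambda>f0 f1. pure K (scalars K) H \<one>\<^bsub>K\<^esub> (ev ?U f0 m \<odot>\<^bsub>H\<^esub> f1)) t"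
      by (rule sw_cong[OF refl], rule pure_scalars) simp_all
    also have "\<dots> = pure K (scalars K) H \<one>\<^bsub>K\<^esub> (sw K ?DV H H (\<lambda>f0 f1. ev ?U f0 m \<odot>\<^bsub>H\<^esub> f1) t)"
      by (rule sw_push[OF lin_pure_right, symmetric]) simp_all
    finally have 1: "sweedler K ?kH (\<lambda>f0 f1. pure K (scalars K) H (functional K M f0 m) f1) t =
      pure K (scalars K) H \<one>\<^bsub>K\<^esub> (sw K ?DV H H (\<lambda>f0 f1. ev ?U f0 m \<odot>\<^bsub>H\<^esub> f1) t)" .
    have "sweedler K ?kH (\<lambda>m0 m1. pure K (scalars K) H (functional K M f m0) (T m1)) (coact M m) =
        sw K ?U H ?kH (\<lambda>m0 m1. pure K (scalars K) H (ev ?U f m0) (T m1)) (coact M m)"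
      unfolding fn by simp
    also have "\<dots> = sw K ?U H ?kH (\<lambda>m0 m1. pure K (scalars K) H \<one>\<^bsub>K\<^esub> (ev ?U f m0 \<odot>\<^bsub>H\<^esub> T m1)) (coact M m)"
      by (rule sw_cong[OF refl], rule pure_scalars) simp_all
    also have "\<dots> = pure K (scalars K) H \<one>\<^bsub>K\<^esub> (?g m)"
      by (rule sw_push[OF lin_pure_right, symmetric]) simp_all
    finally show "(sweedler K ?kH (\<lambda>f0 f1. pure K (scalars K) H (functional K M f0 m) f1) t =
        sweedler K ?kH (\<lambda>m0 m1. pure K (scalars K) H (functional K M f m0) (T m1)) (coact M m)) \<longleftrightarrow>
      sw K ?DV H H (\<lambda>f0 f1. ev ?U f0 m \<odot>\<^bsub>H\<^esub> f1) t = ?g m"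
      unfolding 1 by (simp only: pure_scalars_inj sw_closed)
        (rule pure_scalars_inj; simp)
  qed
  have "coact (yd_dual K H S T M) f = (THE t. t \<in> carrier (tensor K ?DV H) \<and>
      (\<forall>m \<in> carrier ?U. sweedler K ?kH (\<lambda>f0 f1. pure K (scalars K) H (functional K M f0 m) f1) t =
          sweedler K ?kH (\<lambda>m0 m1. pure K (scalars K) H (functional K M f m0) (T m1)) (coact M m)))"
    by (simp add: yd_dual_def Let_def)
  also have "\<dots> = (THE t. ?Q t)"
  proof -
    have "(\<lambda>t. t \<in> carrier (tensor K ?DV H) \<and>
      (\<forall>m \<in> carrier ?U. sweedler K ?kH (\<lambda>f0 f1. pure K (scalars K) H (functional K M f0 m) f1) t =
          sweedler K ?kH (\<lambda>m0 m1. pure K (scalars K) H (functional K M f m0) (T m1)) (coact M m))) = ?Q"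
      by (rule ext, rule conj_cong[OF refl], rule Q)
    then show ?thesis by (rule arg_cong[where f = The])
  qed
  finally show "coact (yd_dual K H S T M) f = (THE t. ?Q t)" .
qed

end

context
  fixes S T :: "'h \<Rightarrow> 'h" and M :: "('k, 'h, 'v) yd"
  assumes S: "anti_auto S" and T: "anti_auto T" and TS: "\<forall>h \<in> carrier H. T (S h) = h"
    and M [simp]: "ydm M"
begin

lemma
  assumes f: "f \<in> carrier (DV (Space M))"
  shows coact_yd_dual_closed: "coact (yd_dual K H S T M) f \<in> carrier (tensor K (DV (Space M)) H)"
    and coact_yd_dual_ev: "m \<in> carrier (Space M) \<Longrightarrow>
      sw K (DV (Space M)) H H (\<lambda>f0 f1. ev (Space M) f0 m \<odot>\<^bsub>H\<^esub> f1) (coact (yd_dual K H S T M) f) =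
      sw K (Space M) H H (\<lambda>m0 m1. ev (Space M) f m0 \<odot>\<^bsub>H\<^esub> T m1) (coact M m)"
  using theI'[OF coact_yd_dual(1)[OF S T TS M f]] unfolding coact_yd_dual(2)[OF S T TS M f, symmetric] by blast+

lemma coact_yd_dual_unique:
  assumes f: "f \<in> carrier (DV (Space M))" and t: "t \<in> carrier (tensor K (DV (Space M)) H)"
    and "\<And>m. m \<in> carrier (Space M) \<Longrightarrow>
      sw K (DV (Space M)) H H (\<lambda>f0 f1. ev (Space M) f0 m \<odot>\<^bsub>H\<^esub> f1) t =
      sw K (Space M) H H (\<lambda>m0 m1. ev (Space M) f m0 \<odot>\<^bsub>H\<^esub> T m1) (coact M m)"
  shows "coact (yd_dual K H S T M) f = t"
  by (rule dual_tensor_ext[of "Space M" H])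
    (use coact_yd_dual_closed[OF f] coact_yd_dual_ev[OF f] t assms(3) in simp_all)

text \<open>The coaction is specified implicitly, so linearity comes from uniqueness: the sum and
  the multiple have the evaluations required of the coaction of the sum and the multiple.\<close>

lemma lin_coact_dual: "lin K (DV (Space M)) (tensor K (DV (Space M)) H) (coact (yd_dual K H S T M))"
proof (rule linI)
  let ?U = "Space M" and ?D = "yd_dual K H S T M"
  let ?DV = "DV ?U"
  note [simp] = anti_rules[OF T]
  interpret DV: vectorspace K ?DV by simp
  interpret TD: vectorspace K "tensor K ?DV H" by simp
  note cl [simp] = coact_yd_dual_closed
  have l: "lin K (tensor K ?DV H) H (\<lambda>t. sw K ?DV H H (\<lambda>f0 f1. ev ?U f0 m \<odot>\<^bsub>H\<^esub> f1) t)"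
    if "m \<in> carrier ?U" for m using that by simp
  have r: "lin K ?DV H (\<lambda>f. sw K ?U H H (\<lambda>m0 m1. ev ?U f m0 \<odot>\<^bsub>H\<^esub> T m1) (coact M m))"
    if "m \<in> carrier ?U" for m using that by simp
  show "coact ?D f \<in> carrier (tensor K ?DV H)" if "f \<in> carrier ?DV" for f by (rule cl[OF that])
  show "coact ?D (f \<oplus>\<^bsub>?DV\<^esub> g) = coact ?D f \<oplus>\<^bsub>tensor K ?DV H\<^esub> coact ?D g"
    if [simp]: "f \<in> carrier ?DV" "g \<in> carrier ?DV" for f g
    by (rule coact_yd_dual_unique)
      (simp_all add: lin_add[OF l] lin_add[OF r] coact_yd_dual_ev)
  show "coact ?D (c \<odot>\<^bsub>?DV\<^esub> f) = c \<odot>\<^bsub>tensor K ?DV H\<^esub> coact ?D f"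
    if [simp]: "c \<in> carrier K" "f \<in> carrier ?DV" for c f
    by (rule coact_yd_dual_unique)
      (simp_all only: DV.smult_closed TD.smult_closed that cl lin_smult[OF l] lin_smult[OF r] coact_yd_dual_ev)
qed

lemmas coact_dual_rules = coact_yd_dual_closed lin_arg[OF lin_coact_dual] lin_smult[OF lin_coact_dual]
  sw_push[OF lin_coact_dual _ _ vs_fdv[OF fdv_DV[OF ydm_fdv[OF M]]] vs_tensor[OF vs_fdv[OF fdv_DV[OF ydm_fdv[OF M]]] vs_H]]

text \<open>The key to all computations with duals: under any linear map \<open>Q\<close>,
  evaluating the coaction of f at m trades it for the coaction of m, with \<open>T\<close> applied
  to the H-leg.\<close>

lemma coact_dual_eval:
  assumes P [simp]: "vectorspace K P" and Q: "lin K H P Q"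
    and [simp]: "f \<in> carrier (DV (Space M))" "m \<in> carrier (Space M)"
  shows "sw K (DV (Space M)) H P (\<lambda>f0 f1. ev (Space M) f0 m \<odot>\<^bsub>P\<^esub> Q f1) (coact (yd_dual K H S T M) f) =
      sw K (Space M) H P (\<lambda>m0 m1. ev (Space M) f m0 \<odot>\<^bsub>P\<^esub> Q (T m1)) (coact M m)"
proof -
  note [simp] = lin_closed[OF Q] lin_smult[OF Q] sw_push[OF Q] coact_dual_rules anti_rules[OF T]
  have "Q (sw K (DV (Space M)) H H (\<lambda>f0 f1. ev (Space M) f0 m \<odot>\<^bsub>H\<^esub> f1) (coact (yd_dual K H S T M) f)) =
      Q (sw K (Space M) H H (\<lambda>m0 m1. ev (Space M) f m0 \<odot>\<^bsub>H\<^esub> T m1) (coact M m))"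
    by (simp only: coact_yd_dual_ev assms)
  then show ?thesis by simp
qed

text \<open>For expressions in which the evaluation is not a visible scalar factor. Linearity in the
  scalar gives Q(a, h) = a Q(1, h).\<close>

lemma coact_dual_eval':
  assumes P [simp]: "vectorspace K P"
    and Q: "\<And>h. h \<in> carrier H \<Longrightarrow> lin K (scalars K) P (\<lambda>a. Q a h)" "\<And>a. a \<in> carrier K \<Longrightarrow> lin K H P (\<lambda>h. Q a h)"
    and [simp]: "f \<in> carrier (DV (Space M))" "m \<in> carrier (Space M)"
  shows "sw K (DV (Space M)) H P (\<lambda>f0 f1. Q (ev (Space M) f0 m) f1) (coact (yd_dual K H S T M) f) =
      sw K (Space M) H P (\<lambda>m0 m1. Q (ev (Space M) f m0) (T m1)) (coact M m)"
proof -
  note [simp] = coact_dual_rules anti_rules[OF T]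
  have q: "Q a h = a \<odot>\<^bsub>P\<^esub> Q \<one>\<^bsub>K\<^esub> h" if "a \<in> carrier K" "h \<in> carrier H" for a h
    using lin_smult[OF Q(1)[OF that(2)], of a "\<one>\<^bsub>K\<^esub>"] that by simp
  have "sw K (DV (Space M)) H P (\<lambda>f0 f1. Q (ev (Space M) f0 m) f1) (coact (yd_dual K H S T M) f) =
      sw K (DV (Space M)) H P (\<lambda>f0 f1. ev (Space M) f0 m \<odot>\<^bsub>P\<^esub> Q \<one>\<^bsub>K\<^esub> f1) (coact (yd_dual K H S T M) f)"
    by (rule sw_cong[OF refl], rule q) simp_all
  also have "\<dots> = sw K (Space M) H P (\<lambda>m0 m1. ev (Space M) f m0 \<odot>\<^bsub>P\<^esub> Q \<one>\<^bsub>K\<^esub> (T m1)) (coact M m)"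
    by (rule coact_dual_eval) (simp_all add: Q)
  also have "\<dots> = sw K (Space M) H P (\<lambda>m0 m1. Q (ev (Space M) f m0) (T m1)) (coact M m)"
    by (rule sw_cong[OF refl], rule q[symmetric]) simp_all
  finally show ?thesis .
qed

lemma ydm_yd_dual: "ydm (yd_dual K H S T M)"
proof (rule ydmI'[OF _ _ yd_dual_def[unfolded Let_def]])
  let ?U = "Space M" and ?D = "yd_dual K H S T M"
  let ?DV = "DV ?U"
  let ?\<sigma> = "\<lambda>h. (inv\<^bsub>A\<^esub> (snd (idx M))) ((inv\<^bsub>A\<^esub> (fst (idx M))) h)"
  let ?op = "\<lambda>h f. mk ?U (\<lambda>m. ev ?U f (act M (?\<sigma> (S h)) m))"
  let ?b = "\<lambda>h. fst (idx M) ((inv\<^bsub>A\<^esub> (snd (idx M))) ((inv\<^bsub>A\<^esub> (fst (idx M))) h))"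
  note [simp] = anti_rules[OF S] anti_rules[OF T] bspec[OF TS] coact_dual_rules
  show "act ?D h f = ?op h f" if "h \<in> carrier H" "f \<in> carrier (Space ?D)" for h f
    using that act_yd_dual[OF S T TS M] by simp
  show "?op \<one>\<^bsub>H\<^esub> f = f" if "f \<in> carrier (Space ?D)" for f
    by (rule ev_ext[of ?U]) (use that in simp_all)
  show "?op (g \<otimes>\<^bsub>H\<^esub> h) f = ?op g (?op h f)"
    if "g \<in> carrier H" "h \<in> carrier H" "f \<in> carrier (Space ?D)" for g h f
    by (rule ev_ext[of ?U]) (use that in simp_all)
  show "lin K (Space ?D) (tensor K (Space ?D) H) (coact ?D)" using lin_coact_dual by simp
  let ?W = "Space ?D"
  show "sw K ?W H ?W (\<lambda>f0 f1. counit H f1 \<odot>\<^bsub>?W\<^esub> f0) (coact ?D f) = f" if "f \<in> carrier ?W" for f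
  proof (rule ev_ext[of ?U])
    have f [simp]: "f \<in> carrier ?DV" using that by simp
    fix m assume m [simp]: "m \<in> carrier ?U"
    have "ev ?U (sw K ?DV H ?DV (\<lambda>f0 f1. counit H f1 \<odot>\<^bsub>?DV\<^esub> f0) (coact ?D f)) m =
        sw K ?DV H (scalars K) (\<lambda>f0 f1. ev ?U f0 m \<odot>\<^bsub>scalars K\<^esub> counit H f1) (coact ?D f)"
      by (simp add: Kf.m_comm)
    also have "\<dots> = sw K ?U H (scalars K) (\<lambda>m0 m1. ev ?U f m0 \<odot>\<^bsub>scalars K\<^esub> counit H (T m1)) (coact M m)"
      by (rule coact_dual_eval) (simp_all add: lin_counit)
    also have "\<dots> = sw K ?U H (scalars K) (\<lambda>m0 m1. counit H m1 \<odot>\<^bsub>scalars K\<^esub> ev ?U f m0) (coact M m)"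
      by (simp add: Kf.m_comm)
    also have "\<dots> = ev ?U f m" by (rule coact_counit[OF M]) (simp_all add: lin_ev_right)
    finally show "ev ?U (sw K ?W H ?W (\<lambda>f0 f1. counit H f1 \<odot>\<^bsub>?W\<^esub> f0) (coact ?D f)) m = ev ?U f m" by simp
  qed (use that in simp_all)
  show "sw K ?W H (tensor K ?W HH) (\<lambda>f0 f1. sw K ?W H (tensor K ?W HH)
          (\<lambda>f00 f01. pure K ?W HH f00 (pure K H H f01 f1)) (coact ?D f0)) (coact ?D f) =
      sw K ?W H (tensor K ?W HH) (\<lambda>f0 f1. pure K ?W HH f0 (comult H f1)) (coact ?D f)" (is "?lhs = ?rhs")
    if "f \<in> carrier ?W" for f
  proof (rule dual_tensor_ext[of ?U HH])
    have f [simp]: "f \<in> carrier ?DV" using that by simp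
    show "?lhs \<in> carrier (tensor K ?DV HH)" "?rhs \<in> carrier (tensor K ?DV HH)" by simp_all
    fix m assume m [simp]: "m \<in> carrier ?U"
    have "sw K ?DV HH HH (\<lambda>f w. ev ?U f m \<odot>\<^bsub>HH\<^esub> w) ?lhs =
        sw K ?DV H HH (\<lambda>f0 f1. sw K ?DV H HH (\<lambda>f00 f01. ev ?U f00 m \<odot>\<^bsub>HH\<^esub> pure K H H f01 f1)
          (coact ?D f0)) (coact ?D f)"
      by simp
    also have "\<dots> = sw K ?DV H HH (\<lambda>f0 f1. sw K ?U H HH (\<lambda>m0 m1. ev ?U f0 m0 \<odot>\<^bsub>HH\<^esub> pure K H H (T m1) f1)
          (coact M m)) (coact ?D f)"
      by (rule sw_cong[OF refl], rule coact_dual_eval) simp_all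
    also have "\<dots> = sw K ?U H HH (\<lambda>m0 m1. sw K ?DV H HH (\<lambda>f0 f1. ev ?U f0 m0 \<odot>\<^bsub>HH\<^esub> pure K H H (T m1) f1)
          (coact ?D f)) (coact M m)"
      by (rule sw_swap) simp_all
    also have "\<dots> = sw K ?U H HH (\<lambda>m0 m1. sw K ?U H HH (\<lambda>m00 m01. ev ?U f m00 \<odot>\<^bsub>HH\<^esub> pure K H H (T m1) (T m01))
          (coact M m0)) (coact M m)"
      by (rule sw_cong[OF refl], rule coact_dual_eval) simp_all
    \<comment> \<open>Coassociativity of the coaction of m produces the legs in reverse order. The
      map \<open>T\<close> reverses the comultiplication, which restores the order wanted in the
      dual.\<close>
    also have "\<dots> = sw K ?U H HH (\<lambda>m0 m1. sw K H H HH (\<lambda>a b. ev ?U f m0 \<odot>\<^bsub>HH\<^esub> pure K H H (T b) (T a))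
          (comult H m1)) (coact M m)"
      by (rule coact_coassoc[OF M]) simp_all
    also have "\<dots> = sw K ?U H HH (\<lambda>m0 m1. ev ?U f m0 \<odot>\<^bsub>HH\<^esub> comult H (T m1)) (coact M m)"
      by simp
    also have "\<dots> = sw K ?DV H HH (\<lambda>f0 f1. ev ?U f0 m \<odot>\<^bsub>HH\<^esub> comult H f1) (coact ?D f)"
      by (rule coact_dual_eval[symmetric]) (simp_all add: lin_comult)
    also have "\<dots> = sw K ?DV HH HH (\<lambda>f w. ev ?U f m \<odot>\<^bsub>HH\<^esub> w) ?rhs" by simp
    finally show "sw K ?DV HH HH (\<lambda>f w. ev ?U f m \<odot>\<^bsub>HH\<^esub> w) ?lhs = sw K ?DV HH HH (\<lambda>f w. ev ?U f m \<odot>\<^bsub>HH\<^esub> w) ?rhs" .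
  qed simp_all
  show "yd_compat ?W ?op (coact ?D) (fst (idx ?D)) (snd (idx ?D))"
    unfolding yd_compat_def
  proof (intro ballI)
    fix h f assume h [simp]: "h \<in> carrier H" and "f \<in> carrier ?W"
    then have f [simp]: "f \<in> carrier ?DV" by simp
    show "sw K H H (tensor K ?W H) (\<lambda>h1 h2. sw K ?W H (tensor K ?W H) (\<lambda>f0 f1.
        pure K ?W H (?op h1 f0) (snd (idx ?D) h2 \<otimes>\<^bsub>H\<^esub> f1)) (coact ?D f)) (comult H h) =
      sw K H H (tensor K ?W H) (\<lambda>h1 h2. sw K ?W H (tensor K ?W H) (\<lambda>f0 f1.
        pure K ?W H f0 (f1 \<otimes>\<^bsub>H\<^esub> fst (idx ?D) h1)) (coact ?D (?op h2 f))) (comult H h)" (is "?lhs = ?rhs")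
    proof (rule dual_tensor_ext[of ?U H])
      show "?lhs \<in> carrier (tensor K ?DV H)" "?rhs \<in> carrier (tensor K ?DV H)" by (simp_all add: G_inv_apply)
      fix m assume m [simp]: "m \<in> carrier ?U"
      have "sw K ?DV H H (\<lambda>f w. ev ?U f m \<odot>\<^bsub>H\<^esub> w) ?lhs =
          sw K H H H (\<lambda>a b. sw K ?DV H H (\<lambda>f0 f1. ev ?U f0 (act M (?\<sigma> (S a)) m) \<odot>\<^bsub>H\<^esub> (?b b \<otimes>\<^bsub>H\<^esub> f1)) (coact ?D f)) (comult H h)"
        by (simp add: G_inv_apply)
      also have "\<dots> = sw K H H H (\<lambda>a b. sw K ?U H H (\<lambda>m0 m1. ev ?U f m0 \<odot>\<^bsub>H\<^esub> (?b b \<otimes>\<^bsub>H\<^esub> T m1)) (coact M (act M (?\<sigma> (S a)) m))) (comult H h)"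
        by (rule sw_cong[OF refl], rule coact_dual_eval) simp_all
      \<comment> \<open>The compatibility of M at \<beta>^-1 \<alpha>^-1(S(h)), where S swaps the
        legs of h. Since \<open>T\<close> reverses products and T(S(h)) = h, the two outer factors
        become \<alpha>^-1(a) and \<alpha> \<beta>^-1 \<alpha>^-1(b), as the index of the dual
        requires.\<close>
      also have "\<dots> = sw K H H H (\<lambda>a b. sw K ?U H H (\<lambda>m0 m1. ev ?U f (act M (?\<sigma> (S b)) m0) \<odot>\<^bsub>H\<^esub> (T m1 \<otimes>\<^bsub>H\<^esub> (inv\<^bsub>A\<^esub> (fst (idx M))) a)) (coact M m)) (comult H h)"
        using compat_auto[OF M, of "inv\<^bsub>A\<^esub> (snd (idx M)) \<otimes>\<^bsub>A\<^esub> inv\<^bsub>A\<^esub> (fst (idx M))" ?\<sigma> H "\<lambda>x y. ev ?U f x \<odot>\<^bsub>H\<^esub> T y" "S h" m]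
        by simp
      also have "\<dots> = sw K H H H (\<lambda>a b. sw K ?U H H (\<lambda>m0 m1. ev ?U (?op b f) m0 \<odot>\<^bsub>H\<^esub> (T m1 \<otimes>\<^bsub>H\<^esub> (inv\<^bsub>A\<^esub> (fst (idx M))) a)) (coact M m)) (comult H h)"
        by simp
      also have "\<dots> = sw K H H H (\<lambda>a b. sw K ?DV H H (\<lambda>f0 f1. ev ?U f0 m \<odot>\<^bsub>H\<^esub> (f1 \<otimes>\<^bsub>H\<^esub> (inv\<^bsub>A\<^esub> (fst (idx M))) a)) (coact ?D (?op b f))) (comult H h)"
        by (rule sw_cong[OF refl], rule coact_dual_eval[symmetric]) simp_all
      also have "\<dots> = sw K ?DV H H (\<lambda>f w. ev ?U f m \<odot>\<^bsub>H\<^esub> w) ?rhs"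
        by (simp add: G_inv_apply)
      finally show "sw K ?DV H H (\<lambda>f w. ev ?U f m \<odot>\<^bsub>H\<^esub> w) ?lhs = sw K ?DV H H (\<lambda>f w. ev ?U f m \<odot>\<^bsub>H\<^esub> w) ?rhs" .
    qed simp_all
  qed
qed (simp_all add: anti_rules[OF S])

end

subsection \<open>The canonical element\<close>

definition cas_basis :: "('k, 'v) module \<Rightarrow> 'v set \<Rightarrow> ('v \<times> 'v \<Rightarrow> 'k) set" where
  "cas_basis U B = finsum (tensor K (DV U) U) (\<lambda>e. pure K (DV U) U (dvec U B e) e) B"

definition cas :: "('k, 'v) module \<Rightarrow> ('v \<times> 'v \<Rightarrow> 'k) set" where
  "cas U = cas_basis U (SOME B. vectorspace.basis K U B)"

context
  fixes U :: "('k, 'v) module"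
  assumes U [simp]: "fdv K U"
begin

lemma
  assumes B: "vectorspace.basis K U B"
  shows cas_basis_closed: "cas_basis U B \<in> carrier (tensor K (DV U) U)"
    and sw_cas_basis: "vectorspace K P \<Longrightarrow> bilin K (DV U) U P Q \<Longrightarrow>
      sw K (DV U) U P Q (cas_basis U B) = finsum P (\<lambda>e. Q (dvec U B e) e) B"
proof -
  note [simp] = dvec_closed[OF U B] basis_closed[OF U B]
  have v: "vectorspace K (tensor K (DV U) U)" by simp
  interpret TD: vectorspace K "tensor K (DV U) U" by (rule v)
  show "cas_basis U B \<in> carrier (tensor K (DV U) U)"
    unfolding cas_basis_def by (rule TD.M.finsum_closed) simp
  assume P: "vectorspace K P" and Q: "bilin K (DV U) U P Q"
  show "sw K (DV U) U P Q (cas_basis U B) = finsum P (\<lambda>e. Q (dvec U B e) e) B"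
    unfolding cas_basis_def
    by (subst lin_finsum[OF v P lin_sw[OF _ _ P Q]])
      (use P Q sw_pure[OF _ _ P Q] in \<open>auto intro!: finsum_cong_weak simp del: bilin_def\<close>)
qed

text \<open>The expansions \<open>expand_vector\<close> and \<open>expand_functional\<close>, read
  as contractions of one leg of the canonical element.\<close>

lemma cas_basis_eval:
  assumes B: "vectorspace.basis K U B" and [simp]: "vectorspace K P"
  shows "lin K U P L \<Longrightarrow> m \<in> carrier U \<Longrightarrow> sw K (DV U) U P (\<lambda>f u. ev U f m \<odot>\<^bsub>P\<^esub> L u) (cas_basis U B) = L m"
    and "lin K (DV U) P L' \<Longrightarrow> f \<in> carrier (DV U) \<Longrightarrow>
      sw K (DV U) U P (\<lambda>g u. ev U f u \<odot>\<^bsub>P\<^esub> L' g) (cas_basis U B) = L' f"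
proof -
  assume L: "lin K U P L" and [simp]: "m \<in> carrier U"
  note [simp] = lin_closed[OF L] lin_arg[OF L]
  show "sw K (DV U) U P (\<lambda>f u. ev U f m \<odot>\<^bsub>P\<^esub> L u) (cas_basis U B) = L m"
    by (subst sw_cas_basis[OF B]) (simp_all add: L expand_vector[OF U B])
next
  assume L: "lin K (DV U) P L'" and [simp]: "f \<in> carrier (DV U)"
  note [simp] = lin_closed[OF L] lin_arg[OF L]
  show "sw K (DV U) U P (\<lambda>g u. ev U f u \<odot>\<^bsub>P\<^esub> L' g) (cas_basis U B) = L' f"
    by (subst sw_cas_basis[OF B]) (simp_all add: L expand_functional[OF U B])
qed

lemma some_basis: "vectorspace.basis K U (SOME B. vectorspace.basis K U B)"
  using fdv_basis_exists[OF U] by (rule someI_ex)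

lemma cas_basis_independent:
  assumes B: "vectorspace.basis K U B" shows "cas_basis U B = cas U"
  unfolding cas_def
  by (rule dual_tensor_ext[OF U vs_fdv[OF U]])
    (use cas_basis_closed[OF B] cas_basis_closed[OF some_basis] cas_basis_eval(1)[OF B vs_fdv[OF U] lin_id]
      cas_basis_eval(1)[OF some_basis vs_fdv[OF U] lin_id] in simp_all)

lemmas cas_closed = cas_basis_closed[OF some_basis, folded cas_def]
lemmas cas_eval = cas_basis_eval[OF some_basis, folded cas_def]

end

declare cas_closed [simp] cas_eval [simp]

subsection \<open>Evaluation and coevaluation\<close>

text \<open>Both coevaluations are images of the single element \<open>cas U\<close>, with the legs
  in one order or the other, and inherit its independence of the basis.\<close>

definition lcoev_elt :: "('k, 'v) module \<Rightarrow> 'v" where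
  "lcoev_elt U = sw K (DV U) U (tsp U (DV U)) (\<lambda>f u. tp U (DV U) u f) (cas U)"

definition rcoev_elt :: "('k, 'v) module \<Rightarrow> 'v" where
  "rcoev_elt U = sw K (DV U) U (tsp (DV U) U) (\<lambda>f u. tp (DV U) U f u) (cas U)"

lemma coev_elt_closed [simp]:
  assumes [simp]: "fdv K U"
  shows "lcoev_elt U \<in> carrier (tsp U (DV U))" "rcoev_elt U \<in> carrier (tsp (DV U) U)"
  by (simp_all add: lcoev_elt_def rcoev_elt_def)

abbreviation LD :: "('k, 'h, 'v) yd \<Rightarrow> ('k, 'h, 'v) yd" where "LD M \<equiv> yd_left_dual K H M"
abbreviation RD :: "('k, 'h, 'v) yd \<Rightarrow> ('k, 'h, 'v) yd" where "RD M \<equiv> yd_right_dual K H M"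

lemma anti_inverse: "\<forall>h \<in> carrier H. Sinv (antipode H h) = h" "\<forall>h \<in> carrier H. antipode H (Sinv h) = h"
  by simp_all

lemmas LR_intro = anti_auto_antipode anti_auto_Sinv anti_inverse(1)
lemmas RL_intro = anti_auto_Sinv anti_auto_antipode anti_inverse(2)

context
  fixes M :: "('k, 'h, 'v) yd" assumes M: "ydm M"
begin

lemmas left_dual_rules =
  ydm_yd_dual[OF LR_intro M, folded yd_left_dual_def] yd_dual_simps[OF M, of "antipode H" Sinv, folded yd_left_dual_def]
  act_yd_dual[OF LR_intro M, folded yd_left_dual_def]
lemmas left_dual_coact_eval = coact_dual_eval[OF LR_intro M, folded yd_left_dual_def]
lemmas left_dual_coact_eval' = coact_dual_eval'[OF LR_intro M, folded yd_left_dual_def]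
lemmas left_dual_coact_rules = coact_dual_rules[OF LR_intro M, folded yd_left_dual_def]

lemmas right_dual_rules =
  ydm_yd_dual[OF RL_intro M, folded yd_right_dual_def] yd_dual_simps[OF M, of Sinv "antipode H", folded yd_right_dual_def]
  act_yd_dual[OF RL_intro M, folded yd_right_dual_def]
lemmas right_dual_coact_eval = coact_dual_eval[OF RL_intro M, folded yd_right_dual_def]
lemmas right_dual_coact_eval' = coact_dual_eval'[OF RL_intro M, folded yd_right_dual_def]
lemmas right_dual_coact_rules = coact_dual_rules[OF RL_intro M, folded yd_right_dual_def]

end

declare left_dual_rules [simp] left_dual_coact_rules [simp] right_dual_rules [simp] right_dual_coact_rules [simp]

text \<open>A morphism from the unit object amounts to an invariant and coinvariant vector in an
  object of degree one.\<close>

lemma homI_unit: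
  assumes N [simp]: "ydm N" and idx: "idx N = \<one>\<^bsub>G\<^esub>" and w [simp]: "w \<in> carrier (Space N)"
    and act: "\<And>h. h \<in> carrier H \<Longrightarrow> act N h w = counit H h \<odot>\<^bsub>Space N\<^esub> w"
    and coact: "coact N w = pure K (Space N) H w \<one>\<^bsub>H\<^esub>"
    and f: "source f = yd_unit K H" "target f = N"
      "mapping f = (\<lambda>c \<in> carrier KK. uK c \<odot>\<^bsub>Space N\<^esub> w)"
  shows "hom f (yd_unit K H) N"
  by (rule homI[where F = "\<lambda>c. uK c \<odot>\<^bsub>Space N\<^esub> w"]) (simp_all add: idx f act coact Kf.m_comm)

text \<open>The identities are first proved with the dual as left factor, where
  \<open>dual_tensor_ext\<close> applies, and the flip of the factors is applied to both sides
  afterwards.\<close>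

lemma hom_left_coev_aux:
  assumes M [simp]: "ydm M"
  shows "h \<in> carrier H \<Longrightarrow> act (yd_tensor K H M (LD M)) h (lcoev_elt (Space M)) =
      counit H h \<odot>\<^bsub>tsp (Space M) (DV (Space M))\<^esub> lcoev_elt (Space M)"
    and "coact (yd_tensor K H M (LD M)) (lcoev_elt (Space M)) =
      pure K (tsp (Space M) (DV (Space M))) H (lcoev_elt (Space M)) \<one>\<^bsub>H\<^esub>"
proof -
  let ?U = "Space M" let ?DV = "DV ?U" let ?X = "tsp ?U ?DV"
  assume h [simp]: "h \<in> carrier H"
  let ?T = "tensor K ?DV ?U"
  let ?ai = "\<lambda>h. (inv\<^bsub>A\<^esub> (fst (idx M))) h"
  let ?c = "\<lambda>h. fst (idx M) (snd (idx M) ((inv\<^bsub>A\<^esub> (fst (idx M))) h))"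
  have r: "sw K H H ?U (\<lambda>a b. act M (?ai a) (act M (?ai (antipode H b)) m)) (comult H h) = counit H h \<odot>\<^bsub>?U\<^esub> m"
    if [simp]: "m \<in> carrier ?U" for m
    using antipode_right_lin[of ?U "\<lambda>z. act M (?ai z) m" h] by simp
  \<comment> \<open>In the tensor product M is acted on through \<alpha>^-1(a) and the dual through
    \<alpha> \<beta> \<alpha>^-1(b). Transposing the latter gives \<beta>^-1 \<alpha>^-1 S(\<alpha>
    \<beta> \<alpha>^-1(b)) = \<alpha>^-1(S(b)), so that evaluation at m leaves the antipode
    axiom.\<close>
  have "sw K H H ?T (\<lambda>a b. sw K ?DV ?U ?T (\<lambda>f u. pure K ?DV ?U (act (LD M) (?c b) f) (act M (?ai a) u)) (cas ?U)) (comult H h) =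
      counit H h \<odot>\<^bsub>?T\<^esub> cas ?U"
    by (rule dual_tensor_ext[of ?U ?U]) (simp_all add: r)
  then have "sw K ?DV ?U ?X (\<lambda>f u. tp ?U ?DV u f) (sw K H H ?T (\<lambda>a b. sw K ?DV ?U ?T
      (\<lambda>f u. pure K ?DV ?U (act (LD M) (?c b) f) (act M (?ai a) u)) (cas ?U)) (comult H h)) =
      sw K ?DV ?U ?X (\<lambda>f u. tp ?U ?DV u f) (counit H h \<odot>\<^bsub>?T\<^esub> cas ?U)" by simp
  then show "act (yd_tensor K H M (LD M)) h (lcoev_elt ?U) = counit H h \<odot>\<^bsub>?X\<^esub> lcoev_elt ?U"
    by (simp add: lcoev_elt_def G_inv_apply)
next
  let ?U = "Space M" let ?DV = "DV ?U" let ?X = "tsp ?U ?DV"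
  let ?UH = "tensor K ?U H"
  let ?T = "tensor K ?DV ?UH"
  have r: "sw K H H ?UH (\<lambda>a b. pure K ?U H m (Sinv b \<otimes>\<^bsub>H\<^esub> a)) (comult H h) = counit H h \<odot>\<^bsub>?UH\<^esub> pure K ?U H m \<one>\<^bsub>H\<^esub>"
    if [simp]: "m \<in> carrier ?U" "h \<in> carrier H" for m h
    using Sinv_left_lin[of ?UH "\<lambda>z. pure K ?U H m z" h] by simp
  have "sw K ?DV ?U ?T (\<lambda>f u. sw K ?U H ?T (\<lambda>u0 u1. sw K ?DV H ?T (\<lambda>f0 f1. pure K ?DV ?UH f0 (pure K ?U H u0 (f1 \<otimes>\<^bsub>H\<^esub> u1)))
      (coact (LD M) f)) (coact M u)) (cas ?U) = sw K ?DV ?U ?T (\<lambda>f u. pure K ?DV ?UH f (pure K ?U H u \<one>\<^bsub>H\<^esub>)) (cas ?U)"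
    (is "?lhs = ?rhs")
  proof (rule dual_tensor_ext[of ?U ?UH])
    fix m assume m [simp]: "m \<in> carrier ?U"
    have "sw K ?DV ?UH ?UH (\<lambda>f w. ev ?U f m \<odot>\<^bsub>?UH\<^esub> w) ?lhs =
        sw K ?DV ?U ?UH (\<lambda>f u. sw K ?U H ?UH (\<lambda>u0 u1. sw K ?DV H ?UH (\<lambda>f0 f1. ev ?U f0 m \<odot>\<^bsub>?UH\<^esub> pure K ?U H u0 (f1 \<otimes>\<^bsub>H\<^esub> u1))
          (coact (LD M) f)) (coact M u)) (cas ?U)" by simp
    also have "\<dots> = sw K ?DV ?U ?UH (\<lambda>f u. sw K ?U H ?UH (\<lambda>u0 u1. sw K ?U H ?UH (\<lambda>m0 m1. ev ?U f m0 \<odot>\<^bsub>?UH\<^esub> pure K ?U H u0 (Sinv m1 \<otimes>\<^bsub>H\<^esub> u1))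
          (coact M m)) (coact M u)) (cas ?U)"
      by (rule sw_cong[OF refl], rule sw_cong[OF refl], rule left_dual_coact_eval) simp_all
    \<comment> \<open>The coaction of m is moved outside the sum over the canonical element, since
      \<open>cas_eval\<close> contracts the latter for a fixed m_0. What remains is S^-1(m_2)
      m_1.\<close>
    also have "\<dots> = sw K ?DV ?U ?UH (\<lambda>f u. sw K ?U H ?UH (\<lambda>m0 m1. sw K ?U H ?UH (\<lambda>u0 u1. ev ?U f m0 \<odot>\<^bsub>?UH\<^esub> pure K ?U H u0 (Sinv m1 \<otimes>\<^bsub>H\<^esub> u1))
          (coact M u)) (coact M m)) (cas ?U)"
      by (rule sw_cong[OF refl], rule sw_swap) simp_all
    also have "\<dots> = sw K ?U H ?UH (\<lambda>m0 m1. sw K ?DV ?U ?UH (\<lambda>f u. sw K ?U H ?UH (\<lambda>u0 u1. ev ?U f m0 \<odot>\<^bsub>?UH\<^esub> pure K ?U H u0 (Sinv m1 \<otimes>\<^bsub>H\<^esub> u1))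
          (coact M u)) (cas ?U)) (coact M m)"
      by (rule sw_swap) simp_all
    also have "\<dots> = sw K ?U H ?UH (\<lambda>m0 m1. sw K ?U H ?UH (\<lambda>u0 u1. pure K ?U H u0 (Sinv m1 \<otimes>\<^bsub>H\<^esub> u1))
          (coact M m0)) (coact M m)" by simp
    also have "\<dots> = pure K ?U H m \<one>\<^bsub>H\<^esub>" by (simp add: coact_coassoc r coact_counit)
    also have "\<dots> = sw K ?DV ?UH ?UH (\<lambda>f w. ev ?U f m \<odot>\<^bsub>?UH\<^esub> w) ?rhs" by simp
    finally show "sw K ?DV ?UH ?UH (\<lambda>f w. ev ?U f m \<odot>\<^bsub>?UH\<^esub> w) ?lhs = sw K ?DV ?UH ?UH (\<lambda>f w. ev ?U f m \<odot>\<^bsub>?UH\<^esub> w) ?rhs" .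
  qed simp_all
  then have "sw K ?DV ?UH (tensor K ?X H) (\<lambda>f y. sw K ?U H (tensor K ?X H) (\<lambda>u h. pure K ?X H (tp ?U ?DV u f) h) y) ?lhs =
    sw K ?DV ?UH (tensor K ?X H) (\<lambda>f y. sw K ?U H (tensor K ?X H) (\<lambda>u h. pure K ?X H (tp ?U ?DV u f) h) y) ?rhs" by simp
  then show "coact (yd_tensor K H M (LD M)) (lcoev_elt ?U) = pure K ?X H (lcoev_elt ?U) \<one>\<^bsub>H\<^esub>"
    by (simp add: lcoev_elt_def)
qed

text \<open>As for the left dual, with \<beta>^-1 in place of \<alpha>^-1: after transposition h
  acts through \<beta>^-1(h_2) \<beta>^-1(S^-1(h_1)), and the coaction leaves m_1 S(m_2).\<close>

lemma hom_right_coev_aux: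
  assumes M [simp]: "ydm M"
  shows "h \<in> carrier H \<Longrightarrow> act (yd_tensor K H (RD M) M) h (rcoev_elt (Space M)) =
      counit H h \<odot>\<^bsub>tsp (DV (Space M)) (Space M)\<^esub> rcoev_elt (Space M)"
    and "coact (yd_tensor K H (RD M) M) (rcoev_elt (Space M)) =
      pure K (tsp (DV (Space M)) (Space M)) H (rcoev_elt (Space M)) \<one>\<^bsub>H\<^esub>"
proof -
  let ?U = "Space M" let ?DV = "DV ?U" let ?X = "tsp ?DV ?U"
  assume h [simp]: "h \<in> carrier H"
  let ?T = "tensor K ?DV ?U"
  let ?bi = "\<lambda>h. (inv\<^bsub>A\<^esub> (snd (idx M))) h"
  have r: "sw K H H ?U (\<lambda>a b. act M (?bi b) (act M (?bi (Sinv a)) m)) (comult H h) = counit H h \<odot>\<^bsub>?U\<^esub> m"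
    if [simp]: "m \<in> carrier ?U" for m
    using Sinv_right_lin[of ?U "\<lambda>z. act M (?bi z) m" h] by simp
  have "sw K H H ?T (\<lambda>a b. sw K ?DV ?U ?T (\<lambda>f u. pure K ?DV ?U (act (RD M) (fst (idx M) a) f) (act M (?bi b) u)) (cas ?U)) (comult H h) =
      counit H h \<odot>\<^bsub>?T\<^esub> cas ?U"
    by (rule dual_tensor_ext[of ?U ?U]) (simp_all add: r)
  then have "sw K ?DV ?U ?X (\<lambda>f u. tp ?DV ?U f u) (sw K H H ?T (\<lambda>a b. sw K ?DV ?U ?T
      (\<lambda>f u. pure K ?DV ?U (act (RD M) (fst (idx M) a) f) (act M (?bi b) u)) (cas ?U)) (comult H h)) =
      sw K ?DV ?U ?X (\<lambda>f u. tp ?DV ?U f u) (counit H h \<odot>\<^bsub>?T\<^esub> cas ?U)" by simp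
  then show "act (yd_tensor K H (RD M) M) h (rcoev_elt ?U) = counit H h \<odot>\<^bsub>?X\<^esub> rcoev_elt ?U"
    by (simp add: rcoev_elt_def G_inv_apply)
next
  let ?U = "Space M" let ?DV = "DV ?U" let ?X = "tsp ?DV ?U"
  let ?UH = "tensor K ?U H"
  let ?T = "tensor K ?DV ?UH"
  have r: "sw K H H ?UH (\<lambda>a b. pure K ?U H m (a \<otimes>\<^bsub>H\<^esub> antipode H b)) (comult H h) = counit H h \<odot>\<^bsub>?UH\<^esub> pure K ?U H m \<one>\<^bsub>H\<^esub>"
    if [simp]: "m \<in> carrier ?U" "h \<in> carrier H" for m h
    using antipode_right_lin[of ?UH "\<lambda>z. pure K ?U H m z" h] by simp
  have "sw K ?DV ?U ?T (\<lambda>f u. sw K ?DV H ?T (\<lambda>f0 f1. sw K ?U H ?T (\<lambda>u0 u1. pure K ?DV ?UH f0 (pure K ?U H u0 (u1 \<otimes>\<^bsub>H\<^esub> f1)))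
      (coact M u)) (coact (RD M) f)) (cas ?U) = sw K ?DV ?U ?T (\<lambda>f u. pure K ?DV ?UH f (pure K ?U H u \<one>\<^bsub>H\<^esub>)) (cas ?U)"
    (is "?lhs = ?rhs")
  proof (rule dual_tensor_ext[of ?U ?UH])
    fix m assume m [simp]: "m \<in> carrier ?U"
    have "sw K ?DV ?UH ?UH (\<lambda>f w. ev ?U f m \<odot>\<^bsub>?UH\<^esub> w) ?lhs =
        sw K ?DV ?U ?UH (\<lambda>f u. sw K ?DV H ?UH (\<lambda>f0 f1. ev ?U f0 m \<odot>\<^bsub>?UH\<^esub> sw K ?U H ?UH (\<lambda>u0 u1. pure K ?U H u0 (u1 \<otimes>\<^bsub>H\<^esub> f1))
          (coact M u)) (coact (RD M) f)) (cas ?U)" by simp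
    also have "\<dots> = sw K ?DV ?U ?UH (\<lambda>f u. sw K ?U H ?UH (\<lambda>m0 m1. ev ?U f m0 \<odot>\<^bsub>?UH\<^esub> sw K ?U H ?UH (\<lambda>u0 u1. pure K ?U H u0 (u1 \<otimes>\<^bsub>H\<^esub> antipode H m1))
          (coact M u)) (coact M m)) (cas ?U)"
      by (rule sw_cong[OF refl], rule right_dual_coact_eval) simp_all
    also have "\<dots> = sw K ?U H ?UH (\<lambda>m0 m1. sw K ?DV ?U ?UH (\<lambda>f u. ev ?U f m0 \<odot>\<^bsub>?UH\<^esub> sw K ?U H ?UH (\<lambda>u0 u1. pure K ?U H u0 (u1 \<otimes>\<^bsub>H\<^esub> antipode H m1))
          (coact M u)) (cas ?U)) (coact M m)"
      by (rule sw_swap) simp_all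
    also have "\<dots> = sw K ?U H ?UH (\<lambda>m0 m1. sw K ?U H ?UH (\<lambda>u0 u1. pure K ?U H u0 (u1 \<otimes>\<^bsub>H\<^esub> antipode H m1))
          (coact M m0)) (coact M m)" by simp
    also have "\<dots> = pure K ?U H m \<one>\<^bsub>H\<^esub>" by (simp add: coact_coassoc r coact_counit)
    also have "\<dots> = sw K ?DV ?UH ?UH (\<lambda>f w. ev ?U f m \<odot>\<^bsub>?UH\<^esub> w) ?rhs" by simp
    finally show "sw K ?DV ?UH ?UH (\<lambda>f w. ev ?U f m \<odot>\<^bsub>?UH\<^esub> w) ?lhs = sw K ?DV ?UH ?UH (\<lambda>f w. ev ?U f m \<odot>\<^bsub>?UH\<^esub> w) ?rhs" .
  qed simp_all
  then have "sw K ?DV ?UH (tensor K ?X H) (\<lambda>f y. sw K ?U H (tensor K ?X H) (\<lambda>u h. pure K ?X H (tp ?DV ?U f u) h) y) ?lhs =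
    sw K ?DV ?UH (tensor K ?X H) (\<lambda>f y. sw K ?U H (tensor K ?X H) (\<lambda>u h. pure K ?X H (tp ?DV ?U f u) h) y) ?rhs" by simp
  then show "coact (yd_tensor K H (RD M) M) (rcoev_elt ?U) = pure K ?X H (rcoev_elt ?U) \<one>\<^bsub>H\<^esub>"
    by (simp add: rcoev_elt_def)
qed

lemma functional_ev [simp]: "functional K M f = ev (Space M) f"
  by (simp add: functional_def ev_def)

lemma dual_elt_dvec: "dual_elt K M B e = dvec (Space M) B e"
  by (simp add: dual_elt_def dvec_def)

text \<open>By \<open>cas_basis_independent\<close> the sum over \<open>B\<close> is the image of
  the canonical element. The right-hand sides do not mention \<open>B\<close>, which gives the
  independence of the basis.\<close>

lemma coev_basis_eq:
  fixes M :: "('k, 'h, 'v) yd"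
  assumes M [simp]: "ydm M" and B: "vectorspace.basis K (Space M) B"
  shows "left_coev_basis K H B M = \<lparr>source = yd_unit K H, target = yd_tensor K H M (LD M),
      mapping = (\<lambda>c \<in> carrier KK. uK c \<odot>\<^bsub>tsp (Space M) (DV (Space M))\<^esub> lcoev_elt (Space M))\<rparr>"
    and "right_coev_basis K H B M = \<lparr>source = yd_unit K H, target = yd_tensor K H (RD M) M,
      mapping = (\<lambda>c \<in> carrier KK. uK c \<odot>\<^bsub>tsp (DV (Space M)) (Space M)\<^esub> rcoev_elt (Space M))\<rparr>"
proof -
  have e: "lcoev_elt (Space M) = finsum (tsp (Space M) (DV (Space M)))
      (\<lambda>e. tp (Space M) (DV (Space M)) e (dvec (Space M) B e)) B"
    unfolding lcoev_elt_def cas_basis_independent[OF ydm_fdv[OF M] B, symmetric]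
    by (rule sw_cas_basis[OF ydm_fdv[OF M] B]) simp_all
  show "left_coev_basis K H B M = \<lparr>source = yd_unit K H, target = yd_tensor K H M (LD M),
      mapping = (\<lambda>c \<in> carrier KK. uK c \<odot>\<^bsub>tsp (Space M) (DV (Space M))\<^esub> lcoev_elt (Space M))\<rparr>"
    unfolding e by (simp add: left_coev_basis_def Let_def ten_space_def ten_pure_def dual_elt_dvec)
  have e: "rcoev_elt (Space M) = finsum (tsp (DV (Space M)) (Space M))
      (\<lambda>e. tp (DV (Space M)) (Space M) (dvec (Space M) B e) e) B"
    unfolding rcoev_elt_def cas_basis_independent[OF ydm_fdv[OF M] B, symmetric]
    by (rule sw_cas_basis[OF ydm_fdv[OF M] B]) simp_all
  show "right_coev_basis K H B M = \<lparr>source = yd_unit K H, target = yd_tensor K H (RD M) M,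
      mapping = (\<lambda>c \<in> carrier KK. uK c \<odot>\<^bsub>tsp (DV (Space M)) (Space M)\<^esub> rcoev_elt (Space M))\<rparr>"
    unfolding e by (simp add: right_coev_basis_def Let_def ten_space_def ten_pure_def dual_elt_dvec)
qed

lemmas coev_eq = coev_basis_eq[OF _ some_basis[OF ydm_fdv], folded left_coev_def right_coev_def]

lemma coev_simps [simp]:
  fixes M :: "('k, 'h, 'v) yd"
  assumes M [simp]: "ydm M"
  shows "source (left_coev K H M) = yd_unit K H" "target (left_coev K H M) = yd_tensor K H M (LD M)"
    "c \<in> carrier KK \<Longrightarrow> mapping (left_coev K H M) c = uK c \<odot>\<^bsub>tsp (Space M) (DV (Space M))\<^esub> lcoev_elt (Space M)"
    "source (right_coev K H M) = yd_unit K H" "target (right_coev K H M) = yd_tensor K H (RD M) M"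
    "c \<in> carrier KK \<Longrightarrow> mapping (right_coev K H M) c = uK c \<odot>\<^bsub>tsp (DV (Space M)) (Space M)\<^esub> rcoev_elt (Space M)"
  by (simp_all add: coev_eq)

lemma hom_left_coev: "ydm M \<Longrightarrow> hom (left_coev K H M) (yd_unit K H) (yd_tensor K H M (LD M))"
  by (rule homI_unit[where w = "lcoev_elt (Space M)"])
    (simp_all add: hom_left_coev_aux coev_eq del: act_yd_tensor coact_yd_tensor)

lemma hom_right_coev: "ydm M \<Longrightarrow> hom (right_coev K H M) (yd_unit K H) (yd_tensor K H (RD M) M)"
  by (rule homI_unit[where w = "rcoev_elt (Space M)"])
    (simp_all add: hom_right_coev_aux coev_eq del: act_yd_tensor coact_yd_tensor)

definition left_ev_map :: "('k, 'v) module \<Rightarrow> 'v \<Rightarrow> 'v" where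
  "left_ev_map U = (\<lambda>x. lift (DV U) U KK (\<lambda>f m. rK (ev U f m)) x)"

definition right_ev_map :: "('k, 'v) module \<Rightarrow> 'v \<Rightarrow> 'v" where
  "right_ev_map U = (\<lambda>x. lift U (DV U) KK (\<lambda>m f. rK (ev U f m)) x)"

context
  fixes U :: "('k, 'v) module" assumes U [simp]: "fdv K U"
begin

lemma lin_left_ev_map: "lin K (tsp (DV U) U) KK (left_ev_map U)"
  unfolding left_ev_map_def by simp

lemma lin_right_ev_map: "lin K (tsp U (DV U)) KK (right_ev_map U)"
  unfolding right_ev_map_def by simp

lemma ev_map_tp:
  assumes "f \<in> carrier (DV U)" "m \<in> carrier U"
  shows "left_ev_map U (tp (DV U) U f m) = rK (ev U f m)" "right_ev_map U (tp U (DV U) m f) = rK (ev U f m)"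
  using assms by (simp_all add: left_ev_map_def right_ev_map_def)

lemmas ev_map_rules = ev_map_tp
  lin_closed[OF lin_left_ev_map] lin_arg[OF lin_left_ev_map] lin_smult[OF lin_left_ev_map]
  sw_push[OF lin_left_ev_map _ _ vs_fdv[OF fdv_realize_space[OF fdv_tensor[OF fdv_DV[OF U] U]]] vs_fdv[OF fdv_realize_space[OF fdv_scalars[OF K_field]]]]
  lin_closed[OF lin_right_ev_map] lin_arg[OF lin_right_ev_map] lin_smult[OF lin_right_ev_map]
  sw_push[OF lin_right_ev_map _ _ vs_fdv[OF fdv_realize_space[OF fdv_tensor[OF U fdv_DV[OF U]]]] vs_fdv[OF fdv_realize_space[OF fdv_scalars[OF K_field]]]]

end

declare ev_map_rules [simp]

lemma ev_simps [simp]: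
  fixes M :: "('k, 'h, 'v) yd"
  assumes M [simp]: "ydm M"
  shows "source (left_ev K H M) = yd_tensor K H (LD M) M" "target (left_ev K H M) = yd_unit K H"
    "mapping (left_ev K H M) \<in> extensional (carrier (tsp (DV (Space M)) (Space M)))"
    "x \<in> carrier (tsp (DV (Space M)) (Space M)) \<Longrightarrow> mapping (left_ev K H M) x = left_ev_map (Space M) x"
    "source (right_ev K H M) = yd_tensor K H M (RD M)" "target (right_ev K H M) = yd_unit K H"
    "mapping (right_ev K H M) \<in> extensional (carrier (tsp (Space M) (DV (Space M))))"
    "x \<in> carrier (tsp (Space M) (DV (Space M))) \<Longrightarrow> mapping (right_ev K H M) x = right_ev_map (Space M) x"
  by (simp_all add: left_ev_def right_ev_def Let_def ten_space_def left_ev_map_def right_ev_map_def lift_def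
      ten_sweedler_sw[of "LD M" M, simplified] ten_sweedler_sw[of M "RD M", simplified])

lemma hom_left_ev:
  assumes M [simp]: "ydm M"
  shows "hom (left_ev K H M) (yd_tensor K H (LD M) M) (yd_unit K H)"
proof (rule homI_tensor[where F = "left_ev_map (Space M)"])
  let ?U = "Space M" and ?b = "\<lambda>h. (inv\<^bsub>A\<^esub> (snd (idx M))) h"
  let ?DV = "DV ?U"
  fix f m assume "f \<in> carrier (Space (LD M))" and m [simp]: "m \<in> carrier ?U"
  then have f [simp]: "f \<in> carrier ?DV" by simp
  have l: "sw K H H KK (\<lambda>a b. rK (ev ?U f (act M (?b (antipode H a)) (act M (?b b) m)))) (comult H h) =
      counit H h \<odot>\<^bsub>KK\<^esub> rK (ev ?U f m)" if [simp]: "h \<in> carrier H" for h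
    using antipode_left_lin[of KK "\<lambda>z. rK (ev ?U f (act M (?b z) m))" h] by simp
  show "left_ev_map ?U (act (yd_tensor K H (LD M) M) h (tp (Space (LD M)) ?U f m)) =
      act (yd_unit K H) h (left_ev_map ?U (tp (Space (LD M)) ?U f m))" if [simp]: "h \<in> carrier H" for h
    by (simp add: l G_inv_apply)
  let ?T = "tensor K KK H"
  have r: "sw K H H ?T (\<lambda>a b. pure K KK H x (b \<otimes>\<^bsub>H\<^esub> Sinv a)) (comult H h) = counit H h \<odot>\<^bsub>?T\<^esub> pure K KK H x \<one>\<^bsub>H\<^esub>"
    if [simp]: "x \<in> carrier KK" "h \<in> carrier H" for x h
    using Sinv_right_lin[of ?T "\<lambda>z. pure K KK H x z" h] by simp
  \<comment> \<open>The coaction of f has to become the inner sum before it can be evaluated at m_0.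
    The H-leg is then m_2 S^-1(m_1), which collapses to the counit.\<close>
  have "sw K ?DV H ?T (\<lambda>f0 f1. sw K ?U H ?T (\<lambda>m0 m1. pure K KK H (rK (ev ?U f0 m0)) (m1 \<otimes>\<^bsub>H\<^esub> f1)) (coact M m)) (coact (LD M) f) =
      sw K ?U H ?T (\<lambda>m0 m1. sw K ?DV H ?T (\<lambda>f0 f1. pure K KK H (rK (ev ?U f0 m0)) (m1 \<otimes>\<^bsub>H\<^esub> f1)) (coact (LD M) f)) (coact M m)"
    by (rule sw_swap) simp_all
  also have "\<dots> = sw K ?U H ?T (\<lambda>m0 m1. sw K ?U H ?T (\<lambda>m00 m01. pure K KK H (rK (ev ?U f m00)) (m1 \<otimes>\<^bsub>H\<^esub> Sinv m01)) (coact M m0)) (coact M m)"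
    by (rule sw_cong[OF refl], rule left_dual_coact_eval'[where Q = "\<lambda>a f1. pure K KK H (rK a) (_ \<otimes>\<^bsub>H\<^esub> f1)"]) simp_all
  also have "\<dots> = pure K KK H (rK (ev ?U f m)) \<one>\<^bsub>H\<^esub>"
    by (simp add: coact_coassoc r coact_counit)
  finally have c: "sw K ?DV H ?T (\<lambda>f0 f1. sw K ?U H ?T (\<lambda>m0 m1. pure K KK H (rK (ev ?U f0 m0)) (m1 \<otimes>\<^bsub>H\<^esub> f1)) (coact M m)) (coact (LD M) f) =
    pure K KK H (rK (ev ?U f m)) \<one>\<^bsub>H\<^esub>" .
  show "coact (yd_unit K H) (left_ev_map ?U (tp (Space (LD M)) ?U f m)) =
      sw K (tsp (Space (LD M)) ?U) H (tensor K (Space (yd_unit K H)) H)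
        (\<lambda>x h. pure K (Space (yd_unit K H)) H (left_ev_map ?U x) h)
        (coact (yd_tensor K H (LD M) M) (tp (Space (LD M)) ?U f m))"
    using c by simp
qed (simp_all add: lin_left_ev_map)

lemma hom_right_ev:
  assumes M [simp]: "ydm M"
  shows "hom (right_ev K H M) (yd_tensor K H M (RD M)) (yd_unit K H)"
proof (rule homI_tensor[where F = "right_ev_map (Space M)"])
  let ?U = "Space M" and ?a = "\<lambda>h. (inv\<^bsub>A\<^esub> (fst (idx M))) h"
  let ?DV = "DV ?U"
  fix m f assume m [simp]: "m \<in> carrier ?U" and "f \<in> carrier (Space (RD M))"
  then have f [simp]: "f \<in> carrier ?DV" by simp
  have l: "sw K H H KK (\<lambda>a b. rK (ev ?U f (act M (?a (Sinv b)) (act M (?a a) m)))) (comult H h) =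
      counit H h \<odot>\<^bsub>KK\<^esub> rK (ev ?U f m)" if [simp]: "h \<in> carrier H" for h
    using Sinv_left_lin[of KK "\<lambda>z. rK (ev ?U f (act M (?a z) m))" h] by simp
  show "right_ev_map ?U (act (yd_tensor K H M (RD M)) h (tp ?U (Space (RD M)) m f)) =
      act (yd_unit K H) h (right_ev_map ?U (tp ?U (Space (RD M)) m f))" if [simp]: "h \<in> carrier H" for h
    by (simp add: l G_inv_apply)
  let ?T = "tensor K KK H"
  have r: "sw K H H ?T (\<lambda>a b. pure K KK H x (antipode H a \<otimes>\<^bsub>H\<^esub> b)) (comult H h) = counit H h \<odot>\<^bsub>?T\<^esub> pure K KK H x \<one>\<^bsub>H\<^esub>"
    if [simp]: "x \<in> carrier KK" "h \<in> carrier H" for x h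
    using antipode_left_lin[of ?T "\<lambda>z. pure K KK H x z" h] by simp
  \<comment> \<open>In this order of the factors the coaction of f is already the inner sum, and the
    H-leg becomes S(m_1) m_2.\<close>
  have "sw K ?U H ?T (\<lambda>m0 m1. sw K ?DV H ?T (\<lambda>f0 f1. pure K KK H (rK (ev ?U f0 m0)) (f1 \<otimes>\<^bsub>H\<^esub> m1)) (coact (RD M) f)) (coact M m) =
      sw K ?U H ?T (\<lambda>m0 m1. sw K ?U H ?T (\<lambda>m00 m01. pure K KK H (rK (ev ?U f m00)) (antipode H m01 \<otimes>\<^bsub>H\<^esub> m1)) (coact M m0)) (coact M m)"
    by (rule sw_cong[OF refl], rule right_dual_coact_eval'[where Q = "\<lambda>a f1. pure K KK H (rK a) (f1 \<otimes>\<^bsub>H\<^esub> _)"]) simp_all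
  also have "\<dots> = pure K KK H (rK (ev ?U f m)) \<one>\<^bsub>H\<^esub>"
    by (simp add: coact_coassoc r coact_counit)
  finally have c: "sw K ?U H ?T (\<lambda>m0 m1. sw K ?DV H ?T (\<lambda>f0 f1. pure K KK H (rK (ev ?U f0 m0)) (f1 \<otimes>\<^bsub>H\<^esub> m1)) (coact (RD M) f)) (coact M m) =
    pure K KK H (rK (ev ?U f m)) \<one>\<^bsub>H\<^esub>" .
  show "coact (yd_unit K H) (right_ev_map ?U (tp ?U (Space (RD M)) m f)) =
      sw K (tsp ?U (Space (RD M))) H (tensor K (Space (yd_unit K H)) H)
        (\<lambda>x h. pure K (Space (yd_unit K H)) H (right_ev_map ?U x) h)
        (coact (yd_tensor K H M (RD M)) (tp ?U (Space (RD M)) m f))"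
    using c by simp
qed (simp_all add: lin_right_ev_map)

subsection \<open>The dualities\<close>

lemma extensional_comp_id:
  fixes f g :: "('k, 'h, 'v) yd_arrow" and M :: "('k, 'h, 'v) yd"
  shows "Space (source f) = X \<Longrightarrow> mapping (yd_comp g f) \<in> extensional (carrier X)"
    and "Space M = X \<Longrightarrow> mapping (yd_id M) \<in> extensional (carrier X)"
  by auto

text \<open>The snake identities are the contractions \<open>cas_eval\<close>: inserting the
  canonical element and contracting it with a vector or a functional returns that vector or
  functional.\<close>

lemma left_snake1:
  assumes [simp]: "ydm M"
  shows "yd_comp (yd_runit K H M) (yd_comp (yd_tensor_arrow K H (yd_id M) (left_ev K H M))
    (yd_comp (yd_assoc K H M (LD M) M) (yd_comp (yd_tensor_arrow K H (left_coev K H M) (yd_id M))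
      (inv_arrow C (yd_lunit K H M))))) = yd_id M"
  by (rule arrow_eqI) (simp_all add: lcoev_elt_def extensional_comp_id)

lemma left_snake2:
  assumes [simp]: "ydm M"
  shows "yd_comp (yd_lunit K H (LD M)) (yd_comp (yd_tensor_arrow K H (left_ev K H M) (yd_id (LD M)))
    (yd_comp (inv_arrow C (yd_assoc K H (LD M) M (LD M))) (yd_comp (yd_tensor_arrow K H (yd_id (LD M)) (left_coev K H M))
      (inv_arrow C (yd_runit K H (LD M)))))) = yd_id (LD M)"
  by (rule arrow_eqI) (simp_all add: lcoev_elt_def extensional_comp_id)

lemma right_snake1:
  assumes [simp]: "ydm M"
  shows "yd_comp (yd_lunit K H M) (yd_comp (yd_tensor_arrow K H (right_ev K H M) (yd_id M))
    (yd_comp (inv_arrow C (yd_assoc K H M (RD M) M)) (yd_comp (yd_tensor_arrow K H (yd_id M) (right_coev K H M))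
      (inv_arrow C (yd_runit K H M))))) = yd_id M"
  by (rule arrow_eqI) (simp_all add: rcoev_elt_def extensional_comp_id)

lemma right_snake2:
  assumes [simp]: "ydm M"
  shows "yd_comp (yd_runit K H (RD M)) (yd_comp (yd_tensor_arrow K H (yd_id (RD M)) (right_ev K H M))
    (yd_comp (yd_assoc K H (RD M) M (RD M)) (yd_comp (yd_tensor_arrow K H (right_coev K H M) (yd_id (RD M)))
      (inv_arrow C (yd_lunit K H (RD M)))))) = yd_id (RD M)"
  by (rule arrow_eqI) (simp_all add: rcoev_elt_def extensional_comp_id)

lemma ev_act_dual:
  assumes S: "anti_auto S" and T: "anti_auto T" and TS: "\<forall>h \<in> carrier H. T (S h) = h" and M [simp]: "ydm M"
    and [simp]: "h \<in> carrier H" "f \<in> carrier (DV (Space M))" "m \<in> carrier (Space M)"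
  shows "ev (Space M) (act (yd_dual K H S T M) h f) m =
    ev (Space M) f (act M ((inv\<^bsub>A\<^esub> (snd (idx M))) ((inv\<^bsub>A\<^esub> (fst (idx M))) (S h))) m)"
  using anti_rules(1)[OF S] by (simp add: act_yd_dual[OF S T TS M])

text \<open>Both objects live on the same realized dual space, which depends on
  \<open>Space M\<close> alone. \<open>S\<close> and \<open>T\<close> commute with automorphisms, so
  actions and coactions agree as well.\<close>

lemma yd_phi_dual:
  assumes S: "anti_auto S" and T: "anti_auto T" and TS: "\<forall>h \<in> carrier H. T (S h) = h"
    and M [simp]: "ydm M" and a [simp]: "a \<in> carrier G"
  shows "yd_phi K H a (yd_dual K H S T M) = yd_dual K H S T (yd_phi K H a M)"
proof (rule ydm_eqI)
  let ?U = "Space M" and ?D = "yd_dual K H S T M" and ?N = "yd_phi K H a M"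
  let ?DV = "DV ?U"
  have N: "ydm ?N" by simp
  have D [simp]: "ydm ?D" by (rule ydm_yd_dual[OF S T TS M])
  note [simp] = anti_rules[OF S] anti_rules[OF T] coact_dual_rules[OF S T TS M]
  show "ydm (yd_phi K H a ?D)" by simp
  show "ydm (yd_dual K H S T ?N)" by (rule ydm_yd_dual[OF S T TS N])
  show "idx (yd_phi K H a ?D) = idx (yd_dual K H S T ?N)"
    by (simp add: Gg.inv_mult_group Gg.m_assoc)
  show "act (yd_phi K H a ?D) h f = act (yd_dual K H S T ?N) h f"
    if [simp]: "h \<in> carrier H" and "f \<in> carrier (Space (yd_dual K H S T ?N))" for h f
  proof (rule ev_ext[of ?U])
    have f [simp]: "f \<in> carrier ?DV" using that by simp
    have cl: "act ?D k f \<in> carrier ?DV" if "k \<in> carrier H" for k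
      using lin_closed[OF lin_act[OF D that], of f] by simp
    show "act (yd_phi K H a ?D) h f \<in> carrier ?DV" by (simp add: cl)
    show "act (yd_dual K H S T ?N) h f \<in> carrier ?DV"
      using lin_closed[OF lin_act[OF ydm_yd_dual[OF S T TS N] that(1)], of f] by simp
    show "ev ?U (act (yd_phi K H a ?D) h f) m = ev ?U (act (yd_dual K H S T ?N) h f) m"
      if [simp]: "m \<in> carrier ?U" for m
      using ev_act_dual[OF S T TS N, of h f m] ev_act_dual[OF S T TS M]
      by (simp add: G_mult_apply G_inv_apply)
  qed simp
  show "coact (yd_phi K H a ?D) f = coact (yd_dual K H S T ?N) f"
    if "f \<in> carrier (Space (yd_dual K H S T ?N))" for f
  \<comment> \<open>The coaction of the dual of the conjugate is characterized by its evaluations.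
    Those of the conjugate of the dual are the same, because \<alpha> \<beta>^-1 commutes with
    \<open>T\<close>.\<close>
  proof (rule coact_yd_dual_unique[OF S T TS N, symmetric])
    have f [simp]: "f \<in> carrier ?DV" using that by simp
    let ?c = "\<lambda>h. fst a ((inv\<^bsub>A\<^esub> (snd a)) h)"
    show "f \<in> carrier (DV (Space ?N))" by simp
    show "coact (yd_phi K H a ?D) f \<in> carrier (tensor K (DV (Space ?N)) H)" by simp
    fix m assume "m \<in> carrier (Space ?N)"
    then have m [simp]: "m \<in> carrier ?U" by simp
    have "sw K ?DV H H (\<lambda>f0 f1. ev ?U f0 m \<odot>\<^bsub>H\<^esub> ?c f1) (coact ?D f) =
        sw K ?U H H (\<lambda>m0 m1. ev ?U f m0 \<odot>\<^bsub>H\<^esub> ?c (T m1)) (coact M m)"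
      by (rule coact_dual_eval[OF S T TS M]) simp_all
    then show "sw K (DV (Space ?N)) H H (\<lambda>f0 f1. ev (Space ?N) f0 m \<odot>\<^bsub>H\<^esub> f1) (coact (yd_phi K H a ?D) f) =
        sw K (Space ?N) H H (\<lambda>m0 m1. ev (Space ?N) f m0 \<odot>\<^bsub>H\<^esub> T m1) (coact ?N m)"
      by simp
  qed
qed simp_all

lemmas yd_phi_left_dual = yd_phi_dual[OF LR_intro, folded yd_left_dual_def]
lemmas yd_phi_right_dual = yd_phi_dual[OF RL_intro, folded yd_right_dual_def]

lemma yd_phi_coev:
  assumes [simp]: "ydm M" "a \<in> carrier G"
  shows "yd_phi_arrow K H a (left_coev K H M) = left_coev K H (yd_phi K H a M)"
    and "yd_phi_arrow K H a (right_coev K H M) = right_coev K H (yd_phi K H a M)"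
  by (simp_all add: yd_phi_arrow_def coev_eq yd_phi_unit yd_phi_tensor yd_phi_left_dual yd_phi_right_dual)

lemma yd_phi_ev:
  assumes [simp]: "ydm M" "a \<in> carrier G"
  shows "yd_phi_arrow K H a (left_ev K H M) = left_ev K H (yd_phi K H a M)"
    and "yd_phi_arrow K H a (right_ev K H M) = right_ev K H (yd_phi K H a M)"
proof -
  have N: "ydm (yd_phi K H a M)" by simp
  show "yd_phi_arrow K H a (left_ev K H M) = left_ev K H (yd_phi K H a M)"
    using ev_simps(3,4)[OF N]
    by (intro arrow_eqI) (simp_all add: yd_phi_unit yd_phi_tensor yd_phi_left_dual)
  show "yd_phi_arrow K H a (right_ev K H M) = right_ev K H (yd_phi K H a M)"
    using ev_simps(7,8)[OF N]
    by (intro arrow_eqI) (simp_all add: yd_phi_unit yd_phi_tensor yd_phi_right_dual)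
qed

lemma C_left_duality: "left_duality G C (yd_left_dual K H) (left_coev K H) (left_ev K H)"
  by (rule left_duality.intro[OF C_T_category left_duality_axioms.intro])
    (simp_all add: hom_left_coev hom_left_ev left_snake1 left_snake2 yd_phi_left_dual yd_phi_coev yd_phi_ev)

lemma C_right_duality: "right_duality G C (yd_right_dual K H) (right_coev K H) (right_ev K H)"
  by (rule right_duality.intro[OF C_T_category right_duality_axioms.intro])
    (simp_all add: hom_right_coev hom_right_ev right_snake1 right_snake2 yd_phi_right_dual yd_phi_coev yd_phi_ev)

lemma C_coev_basis:
  "ydm M \<Longrightarrow> vectorspace.basis K (Space M) B \<Longrightarrow> left_coev K H M = left_coev_basis K H B M"
  "ydm M \<Longrightarrow> vectorspace.basis K (Space M) B \<Longrightarrow> right_coev K H M = right_coev_basis K H B M"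
  for M :: "('k, 'h, 'v) yd"
  by (simp_all only: coev_basis_eq coev_eq)

end

theorem theorem3p8:
  fixes K :: "('k, 'y) ring_scheme" and H :: "('k, 'h, 'z) hopf_scheme"
  assumes "field K"
    and "hopf_algebra K H"
    and "bij_betw (antipode H) (carrier H) (carrier H)"
    and "infinite (UNIV :: 'v set)"
    and "\<exists>r :: 'k \<Rightarrow> 'v. inj_on r (carrier K)"
  shows "let G = yd_group K H;
             C = (YD_fd K H :: (('k, 'h, 'v) yd, ('k, 'h, 'v) yd_arrow,
                                ('h \<Rightarrow> 'h) \<times> ('h \<Rightarrow> 'h)) t_data)
         in braided_T_category G C \<and>
            left_duality G C (yd_left_dual K H) (left_coev K H) (left_ev K H) \<and>
            right_duality G C (yd_right_dual K H) (right_coev K H) (right_ev K H) \<and>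
            (\<forall>M \<in> Obj C. \<forall>B. vectorspace.basis K (Space M) B \<longrightarrow>
               left_coev K H M = left_coev_basis K H B M \<and>
               right_coev K H M = right_coev_basis K H B M)"
proof -
  interpret hopf_setting K "TYPE('v)" H
    by (intro hopf_setting.intro big_type.intro hopf_setting_axioms.intro assms)
  show ?thesis
    unfolding Let_def using C_braided C_left_duality C_right_duality C_coev_basis by simp
qed

end
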